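(* Let $T$ be Thompson's group acting on the circle and let $\overline{T}\leq \mathrm{Homeo}(\mathbb{R})$ be its lift to the real line. Then: (i) $\overline{T}$ does not act properly on any median graph; (ii) every action of $\overline{T}$ on a median graph with finite cubical dimension has a finite orbit; (iii) $\overline{T}$ is quasi-isometric to $T\times\mathbb{Z}$; and (iv) $T\times\mathbb{Z}$ acts properly on a median graph.
   Context: Thompson's group $T$ is the group of orientation-preserving piecewise linear homeomorphisms of $\mathbb{S}^1=\mathbb{R}/\mathbb{Z}$ that map dyadic rationals (mod 1) to dyadic rationals (mod 1), are differentiable except at finitely many points, all of which are dyadic rationals (mod 1), and have slopes that are integer powers of $2$. Its lift $\overline{T}$ is the group of all homeomorphisms of $\mathbb{R}$ that commute with the integer translations and induce an element of $T$ on $\mathbb{R}/\mathbb{Z}$. A median graph is a connected (non-empty, simplicial) graph $X$, with its path metric $d$, such that for all vertices $x,y,z$ there is a unique vertex $m$ lying on geodesics between each pair among $x,y,z$, i.e. $d(x,y)=d(x,m)+d(m,y)$, $d(y,z)=d(y,m)+d(m,z)$, $d(x,z)=d(x,m)+d(m,z)$ (equivalently, $X$ is the one-skeleton of a CAT(0) cube complex). No local finiteness is assumed. Its cubical dimension is the supremum of the $n$ such that $X$ contains the one-skeleton of an $n$-cube as a subgraph that is an induced cube (the dimension of the associated CAT(0) cube complex). Groups act on graphs by graph automorphisms; an action on a graph is proper if all vertex-stabilisers are finite. Quasi-isometry of finitely generated groups is with respect to word metrics. *)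

theory Defs
  imports
    "HOL-Analysis.Analysis"
    "HOL-Library.Extended_Nat"
    "HOL-Algebra.Generated_Groups"
    "HOL-Algebra.Elementary_Groups"
    "HOL-Algebra.Group_Action"
begin

section \<open>The circle and Thompson's group\<close>

quotient_type circle = real / "\<lambda>x y :: real. x - y \<in> \<int>"
  morphisms circle_rep circle_proj
proof (rule equivpI)
  show "reflp (\<lambda>x y :: real. x - y \<in> \<int>)"
    by (simp add: reflp_def)
  show "symp (\<lambda>x y :: real. x - y \<in> \<int>)"
    by (rule sympI) (metis Ints_minus minus_diff_eq)
  show "transp (\<lambda>x y :: real. x - y \<in> \<int>)"
  proof (rule transpI)
    fix x y z :: real
    assume "x - y \<in> \<int>" "y - z \<in> \<int>"
    then have "(x - y) + (y - z) \<in> \<int>" by (rule Ints_add)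
    then show "x - z \<in> \<int>" by simp
  qed
qed

lemma circle_proj_eq_iff: "circle_proj x = circle_proj y \<longleftrightarrow> x - y \<in> \<int>"
  by (rule circle.abs_eq_iff)

text \<open>The circle carries the quotient topology of \<open>\<real>/\<int>\<close>.\<close>

instantiation circle :: topological_space
begin

definition open_circle :: "circle set \<Rightarrow> bool"
  where "open_circle U \<longleftrightarrow> open (circle_proj -` U)"

instance
proof
  show "open (UNIV :: circle set)"
    by (simp add: open_circle_def)
  show "open (S \<inter> T)" if "open S" "open T" for S T :: "circle set"
    using that by (simp add: open_circle_def open_Int)
  show "open (\<Union>K)" if "\<forall>S\<in>K. open S" for K :: "circle set set"
    using that by (auto simp: open_circle_def vimage_Union)
qed

end

definition dyadic :: "real set"
  where "dyadic = {x. \<exists>(a::int) (n::nat). x = of_int a / 2 ^ n}"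

definition dyadic_circle :: "circle set"
  where "dyadic_circle = circle_proj ` dyadic"

definition circle_lift :: "(circle \<Rightarrow> circle) \<Rightarrow> (real \<Rightarrow> real) \<Rightarrow> bool"
  where "circle_lift f F \<longleftrightarrow>
    continuous_on UNIV F \<and> (\<forall>x. f (circle_proj x) = circle_proj (F x))"

text \<open>Piecewise linearity on the circle, expressed for a lift: locally affine away from the
  preimage of a finite set of breakpoints.\<close>

definition piecewise_linear_mod1 :: "(real \<Rightarrow> real) \<Rightarrow> bool"
  where "piecewise_linear_mod1 F \<longleftrightarrow>
    (\<exists>P :: circle set. finite P \<and>
      (\<forall>x. circle_proj x \<notin> P \<longrightarrow> (\<exists>m b. \<forall>\<^sub>F y in nhds x. F y = m * y + b)))"

text \<open>Differentiability and slopes of a circle map are those of a lift. A circle homeomorphism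
  preserves orientation iff it has an increasing lift; lifts differ by integer constants, so it
  does not matter which one is used.\<close>

definition thompson_T_set :: "(circle \<Rightarrow> circle) set"
  where "thompson_T_set = {f.
    (\<exists>g. homeomorphism UNIV UNIV f g) \<and>
    f ` dyadic_circle \<subseteq> dyadic_circle \<and>
    (\<exists>F. circle_lift f F \<and> strict_mono F \<and> piecewise_linear_mod1 F \<and>
      finite (circle_proj ` {x. \<not> F differentiable (at x)}) \<and>
      circle_proj ` {x. \<not> F differentiable (at x)} \<subseteq> dyadic_circle \<and>
      (\<forall>x s. (F has_real_derivative s) (at x) \<longrightarrow> (\<exists>k::int. s = 2 powi k)))}"

definition thompson_T :: "(circle \<Rightarrow> circle) monoid"
  where "thompson_T = \<lparr>carrier = thompson_T_set, monoid.mult = (\<circ>), one = id\<rparr>"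

definition thompson_T_lift_set :: "(real \<Rightarrow> real) set"
  where "thompson_T_lift_set = {h.
    (\<exists>g. homeomorphism UNIV UNIV h g) \<and>
    (\<forall>x (n::int). h (x + of_int n) = h x + of_int n) \<and>
    (\<exists>f\<in>thompson_T_set. \<forall>x. f (circle_proj x) = circle_proj (h x))}"

definition thompson_T_lift :: "(real \<Rightarrow> real) monoid"
  where "thompson_T_lift = \<lparr>carrier = thompson_T_lift_set, monoid.mult = (\<circ>), one = id\<rparr>"


section \<open>Quasi-isometry of finitely generated groups\<close>

definition word_length :: "('a, 'm) monoid_scheme \<Rightarrow> 'a set \<Rightarrow> 'a \<Rightarrow> nat"
  where "word_length G A g = (LEAST n. \<exists>ws. length ws = n \<and>
    set ws \<subseteq> A \<union> m_inv G ` A \<and> foldr (mult G) ws (one G) = g)"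

definition word_dist :: "('a, 'm) monoid_scheme \<Rightarrow> 'a set \<Rightarrow> 'a \<Rightarrow> 'a \<Rightarrow> real"
  where "word_dist G A g h = real (word_length G A (inv\<^bsub>G\<^esub> g \<otimes>\<^bsub>G\<^esub> h))"

definition quasi_isometric ::
    "'a set \<Rightarrow> ('a \<Rightarrow> 'a \<Rightarrow> real) \<Rightarrow> 'b set \<Rightarrow> ('b \<Rightarrow> 'b \<Rightarrow> real) \<Rightarrow> bool"
  where "quasi_isometric M d N d' \<longleftrightarrow>
    (\<exists>f\<in>M \<rightarrow> N. \<exists>K\<ge>1. \<exists>C\<ge>0.
      (\<forall>x\<in>M. \<forall>y\<in>M. d x y / K - C \<le> d' (f x) (f y) \<and> d' (f x) (f y) \<le> K * d x y + C) \<and>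
      (\<forall>z\<in>N. \<exists>x\<in>M. d' (f x) z \<le> C))"

text \<open>Changing the finite generating sets changes the word metrics by bilipschitz equivalences, so
  some choice of them works iff every choice does.\<close>

definition quasi_isometric_groups ::
    "('a, 'm) monoid_scheme \<Rightarrow> ('b, 'n) monoid_scheme \<Rightarrow> bool"
  where "quasi_isometric_groups G H \<longleftrightarrow> group G \<and> group H \<and>
    (\<exists>A B. finite A \<and> A \<subseteq> carrier G \<and> generate G A = carrier G \<and>
           finite B \<and> B \<subseteq> carrier H \<and> generate H B = carrier H \<and>
           quasi_isometric (carrier G) (word_dist G A) (carrier H) (word_dist H B))"


section \<open>Median graphs\<close>

locale simplicial_graph =
  fixes V :: "'v set" and adj :: "'v \<Rightarrow> 'v \<Rightarrow> bool"
  assumes adj_in_V: "adj x y \<Longrightarrow> x \<in> V \<and> y \<in> V"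
    and adj_sym: "adj x y \<Longrightarrow> adj y x"
    and adj_irrefl: "\<not> adj x x"

text \<open>The path metric; \<open>(adj ^^ n) x y\<close> says that there is a walk of length \<open>n\<close>
  from \<open>x\<close> to \<open>y\<close>.\<close>

definition graph_dist :: "('v \<Rightarrow> 'v \<Rightarrow> bool) \<Rightarrow> 'v \<Rightarrow> 'v \<Rightarrow> nat"
  where "graph_dist adj x y = (LEAST n. (adj ^^ n) x y)"

locale median_graph = simplicial_graph +
  assumes nonempty: "V \<noteq> {}"
    and connected: "\<lbrakk>x \<in> V; y \<in> V\<rbrakk> \<Longrightarrow> \<exists>n. (adj ^^ n) x y"
    and median: "\<lbrakk>x \<in> V; y \<in> V; z \<in> V\<rbrakk> \<Longrightarrow> \<exists>!m. m \<in> V \<and>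
      graph_dist adj x y = graph_dist adj x m + graph_dist adj m y \<and>
      graph_dist adj y z = graph_dist adj y m + graph_dist adj m z \<and>
      graph_dist adj x z = graph_dist adj x m + graph_dist adj m z"

text \<open>The vertices of the \<open>n\<close>-cube are the subsets of \<open>{..<n}\<close>, adjacent when they differ in
  exactly one element.\<close>

definition has_induced_cube :: "'v set \<Rightarrow> ('v \<Rightarrow> 'v \<Rightarrow> bool) \<Rightarrow> nat \<Rightarrow> bool"
  where "has_induced_cube V adj n \<longleftrightarrow>
    (\<exists>\<iota> \<in> Pow {..<n} \<rightarrow> V. inj_on \<iota> (Pow {..<n}) \<and>
      (\<forall>A\<in>Pow {..<n}. \<forall>B\<in>Pow {..<n}. adj (\<iota> A) (\<iota> B) \<longleftrightarrow> card (sym_diff A B) = 1))"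

definition cubical_dim :: "'v set \<Rightarrow> ('v \<Rightarrow> 'v \<Rightarrow> bool) \<Rightarrow> enat"
  where "cubical_dim V adj = Sup {enat n | n. has_induced_cube V adj n}"

locale graph_action = group_action G V \<phi> + simplicial_graph V adj
  for G (structure) and V :: "'v set" and adj :: "'v \<Rightarrow> 'v \<Rightarrow> bool" and \<phi> +
  assumes preserves_adj:
    "\<lbrakk>g \<in> carrier G; x \<in> V; y \<in> V\<rbrakk> \<Longrightarrow> adj (\<phi> g x) (\<phi> g y) \<longleftrightarrow> adj x y"

definition proper_graph_action ::
    "('a, 'm) monoid_scheme \<Rightarrow> 'v set \<Rightarrow> ('v \<Rightarrow> 'v \<Rightarrow> bool) \<Rightarrow> ('a \<Rightarrow> 'v \<Rightarrow> 'v) \<Rightarrow> bool"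
  where "proper_graph_action G V adj \<phi> \<longleftrightarrow>
    graph_action G V adj \<phi> \<and> (\<forall>x\<in>V. finite (stabilizer G \<phi> x))"

end

theory Submission
  imports Defs
begin

text \<open>
  In a median graph every group element \<open>g\<close> has a set \<open>Hp g\<close> of halfspaces through which its orbits
  move from the outside to the inside. If \<open>g\<close> has roots of arbitrarily high order, then \<open>Hp g\<close> is empty and a power of
  \<open>g\<close> fixes a vertex. The unit translation has such roots, namely the translations by \<open>1 / 2 ^ n\<close>,
  so some vertex stabiliser is infinite.

  In finite dimension the same emptiness holds for an element \<open>k\<close> supported in an arc: the group of the complementary arc is perfect,
  contains displacing elements and commutes with \<open>k\<close>, so it fixes the halfspaces in \<open>Hp k\<close>, and conjugates of \<open>k\<close> on disjoint arcs
  would span a cube of too large dimension. Arc groups are finitely generated, hence have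
  bounded orbits, and the lift is a bounded product of arc groups and rotations of finite order
  modulo the centre. A bounded orbit yields a finite one by a discrete circumcentre.

  The quasi-isometry sends \<open>h\<close> to its image in \<open>T\<close> together with \<open>\<lfloor>h 0\<rfloor>\<close>. The proper
  action comes from the set of standard dyadic charts of the circle, which \<open>T\<close> commensurates: \<open>T\<close> acts
  on the cube complex of all sets commensurate to it.
\<close>

section \<open>Median graphs\<close>

text \<open>Both groups are central extensions of \<open>T\<close> by \<open>\<int>\<close>. In the
  lift the central translation \<open>tr 1\<close> has roots of order \<open>2 ^ m\<close> for every
  \<open>m\<close>, whereas the generator of the factor \<open>\<int>\<close> has only trivial
  roots; yet \<open>\<lfloor>h 0\<rfloor>\<close> is additive up to a bounded error, so word metrics
  cannot tell the two apart. Roots alone do not yield finite orbits: the lift also acts through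
  \<open>T\<close> on the complex built for the product, where every orbit is infinite. The
  dimension has to enter, and it enters as a bound on families of pairwise transverse halfspaces.
  Non-trivial elements supported in an arc lack high roots, so their conjugates on disjoint arcs are
  made independent instead. The commuting group must have no homomorphism onto
  \<open>\<int>\<close>, but the full group of an arc has two, given by the slopes at its ends; this
  is why \<open>Lc\<close> collects only the elements supported strictly inside the arc. The same
  slopes explain the half-line coordinate on an arc: under \<open>chi\<close> a slope at the end
  turns into a shift at infinity, that is, into the exponent sum of a word.\<close>

context median_graph
begin

section \<open>Path metric and medians\<close>

abbreviation d :: "'a \<Rightarrow> 'a \<Rightarrow> nat" where "d \<equiv> graph_dist adj"

lemma dist_walk: "x \<in> V \<Longrightarrow> y \<in> V \<Longrightarrow> (adj ^^ d x y) x y"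
  unfolding graph_dist_def using connected by (auto intro: LeastI_ex)

lemma dist_le: "(adj ^^ n) x y \<Longrightarrow> d x y \<le> n"
  unfolding graph_dist_def by (rule Least_le)

lemma dist_self [simp]: "d x x = 0"
  using dist_le[of 0 x x] by simp

lemma dist_eq_0: "x \<in> V \<Longrightarrow> y \<in> V \<Longrightarrow> d x y = 0 \<longleftrightarrow> x = y"
  using dist_walk[of x y] by auto

lemma walk_sym: "(adj ^^ n) x y \<Longrightarrow> (adj ^^ n) y x"
proof (induction n arbitrary: y)
  case (Suc n)
  then obtain z where "(adj ^^ n) x z" "adj z y" by (auto elim: relpowp_Suc_E)
  then show ?case using Suc.IH adj_sym by (blast intro: relpowp_Suc_I2)
qed auto

lemma dist_sym: "d x y = d y x"
  unfolding graph_dist_def using walk_sym by metis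

lemma dist_triangle: "x \<in> V \<Longrightarrow> y \<in> V \<Longrightarrow> z \<in> V \<Longrightarrow> d x z \<le> d x y + d y z"
  by (meson dist_le dist_walk relpowp_trans)

lemma adj_dist: "adj x y \<longleftrightarrow> x \<in> V \<and> y \<in> V \<and> d x y = 1"
proof
  assume a: "adj x y"
  then have V: "x \<in> V" "y \<in> V" using adj_in_V by auto
  have "d x y \<le> 1" using dist_le[of 1 x y] a by (simp only: relpowp_1)
  moreover have "d x y \<noteq> 0" using a V adj_irrefl dist_eq_0 by auto
  ultimately show "x \<in> V \<and> y \<in> V \<and> d x y = 1" using V by auto
next
  assume "x \<in> V \<and> y \<in> V \<and> d x y = 1"
  then show "adj x y" using dist_walk[of x y] by (metis relpowp_1)
qed

lemma first_step:
  assumes "x \<in> V" "y \<in> V" "x \<noteq> y"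
  obtains z where "adj x z" "d x y = Suc (d z y)"
proof -
  obtain n where n: "d x y = Suc n"
    using assms dist_eq_0 by (metis not0_implies_Suc)
  then have "(adj ^^ Suc n) x y" using dist_walk assms by metis
  then obtain z where z: "adj x z" "(adj ^^ n) z y" using relpowp_Suc_D2[of n adj x y] by blast
  have "d z y \<le> n" using z dist_le by auto
  moreover have "d x y \<le> d x z + d z y" using z assms adj_in_V dist_triangle by blast
  moreover have "d x z = 1" using z adj_dist by auto
  ultimately show ?thesis using that z n by auto
qed

definition med :: "'a \<Rightarrow> 'a \<Rightarrow> 'a \<Rightarrow> 'a"
  where "med x y z = (THE m. m \<in> V \<and> d x y = d x m + d m y \<and> d y z = d y m + d m z \<and>
      d x z = d x m + d m z)"

lemma med:
  assumes "x \<in> V" "y \<in> V" "z \<in> V"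
  shows "med x y z \<in> V" "d x y = d x (med x y z) + d (med x y z) y"
    "d y z = d y (med x y z) + d (med x y z) z"
    "d x z = d x (med x y z) + d (med x y z) z"
  using theI'[OF median[OF assms]] unfolding med_def by auto

lemma med_unique:
  assumes "x \<in> V" "y \<in> V" "z \<in> V" "m \<in> V" "d x y = d x m + d m y"
    "d y z = d y m + d m z" "d x z = d x m + d m z"
  shows "m = med x y z"
  using median[OF assms(1-3)] med[OF assms(1-3)] assms(4-) by metis

section \<open>Halfspaces and the distance formula\<close>

definition hs :: "'a \<Rightarrow> 'a \<Rightarrow> 'a set"
  where "hs a b = {v \<in> V. d v a < d v b}"

text \<open>Hyperplanes are represented by their two sides, so no parallelism relation on edges is
  formed: parallel edges simply define the same set, by \<open>hs_unique\<close>.\<close>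

definition Hs :: "'a set set"
  where "Hs = {hs a b | a b. adj a b}"

text \<open>Since \<open>d a b = 1\<close>, the median of \<open>a\<close>, \<open>b\<close>,
  \<open>v\<close> is an endpoint of the edge. So no vertex is equidistant from two adjacent ones,
  and the two halfspaces of an edge partition \<open>V\<close>.\<close>

lemma adj_step:
  assumes "adj a b" "v \<in> V"
  shows "d v b = Suc (d v a) \<or> d v a = Suc (d v b)"
proof -
  have V: "a \<in> V" "b \<in> V" and ab: "d a b = 1" using assms adj_dist by auto
  note m = med[OF V(1,2) assms(2)]
  have "d a (med a b v) = 0 \<or> d (med a b v) b = 0" using m(2) ab by auto
  then consider "med a b v = a" | "med a b v = b" using dist_eq_0[OF V(1) m(1)] dist_eq_0[OF m(1) V(2)] by auto
  then show ?thesis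
  proof cases
    case 1
    then have "d b v = Suc (d a v)" using m(3) ab unfolding 1 dist_sym[of b a] by linarith
    then show ?thesis by (simp add: dist_sym[of v])
  next
    case 2
    then have "d a v = Suc (d b v)" using m(4) ab unfolding 2 by linarith
    then show ?thesis by (simp add: dist_sym[of v])
  qed
qed

lemma adj_step':
  "adj a b \<Longrightarrow> v \<in> V \<Longrightarrow> d b v = Suc (d a v) \<or> d a v = Suc (d b v)"
  using adj_step[of a b v] by (simp add: dist_sym[of v])

lemma hs_iff: "adj a b \<Longrightarrow> v \<in> hs a b \<longleftrightarrow> v \<in> V \<and> d v b = Suc (d v a)"
  using adj_step[of a b v] by (auto simp: hs_def)

lemma hs_compl: "adj a b \<Longrightarrow> V - hs a b = hs b a"
  using adj_step[of a b] by (fastforce simp: hs_def)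

lemma Hs_compl: "h \<in> Hs \<Longrightarrow> V - h \<in> Hs"
  unfolding Hs_def mem_Collect_eq using hs_compl adj_sym by metis

lemma Hs_subset: "h \<in> Hs \<Longrightarrow> h \<subseteq> V"
  unfolding Hs_def hs_def by auto

text \<open>On the side of \<open>a\<close> one has \<open>d x b = Suc (d x a)\<close>. Comparison
  with the triangle inequality through \<open>u\<close> leaves \<open>d u a < d u b\<close>, and
  then equality throughout: \<open>u\<close> is between \<open>x\<close> and \<open>b\<close> as
  well.\<close>

lemma hs_interval_end:
  assumes "adj a b" "x \<in> hs a b" "u \<in> V" "d x a = d x u + d u a"
  shows "u \<in> hs a b" "d x b = d x u + d u b"
proof -
  have x: "x \<in> V" "d x b = Suc (d x a)" using assms(1,2) hs_iff by auto
  have V: "a \<in> V" "b \<in> V" using assms adj_dist by auto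
  have "d x b \<le> d x u + d u b" using x V assms dist_triangle by blast
  then have "Suc (d u a) \<le> d u b" using x assms by auto
  then show u: "u \<in> hs a b" using assms by (simp add: hs_def)
  show "d x b = d x u + d u b" using u x assms hs_iff by auto
qed

text \<open>If \<open>u\<close> were the first exit of a geodesic from \<open>x\<close> to \<open>y\<close> out of \<open>hs a b\<close>, then the median of
  \<open>u, y, b\<close> would be a second median of \<open>x, y, b\<close>, besides that of \<open>x, y, a\<close>.\<close>

lemma hs_no_exit:
  assumes ab: "adj a b" and x: "x \<in> hs a b" and y: "y \<in> hs a b"
    and xu: "adj x u" and u: "d x y = Suc (d u y)"
  shows "u \<in> hs a b"
proof (rule ccontr)
  assume nu: "u \<notin> hs a b"
  have V: "a \<in> V" "b \<in> V" "u \<in> V" "x \<in> V" "y \<in> V"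
    using adj_in_V[OF ab] adj_in_V[OF xu] y by (auto simp: hs_def)
  have ub: "u \<in> hs b a" using nu hs_compl[OF ab] V by auto
  define w where "w = med x y a"
  note w = med[OF V(4) V(5) V(1), folded w_def]
  have wh: "w \<in> hs a b" "d x b = d x w + d w b" "d y b = d y w + d w b"
    using hs_interval_end[OF ab x w(1) w(4)] hs_interval_end[OF ab y w(1) w(3)] by auto
  \<comment> \<open>\<open>w\<close>, \<open>x\<close> and \<open>y\<close> are all on the side of
    \<open>a\<close>, so \<open>w\<close> is between each of \<open>x\<close>, \<open>y\<close> and
    \<open>b\<close> too: one vertex is the median for both ends of the edge.\<close>
  have w': "w = med x y b" by (rule med_unique) (use V w wh in auto)
  define s where "s = med u y b"
  note s = med[OF V(3) V(5) V(2), folded s_def]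
  have sh: "s \<in> hs b a" using hs_interval_end(1)[OF adj_sym[OF ab] ub s(1) s(4)] .
  have xu1: "d x u = 1" using xu adj_dist by auto
  have xb: "d x b = Suc (d x a)" "d u a = Suc (d u b)"
    using x ub hs_iff ab adj_sym by auto
  \<comment> \<open>The step from \<open>x\<close> to \<open>u\<close> approaches \<open>b\<close>
    as well as \<open>y\<close>, so the median \<open>s\<close> seen from \<open>u\<close> is also a
    median seen from \<open>x\<close>.\<close>
  have "d x b = Suc (d u b)"
    using adj_step'[OF xu V(1)] adj_step'[OF xu V(2)] xb by arith
  moreover have "d x b \<le> d x s + d s b" "d x y \<le> d x s + d s y" "d x s \<le> d x u + d u s"
    using dist_triangle V s by auto
  ultimately have "d x b = d x s + d s b" "d x y = d x s + d s y"
    using s u xu1 by auto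
  then have "s = med x y b" using med_unique V s by auto
  then have "s \<in> hs a b" using w' wh by simp
  then show False using sh by (simp add: hs_def)
qed

text \<open>A geodesic from \<open>x\<close> to \<open>u\<close> is walked edge by edge; each vertex
  on it still lies on a geodesic to \<open>y\<close>, so \<open>hs_no_exit\<close> applies
  again.\<close>

lemma hs_convex:
  assumes ab: "adj a b" and x: "x \<in> hs a b" and y: "y \<in> hs a b"
    and u: "u \<in> V" "d x y = d x u + d u y"
  shows "u \<in> hs a b"
  using x u(2)
proof (induction "d x u" arbitrary: x)
  case 0
  have "x \<in> V" using 0(2) by (simp add: hs_def)
  then have "x = u" using dist_eq_0[of x u] u(1) 0(1) by metis
  then show ?case using 0(2) by simp
next
  case (Suc n)
  have V: "x \<in> V" "y \<in> V" using Suc y by (auto simp: hs_def)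
  have "x \<noteq> u" using Suc.hyps by auto
  then obtain z where z: "adj x z" "d x u = Suc (d z u)" using first_step V u by metis
  have zV: "z \<in> V" using z adj_in_V by auto
  have "d z y \<le> d z u + d u y" using dist_triangle zV u V by auto
  moreover have "d x y \<le> d x z + d z y" using dist_triangle zV V by auto
  moreover have "d x z = 1" using z adj_dist by auto
  ultimately have e: "d z y = d z u + d u y" "d x y = Suc (d z y)"
    using Suc.prems z by auto
  have "z \<in> hs a b" using hs_no_exit[OF ab Suc.prems(1) y z(1) e(2)] .
  then show ?case using Suc.hyps(1)[of z] Suc.hyps(2) z e by auto
qed

lemma Hs_convex:
  "h \<in> Hs \<Longrightarrow> x \<in> h \<Longrightarrow> y \<in> h \<Longrightarrow> u \<in> V \<Longrightarrow> d x y = d x u + d u y \<Longrightarrow> u \<in> h"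
  unfolding Hs_def using hs_convex by blast

text \<open>Majority rule: two points on one side pull the median to that side by convexity, and
  this is applied to \<open>h\<close> and to its complement.\<close>

lemma Hs_med:
  assumes "h \<in> Hs" "x \<in> V" "y \<in> V" "z \<in> V"
  shows "med x y z \<in> h \<longleftrightarrow> (x \<in> h \<and> y \<in> h) \<or> (y \<in> h \<and> z \<in> h) \<or> (x \<in> h \<and> z \<in> h)"
proof -
  note m = med[OF assms(2-4)]
  have *: "med x y z \<in> k" if "k \<in> Hs" "(x \<in> k \<and> y \<in> k) \<or> (y \<in> k \<and> z \<in> k) \<or> (x \<in> k \<and> z \<in> k)" for k
    using that(2) Hs_convex[OF that(1) _ _ m(1)] m(2-4) by metis
  show ?thesis
    using *[OF assms(1)] *[OF Hs_compl[OF assms(1)]] assms by auto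
qed

text \<open>If \<open>v\<close> is closer to \<open>a\<close>, then \<open>a\<close> is between
  \<open>v\<close> and \<open>b\<close>; so \<open>v\<close> outside \<open>h\<close> would force
  \<open>a\<close> outside \<open>h\<close> by convexity of the complement. The other side is
  symmetric.\<close>

lemma hs_unique:
  assumes h: "h \<in> Hs" and ab: "adj a b" "a \<in> h" "b \<notin> h"
  shows "h = hs a b"
proof -
  have V: "a \<in> V" "b \<in> V" using ab adj_in_V by auto
  have d1: "d a b = 1" "d b a = 1" using ab adj_dist adj_sym by blast+
  have 1: "hs a b \<subseteq> h"
  proof
    fix v assume v: "v \<in> hs a b"
    then have vV: "v \<in> V" by (simp add: hs_def)
    have "d v b = d v a + d a b" using v d1 ab hs_iff by simp
    then show "v \<in> h" using Hs_convex[OF Hs_compl[OF h], of v b a] ab V vV by auto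
  qed
  have 2: "hs b a \<subseteq> V - h"
  proof
    fix v assume v: "v \<in> hs b a"
    then have vV: "v \<in> V" by (simp add: hs_def)
    have "d v a = d v b + d b a" using v d1 ab hs_iff[OF adj_sym] by simp
    then show "v \<in> V - h" using Hs_convex[OF h, of v a b] ab V vV by auto
  qed
  show ?thesis using 1 2 hs_compl[OF ab(1)] Hs_subset[OF h] by auto
qed

definition sep :: "'a \<Rightarrow> 'a \<Rightarrow> 'a set set"
  where "sep x y = {h \<in> Hs. x \<in> h \<and> y \<notin> h}"

text \<open>The first edge of a geodesic crosses exactly one halfspace, by \<open>hs_unique\<close>,
  and convexity keeps the rest of the geodesic from crossing it back. Each hyperplane between the
  vertices is counted once, by its side that contains \<open>x\<close>.\<close>

lemma card_sep: "x \<in> V \<Longrightarrow> y \<in> V \<Longrightarrow> finite (sep x y) \<and> card (sep x y) = d x y"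
proof (induction "d x y" arbitrary: x)
  case 0
  then show ?case using dist_eq_0 by (auto simp: sep_def)
next
  case (Suc n)
  then have "x \<noteq> y" by auto
  then obtain z where z: "adj x z" "d x y = Suc (d z y)" using first_step Suc by metis
  have zV: "z \<in> V" using z adj_in_V by auto
  have dxz: "d x z = 1" using z adj_dist by auto
  have IH: "finite (sep z y)" "card (sep z y) = d z y"
    using Suc.hyps(1)[of z] Suc.hyps(2) z zV Suc.prems by auto
  have e: "d x y = d x z + d z y" using z dxz by linarith
  have hx: "hs x z \<in> Hs" using z by (auto simp: Hs_def)
  have xin: "x \<in> hs x z" "z \<notin> hs x z" using z adj_dist by (auto simp: hs_def)
  have yn: "y \<notin> hs x z" using z by (simp add: hs_def dist_sym[of y])
  have "sep x y = insert (hs x z) (sep z y)"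
  proof (intro equalityI subsetI)
    fix h assume h: "h \<in> sep x y"
    show "h \<in> insert (hs x z) (sep z y)"
      using h hs_unique[of h x z] z by (auto simp: sep_def)
  next
    fix h assume h: "h \<in> insert (hs x z) (sep z y)"
    then show "h \<in> sep x y"
    proof
      assume "h = hs x z"
      then show ?thesis using hx xin yn by (simp add: sep_def)
    next
      assume h: "h \<in> sep z y"
      have "x \<in> h"
      proof (rule ccontr)
        assume "x \<notin> h"
        then have "z \<in> V - h"
          using Hs_convex[OF Hs_compl, of h x y z] h Suc.prems zV e by (simp add: sep_def)
        then show False using h by (simp add: sep_def)
      qed
      then show ?thesis using h by (simp add: sep_def)
    qed
  qed
  moreover have "hs x z \<notin> sep z y" using xin by (simp add: sep_def)
  ultimately show ?case using IH z by simp
qed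

lemma finite_sep: "x \<in> V \<Longrightarrow> y \<in> V \<Longrightarrow> finite (sep x y)"
  using card_sep by blast

lemma ex_sep:
  assumes "x \<in> V" "y \<in> V" "x \<noteq> y"
  obtains h where "h \<in> Hs" "x \<in> h" "y \<notin> h"
proof -
  have "card (sep x y) \<noteq> 0" using assms card_sep dist_eq_0 by auto
  then have "sep x y \<noteq> {}" by auto
  then show ?thesis using that by (auto simp: sep_def)
qed

lemma Hs_nonempty: "h \<in> Hs \<Longrightarrow> h \<noteq> {}"
proof -
  assume "h \<in> Hs"
  then obtain a b where ab: "adj a b" "h = hs a b" by (auto simp: Hs_def)
  then have "a \<in> h" using adj_dist[of a b] by (simp add: hs_def)
  then show ?thesis by auto
qed

end

section \<open>Finite families and truth values indexed by the integers\<close>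

lemma common_multiple:
  assumes "finite S" "\<And>h. h \<in> S \<Longrightarrow> \<exists>p>0::nat. Q h p" "\<And>h p q. q > 0 \<Longrightarrow> Q h p \<Longrightarrow> Q h (p * q)"
  shows "\<exists>N>0::nat. \<forall>h\<in>S. Q h N"
  using assms(1,2)
proof (induction rule: finite_induct)
  case empty
  then show ?case by (auto intro: exI[of _ 1])
next
  case (insert h S)
  then obtain N p where "N > 0" "\<forall>h\<in>S. Q h N" "p > 0" "Q h p" by (metis insertCI)
  then show ?case using assms(3)[of N h p] assms(3)[of p _ N]
    by (intro exI[of _ "N * p"]) (auto simp: mult.commute)
qed

lemma common_bound:
  assumes "finite S" "\<And>h. h \<in> S \<Longrightarrow> \<exists>R::int. P h R" "\<And>h R R'. P h R \<Longrightarrow> R \<le> R' \<Longrightarrow> P h R'"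
  shows "\<exists>R. \<forall>h\<in>S. P h R"
  using assms(1,2)
proof (induction rule: finite_induct)
  case (insert h S)
  then obtain R R' where "\<forall>h\<in>S. P h R" "P h R'" by (metis insertCI)
  then show ?case using assms(3) by (intro exI[of _ "max R R'"]) (auto intro: assms(3))
qed auto

lemma int_transition:
  fixes s :: "int \<Rightarrow> bool"
  assumes "s a \<noteq> s b"
  shows "\<exists>n. s n \<noteq> s (n + 1)"
proof (rule ccontr)
  assume "\<not> ?thesis"
  then have *: "s n = s (n + 1)" for n by blast
  have "s n = s 0" for n
  proof (induction n rule: int_induct[where k = 0])
    case (step1 i)
    then show ?case using *[of i] by simp
  next
    case (step2 i)
    then show ?case using *[of "i - 1"] by simp
  qed simp
  then show False using assms by metis
qed

lemma int_transition_up: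
  fixes s :: "int \<Rightarrow> bool"
  assumes "\<forall>n\<ge>N. s n" "\<forall>n\<le>M. \<not> s n"
  shows "\<exists>n. \<not> s n \<and> s (n + 1)"
proof (rule ccontr)
  assume "\<not> ?thesis"
  then have *: "\<not> s n \<Longrightarrow> \<not> s (n + 1)" for n by blast
  have "\<not> s n" if "n \<ge> M" for n
    using that by (induction n rule: int_ge_induct) (use * assms in auto)
  from this[of "max M N"] show False using assms by auto
qed

text \<open>Finitely many changes of truth value fit into a bounded window. The constants on the two
  sides may differ, and this difference is what \<open>Hp\<close> records.\<close>

lemma int_eventually_const:
  fixes s :: "int \<Rightarrow> bool"
  assumes "finite {n. s n \<noteq> s (n + 1)}"
  shows "\<exists>M b c. (\<forall>n\<ge>M. s n = b) \<and> (\<forall>n\<le>-M. s n = c)"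
proof -
  obtain M where M: "\<forall>n\<in>{n. s n \<noteq> s (n + 1)}. \<bar>n\<bar> < M"
    using finite_nat_set_iff_bounded[of "(\<lambda>n. nat \<bar>n\<bar>) ` {n. s n \<noteq> s (n + 1)}"] assms
    by (metis (no_types, lifting) finite_imageI imageI nat_less_iff abs_ge_zero zless_nat_eq_int_zless)
  then have *: "s n = s (n + 1)" if "\<bar>n\<bar> \<ge> M" for n using that by force
  have "s n = s M" if "n \<ge> M" for n
    using that
  proof (induction n rule: int_ge_induct)
    case (step i)
    then show ?case using *[of i] by simp
  qed simp
  moreover have "s n = s (-M)" if "n \<le> -M" for n
    using that
  proof (induction n rule: int_le_induct)
    case (step i)
    then show ?case using *[of "i - 1"] by auto
  qed auto
  ultimately show ?thesis by metis
qed

section \<open>Automorphisms acting on halfspaces\<close>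

locale median_action = graph_action G V adj \<phi> + median_graph V adj
  for G (structure) and V :: "'v set" and adj :: "'v \<Rightarrow> 'v \<Rightarrow> bool" and \<phi>
begin

lemma group_G: "group G"
  using group_hom group_hom.axioms(1) by blast

sublocale Gr: group G by (rule group_G)

lemma act_closed [simp]: "g \<in> carrier G \<Longrightarrow> x \<in> V \<Longrightarrow> \<phi> g x \<in> V"
  using element_image by blast

lemma act_mult: "g \<in> carrier G \<Longrightarrow> k \<in> carrier G \<Longrightarrow> x \<in> V \<Longrightarrow> \<phi> (g \<otimes> k) x = \<phi> g (\<phi> k x)"
  using composition_rule by blast

lemma act_one [simp]: "x \<in> V \<Longrightarrow> \<phi> \<one> x = x"
  using id_eq_one by (metis restrict_apply')

lemma act_inv [simp]:
  assumes "g \<in> carrier G" "x \<in> V"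
  shows "\<phi> (inv g) (\<phi> g x) = x" "\<phi> g (\<phi> (inv g) x) = x"
  using act_mult[of "inv g" g x] act_mult[of g "inv g" x] assms by simp_all

lemma walk_act:
  assumes "g \<in> carrier G" "(adj ^^ n) x y" "x \<in> V" "y \<in> V"
  shows "(adj ^^ n) (\<phi> g x) (\<phi> g y)"
  using assms(2-4)
proof (induction n arbitrary: y)
  case (Suc n)
  then obtain z where z: "(adj ^^ n) x z" "adj z y" by (auto elim: relpowp_Suc_E)
  then show ?case using Suc preserves_adj[OF assms(1)] adj_in_V
    by (meson relpowp_Suc_I)
qed auto

lemma dist_act: "g \<in> carrier G \<Longrightarrow> x \<in> V \<Longrightarrow> y \<in> V \<Longrightarrow> d (\<phi> g x) (\<phi> g y) = d x y"
proof (rule antisym)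
  assume g: "g \<in> carrier G" and V: "x \<in> V" "y \<in> V"
  have *: "d (\<phi> k u) (\<phi> k v) \<le> d u v" if "k \<in> carrier G" "u \<in> V" "v \<in> V" for k u v
    using dist_le[OF walk_act[OF that(1) dist_walk[OF that(2,3)] that(2,3)]] .
  show "d (\<phi> g x) (\<phi> g y) \<le> d x y" using * g V by blast
  show "d x y \<le> d (\<phi> g x) (\<phi> g y)" using *[of "inv g" "\<phi> g x" "\<phi> g y"] g V by simp
qed

lemma med_act:
  assumes g: "g \<in> carrier G" and V: "x \<in> V" "y \<in> V" "z \<in> V"
  shows "\<phi> g (med x y z) = med (\<phi> g x) (\<phi> g y) (\<phi> g z)"
  using med[OF V] g V by (intro med_unique) (auto simp: dist_act)

definition hact :: "_ \<Rightarrow> 'v set \<Rightarrow> 'v set" where "hact g h = \<phi> g ` h"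

lemma hact_iff: "g \<in> carrier G \<Longrightarrow> h \<subseteq> V \<Longrightarrow> y \<in> V \<Longrightarrow> y \<in> hact g h \<longleftrightarrow> \<phi> (inv g) y \<in> h"
proof -
  assume g: "g \<in> carrier G" and h: "h \<subseteq> V" and y: "y \<in> V"
  show ?thesis
  proof
    assume "y \<in> hact g h"
    then obtain x where "x \<in> h" "y = \<phi> g x" by (auto simp: hact_def)
    then show "\<phi> (inv g) y \<in> h" using g h by auto
  next
    assume *: "\<phi> (inv g) y \<in> h"
    have "y = \<phi> g (\<phi> (inv g) y)" using g y by simp
    then show "y \<in> hact g h" using * unfolding hact_def by blast
  qed
qed

lemma hact_subset: "g \<in> carrier G \<Longrightarrow> h \<subseteq> V \<Longrightarrow> hact g h \<subseteq> V"
  unfolding hact_def by auto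

lemma act_mem: "g \<in> carrier G \<Longrightarrow> h \<subseteq> V \<Longrightarrow> x \<in> V \<Longrightarrow> \<phi> g x \<in> hact g h \<longleftrightarrow> x \<in> h"
  using hact_iff by simp

lemma hact_one: "h \<subseteq> V \<Longrightarrow> hact \<one> h = h"
  unfolding hact_def by (force simp: subset_iff image_iff)

lemma hact_mult: "g \<in> carrier G \<Longrightarrow> k \<in> carrier G \<Longrightarrow> h \<subseteq> V \<Longrightarrow> hact (g \<otimes> k) h = hact g (hact k h)"
  unfolding hact_def image_image by (rule image_cong) (auto simp: act_mult)

lemma hact_inv: "g \<in> carrier G \<Longrightarrow> h \<subseteq> V \<Longrightarrow> hact (inv g) (hact g h) = h"
  "g \<in> carrier G \<Longrightarrow> h \<subseteq> V \<Longrightarrow> hact g (hact (inv g) h) = h"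
  using hact_mult[of "inv g" g h] hact_mult[of g "inv g" h] hact_one by simp_all

lemma hact_mono: "h \<subseteq> k \<Longrightarrow> hact g h \<subseteq> hact g k"
  unfolding hact_def by auto

lemma hact_diff: "g \<in> carrier G \<Longrightarrow> h \<subseteq> V \<Longrightarrow> hact g (V - h) = V - hact g h"
  using hact_iff[of g h] hact_iff[of g "V - h"] hact_subset[of g "V - h"] by auto

lemma hact_hs:
  assumes g: "g \<in> carrier G" and ab: "adj a b"
  shows "hact g (hs a b) = hs (\<phi> g a) (\<phi> g b)"
proof -
  have V: "a \<in> V" "b \<in> V" using ab adj_in_V by auto
  have eq: "d y (\<phi> g c) = d (\<phi> (inv g) y) c" if "y \<in> V" "c \<in> V" for y c
    using dist_act[OF Gr.inv_closed[OF g], of y "\<phi> g c"] that g by simp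
  have "y \<in> hact g (hs a b) \<longleftrightarrow> y \<in> hs (\<phi> g a) (\<phi> g b)" if "y \<in> V" for y
    using that eq[OF that V(1)] eq[OF that V(2)] g by (subst hact_iff) (auto simp: hs_def)
  moreover have "hact g (hs a b) \<subseteq> V" "hs (\<phi> g a) (\<phi> g b) \<subseteq> V"
    using hact_subset g by (auto simp: hs_def)
  ultimately show ?thesis by blast
qed

lemma hact_Hs: "g \<in> carrier G \<Longrightarrow> h \<in> Hs \<Longrightarrow> hact g h \<in> Hs"
proof -
  assume g: "g \<in> carrier G" and "h \<in> Hs"
  then obtain a b where ab: "adj a b" "h = hs a b" by (auto simp: Hs_def)
  then have "adj (\<phi> g a) (\<phi> g b)" using preserves_adj g adj_in_V by blast
  then show ?thesis using hact_hs[OF g ab(1)] ab(2) by (auto simp: Hs_def)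
qed

abbreviation pw :: "_ \<Rightarrow> int \<Rightarrow> 'v \<Rightarrow> 'v" where "pw g n \<equiv> \<phi> (g [^] n)"

lemma pw_add: "g \<in> carrier G \<Longrightarrow> x \<in> V \<Longrightarrow> pw g (m + n) x = pw g m (pw g n x)"
  by (simp add: Gr.int_pow_mult act_mult)

lemma hact_pw_add: "g \<in> carrier G \<Longrightarrow> h \<subseteq> V \<Longrightarrow> hact (g [^] (m + n :: int)) h = hact (g [^] m) (hact (g [^] n) h)"
  by (simp add: Gr.int_pow_mult hact_mult)

lemma pw_mem:
  assumes "g \<in> carrier G" "h \<subseteq> V" "x \<in> V"
  shows "pw g n x \<in> hact (g [^] j) h \<longleftrightarrow> pw g (n - j) x \<in> h"
proof -
  have "pw g n x = pw g j (pw g (n - j) x)" using pw_add[OF assms(1,3), of j "n - j"] by simp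
  then show ?thesis using act_mem[of "g [^] j" h "pw g (n - j) x"] assms by simp
qed

lemma mem_pw:
  assumes "g \<in> carrier G" "h \<subseteq> V" "x \<in> V"
  shows "x \<in> hact (g [^] (j::int)) h \<longleftrightarrow> pw g (- j) x \<in> h"
  using pw_mem[OF assms, of 0 j] assms by simp

definition aperiodic where
  "aperiodic g h \<longleftrightarrow> (\<forall>p>0::nat. hact (g [^] int p) h \<noteq> h)"

lemma aperiodic_inj:
  assumes g: "g \<in> carrier G" and h: "h \<subseteq> V" and ap: "aperiodic g h"
  shows "inj (\<lambda>n::int. hact (g [^] n) h)"
proof -
  have *: "hact (g [^] n) h \<noteq> hact (g [^] m) h" if "n < m" for n m :: int
  proof
    assume eq: "hact (g [^] n) h = hact (g [^] m) h"
    have "hact (g [^] (m - n)) h = hact (g [^] (-n)) (hact (g [^] m) h)"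
      using hact_pw_add[OF g h, of "-n" m] by simp
    also have "\<dots> = h" unfolding eq[symmetric] using hact_pw_add[OF g h, of "-n" n] hact_one h by simp
    finally show False using ap that unfolding aperiodic_def
      by (metis diff_gt_0_iff_gt pos_int_cases of_nat_0_less_iff)
  qed
  show ?thesis by (rule injI) (metis * linorder_neqE)
qed

lemma periodic_mult:
  assumes g: "g \<in> carrier G" and h: "h \<subseteq> V" and eq: "hact (g [^] (p::int)) h = h"
  shows "hact (g [^] (p * int q)) h = h"
proof (induction q)
  case 0
  then show ?case using hact_one h by simp
next
  case (Suc q)
  have "p * int (Suc q) = p + p * int q" by (simp add: algebra_simps)
  then show ?case using Suc eq hact_pw_add[OF g h, of p "p * int q"] by simp
qed

text \<open>The translates of \<open>h\<close> by the powers \<open>- n\<close> are pairwise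
  distinct, and for \<open>n\<close> in the set each of them separates \<open>x\<close> from
  \<open>y\<close>; only \<open>d x y\<close> halfspaces do that.\<close>

lemma aperiodic_finite:
  assumes g: "g \<in> carrier G" and h: "h \<in> Hs" and ap: "aperiodic g h" and V: "x \<in> V" "y \<in> V"
  shows "finite {n. pw g n x \<in> h \<and> pw g n y \<notin> h}"
proof -
  have hV: "h \<subseteq> V" using h Hs_subset by auto
  let ?E = "{n. pw g n x \<in> h \<and> pw g n y \<notin> h}"
  let ?f = "\<lambda>n::int. hact (g [^] (-n)) h"
  have "?f ` ?E \<subseteq> sep x y"
    using mem_pw[OF g hV V(1)] mem_pw[OF g hV V(2)] hact_Hs[OF _ h] g by (auto simp: sep_def)
  then have "finite (?f ` ?E)" using finite_sep[OF V] finite_subset by blast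
  moreover have "inj_on ?f ?E"
  proof (rule inj_onI)
    fix n m :: int assume "hact (g [^] (- n)) h = hact (g [^] (- m)) h"
    then have "- n = - m" by (rule injD[OF aperiodic_inj[OF g hV ap]])
    then show "n = m" by simp
  qed
  ultimately show ?thesis using finite_imageD by blast
qed

text \<open>By \<open>aperiodic_finite\<close> for \<open>x\<close> and \<open>\<phi> g x\<close>,
  consecutive points of the orbit are separated by \<open>h\<close> only finitely often.\<close>

lemma aperiodic_limits:
  assumes g: "g \<in> carrier G" and h: "h \<in> Hs" and ap: "aperiodic g h" and x: "x \<in> V"
  shows "\<exists>M b c. (\<forall>n\<ge>M. (pw g n x \<in> h) = b) \<and> (\<forall>n\<le>-M. (pw g n x \<in> h) = c)"
proof (rule int_eventually_const[of "\<lambda>n. pw g n x \<in> h"])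
  have gx: "\<phi> g x \<in> V" using g x by simp
  have eq: "pw g (n + 1) x = pw g n (\<phi> g x)" for n using pw_add[OF g x, of n 1] g by simp
  show "finite {n. (pw g n x \<in> h) \<noteq> (pw g (n + 1) x \<in> h)}"
    unfolding eq
    by (rule finite_subset[OF _ finite_UnI[OF aperiodic_finite[OF g h ap x gx] aperiodic_finite[OF g h ap gx x]]])
      auto
qed

text \<open>The halfspaces that every orbit of \<open>\<langle>g\<rangle>\<close> leaves in the past and enters in the future.\<close>

definition Hp where
  "Hp g = {h \<in> Hs. \<exists>x\<in>V. (\<exists>N. \<forall>n\<ge>N. pw g n x \<in> h) \<and> (\<exists>N. \<forall>n\<le>N. pw g n x \<notin> h)}"

lemma Hp_Hs: "h \<in> Hp g \<Longrightarrow> h \<in> Hs" by (simp add: Hp_def)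

text \<open>A period of \<open>h\<close> would make membership along the orbit periodic, against its
  two different limits.\<close>

lemma Hp_aperiodic:
  assumes g: "g \<in> carrier G" and h: "h \<in> Hp g"
  shows "aperiodic g h"
  unfolding aperiodic_def
proof (intro allI impI notI)
  fix p :: nat assume p: "p > 0" and eq: "hact (g [^] int p) h = h"
  obtain x N M where x: "x \<in> V" "\<forall>n\<ge>N. pw g n x \<in> h" "\<forall>n\<le>M. pw g n x \<notin> h"
    using h by (auto simp: Hp_def)
  have hV: "h \<subseteq> V" using h Hp_Hs Hs_subset by auto
  have per: "hact (g [^] (int p * int q)) h = h" for q using periodic_mult[OF g hV eq] .
  define q where "q = nat (\<bar>N - M\<bar>)"
  have "int p * int q \<ge> int q" using mult_right_mono[of 1 "int p" "int q"] p by simp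
  then have q: "M + int p * int q \<ge> N" unfolding q_def by linarith
  have "pw g (M + int p * int q) x \<in> h" using x q by blast
  then have "pw g M x \<in> h" using pw_mem[OF g hV x(1), of "M + int p * int q" "int p * int q"] per[of q] by simp
  then show False using x by blast
qed

text \<open>\<open>Hp\<close> asks for one vertex with these limits. The orbits of two vertices are
  separated by an aperiodic halfspace only finitely often, so the limits do not depend on the
  vertex.\<close>

lemma Hp_limits:
  assumes g: "g \<in> carrier G" and h: "h \<in> Hp g" and y: "y \<in> V"
  shows "\<exists>N. \<forall>n\<ge>N. pw g n y \<in> h" "\<exists>N. \<forall>n\<le>N. pw g n y \<notin> h"
proof -
  obtain x N M where x: "x \<in> V" "\<forall>n\<ge>N. pw g n x \<in> h" "\<forall>n\<le>M. pw g n x \<notin> h"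
    using h unfolding Hp_def mem_Collect_eq by metis
  note ap = Hp_aperiodic[OF g h] and hH = Hp_Hs[OF h]
  obtain K b c where K: "\<forall>n\<ge>K. (pw g n y \<in> h) = b" "\<forall>n\<le>-K. (pw g n y \<in> h) = c"
    using aperiodic_limits[OF g hH ap y] by auto
  have b
  proof (rule ccontr)
    assume "\<not> b"
    then have "{max N K..} \<subseteq> {n. pw g n x \<in> h \<and> pw g n y \<notin> h}" using x K by auto
    then show False using aperiodic_finite[OF g hH ap x(1) y] finite_subset infinite_Ici by blast
  qed
  moreover have "\<not> c"
  proof
    assume "c"
    then have "{..min M (-K)} \<subseteq> {n. pw g n y \<in> h \<and> pw g n x \<notin> h}" using x K by auto
    then show False using aperiodic_finite[OF g hH ap y x(1)] finite_subset infinite_Iic by blast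
  qed
  ultimately show "\<exists>N. \<forall>n\<ge>N. pw g n y \<in> h" "\<exists>N. \<forall>n\<le>N. pw g n y \<notin> h"
    using K by auto
qed

text \<open>If \<open>s\<close> is an \<open>N\<close>-th root of \<open>g\<close>, the \<open>N\<close> halfspaces \<open>s\<^sup>i h\<close> have \<open>\<langle>g\<rangle>\<close>-translates
  that separate \<open>x\<close> from \<open>g x\<close>, and no two of these coincide.\<close>

lemma Hp_root_bound:
  assumes s: "s \<in> carrier G" and N: "N > 0" and g: "g = s [^] int N"
    and h: "h \<in> Hp g" and x: "x \<in> V"
  shows "N \<le> d (\<phi> g x) x"
proof -
  have gG: "g \<in> carrier G" using s g by simp
  have hV: "h \<subseteq> V" and hH: "h \<in> Hs" using h Hp_Hs Hs_subset by auto
  have gp: "g [^] n = s [^] (int N * n)" for n :: int using s unfolding g by (simp add: Gr.int_pow_pow)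
  have "aperiodic s h"
    unfolding aperiodic_def
  proof (intro allI impI notI)
    fix p :: nat assume p: "p > 0" "hact (s [^] int p) h = h"
    have "hact (g [^] int p) h = h"
      using periodic_mult[OF s hV p(2), of N] unfolding gp by (simp add: mult.commute)
    then show False using Hp_aperiodic[OF gG h] p(1) by (auto simp: aperiodic_def)
  qed
  then have inj: "inj (\<lambda>n::int. hact (s [^] n) h)" using aperiodic_inj[OF s hV] by blast
  have "\<exists>e. e mod int N = int i \<and> hact (s [^] e) h \<in> sep (\<phi> g x) x" if i: "i < N" for i
  proof -
    \<comment> \<open>The moment at which the orbit of \<open>y\<close> under \<open>g\<close>
      enters \<open>h\<close>, translated back, separates \<open>\<phi> g x\<close> from
      \<open>x\<close> by the translate of \<open>h\<close> under \<open>s [^] e\<close>; the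
      residue of \<open>e\<close> modulo \<open>N\<close> remembers \<open>i\<close>.\<close>
    define y where "y = pw s (- int i) x"
    have y: "y \<in> V" using x s by (simp add: y_def)
    obtain A B where "\<forall>n\<ge>A. pw g n y \<in> h" "\<forall>n\<le>B. pw g n y \<notin> h" using Hp_limits[OF gG h y] by auto
    then obtain n where n: "pw g n y \<notin> h" "pw g (n + 1) y \<in> h"
      using int_transition_up[of A "\<lambda>n. pw g n y \<in> h" B] by auto
    define e where "e = int i - int N * n"
    have 1: "pw g n y = pw s (- e) x"
      unfolding gp y_def e_def using pw_add[OF s x, of "int N * n" "- int i"] by simp
    have 2: "pw g (n + 1) y = pw s (- e) (\<phi> g x)"
    proof -
      have "pw g (n + 1) y = pw s (- e + int N) x"
        unfolding gp y_def e_def using pw_add[OF s x, of "int N * (n + 1)" "- int i"]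
        by (simp add: algebra_simps)
      then show ?thesis using pw_add[OF s x, of "-e" "int N"] by (simp add: g)
    qed
    have "e mod int N = int i" using i N by (simp add: e_def mod_diff_right_eq[symmetric])
    moreover have "hact (s [^] e) h \<in> sep (\<phi> g x) x"
      using n mem_pw[OF s hV] x gG hact_Hs[OF _ hH] s unfolding 1 2 by (simp add: sep_def)
    ultimately show ?thesis by blast
  qed
  then obtain e where e: "\<And>i. i < N \<Longrightarrow> e i mod int N = int i \<and> hact (s [^] e i) h \<in> sep (\<phi> g x) x"
    by metis
  have "inj_on (\<lambda>i. hact (s [^] e i) h) {..<N}"
  proof (rule inj_onI)
    fix i j assume ij: "i \<in> {..<N}" "j \<in> {..<N}" "hact (s [^] e i) h = hact (s [^] e j) h"
    then have "e i = e j" using inj by (auto simp: inj_def)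
    then show "i = j" using e ij by (metis lessThan_iff of_nat_eq_iff)
  qed
  moreover have "(\<lambda>i. hact (s [^] e i) h) ` {..<N} \<subseteq> sep (\<phi> g x) x" using e by auto
  ultimately have "card {..<N} \<le> card (sep (\<phi> g x) x)"
    using card_inj_on_le finite_sep gG x act_closed by metis
  then show ?thesis using card_sep[of "\<phi> g x" x] gG x by simp
qed

text \<open>A root of order larger than \<open>d (\<phi> g x) x\<close> contradicts
  \<open>Hp_root_bound\<close>.\<close>

lemma Hp_empty_if_roots:
  assumes "\<And>m::nat. \<exists>s\<in>carrier G. \<exists>N\<ge>m. g = s [^] int N"
  shows "Hp g = {}"
proof (rule ccontr)
  assume "Hp g \<noteq> {}"
  then obtain h where h: "h \<in> Hp g" by auto
  obtain x where x: "x \<in> V" using nonempty by auto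
  obtain s N where "s \<in> carrier G" "N \<ge> Suc (d (\<phi> g x) x)" "g = s [^] int N" using assms by metis
  then show False using Hp_root_bound[of s N g h x] h x by simp
qed

text \<open>For large \<open>M\<close>, all but at most one of \<open>x, g\<^sup>N\<^sup>M x, g\<^sup>2\<^sup>N\<^sup>M x\<close> lie on the limit side of any
  given aperiodic halfspace, and \<open>g\<^sup>N\<close> preserves the periodic ones; hence the median of the three is fixed.\<close>

lemma Hp_empty_fixed_vertex:
  assumes g: "g \<in> carrier G" and emp: "Hp g = {}"
  shows "\<exists>N>0::nat. \<exists>y\<in>V. pw g (int N) y = y"
proof -
  obtain x where x: "x \<in> V" using nonempty by auto
  \<comment> \<open>The halfspaces crossed in one step of the orbit, in either direction. They are
    finitely many, and every halfspace that cuts the orbit is a translate of one of them.\<close>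
  define S where "S = sep x (\<phi> g x) \<union> sep (\<phi> g x) x"
  have fS: "finite S" using finite_sep g x by (simp add: S_def)
  have SH: "h \<in> Hs" if "h \<in> S" for h using that by (auto simp: S_def sep_def)
  have tr: "\<exists>j. \<exists>h0\<in>S. h = hact (g [^] (j::int)) h0"
    if h: "h \<in> Hs" and ab: "pw g a x \<in> h" "pw g b x \<notin> h" for h a b
  proof -
    obtain n where n: "(pw g n x \<in> h) \<noteq> (pw g (n + 1) x \<in> h)"
      using int_transition[of "\<lambda>n. pw g n x \<in> h" a b] ab by auto
    have hV: "h \<subseteq> V" using h Hs_subset by auto
    have eq: "pw g (n + 1) x = pw g n (\<phi> g x)" using pw_add[OF g x, of n 1] g by simp
    have "hact (g [^] (-n)) h \<in> S"
      using n mem_pw[OF g hV, of _ "-n"] g x hact_Hs[OF _ h] unfolding eq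
      by (auto simp: S_def sep_def)
    moreover have "h = hact (g [^] n) (hact (g [^] (-n)) h)"
      using hact_pw_add[OF g hV, of n "-n"] hact_one hV by simp
    ultimately show ?thesis by blast
  qed
  \<comment> \<open>One exponent that is a period of all periodic members of
    \<open>S\<close>.\<close>
  obtain N where N: "N > 0" "\<forall>h\<in>S. \<not> aperiodic g h \<longrightarrow> hact (g [^] int N) h = h"
  proof -
    have "\<exists>N>0. \<forall>h\<in>S. h \<subseteq> V \<and> (\<not> aperiodic g h \<longrightarrow> hact (g [^] int N) h = h)"
    proof (rule common_multiple[OF fS])
      show "\<exists>p>0. h \<subseteq> V \<and> (\<not> aperiodic g h \<longrightarrow> hact (g [^] int p) h = h)" if "h \<in> S" for h
        using SH[OF that] Hs_subset unfolding aperiodic_def by (cases "aperiodic g h") (auto simp: aperiodic_def)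
      show "h \<subseteq> V \<and> (\<not> aperiodic g h \<longrightarrow> hact (g [^] int (p * q)) h = h)"
        if "h \<subseteq> V \<and> (\<not> aperiodic g h \<longrightarrow> hact (g [^] int p) h = h)" for h p q
        using periodic_mult[OF g, of h "int p" q] that by auto
    qed
    then show ?thesis using that by blast
  qed
  have lim: "\<exists>R. aperiodic g h \<longrightarrow> (\<exists>b. \<forall>n. \<bar>n\<bar> \<ge> R \<longrightarrow> (pw g n x \<in> h) = b)" if h: "h \<in> S" for h
  proof (cases "aperiodic g h")
    case True
    obtain M b c where M: "\<forall>n\<ge>M. (pw g n x \<in> h) = b" "\<forall>n\<le>-M. (pw g n x \<in> h) = c"
      using aperiodic_limits[OF g SH[OF h] True x] by auto
    \<comment> \<open>Different limits would put \<open>h\<close> or its complement into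
      \<open>Hp g\<close>, depending on the direction of crossing.\<close>
    have "b = c"
    proof (rule ccontr)
      assume "b \<noteq> c"
      then consider "b" "\<not> c" | "\<not> b" "c" by auto
      then show False
      proof cases
        case 1
        then have "h \<in> Hp g" using M SH[OF h] x unfolding Hp_def by auto
        then show False using emp by auto
      next
        case 2
        have "pw g n x \<in> V" for n using g x by simp
        then have "V - h \<in> Hp g"
          using 2 M Hs_compl[OF SH[OF h]] x unfolding Hp_def mem_Collect_eq
          by (intro conjI bexI[of _ x] exI[of _ M] exI[of _ "-M"]) auto
        then show False using emp by auto
      qed
    qed
    then have "(pw g n x \<in> h) = b" if "\<bar>n\<bar> \<ge> M" for n using M that by (cases "n \<ge> 0") auto
    then show ?thesis by blast
  qed auto
  obtain R where R: "\<forall>h\<in>S. aperiodic g h \<longrightarrow> (\<exists>b. \<forall>n. \<bar>n\<bar> \<ge> R \<longrightarrow> (pw g n x \<in> h) = b)"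
  proof -
    have "\<exists>R. \<forall>h\<in>S. aperiodic g h \<longrightarrow> (\<exists>b. \<forall>n. \<bar>n\<bar> \<ge> R \<longrightarrow> (pw g n x \<in> h) = b)"
    proof (rule common_bound[OF fS lim])
      fix h and R R' :: int
      assume "aperiodic g h \<longrightarrow> (\<exists>b. \<forall>n. \<bar>n\<bar> \<ge> R \<longrightarrow> (pw g n x \<in> h) = b)" "R \<le> R'"
      then show "aperiodic g h \<longrightarrow> (\<exists>b. \<forall>n. \<bar>n\<bar> \<ge> R' \<longrightarrow> (pw g n x \<in> h) = b)"
        by (meson order_trans)
    qed
    then show ?thesis using that by blast
  qed
  \<comment> \<open>An orbit point may be on the wrong side of the \<open>j\<close>-th translate
    only if its index is within less than \<open>\<bar>R\<bar>\<close> of \<open>j\<close>. As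
    \<open>K > 2 * \<bar>R\<bar>\<close>, at most one of three indices spaced by \<open>K\<close> is
    so close.\<close>
  define K where "K = int N * (2 * \<bar>R\<bar> + 1)"
  have "1 * (2 * \<bar>R\<bar> + 1) \<le> K" unfolding K_def using N by (intro mult_right_mono) auto
  then have K: "K > 2 * \<bar>R\<bar>" by simp
  have pV: "pw g n x \<in> V" for n using g x by simp
  define m where "m = med x (pw g K x) (pw g (2 * K) x)"
  have m0: "m = med (pw g 0 x) (pw g K x) (pw g (2 * K) x)" using x by (simp add: m_def)
  have mV: "m \<in> V" using med(1) pV x by (simp add: m_def)
  have mN: "pw g (int N) m = med (pw g (int N) x) (pw g (int N + K) x) (pw g (int N + 2 * K) x)"
    unfolding m_def using g x pV by (subst med_act) (auto simp: pw_add)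
  have "pw g (int N) m = m"
  proof (rule ccontr)
    assume "pw g (int N) m \<noteq> m"
    then obtain h where h: "h \<in> Hs" "m \<in> h" "pw g (int N) m \<notin> h"
      using ex_sep[of m "pw g (int N) m"] g mV by (metis act_closed Gr.int_pow_closed)
    have hV: "h \<subseteq> V" using h Hs_subset by auto
    have m1: "(pw g 0 x \<in> h \<and> pw g K x \<in> h) \<or> (pw g K x \<in> h \<and> pw g (2 * K) x \<in> h) \<or> (pw g 0 x \<in> h \<and> pw g (2 * K) x \<in> h)"
      using h(2) unfolding m0 Hs_med[OF h(1) pV pV pV] .
    have m2: "\<not> ((pw g (int N) x \<in> h \<and> pw g (int N + K) x \<in> h) \<or> (pw g (int N + K) x \<in> h \<and> pw g (int N + 2 * K) x \<in> h) \<or> (pw g (int N) x \<in> h \<and> pw g (int N + 2 * K) x \<in> h))"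
      using h(3) unfolding mN Hs_med[OF h(1) pV pV pV] .
    obtain a b where "pw g a x \<in> h" "pw g b x \<notin> h" using m1 m2 by blast
    then obtain j h0 where j: "h0 \<in> S" "h = hact (g [^] (j::int)) h0" using tr[OF h(1)] by blast
    have h0V: "h0 \<subseteq> V" using SH[OF j(1)] Hs_subset by auto
    show False
    proof (cases "aperiodic g h0")
      case False
      then have "hact (g [^] int N) h0 = h0" using N j by auto
      then have "hact (g [^] int N) h = h"
        using hact_pw_add[OF g h0V, of "int N" j] hact_pw_add[OF g h0V, of j "int N"] j
        by (simp add: add.commute)
      then have "pw g (int N) m \<in> h" using act_mem[of "g [^] int N" h m] g hV mV h(2) by simp
      then show False using h by blast
    next
      case True
      then obtain b where b: "\<forall>n. \<bar>n\<bar> \<ge> R \<longrightarrow> (pw g n x \<in> h0) = b" using R j by blast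
      have hb: "(pw g n x \<in> h) = b" if "\<bar>n - j\<bar> \<ge> \<bar>R\<bar>" for n
        using b that pw_mem[OF g h0V x, of n j] j(2) by auto
      have one: "(\<bar>p - j\<bar> \<ge> \<bar>R\<bar> \<and> \<bar>p + K - j\<bar> \<ge> \<bar>R\<bar>) \<or> (\<bar>p + K - j\<bar> \<ge> \<bar>R\<bar> \<and> \<bar>p + 2 * K - j\<bar> \<ge> \<bar>R\<bar>) \<or> (\<bar>p - j\<bar> \<ge> \<bar>R\<bar> \<and> \<bar>p + 2 * K - j\<bar> \<ge> \<bar>R\<bar>)" for p
        using K by linarith
      have "b" using one[of 0] hb[of 0] hb[of K] hb[of "2 * K"] m1 by auto
      moreover have "\<not> b" using one[of "int N"] hb[of "int N"] hb[of "int N + K"] hb[of "int N + 2 * K"] m2 by auto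
      ultimately show False by blast
    qed
  qed
  then show ?thesis using N mV by blast
qed

end

section \<open>Convexity, the Helly property and cubes\<close>

context median_graph
begin

definition mconvex :: "'a set \<Rightarrow> bool" where
  "mconvex C \<longleftrightarrow> C \<subseteq> V \<and> (\<forall>x\<in>C. \<forall>y\<in>C. \<forall>u\<in>V. d x y = d x u + d u y \<longrightarrow> u \<in> C)"

lemma mconvex_in: "mconvex C \<Longrightarrow> x \<in> C \<Longrightarrow> x \<in> V"
  unfolding mconvex_def by blast

lemma mconvex_Hs: "h \<in> Hs \<Longrightarrow> mconvex h"
  unfolding mconvex_def using Hs_subset Hs_convex by blast

lemma mconvex_Int: "mconvex A \<Longrightarrow> mconvex B \<Longrightarrow> mconvex (A \<inter> B)"
  unfolding mconvex_def by blast

lemma mconvex_med: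
  assumes "mconvex C" "x \<in> V" "y \<in> V" "z \<in> V" "(x \<in> C \<and> y \<in> C) \<or> (y \<in> C \<and> z \<in> C) \<or> (x \<in> C \<and> z \<in> C)"
  shows "med x y z \<in> C"
  using med[OF assms(2-4)] assms(1,5) unfolding mconvex_def by metis

text \<open>Pick one point in each pairwise intersection: each of the three sets contains two of
  these points, hence their median.\<close>

lemma Helly3:
  assumes "mconvex A" "mconvex B" "mconvex C" "A \<inter> B \<noteq> {}" "B \<inter> C \<noteq> {}" "A \<inter> C \<noteq> {}"
  shows "A \<inter> B \<inter> C \<noteq> {}"
proof -
  obtain x y z where p: "x \<in> A" "x \<in> B" "y \<in> B" "y \<in> C" "z \<in> A" "z \<in> C" using assms(4-6) by blast
  then have V: "x \<in> V" "y \<in> V" "z \<in> V" using assms(1-3) unfolding mconvex_def by blast+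
  have "med x y z \<in> A" "med x y z \<in> B" "med x y z \<in> C"
    using mconvex_med[OF assms(1) V] mconvex_med[OF assms(2) V] mconvex_med[OF assms(3) V] p by auto
  then show ?thesis by auto
qed

text \<open>All members are cut down to one of them, \<open>C\<close>; \<open>Helly3\<close> keeps
  the pairwise intersections non-empty, and the family gets smaller.\<close>

lemma Helly:
  assumes "finite F" "\<And>C. C \<in> F \<Longrightarrow> mconvex C" "\<And>A B. A \<in> F \<Longrightarrow> B \<in> F \<Longrightarrow> A \<inter> B \<noteq> {}"
  shows "\<exists>v\<in>V. \<forall>C\<in>F. v \<in> C"
  using assms
proof (induction "card F" arbitrary: F rule: less_induct)
  case less
  show ?case
  proof (cases "F = {}")
    case True
    then show ?thesis using nonempty by auto
  next
    case False
    then obtain C F' where F: "F = insert C F'" "C \<notin> F'" by (metis equals0I mk_disjoint_insert)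
    have fin: "finite F'" using less.prems F by simp
    show ?thesis
    proof (cases "F' = {}")
      case True
      moreover have "C \<noteq> {}" using less.prems(3)[of C C] F by auto
      ultimately show ?thesis using mconvex_in less.prems(2)[of C] F by auto
    next
      case False
      let ?F = "(\<lambda>A. A \<inter> C) ` F'"
      have "card ?F < card F" using F fin card_image_le[OF fin, of "\<lambda>A. A \<inter> C"] by simp
      moreover have "mconvex D" if "D \<in> ?F" for D using that less.prems(2) F mconvex_Int by auto
      moreover have "D \<inter> E \<noteq> {}" if DE: "D \<in> ?F" "E \<in> ?F" for D E
      proof -
        obtain A B where AB: "A \<in> F'" "B \<in> F'" "D = A \<inter> C" "E = B \<inter> C" using DE by auto
        have "A \<inter> B \<inter> C \<noteq> {}"
          by (rule Helly3) (use AB less.prems(2,3) F in auto)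
        then show ?thesis using AB by auto
      qed
      ultimately obtain v where "v \<in> V" "\<forall>D\<in>?F. v \<in> D" using less.hyps[of ?F] fin by auto
      then show ?thesis using F False by auto
    qed
  qed
qed

text \<open>\<open>v\<close> is a vertex of \<open>C\<close> nearest to \<open>x\<close>. If some
  \<open>a \<in> C\<close> lay outside \<open>h\<close>, the median of \<open>v\<close>,
  \<open>a\<close>, \<open>x\<close> would be in \<open>C\<close>, outside \<open>h\<close> and
  strictly closer to \<open>x\<close>. Statements about all of \<open>C\<close> can thus be read off
  from one vertex.\<close>

lemma gate:
  assumes C: "mconvex C" "C \<noteq> {}" and x: "x \<in> V"
  obtains v where "v \<in> C" "\<And>h. h \<in> Hs \<Longrightarrow> v \<in> h \<Longrightarrow> x \<notin> h \<Longrightarrow> C \<subseteq> h"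
proof -
  obtain v where v: "v \<in> C" "\<And>u. u \<in> C \<Longrightarrow> d x v \<le> d x u"
    using ex_has_least_nat[of "\<lambda>v. v \<in> C" _ "d x"] C(2) by blast
  have vV: "v \<in> V" using mconvex_in[OF C(1) v(1)] .
  have "C \<subseteq> h" if h: "h \<in> Hs" "v \<in> h" "x \<notin> h" for h
  proof (rule ccontr)
    assume "\<not> C \<subseteq> h"
    then obtain a where a: "a \<in> C" "a \<notin> h" by auto
    have aV: "a \<in> V" using mconvex_in[OF C(1) a(1)] .
    let ?m = "med v a x"
    note m = med[OF vV aV x]
    have "?m \<in> C" using mconvex_med[OF C(1) vV aV x] v a by auto
    moreover have "?m \<notin> h" using Hs_med[OF h(1) vV aV x] a h by auto
    then have "d v ?m \<noteq> 0" using h(2) dist_eq_0[OF vV m(1)] by metis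
    then have "d x ?m < d x v" using m(4) dist_sym[of x] by simp
    ultimately show False using v(2) by (metis not_less)
  qed
  then show ?thesis using that v by blast
qed

text \<open>The halfspaces realise all sign patterns, but the witnesses may be far apart. A pair
  \<open>v\<close>, \<open>w\<close> on opposite sides of all of them is taken at minimal distance;
  then only the \<open>h i\<close> separate \<open>v\<close> from \<open>w\<close>, and medians with
  \<open>v\<close> and \<open>w\<close> project the witnesses to the corners of a cube.\<close>

lemma card_separating_cube:
  fixes h :: "nat \<Rightarrow> 'a set"
  assumes hH: "\<And>i. i < m \<Longrightarrow> h i \<in> Hs"
    and q: "\<And>A. A \<subseteq> {..<m} \<Longrightarrow> \<exists>v\<in>V. \<forall>i<m. v \<in> h i \<longleftrightarrow> i \<in> A"
  shows "has_induced_cube V adj m"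
proof -
  define P where "P = (\<lambda>(v, w). v \<in> V \<and> w \<in> V \<and> (\<forall>i<m. v \<in> h i) \<and> (\<forall>i<m. w \<notin> h i))"
  have "\<exists>p. P p" using q[of "{..<m}"] q[of "{}"] by (auto simp: P_def)
  then obtain p where p: "P p" "\<And>p'. P p' \<Longrightarrow> d (fst p) (snd p) \<le> d (fst p') (snd p')"
    using ex_has_least_nat[of P _ "\<lambda>p. d (fst p) (snd p)"] by blast
  obtain v w where vw: "p = (v, w)" by (cases p)
  have V: "v \<in> V" "w \<in> V" and vh: "\<forall>i<m. v \<in> h i" and wh: "\<forall>i<m. w \<notin> h i"
    using p(1) by (auto simp: P_def vw)
  have least: "d v w \<le> d v' w'" if "v' \<in> V" "w' \<in> V" "\<forall>i<m. v' \<in> h i" "\<forall>i<m. w' \<notin> h i" for v' w'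
    using p(2)[of "(v', w')"] that by (simp add: P_def vw)
  have kh: "\<exists>i<m. k = h i" if k: "k \<in> Hs" "v \<in> k" "w \<notin> k" for k
  proof -
    \<comment> \<open>A vertex inside all \<open>h i\<close> but outside \<open>k\<close> would
      give, as the median of \<open>v\<close>, \<open>a\<close>, \<open>w\<close>, a replacement for
      \<open>v\<close> nearer to \<open>w\<close>.\<close>
    have A: "a \<in> k" if a: "a \<in> V" "\<forall>i<m. a \<in> h i" for a
    proof (rule ccontr)
      assume ak: "a \<notin> k"
      note m = med[OF V(1) a(1) V(2)]
      have "\<forall>i<m. med v a w \<in> h i" using Hs_med[OF hH V(1) a(1) V(2)] a vh by auto
      then have "d v w \<le> d (med v a w) w" using least m(1) V wh by blast
      then have "med v a w = v" using m(4) dist_eq_0[OF V(1) m(1)] by auto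
      then show False using Hs_med[OF k(1) V(1) a(1) V(2)] k ak by auto
    qed
    have B: "b \<notin> k" if b: "b \<in> V" "\<forall>i<m. b \<notin> h i" for b
    proof
      assume bk: "b \<in> k"
      note m = med[OF V(1) b(1) V(2)]
      have "\<forall>i<m. med v b w \<notin> h i" using Hs_med[OF hH V(1) b(1) V(2)] b wh by auto
      then have "d v w \<le> d v (med v b w)" using least m(1) V vh by blast
      then have "med v b w = w" using m(4) dist_eq_0[OF m(1) V(2)] by auto
      then show False using Hs_med[OF k(1) V(1) b(1) V(2)] k bk by auto
    qed
    have hh: "h i \<inter> h j \<noteq> {}" if "i < m" "j < m" for i j using that vh by auto
    have hc: "(V - h i) \<inter> (V - h j) \<noteq> {}" if "i < m" "j < m" for i j using that wh V by auto
    \<comment> \<open>Otherwise the complement of \<open>k\<close> meets every \<open>h j\<close>,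
      and Helly yields a vertex that \<open>A\<close> forbids.\<close>
    have 1: "\<exists>j<m. h j \<subseteq> k"
    proof (rule ccontr)
      assume n: "\<not> ?thesis"
      have "\<exists>u\<in>V. \<forall>C\<in>insert (V - k) (h ` {..<m}). u \<in> C"
      proof (rule Helly)
        show "mconvex C" if "C \<in> insert (V - k) (h ` {..<m})" for C
          using that hH mconvex_Hs Hs_compl[OF k(1)] by auto
        have "(V - k) \<inter> h j \<noteq> {}" if "j < m" for j using n that Hs_subset[OF hH[OF that]] by auto
        moreover have "(V - k) \<noteq> {}" using k V by auto
        ultimately show "A \<inter> B \<noteq> {}" if "A \<in> insert (V - k) (h ` {..<m})" "B \<in> insert (V - k) (h ` {..<m})" for A B
          using that hh by (auto simp: Int_commute)
      qed auto
      then show False using A by auto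
    qed
    have 2: "\<exists>j<m. k \<subseteq> h j"
    proof (rule ccontr)
      assume n: "\<not> ?thesis"
      have "\<exists>u\<in>V. \<forall>C\<in>insert k ((\<lambda>i. V - h i) ` {..<m}). u \<in> C"
      proof (rule Helly)
        show "mconvex C" if "C \<in> insert k ((\<lambda>i. V - h i) ` {..<m})" for C
          using that hH mconvex_Hs Hs_compl k(1) by auto
        have "k \<inter> (V - h j) \<noteq> {}" if "j < m" for j using n that Hs_subset[OF k(1)] by auto
        moreover have "k \<noteq> {}" using k V by auto
        ultimately show "A \<inter> B \<noteq> {}" if "A \<in> insert k ((\<lambda>i. V - h i) ` {..<m})" "B \<in> insert k ((\<lambda>i. V - h i) ` {..<m})" for A B
          using that hc by (auto simp: Int_commute)
      qed auto
      then show False using B by auto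
    qed
    \<comment> \<open>The nesting of \<open>h j\<close> in \<open>k\<close> and of \<open>k\<close>
      in \<open>h i\<close> collapses, since the pattern \<open>{j}\<close> is realised.\<close>
    obtain i j where ij: "i < m" "j < m" "h j \<subseteq> k" "k \<subseteq> h i" using 1 2 by auto
    obtain u where "u \<in> V" "\<forall>l<m. u \<in> h l \<longleftrightarrow> l \<in> {j}" using q[of "{j}"] ij by auto
    then have "i = j" using ij by auto
    then show ?thesis using ij by auto
  qed
  obtain c where c: "\<And>A. A \<subseteq> {..<m} \<Longrightarrow> c A \<in> V \<and> (\<forall>i<m. c A \<in> h i \<longleftrightarrow> i \<in> A)" using q by metis
  define u where "u A = med v w (c A)" for A
  have uV: "u A \<in> V" if "A \<subseteq> {..<m}" for A using med(1) V c that by (simp add: u_def)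
  have uh: "u A \<in> h i \<longleftrightarrow> i \<in> A" if "A \<subseteq> {..<m}" "i < m" for A i
    using Hs_med[OF hH[OF that(2)] V] c[OF that(1)] that vh wh by (auto simp: u_def)
  have same: "u A \<in> k \<longleftrightarrow> v \<in> k" if A: "A \<subseteq> {..<m}" and k: "k \<in> Hs" "v \<in> k \<longleftrightarrow> w \<in> k" for A k
    using Hs_med[OF k(1) V] c[OF A] k(2) by (auto simp: u_def)
  have hinj: "i = j" if "h i = h j" "i < m" "j < m" for i j
  proof -
    have "u {i} \<in> h i" using uh[of "{i}" i] that(2) by simp
    then have "u {i} \<in> h j" unfolding that(1) .
    then show ?thesis using uh[of "{i}" j] that(2,3) by simp
  qed
  have hne: "h i \<noteq> V - h j" if "i < m" "j < m" for i j
    using vh that by auto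
  have dist: "d (u A) (u B) = card (sym_diff A B)" if A: "A \<subseteq> {..<m}" and B: "B \<subseteq> {..<m}" for A B
  proof -
    \<comment> \<open>A separating halfspace is oriented so as to contain \<open>u A\<close>: it is
      \<open>h i\<close> or its complement according to \<open>i \<in> A\<close>.\<close>
    let ?f = "\<lambda>i. if i \<in> A then h i else V - h i"
    have "sep (u A) (u B) = ?f ` sym_diff A B"
    proof (intro equalityI subsetI)
      fix k assume k: "k \<in> sep (u A) (u B)"
      then have kH: "k \<in> Hs" and ku: "u A \<in> k" "u B \<notin> k" by (auto simp: sep_def)
      have "(v \<in> k) \<noteq> (w \<in> k)" using same[OF A kH] same[OF B kH] ku by auto
      then consider "v \<in> k" "w \<notin> k" | "v \<notin> k" "w \<in> k" by auto
      then show "k \<in> ?f ` sym_diff A B"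
      proof cases
        case 1
        then obtain i where "i < m" "k = h i" using kh kH by auto
        then have "i \<in> sym_diff A B" "k = ?f i" using uh A B ku by auto
        then show ?thesis by blast
      next
        case 2
        then obtain i where i: "i < m" "V - k = h i" using kh[OF Hs_compl[OF kH]] V by auto
        then have "k = V - h i" using Hs_subset[OF kH] by auto
        moreover then have "i \<in> sym_diff A B" "i \<notin> A" using uh[OF A] uh[OF B] i(1) ku uV[OF B] by auto
        ultimately show ?thesis by auto
      qed
    next
      fix k assume "k \<in> ?f ` sym_diff A B"
      then obtain i where i: "k = ?f i" "i \<in> sym_diff A B" by (rule imageE)
      then have im: "i < m" using A B by auto
      show "k \<in> sep (u A) (u B)"
        using i uh[OF A im] uh[OF B im] hH[OF im] Hs_compl uV[OF A] uV[OF B] by (auto simp: sep_def)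
    qed
    moreover have "inj_on ?f (sym_diff A B)"
    proof (rule inj_onI)
      fix i j assume i: "i \<in> sym_diff A B" and j: "j \<in> sym_diff A B" and eq: "?f i = ?f j"
      then have ij: "i < m" "j < m" using A B by auto
      have "h i = h j"
      proof (cases "i \<in> A"; cases "j \<in> A")
        assume "i \<notin> A" "j \<notin> A"
        then have "V - h i = V - h j" using eq by simp
        then show ?thesis using Hs_subset[OF hH[OF ij(1)]] Hs_subset[OF hH[OF ij(2)]] by blast
      qed (use eq hne[OF ij] hne[OF ij(2,1)] in auto)
      then show "i = j" using hinj ij by auto
    qed
    ultimately have "card (sep (u A) (u B)) = card (sym_diff A B)" by (metis card_image)
    then show ?thesis using card_sep uV A B by metis
  qed
  show ?thesis
    unfolding has_induced_cube_def
  proof (intro bexI[of _ u] conjI ballI)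
    show "inj_on u (Pow {..<m})"
    proof (rule inj_onI)
      fix A B assume AB: "A \<in> Pow {..<m}" "B \<in> Pow {..<m}" "u A = u B"
      then have "i \<in> A \<longleftrightarrow> i \<in> B" if "i < m" for i
        using uh[of A i] uh[of B i] that by simp
      then show "A = B" using AB by blast
    qed
    show "adj (u A) (u B) \<longleftrightarrow> card (sym_diff A B) = 1" if "A \<in> Pow {..<m}" "B \<in> Pow {..<m}" for A B
    proof -
      have AB: "A \<subseteq> {..<m}" "B \<subseteq> {..<m}" using that by auto
      have "adj (u A) (u B) \<longleftrightarrow> d (u A) (u B) = 1" using uV[OF AB(1)] uV[OF AB(2)] by (metis adj_dist)
      then show ?thesis unfolding dist[OF AB] .
    qed
    show "u \<in> Pow {..<m} \<rightarrow> V" using uV by auto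
  qed
qed

text \<open>For subsets of \<open>V\<close> these conditions say that all four sectors are
  non-empty, that is, the two hyperplanes cross.\<close>

definition transverse :: "'a set \<Rightarrow> 'a set \<Rightarrow> bool" where
  "transverse h k \<longleftrightarrow> h \<inter> k \<noteq> {} \<and> \<not> h \<subseteq> k \<and> \<not> k \<subseteq> h \<and> h \<union> k \<noteq> V"

text \<open>Every choice of sides is a family of pairwise intersecting halfspaces, so Helly realises
  every sign pattern.\<close>

lemma transverse_cube:
  assumes E: "finite E" "E \<subseteq> Hs" and t: "\<And>h k. h \<in> E \<Longrightarrow> k \<in> E \<Longrightarrow> h \<noteq> k \<Longrightarrow> transverse h k"
  shows "has_induced_cube V adj (card E)"
proof -
  obtain h where h: "bij_betw h {0..<card E} E" using ex_bij_betw_nat_finite[OF E(1)] by blast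
  have hE: "h i \<in> E" if "i < card E" for i using h that by (auto simp: bij_betw_def)
  have hne: "h i \<noteq> h j" if "i < card E" "j < card E" "i \<noteq> j" for i j
    using h that by (auto simp: bij_betw_def inj_on_def)
  have sub: "h i \<subseteq> V" "h i \<noteq> {}" "V - h i \<noteq> {}" if "i < card E" for i
    using hE[OF that] E Hs_subset Hs_nonempty Hs_compl by blast+
  show ?thesis
  proof (rule card_separating_cube[of _ h])
    fix A assume A: "A \<subseteq> {..<card E}"
    let ?f = "\<lambda>i. if i \<in> A then h i else V - h i"
    have "\<exists>v\<in>V. \<forall>C\<in>?f ` {..<card E}. v \<in> C"
    proof (rule Helly)
      show "mconvex C" if "C \<in> ?f ` {..<card E}" for C
        using that hE E mconvex_Hs Hs_compl by (auto split: if_splits)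
      show "C \<inter> D \<noteq> {}" if CD: "C \<in> ?f ` {..<card E}" "D \<in> ?f ` {..<card E}" for C D
      proof -
        obtain i j where ij: "i < card E" "j < card E" "C = ?f i" "D = ?f j" using CD by auto
        show ?thesis
        proof (cases "i = j")
          case True
          then show ?thesis using ij sub[OF ij(1)] by auto
        next
          case False
          then have "transverse (h i) (h j)" using t hE hne ij by auto
          then show ?thesis using ij sub[OF ij(1)] sub[OF ij(2)] unfolding transverse_def by auto
        qed
      qed
    qed auto
    then show "\<exists>v\<in>V. \<forall>i<card E. v \<in> h i \<longleftrightarrow> i \<in> A" by (auto split: if_splits) blast
  qed (use hE E in auto)
qed

lemma finite_dim_no_cube:
  assumes "cubical_dim V adj < \<infinity>"
  obtains n where "\<not> has_induced_cube V adj (Suc n)"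
proof (rule ccontr)
  assume "\<not> thesis"
  then have c: "has_induced_cube V adj (Suc n)" for n using that by blast
  have "enat n \<le> cubical_dim V adj" for n
  proof -
    have "enat (Suc n) \<le> cubical_dim V adj"
      unfolding cubical_dim_def by (rule Sup_upper) (use c in auto)
    then show ?thesis by (meson enat_ord_simps(1) le_SucI order_refl order_trans)
  qed
  then show False using assms by (metis enat_ord_simps(2) infinity_ileE linorder_not_less lessI not_infinity_eq order_less_irrefl)
qed

lemma transverse_card:
  assumes "\<not> has_induced_cube V adj (Suc n)" and E: "finite E" "E \<subseteq> Hs"
    and t: "\<And>h k. h \<in> E \<Longrightarrow> k \<in> E \<Longrightarrow> h \<noteq> k \<Longrightarrow> transverse h k"
  shows "card E \<le> n"
proof (rule ccontr)
  assume "\<not> card E \<le> n"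
  then obtain E' where E': "E' \<subseteq> E" "card E' = Suc n" "finite E'"
    using obtain_subset_with_card_n[of "Suc n" E] by (metis not_less_eq_eq)
  then have "has_induced_cube V adj (card E')"
    using E t by (intro transverse_cube) blast+
  then show False using assms(1) E' by simp
qed

end

section \<open>Bounded orbits, and cubes from independent elements\<close>

context median_action
begin

text \<open>Take \<open>y\<close> in \<open>k\<close> outside \<open>hact g k\<close>. Its forward
  orbit stays in \<open>k\<close> by nesting; a backward point in \<open>k\<close> would bring
  \<open>y\<close> into a translate contained in \<open>hact g k\<close>.\<close>

lemma nested_Hp:
  assumes g: "g \<in> carrier G" and k: "k \<in> Hs" and nest: "hact g k \<subset> k"
  shows "k \<in> Hp g"
proof -
  have kV: "k \<subseteq> V" using k Hs_subset by auto
  obtain y where y: "y \<in> k" "y \<notin> hact g k" using nest by auto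
  have yV: "y \<in> V" using y kV by auto
  have sub: "hact (g [^] int n) k \<subseteq> k" for n
  proof (induction n)
    case 0
    then show ?case using hact_one[OF kV] by simp
  next
    case (Suc n)
    have "hact (g [^] int (Suc n)) k = hact (g [^] int n) (hact (g [^] (1::int)) k)"
      using hact_pw_add[OF g kV, of "int n" 1] by (simp add: add.commute)
    also have "\<dots> \<subseteq> hact (g [^] int n) k" using nest g by (intro hact_mono) auto
    finally show ?case using Suc by auto
  qed
  have "pw g n y \<in> k" if "n \<ge> 0" for n
  proof -
    have m: "n = int (nat n)" using that by simp
    have "pw g n y \<in> hact (g [^] n) k" using act_mem[of "g [^] n" k y] g kV yV y by simp
    then show ?thesis using sub[of "nat n"] m by auto
  qed
  moreover have "pw g n y \<notin> k" if n: "n \<le> -1" for n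
  proof
    assume "pw g n y \<in> k"
    then have 1: "y \<in> hact (g [^] (- n)) k" using mem_pw[OF g kV yV, of "-n"] by simp
    define m where "m = nat (- n - 1)"
    have m: "- n = 1 + int m" using n by (simp add: m_def)
    have "hact (g [^] (- n)) k = hact g (hact (g [^] int m) k)"
      unfolding m using hact_pw_add[OF g kV, of 1 "int m"] g by simp
    then have "y \<in> hact g k" using 1 hact_mono[OF sub[of m], of g] by auto
    then show False using y by blast
  qed
  ultimately show ?thesis unfolding Hp_def using k yV by auto
qed

text \<open>Halfspaces separating \<open>x\<close> from \<open>w x\<close> that are translates of one halfspace by the generated
  subgroup are never nested, hence pairwise transverse, so there are at most \<open>n\<close> of them.\<close>

lemma bounded_orbit_generate:
  assumes dim: "\<not> has_induced_cube V adj (Suc n)" and S: "finite S" "S \<subseteq> carrier G"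
    and emp: "\<And>k. k \<in> generate G S \<Longrightarrow> Hp k = {}" and x: "x \<in> V"
  shows "\<exists>B. \<forall>w\<in>generate G S. d x (\<phi> w x) \<le> B"
proof -
  let ?W = "generate G S"
  have W: "w \<in> carrier G" if "w \<in> ?W" for w using that S Gr.generate_in_carrier by blast
  \<comment> \<open>Halfspaces crossed by a single letter. Along a word for \<open>w\<close>, each
    halfspace between \<open>x\<close> and \<open>\<phi> w x\<close> is crossed at some letter and
    is therefore a translate of a member of \<open>Q\<close>.\<close>
  define Q where "Q = (\<Union>s\<in>S. sep (\<phi> s x) x \<union> sep (\<phi> (inv s) x) x)"
  have Q: "finite Q" "Q \<subseteq> Hs"
    unfolding Q_def using S x finite_sep by (auto simp: subset_iff) (auto simp: sep_def)
  have tr: "\<exists>u\<in>?W. \<exists>q\<in>Q. h = hact u q" if "w \<in> ?W" "h \<in> sep (\<phi> w x) x" for w h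
    using that
  proof (induction arbitrary: h rule: generate.induct)
    case one
    then show ?case using x by (simp add: sep_def)
  next
    case (incl s)
    then have "h \<in> Q" "h \<subseteq> V" using Hs_subset by (auto simp: Q_def sep_def)
    then show ?case using hact_one generate.one by metis
  next
    case (inv s)
    then have "h \<in> Q" "h \<subseteq> V" using Hs_subset by (auto simp: Q_def sep_def)
    then show ?case using hact_one generate.one by metis
  next
    case (eng w1 w2)
    have w: "w1 \<in> carrier G" "w2 \<in> carrier G" using eng W by auto
    have hH: "h \<in> Hs" "h \<subseteq> V" using eng.prems Hs_subset by (auto simp: sep_def)
    show ?case
    proof (cases "\<phi> w1 x \<in> h")
      case True
      then have "h \<in> sep (\<phi> w1 x) x" using eng.prems by (auto simp: sep_def)
      then show ?thesis using eng.IH by blast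
    next
      case False
      have "hact (inv w1) h \<in> sep (\<phi> w2 x) x"
        using False eng.prems hact_Hs[OF _ hH(1)] w x hH hact_iff[of "inv w1" h]
        by (auto simp: sep_def act_mult)
      then obtain u q where uq: "u \<in> ?W" "q \<in> Q" "hact (inv w1) h = hact u q" using eng.IH by blast
      have "h = hact w1 (hact u q)" using hact_inv(2)[OF w(1) hH(2)] uq by simp
      also have "\<dots> = hact (w1 \<otimes> u) q"
        using hact_mult[OF w(1) W[OF uq(1)], of q] uq(2) Q Hs_subset by auto
      finally show ?thesis using uq eng.hyps generate.eng by metis
    qed
  qed
  have "d x (\<phi> w x) \<le> card Q * n" if w: "w \<in> ?W" for w
  proof -
    define E where "E q = {h \<in> sep (\<phi> w x) x. \<exists>u\<in>?W. h = hact u q}" for q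
    have wx: "\<phi> w x \<in> V" using W[OF w] x by simp
    have fs: "finite (sep (\<phi> w x) x)" using finite_sep wx x by blast
    have cE: "card (E q) \<le> n" if q: "q \<in> Q" for q
    proof (rule transverse_card[OF dim])
      show "finite (E q)" using fs by (simp add: E_def)
      show "E q \<subseteq> Hs" by (auto simp: E_def sep_def)
      have qV: "q \<subseteq> V" using q Q Hs_subset by auto
      \<comment> \<open>If two translates of \<open>q\<close> were strictly nested, the element
        \<open>g\<close> that takes the larger to the smaller would push \<open>k\<close> into
        itself, and \<open>nested_Hp\<close> would put \<open>k\<close> into the empty set
        \<open>Hp g\<close>.\<close>
      have nn: "\<not> h \<subset> k" if hk: "h \<in> E q" "k \<in> E q" for h k
      proof
        assume hsub: "h \<subset> k"
        obtain u u' where u: "u \<in> ?W" "u' \<in> ?W" "h = hact u q" "k = hact u' q"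
          using hk by (auto simp: E_def)
        have uc: "u \<in> carrier G" "u' \<in> carrier G" using u W by auto
        define g where "g = u \<otimes> inv u'"
        have "inv u' \<in> ?W" using Gr.generate_m_inv_closed S u by blast
        then have gW: "g \<in> ?W" using u generate.eng by (metis g_def)
        have "hact g k = hact u (hact (inv u') (hact u' q))"
          unfolding g_def u(4) using hact_mult[OF uc(1), of "inv u'"] uc qV hact_subset by simp
        then have "hact g k = h" using hact_inv(1)[OF uc(2) qV] u by simp
        then have "k \<in> Hp g" using nested_Hp[OF W[OF gW], of k] hsub hk by (auto simp: E_def sep_def)
        then show False using emp[OF gW] by auto
      qed
      \<comment> \<open>All members contain \<open>\<phi> w x\<close> and miss \<open>x\<close>,
        which inhabits the two sectors that the absence of nesting does not cover.\<close>
      show "transverse h k" if "h \<in> E q" "k \<in> E q" "h \<noteq> k" for h k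
        using nn[OF that(1,2)] nn[OF that(2,1)] that x by (auto simp: transverse_def E_def sep_def)
    qed
    have "sep (\<phi> w x) x = (\<Union>q\<in>Q. E q)" 
    proof (intro equalityI subsetI)
      fix h assume h: "h \<in> sep (\<phi> w x) x"
      then show "h \<in> (\<Union>q\<in>Q. E q)" using tr[OF w h] unfolding E_def by blast
    qed (auto simp: E_def)
    then have "card (sep (\<phi> w x) x) \<le> (\<Sum>q\<in>Q. card (E q))" using card_UN_le[OF Q(1)] by metis
    also have "\<dots> \<le> card Q * n" using sum_bounded_above[of Q "\<lambda>q. card (E q)" n] cE by simp
    finally show ?thesis using card_sep[OF wx x] by (simp add: dist_sym[of x])
  qed
  then show ?thesis by blast
qed

lemma hact_pow_fix:
  assumes g: "g \<in> carrier G" and h: "h \<subseteq> V" and eq: "hact g h = h"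
  shows "hact (g [^] (e::int)) h = h"
proof -
  have *: "hact (g [^] int n) h = h" for n
    using periodic_mult[OF g h, of 1 n] eq g by simp
  show ?thesis
  proof (cases "e \<ge> 0")
    case True
    then show ?thesis using *[of "nat e"] by simp
  next
    case False
    then have "hact (g [^] e) (hact (g [^] int (nat (- e))) h) = h"
      using hact_pw_add[OF g h, of e "- e"] hact_one[OF h] by simp
    then show ?thesis by (simp only: *)
  qed
qed

text \<open>A large power of \<open>k i\<close>, positive or negative, brings any vertex to the
  chosen side of \<open>h i\<close> and leaves its sides of the other halfspaces alone. The sign
  pattern is thus adjusted one coordinate at a time.\<close>

lemma independent_Hp_cube:
  assumes k: "\<And>i. i < m \<Longrightarrow> k i \<in> carrier G" and h: "\<And>i. i < m \<Longrightarrow> h i \<in> Hp (k i)"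
    and fix_other: "\<And>i j. i < m \<Longrightarrow> j < m \<Longrightarrow> i \<noteq> j \<Longrightarrow> hact (k j) (h i) = h i"
  shows "has_induced_cube V adj m"
proof (rule card_separating_cube)
  show "h i \<in> Hs" if "i < m" for i using h that Hp_Hs by blast
  fix A
  have "\<exists>v\<in>V. \<forall>i<m'. v \<in> h i \<longleftrightarrow> i \<in> A" if "m' \<le> m" for m'
    using that
  proof (induction m')
    case 0
    then show ?case using nonempty by auto
  next
    case (Suc m')
    then obtain v where v: "v \<in> V" "\<forall>i<m'. v \<in> h i \<longleftrightarrow> i \<in> A" by auto
    have m': "m' < m" using Suc by simp
    obtain N M where NM: "\<forall>n\<ge>N. pw (k m') n v \<in> h m'" "\<forall>n\<le>M. pw (k m') n v \<notin> h m'"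
      using Hp_limits[OF k[OF m'] h[OF m'] v(1)] by blast
    define e where "e = (if m' \<in> A then N else M)"
    have "pw (k m') e v \<in> h m' \<longleftrightarrow> m' \<in> A" using NM by (simp add: e_def)
    moreover have "pw (k m') e v \<in> h i \<longleftrightarrow> i \<in> A" if i: "i < m'" for i
    proof -
      have iV: "h i \<subseteq> V" using h[of i] i m' Hp_Hs Hs_subset by auto
      have "hact (k m') (h i) = h i" using fix_other[of i m'] i m' by simp
      then have "hact (k m' [^] e) (h i) = h i" using hact_pow_fix[OF k[OF m'] iV] by blast
      then have "pw (k m') e v \<in> h i \<longleftrightarrow> v \<in> h i"
        using act_mem[of "k m' [^] e" "h i" v] k[OF m'] iV v(1) by simp
      then show ?thesis using v(2) i by blast
    qed
    ultimately show ?case using k[OF m'] v(1)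
      by (intro bexI[of _ "pw (k m') e v"]) (auto simp: less_Suc_eq)
  qed
  from this[of m] show "\<exists>v\<in>V. \<forall>i<m. v \<in> h i \<longleftrightarrow> i \<in> A" by simp
qed

end

section \<open>From a bounded orbit to a finite one\<close>

context median_action
begin

text \<open>A discrete circumcentre: a halfspace that cuts a bounded orbit is measured by the longest chain
  of cutting halfspaces inside it, and the centre consists of the vertices lying on the bigger side of
  every unbalanced cutting halfspace. Balanced ones are pairwise transverse, so the centre is finite.\<close>

lemma bounded_orbit_finite_orbit:
  assumes dim: "\<not> has_induced_cube V adj (Suc n)" and x: "x \<in> V"
    and bd: "\<And>g. g \<in> carrier G \<Longrightarrow> d x (\<phi> g x) \<le> B"
  shows "\<exists>v\<in>V. finite (orbit G \<phi> v)"
proof -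
  define Y where "Y = orbit G \<phi> x"
  have YV: "Y \<subseteq> V" using x by (auto simp: Y_def orbit_def)
  have xY: "x \<in> Y" unfolding Y_def orbit_def using act_one[OF x] Gr.one_closed by force
  have Ybd: "d y z \<le> 2 * B" if "y \<in> Y" "z \<in> Y" for y z
  proof -
    have yz: "y \<in> V" "z \<in> V" using that YV by auto
    have "d y z \<le> d y x + d x z" using dist_triangle yz x by blast
    moreover have "d x y \<le> B" "d x z \<le> B" using that bd by (auto simp: Y_def orbit_def)
    ultimately show ?thesis using dist_sym[of y x] by linarith
  qed
  have Yinv: "hact g Y = Y" if g: "g \<in> carrier G" for g
  proof -
    have sub: "hact k Y \<subseteq> Y" if k: "k \<in> carrier G" for k
    proof
      fix y assume "y \<in> hact k Y"
      then obtain l where l: "l \<in> carrier G" "y = \<phi> k (\<phi> l x)" by (auto simp: hact_def Y_def orbit_def)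
      then have "y = \<phi> (k \<otimes> l) x" using act_mult[OF k l(1) x] by simp
      then show "y \<in> Y" unfolding Y_def orbit_def using k l by blast
    qed
    have "Y = hact g (hact (inv g) Y)" using hact_inv(2)[OF g YV] by simp
    also have "\<dots> \<subseteq> hact g Y" using sub[of "inv g"] g by (intro hact_mono) auto
    finally show ?thesis using sub[OF g] by auto
  qed
  define Cr where "Cr = {h \<in> Hs. h \<inter> Y \<noteq> {} \<and> \<not> Y \<subseteq> h}"
  have CrH: "h \<in> Hs" "h \<subseteq> V" if "h \<in> Cr" for h using that Hs_subset by (auto simp: Cr_def)
  have Cr_compl: "V - h \<in> Cr" if "h \<in> Cr" for h
    using that Hs_compl YV by (auto simp: Cr_def)
  have Cr_act: "hact g h \<in> Cr" if g: "g \<in> carrier G" and h: "h \<in> Cr" for g h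
  proof -
    have hV: "h \<subseteq> V" using CrH h by auto
    obtain y z where yz: "y \<in> Y" "y \<in> h" "z \<in> Y" "z \<notin> h" using h by (auto simp: Cr_def)
    have "\<phi> g y \<in> Y" "\<phi> g z \<in> Y" using Yinv[OF g] yz by (auto simp: hact_def)
    moreover have "\<phi> g y \<in> hact g h" "\<phi> g z \<notin> hact g h"
      using act_mem[OF g hV] yz YV by (metis subsetD)+
    ultimately show ?thesis using hact_Hs[OF g CrH(1)[OF h]] by (auto simp: Cr_def)
  qed
  define P where "P h C \<longleftrightarrow> C \<subseteq> Cr \<and> finite C \<and> (\<forall>a\<in>C. \<forall>b\<in>C. a \<subseteq> b \<or> b \<subseteq> a) \<and> (\<forall>c\<in>C. c \<subseteq> h)" for h C
  have PD: "C \<subseteq> Cr" "finite C" "\<forall>a\<in>C. \<forall>b\<in>C. a \<subseteq> b \<or> b \<subseteq> a" "\<forall>c\<in>C. c \<subseteq> h"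
    if "P h C" for h C
    by (insert that[unfolded P_def]) (elim conjE, assumption)+
  \<comment> \<open>The least member of the chain contains some \<open>y \<in> Y\<close> and the
    greatest misses some \<open>z \<in> Y\<close>, so the whole chain separates \<open>y\<close>
    from \<open>z\<close> and has at most \<open>d y z\<close> members.\<close>
  have Pcard: "card C \<le> 2 * B" if P: "P h C" for h C
  proof (cases "C = {}")
    case False
    have C: "C \<subseteq> Cr" "finite C" "\<forall>a\<in>C. \<forall>b\<in>C. a \<subseteq> b \<or> b \<subseteq> a" using PD(1-3)[OF P] .
    obtain a where a: "a \<in> C" "\<forall>b\<in>C. b \<subseteq> a \<longrightarrow> a = b" using finite_has_minimal[OF C(2) False] by blast
    obtain b where b: "b \<in> C" "\<forall>c\<in>C. b \<subseteq> c \<longrightarrow> b = c" using finite_has_maximal[OF C(2) False] by blast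
    obtain y where y: "y \<in> Y" "y \<in> a" using a(1) C(1) unfolding Cr_def by blast
    obtain z where z: "z \<in> Y" "z \<notin> b" using b(1) C(1) unfolding Cr_def by blast
    have "C \<subseteq> sep y z"
    proof
      fix c assume c: "c \<in> C"
      have "a \<subseteq> c" using bspec[OF bspec[OF C(3) a(1)] c] bspec[OF a(2) c] by auto
      moreover have "c \<subseteq> b" using bspec[OF bspec[OF C(3) b(1)] c] bspec[OF b(2) c] by auto
      moreover have "c \<in> Hs" using c C(1) CrH(1) by blast
      ultimately show "c \<in> sep y z" using y(2) z(2) unfolding sep_def by blast
    qed
    moreover have "y \<in> V" "z \<in> V" using y z YV by auto
    ultimately have "card C \<le> d y z" using card_sep[of y z] card_mono[of "sep y z" C] by simp
    then show ?thesis using Ybd[OF y(1) z(1)] by simp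
  qed simp
  define ht where "ht h = Max {card C | C. P h C}" for h
  have htfin: "finite {card C | C. P h C}" for h
    by (rule finite_subset[of _ "{..2 * B}"]) (use Pcard in auto)
  have P0: "P h {}" for h by (simp add: P_def)
  have ht_ge: "card C \<le> ht h" if "P h C" for h C
    unfolding ht_def using htfin that by (intro Max_ge) auto
  have ht_ex: "\<exists>C. P h C \<and> card C = ht h" for h
    using Max_in[OF htfin[of h]] P0[of h] unfolding ht_def by fastforce
  have ht_le: "ht h \<le> 2 * B" for h using ht_ex[of h] Pcard by metis
  \<comment> \<open>\<open>k\<close> itself prolongs a chain below \<open>h\<close>, which makes the
    height strictly monotone.\<close>
  have ht_mono: "ht h < ht k" if hk: "k \<in> Cr" "h \<subset> k" for h k
  proof -
    obtain C where C: "P h C" "card C = ht h" using ht_ex by blast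
    have PC: "C \<subseteq> Cr" "finite C" "\<forall>a\<in>C. \<forall>b\<in>C. a \<subseteq> b \<or> b \<subseteq> a" "\<forall>c\<in>C. c \<subseteq> h"
      using PD[OF C(1)] .
    have ck: "c \<subseteq> k" if "c \<in> C" for c using PC(4) that hk(2) by blast
    have "P k (insert k C)" unfolding P_def
    proof (intro conjI ballI)
      fix a b assume ab: "a \<in> insert k C" "b \<in> insert k C"
      consider "a = k" | "b = k" | "a \<in> C" "b \<in> C" using ab by blast
      then show "a \<subseteq> b \<or> b \<subseteq> a"
      proof cases
        case 1
        then show ?thesis using ab(2) ck[of b] by blast
      next
        case 2
        then show ?thesis using ab(1) ck[of a] by blast
      next
        case 3
        then show ?thesis using PC(3) by blast
      qed
    next
      fix c assume "c \<in> insert k C"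
      then show "c \<subseteq> k" using ck[of c] by blast
    qed (use PC(1,2) hk(1) in auto)
    moreover have "k \<notin> C" using PC(4) hk(2) by blast
    ultimately show ?thesis using ht_ge[of k "insert k C"] C(2) PC(2) by simp
  qed
  have ht_act_le: "ht h \<le> ht (hact g h)" if g: "g \<in> carrier G" and h: "h \<subseteq> V" for g h
  proof -
    obtain C where C: "P h C" "card C = ht h" using ht_ex by blast
    have CV: "c \<subseteq> V" if "c \<in> C" for c using PD(1)[OF C(1)] CrH(2) that by blast
    have "P (hact g h) (hact g ` C)"
      unfolding P_def
    proof (intro conjI ballI)
      show "hact g ` C \<subseteq> Cr" using PD(1)[OF C(1)] Cr_act[OF g] by blast
      show "finite (hact g ` C)" using PD(2)[OF C(1)] by blast
      fix a b assume ab: "a \<in> hact g ` C" "b \<in> hact g ` C"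
      then obtain a' b' where "a' \<in> C" "b' \<in> C" "a = hact g a'" "b = hact g b'" by blast
      moreover then have "a' \<subseteq> b' \<or> b' \<subseteq> a'" using PD(3)[OF C(1)] by blast
      ultimately show "a \<subseteq> b \<or> b \<subseteq> a" using hact_mono by blast
    next
      fix c assume "c \<in> hact g ` C"
      then obtain c' where "c' \<in> C" "c = hact g c'" by blast
      moreover then have "c' \<subseteq> h" using PD(4)[OF C(1)] by blast
      ultimately show "c \<subseteq> hact g h" using hact_mono by blast
    qed
    moreover have "inj_on (hact g) C"
      by (rule inj_on_inverseI[of _ "hact (inv g)"]) (use hact_inv(1)[OF g] CV in auto)
    ultimately show ?thesis using ht_ge[of "hact g h" "hact g ` C"] C by (simp add: card_image)
  qed
  have ht_act: "ht (hact g h) = ht h" if g: "g \<in> carrier G" and h: "h \<subseteq> V" for g h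
    using ht_act_le[OF g h] ht_act_le[of "inv g" "hact g h"] hact_inv(1)[OF g h] g hact_subset[OF g h] by auto
  \<comment> \<open>Membership in all halfspaces that contain \<open>Y\<close> is demanded too, so
    that two vertices of \<open>M\<close> can be separated by cutting halfspaces only.\<close>
  define M where "M = {v \<in> V. (\<forall>h\<in>Hs. Y \<subseteq> h \<longrightarrow> v \<in> h) \<and> (\<forall>h\<in>Cr. ht h > ht (V - h) \<longrightarrow> v \<in> h)}"
  have MY: "v \<in> h" if "v \<in> M" "h \<in> Hs" "Y \<subseteq> h" for v h using that unfolding M_def by blast
  have MC: "v \<in> h" if "v \<in> M" "h \<in> Cr" "ht h > ht (V - h)" for v h using that unfolding M_def by blast
  have Minv: "\<phi> g v \<in> M" if g: "g \<in> carrier G" and v: "v \<in> M" for g v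
  proof -
    have vV: "v \<in> V" using v by (simp add: M_def)
    have *: "\<phi> g v \<in> h \<longleftrightarrow> v \<in> hact (inv g) h" if "h \<subseteq> V" for h
      using hact_iff[of "inv g" h v] g vV that by simp
    have 1: "\<phi> g v \<in> h" if h: "h \<in> Hs" "Y \<subseteq> h" for h
    proof -
      have "Y \<subseteq> hact (inv g) h" using hact_mono[OF h(2), of "inv g"] Yinv[of "inv g"] g by simp
      then show ?thesis using *[OF Hs_subset[OF h(1)]] v hact_Hs[OF _ h(1), of "inv g"] g by (simp add: M_def)
    qed
    have 2: "\<phi> g v \<in> h" if h: "h \<in> Cr" "ht h > ht (V - h)" for h
    proof -
      have hV: "h \<subseteq> V" using CrH h by auto
      have "ht (hact (inv g) h) > ht (V - hact (inv g) h)"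
        using h(2) ht_act[of "inv g" h] ht_act[of "inv g" "V - h"] hact_diff[of "inv g" h] hV g by simp
      then show ?thesis using *[OF hV] v Cr_act[of "inv g" h] g h by (simp add: M_def)
    qed
    show ?thesis using 1 2 g vV by (simp add: M_def)
  qed
  \<comment> \<open>One side of each balanced pair, the one that contains \<open>x\<close>; two such
    sides meet in \<open>x\<close>, as transversality requires.\<close>
  define bal where "bal = {h \<in> Cr. ht h = ht (V - h) \<and> x \<in> h}"
  have compl_sub: "V - k \<subset> V - h" if "h \<subset> k" "k \<subseteq> V" for h k :: "'v set" using that by blast
  have no_nest: "\<not> h \<subset> k" if h: "h \<in> Cr" "ht h = ht (V - h)" and k: "k \<in> Cr" "ht k = ht (V - k)" for h k
  proof
    assume hk: "h \<subset> k"
    have "ht h < ht k" using ht_mono[OF k(1) hk] .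
    moreover have "ht (V - k) < ht (V - h)"
      using ht_mono[OF Cr_compl[OF h(1)] compl_sub[OF hk CrH(2)[OF k(1)]]] .
    ultimately show False using h k by simp
  qed
  have bal_card: "finite E \<Longrightarrow> E \<subseteq> bal \<Longrightarrow> card E \<le> n" for E
  proof (rule transverse_card[OF dim])
    assume E: "finite E" "E \<subseteq> bal"
    show "E \<subseteq> Hs" using E CrH by (auto simp: bal_def)
    fix h k assume hk: "h \<in> E" "k \<in> E" "h \<noteq> k"
    have h: "h \<in> Cr" "ht h = ht (V - h)" "x \<in> h" and k: "k \<in> Cr" "ht k = ht (V - k)" "x \<in> k"
      using hk E by (auto simp: bal_def)
    have "h \<union> k \<noteq> V"
    proof
      assume u: "h \<union> k = V"
      have "V - h \<subset> k" using u k(3) h(3) x by blast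
      then show False
        using no_nest[OF Cr_compl[OF h(1)] _ k(1,2)] h(2) CrH(2)[OF h(1)] by (simp add: double_diff)
    qed
    then show "transverse h k"
      using no_nest[OF h(1,2) k(1,2)] no_nest[OF k(1,2) h(1,2)] h k hk(3) by (auto simp: transverse_def)
  qed
  have fbal: "finite bal"
  proof (rule ccontr)
    assume "infinite bal"
    then obtain E where "E \<subseteq> bal" "card E = Suc n" "finite E" using infinite_arbitrarily_large by metis
    then show False using bal_card by fastforce
  qed
  \<comment> \<open>Only balanced halfspaces can separate two vertices of \<open>M\<close>, so such
    a vertex is determined by the members of the finite set \<open>bal\<close> that contain
    it.\<close>
  have fM: "finite M"
  proof -
    let ?f = "\<lambda>v. {h \<in> bal. v \<in> h}"
    have "v = w" if v: "v \<in> M" and w: "w \<in> M" and eq: "?f v = ?f w" for v w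
    proof (rule ccontr)
      assume "v \<noteq> w"
      then obtain h where h: "h \<in> Hs" "v \<in> h" "w \<notin> h" using ex_sep[of v w] v w by (auto simp: M_def)
      have vw: "v \<in> V" "w \<in> V" using v w by (auto simp: M_def)
      have "\<not> Y \<subseteq> h" using h MY[OF w h(1)] by blast
      moreover have "h \<inter> Y \<noteq> {}"
      proof
        assume "h \<inter> Y = {}"
        then have "Y \<subseteq> V - h" using YV by auto
        then have "v \<in> V - h" by (rule MY[OF v Hs_compl[OF h(1)]])
        then show False using h by auto
      qed
      ultimately have hC: "h \<in> Cr" using h by (simp add: Cr_def)
      have hV: "h \<subseteq> V" using CrH hC by auto
      then have dd: "V - (V - h) = h" by auto
      have "\<not> ht h > ht (V - h)" using MC[OF w hC] h by blast
      moreover have "\<not> ht (V - h) > ht (V - (V - h))"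
        using MC[OF v Cr_compl[OF hC]] h by blast
      ultimately have e: "ht h = ht (V - h)" using dd by simp
      show False
      proof (cases "x \<in> h")
        case True
        then have "h \<in> bal" using hC e by (simp add: bal_def)
        then have "h \<in> ?f w" using eq h by blast
        then show False using h by simp
      next
        case False
        then have "V - h \<in> bal" using Cr_compl[OF hC] e dd x by (simp add: bal_def)
        then have "V - h \<in> ?f w" using h(3) vw(2) by simp
        then have "V - h \<in> ?f v" by (simp only: eq)
        then show False using h by simp
      qed
    qed
    then have "inj_on ?f M" by (auto intro: inj_onI)
    moreover have "finite (?f ` M)" by (rule finite_subset[of _ "Pow bal"]) (use fbal in auto)
    ultimately show ?thesis using finite_imageD by blast
  qed
  have "\<exists>v. v \<in> M"
  proof -
    define big where "big = {h \<in> Cr. ht h > ht (V - h)}"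
    \<comment> \<open>The family \<open>big\<close> may be infinite, so Helly does not apply to it
      directly. Those members that miss \<open>x\<close> are finitely many, being pairwise
      transverse at each height; the others are handled by the gate of \<open>x\<close> in the
      intersection of \<open>D\<close>.\<close>
    define D where "D = {h \<in> big. x \<notin> h}"
    have weak: "h \<inter> k \<noteq> {}" if h: "h \<in> Cr" "ht h \<ge> ht (V - h)" and k: "k \<in> Cr" "ht k \<ge> ht (V - k)"
      and ne: "h \<noteq> V - k" for h k
    proof
      assume "h \<inter> k = {}"
      then have s: "h \<subset> V - k" using ne CrH(2)[OF h(1)] by blast
      have "ht h < ht (V - k)" using ht_mono[OF Cr_compl[OF k(1)] s] .
      moreover have "k \<subset> V - h" using s CrH(2)[OF k(1)] by blast
      then have "ht k < ht (V - h)" using ht_mono[OF Cr_compl[OF h(1)]] by blast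
      ultimately show False using h k by simp
    qed
    have dd: "V - (V - k) = k" if "k \<in> Cr" for k using CrH[OF that] by auto
    have o1: "h \<inter> k \<noteq> {}" if h: "h \<in> big" and k: "k \<in> big" for h k
    proof (rule weak)
      show "h \<noteq> V - k" using h k dd by (auto simp: big_def)
    qed (use h k in \<open>auto simp: big_def\<close>)
    have DH: "D \<subseteq> Hs" using CrH by (auto simp: D_def big_def)
    have fD: "finite D"
    proof -
      have "card E \<le> n" if E: "finite E" "E \<subseteq> {h \<in> D. ht h = r}" for E r
      proof (rule transverse_card[OF dim E(1)])
        show "E \<subseteq> Hs" using E DH by auto
        fix h k assume hk: "h \<in> E" "k \<in> E" "h \<noteq> k"
        have D: "h \<in> D" "k \<in> D" "ht h = ht k" using hk E by auto
        then have Ck: "h \<in> Cr" "k \<in> Cr" by (auto simp: D_def big_def)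
        have "\<not> h \<subset> k" "\<not> k \<subset> h" using ht_mono Ck D(3) by (metis less_irrefl)+
        moreover have "h \<inter> k \<noteq> {}" using o1 D by (auto simp: D_def)
        ultimately show "transverse h k" using D x hk(3) by (auto simp: transverse_def D_def)
      qed
      then have "finite {h \<in> D. ht h = r}" for r
        by (metis (no_types, lifting) infinite_arbitrarily_large not_less_eq_eq order_refl)
      moreover have "D = (\<Union>r\<in>{..2 * B}. {h \<in> D. ht h = r})" using ht_le by auto
      ultimately show ?thesis by (metis (no_types, lifting) finite_UN finite_atMost)
    qed
    define C where "C = V \<inter> \<Inter>D"
    have mC: "mconvex C" unfolding C_def mconvex_def
    proof (intro conjI ballI impI)
      fix a b u assume ab: "a \<in> V \<inter> \<Inter>D" "b \<in> V \<inter> \<Inter>D" and u: "u \<in> V" "d a b = d a u + d u b"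
      have "u \<in> h" if "h \<in> D" for h using Hs_convex[of h a b u] ab u that DH by blast
      then show "u \<in> V \<inter> \<Inter>D" using u by blast
    qed auto
    have DD: "\<exists>v\<in>V. \<forall>h\<in>F. v \<in> h" if "finite F" "F \<subseteq> big" for F
    proof (rule Helly)
      have "big \<subseteq> Hs" using CrH(1) by (auto simp: big_def)
      then show "mconvex A" if "A \<in> F" for A using that \<open>F \<subseteq> big\<close> mconvex_Hs by blast
      show "A \<inter> A' \<noteq> {}" if "A \<in> F" "A' \<in> F" for A A' using that \<open>F \<subseteq> big\<close> o1 by blast
    qed (use that in auto)
    have "\<exists>v\<in>V. \<forall>h\<in>D. v \<in> h" using DD[OF fD] by (auto simp: D_def)
    then have "C \<noteq> {}" by (auto simp: C_def)
    then obtain v where v: "v \<in> C" "\<And>h. h \<in> Hs \<Longrightarrow> v \<in> h \<Longrightarrow> x \<notin> h \<Longrightarrow> C \<subseteq> h"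
      using gate[OF mC _ x] by blast
    have vV: "v \<in> V" using v by (simp add: C_def)
    \<comment> \<open>Were the gate outside a big \<open>h\<close> that contains \<open>x\<close>,
      the gate property for the complement would place all of \<open>C\<close> outside
      \<open>h\<close>, against Helly for \<open>h\<close> together with \<open>D\<close>.\<close>
    have in_big: "v \<in> h" if h: "h \<in> big" for h
    proof (rule ccontr)
      assume nv: "v \<notin> h"
      then have "h \<notin> D" using v by (auto simp: C_def)
      then have xh: "x \<in> h" using h by (simp add: D_def)
      have "V - h \<in> Hs" using h Hs_compl CrH by (auto simp: big_def)
      then have "C \<subseteq> V - h" using v(2) nv vV xh by auto
      moreover obtain u where "u \<in> V" "\<forall>k\<in>insert h D. u \<in> k" using DD[of "insert h D"] fD h by (auto simp: D_def)
      ultimately show False by (auto simp: C_def)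
    qed
    have in_Y: "v \<in> h" if h: "h \<in> Hs" "Y \<subseteq> h" for h
    proof (rule ccontr)
      assume nv: "v \<notin> h"
      have "C \<subseteq> V - h" using v(2)[OF Hs_compl[OF h(1)]] nv vV xY h by auto
      moreover have "\<exists>u\<in>V. \<forall>k\<in>insert h D. u \<in> k"
      proof (rule Helly)
        show "mconvex k" if "k \<in> insert h D" for k using that h DH mconvex_Hs by auto
        have "h \<inter> k \<noteq> {}" if "k \<in> D" for k using that h by (auto simp: D_def big_def Cr_def)
        then show "A \<inter> A' \<noteq> {}" if "A \<in> insert h D" "A' \<in> insert h D" for A A'
          using that o1 xY h by (auto simp: D_def Int_commute)
      qed (use fD in auto)
      ultimately show False by (auto simp: C_def)
    qed
    have "v \<in> M" using in_big in_Y vV by (auto simp: M_def big_def)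
    then show ?thesis by blast
  qed
  then obtain v where v: "v \<in> M" by blast
  have "orbit G \<phi> v \<subseteq> M" using Minv v by (auto simp: orbit_def)
  then have "finite (orbit G \<phi> v)" using fM finite_subset by blast
  moreover have "v \<in> V" using v unfolding M_def by blast
  ultimately show ?thesis by blast
qed

end

section \<open>Groups that commute with a given element\<close>

lemma (in group) int_pow_commute:
  assumes "l \<in> carrier G" "k \<in> carrier G" "l \<otimes> k = k \<otimes> l"
  shows "l \<otimes> k [^] (n::int) = k [^] n \<otimes> l"
proof -
  have nat: "l \<otimes> k [^] m = k [^] m \<otimes> l" for m :: nat
    by (induction m) (use assms in \<open>simp_all add: m_assoc[symmetric]\<close>, simp add: m_assoc)
  show ?thesis
  proof (cases "n \<ge> 0")
    case True
    then show ?thesis using nat[of "nat n"] int_pow_int[of G k "nat n"] by simp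
  next
    case False
    then obtain m :: nat where m: "n = - int m" by (metis int_cases4 linorder_not_le of_nat_0_le_iff)
    define p where "p = k [^] m"
    have p: "p \<in> carrier G" "k [^] n = inv p" "l \<otimes> p = p \<otimes> l"
      using assms nat int_pow_neg_int[of k m] by (auto simp: p_def m)
    have "p \<otimes> (l \<otimes> inv p) = l"
      using p assms by (simp add: m_assoc[symmetric]) (simp add: p(3)[symmetric] m_assoc)
    then have "inv p \<otimes> l = l \<otimes> inv p"
      using p(1) assms(1) by (metis inv_closed inv_solve_left m_closed)
    then show ?thesis unfolding p(2) by simp
  qed
qed

context median_action
begin

text \<open>\<open>\<langle>k\<rangle>\<close> has finitely many orbits on \<open>Hp k\<close>. A subgroup \<open>L\<close> of the centraliser permutes them; Higman's
  displacement trick shows that commutators of \<open>L\<close> act trivially on this finite set. Hence a perfect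
  \<open>L\<close> moves each \<open>h\<close> only within its \<open>\<langle>k\<rangle>\<close>-orbit, which amounts to a homomorphism to \<open>\<int>\<close>, trivial again.\<close>

lemma perfect_displacing_fixes_Hp:
  assumes k: "k \<in> carrier G" and L: "subgroup L G"
    and comm: "\<And>l. l \<in> L \<Longrightarrow> l \<otimes> k = k \<otimes> l"
    and perf: "L \<subseteq> derived G L"
    and disp: "\<And>b c. b \<in> L \<Longrightarrow> c \<in> L \<Longrightarrow> \<exists>t\<in>L. \<forall>N>0::nat.
      (t [^] N \<otimes> b \<otimes> inv (t [^] N)) \<otimes> c = c \<otimes> (t [^] N \<otimes> b \<otimes> inv (t [^] N))"
    and h: "h \<in> Hp k" and l: "l \<in> L"
  shows "hact l h = h"
proof -
  have LG: "l \<in> carrier G" if "l \<in> L" for l using subgroup.mem_carrier[OF L that] .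
  have HV: "h \<subseteq> V" if "h \<in> Hp k" for h using Hp_Hs[OF that] Hs_subset by blast
  have commp: "hact l (hact (k [^] (n::int)) h) = hact (k [^] n) (hact l h)"
    if "l \<in> L" "h \<subseteq> V" for l n h
    using hact_mult[of l "k [^] n" h] hact_mult[of "k [^] n" l h]
      Gr.int_pow_commute[OF LG[OF that(1)] k comm[OF that(1)], of n] LG[OF that(1)] that k by simp
  have Hpinv: "hact l h \<in> Hp k" if l: "l \<in> L" and h: "h \<in> Hp k" for l h
  proof -
    obtain y where y: "y \<in> V" using nonempty by auto
    obtain N M where NM: "\<forall>n\<ge>N. pw k n y \<in> h" "\<forall>n\<le>M. pw k n y \<notin> h"
      using Hp_limits[OF k h y] by blast
    have "pw k n (\<phi> l y) = \<phi> l (pw k n y)" for n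
      using Gr.int_pow_commute[OF LG[OF l] k comm[OF l], of n] LG[OF l] k y
        act_mult[of l "k [^] n" y] act_mult[of "k [^] n" l y] by simp
    then have "pw k n (\<phi> l y) \<in> hact l h \<longleftrightarrow> pw k n y \<in> h" for n
      using act_mem[OF LG[OF l] HV[OF h], of "pw k n y"] k y by simp
    then show ?thesis
      unfolding Hp_def mem_Collect_eq using NM hact_Hs[OF LG[OF l] Hp_Hs[OF h]] LG[OF l] y
      by (intro conjI bexI[of _ "\<phi> l y"] exI[of _ N] exI[of _ M]) auto
  qed
  \<comment> \<open>Lying in the same orbit of the powers of \<open>k\<close>. Elements of
    \<open>L\<close> commute with \<open>k\<close>, so they respect this relation.\<close>
  define sim where "sim h h' \<longleftrightarrow> (\<exists>j::int. h' = hact (k [^] j) h)" for h h'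
  have sim_refl: "sim h h" if "h \<subseteq> V" for h
    unfolding sim_def using hact_one[OF that] by (intro exI[of _ 0]) simp
  have sim_sym: "sim h' h" if s: "sim h h'" "h \<subseteq> V" for h h'
  proof -
    obtain j :: int where j: "h' = hact (k [^] j) h" using s by (auto simp: sim_def)
    have "h = hact (k [^] (-j)) h'" unfolding j
      using hact_pw_add[OF k s(2), of "-j" j] hact_one[OF s(2)] by simp
    then show ?thesis unfolding sim_def by blast
  qed
  have sim_trans: "sim h h''" if s: "sim h h'" "sim h' h''" "h \<subseteq> V" for h h' h''
  proof -
    obtain i j :: int where j: "h' = hact (k [^] j) h" "h'' = hact (k [^] i) h'"
      using s by (auto simp: sim_def)
    have "h'' = hact (k [^] (i + j)) h" using j hact_pw_add[OF k s(3), of i j] by simp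
    then show ?thesis unfolding sim_def by blast
  qed
  have sim_act: "sim (hact l h) (hact l h')" if "sim h h'" "l \<in> L" "h \<subseteq> V" for h h' l
    using that commp unfolding sim_def by metis
  have invL: "inv l \<in> L" if "l \<in> L" for l using subgroup.m_inv_closed[OF L that] .
  have multL: "l \<otimes> m \<in> L" if "l \<in> L" "m \<in> L" for l m using subgroup.m_closed[OF L that] .
  have powL: "t [^] (N::nat) \<in> L" if "t \<in> L" for t N
    by (induction N) (use that multL subgroup.one_closed[OF L] in auto)
  obtain x where x: "x \<in> V" using nonempty by auto
  \<comment> \<open>Each orbit of the powers of \<open>k\<close> on \<open>Hp k\<close> has a member
    that is entered in the one step from \<open>x\<close> to \<open>\<phi> k x\<close>, so the
    finite set \<open>R\<close> represents all orbits.\<close>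
  define R where "R = {h \<in> Hp k. h \<in> sep (\<phi> k x) x}"
  have fR: "finite R" using finite_sep[of "\<phi> k x" x] k x by (auto simp: R_def intro: finite_subset[of _ "sep (\<phi> k x) x"])
  have powHp: "hact (k [^] (n::int)) h \<in> Hp k" if h: "h \<in> Hp k" for n h
  proof -
    obtain N M where NM: "\<forall>m\<ge>N. pw k m x \<in> h" "\<forall>m\<le>M. pw k m x \<notin> h"
      using Hp_limits[OF k h x] by blast
    then show ?thesis
      unfolding Hp_def mem_Collect_eq using hact_Hs[OF _ Hp_Hs[OF h]] k x pw_mem[OF k HV[OF h] x, of _ n]
      by (intro conjI bexI[of _ x] exI[of _ "N + n"] exI[of _ "M + n"]) auto
  qed
  have rep: "\<exists>r\<in>R. sim h r" if h: "h \<in> Hp k" for h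
  proof -
    obtain N M where NM: "\<forall>n\<ge>N. pw k n x \<in> h" "\<forall>n\<le>M. pw k n x \<notin> h"
      using Hp_limits[OF k h x] by blast
    obtain n where n: "pw k n x \<notin> h" "pw k (n + 1) x \<in> h"
      using int_transition_up[of N "\<lambda>n. pw k n x \<in> h" M] NM by auto
    have eq: "pw k (n + 1) x = pw k n (\<phi> k x)" using pw_add[OF k x, of n 1] k by simp
    have "hact (k [^] (-n)) h \<in> R"
      using n mem_pw[OF k HV[OF h], of _ "-n"] k x powHp[OF h] Hp_Hs[OF powHp[OF h]] unfolding eq
      by (simp add: R_def sep_def)
    then show ?thesis unfolding sim_def by blast
  qed
  have RV: "r \<subseteq> V" "r \<in> Hp k" if "r \<in> R" for r using that HV by (auto simp: R_def)
  \<comment> \<open>Pigeonhole on the finitely many orbits: some positive power of \<open>t\<close>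
    returns each \<open>r \<in> R\<close> to its orbit, and a common multiple works for all.\<close>
  have power_trivial: "\<exists>N>0::nat. \<forall>h\<in>Hp k. sim h (hact (t [^] N) h)" if t: "t \<in> L" for t
  proof -
    have tG: "t \<in> carrier G" using LG t by blast
    have tp: "hact (t [^] (a + b)) h = hact (t [^] a) (hact (t [^] b) h)" if "h \<subseteq> V" for a b :: nat and h
      using hact_mult[of "t [^] a" "t [^] b" h] tG that by (simp add: Gr.nat_pow_mult)
    have "\<exists>N>0::nat. \<forall>r\<in>R. r \<subseteq> V \<and> sim r (hact (t [^] N) r)"
    proof (rule common_multiple[OF fR, where Q = "\<lambda>r N. r \<subseteq> V \<and> sim r (hact (t [^] N) r)"])
      fix r assume r: "r \<in> R"
      have "\<exists>r'. r' \<in> R \<and> sim (hact (t [^] i) r) r'" for i :: nat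
        using rep[OF Hpinv[OF powL[OF t] RV(2)[OF r]]] by blast
      then obtain f where f: "\<And>i::nat. f i \<in> R \<and> sim (hact (t [^] i) r) (f i)" by metis
      have "\<not> inj f" using finite_imageD[of f UNIV] finite_subset[of "range f" R] f fR by auto
      then obtain i j where ij: "i < j" "f i = f j" unfolding inj_def by (metis linorder_neqE_nat)
      have V: "hact (t [^] a) r \<subseteq> V" for a :: nat using hact_subset RV(1)[OF r] tG by simp
      have "sim (hact (t [^] i) r) (hact (t [^] j) r)"
        using f[of i] f[of j] sim_sym[OF _ V] sim_trans[OF _ _ V] ij by metis
      then have "sim (hact (inv (t [^] i)) (hact (t [^] i) r)) (hact (inv (t [^] i)) (hact (t [^] j) r))"
        using sim_act invL powL[OF t] V by blast
      moreover have "hact (inv (t [^] i)) (hact (t [^] j) r) = hact (t [^] (j - i)) r"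
      proof -
        have e: "hact (t [^] j) r = hact (t [^] i) (hact (t [^] (j - i)) r)"
          using tp[OF RV(1)[OF r], of i "j - i"] ij by simp
        show ?thesis unfolding e using hact_inv(1)[of "t [^] i", OF _ V] tG by simp
      qed
      ultimately have "sim r (hact (t [^] (j - i)) r)" using hact_inv(1)[of "t [^] i" r] tG RV(1)[OF r] by simp
      then show "\<exists>p>0::nat. r \<subseteq> V \<and> sim r (hact (t [^] p) r)" using ij RV(1)[OF r] by (intro exI[of _ "j - i"]) simp
    next
      fix r :: "'v set" and p q :: nat assume rp: "r \<subseteq> V \<and> sim r (hact (t [^] p) r)"
      have "sim r (hact (t [^] (p * q)) r)"
      proof (induction q)
        case 0
        then show ?case using rp hact_one sim_refl by simp
      next
        case (Suc q)
        have "hact (t [^] (p * Suc q)) r = hact (t [^] p) (hact (t [^] (p * q)) r)"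
          using tp[of r p "p * q"] rp by simp
        moreover have "sim (hact (t [^] p) r) (hact (t [^] p) (hact (t [^] (p * q)) r))"
          using sim_act[OF Suc powL[OF t]] rp by blast
        ultimately show ?case using sim_trans rp by metis
      qed
      then show "r \<subseteq> V \<and> sim r (hact (t [^] (p * q)) r)" using rp by blast
    qed
    then obtain N :: nat where N: "N > 0" "\<forall>r\<in>R. sim r (hact (t [^] N) r)" by blast
    have "sim h (hact (t [^] N) h)" if h: "h \<in> Hp k" for h
    proof -
      obtain r where r: "r \<in> R" "sim h r" using rep[OF h] by blast
      note hV = HV[OF h]
      have tV: "hact (t [^] N) h \<subseteq> V" using hact_subset[OF _ hV] tG by simp
      have "sim (hact (t [^] N) h) (hact (t [^] N) r)" using sim_act[OF r(2) powL[OF t] hV] .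
      then have "sim (hact (t [^] N) r) (hact (t [^] N) h)" using sim_sym tV by blast
      moreover have "sim r (hact (t [^] N) r)" using N r by blast
      ultimately show ?thesis using r(2) sim_trans hV RV(1)[OF r(1)] by metis
    qed
    then show ?thesis using N by blast
  qed
  define T where "T = {l \<in> L. \<forall>h\<in>Hp k. sim h (hact l h)}"
  have T_mult: "l \<otimes> m \<in> T" if lm: "l \<in> T" "m \<in> T" for l m
  proof -
    have lL: "l \<in> L" "m \<in> L" using lm by (auto simp: T_def)
    have "sim h (hact (l \<otimes> m) h)" if h: "h \<in> Hp k" for h
    proof -
      have "sim h (hact m h)" "sim (hact m h) (hact l (hact m h))" using lm h Hpinv[OF lL(2)] by (auto simp: T_def)
      then show ?thesis using sim_trans[OF _ _ HV[OF h]] hact_mult[OF LG LG HV[OF h]] lL by metis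
    qed
    then show ?thesis using multL[OF lL] by (simp add: T_def)
  qed
  have T_inv: "inv l \<in> T" if l: "l \<in> T" for l
  proof -
    have lL: "l \<in> L" using l by (auto simp: T_def)
    have "sim h (hact (inv l) h)" if h: "h \<in> Hp k" for h
    proof -
      note h' = Hpinv[OF invL[OF lL] h]
      have "sim (hact (inv l) h) (hact l (hact (inv l) h))" using l h' by (auto simp: T_def)
      then have "sim (hact (inv l) h) h" using hact_inv(2)[OF LG[OF lL] HV[OF h]] by simp
      then show ?thesis using sim_sym HV[OF h'] by blast
    qed
    then show ?thesis using invL[OF lL] by (simp add: T_def)
  qed
  have T_conj: "b \<otimes> g \<otimes> inv b \<in> T" if g: "g \<in> T" and b: "b \<in> L" for b g
  proof -
    have gL: "g \<in> L" using g by (auto simp: T_def)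
    have "sim h (hact (b \<otimes> g \<otimes> inv b) h)" if h: "h \<in> Hp k" for h
    proof -
      note h' = Hpinv[OF invL[OF b] h]
      have "sim (hact (inv b) h) (hact g (hact (inv b) h))" using g h' by (auto simp: T_def)
      then have "sim (hact b (hact (inv b) h)) (hact b (hact g (hact (inv b) h)))"
        using sim_act b HV[OF h'] by blast
      then show ?thesis
        using hact_inv(2)[OF LG[OF b] HV[OF h]] hact_mult LG b gL HV[OF h] HV[OF h'] by simp
    qed
    then show ?thesis using multL[OF multL[OF b gL] invL[OF b]] by (simp add: T_def)
  qed
  have T_comm: "b \<otimes> c \<otimes> inv b \<otimes> inv c \<in> T" if b: "b \<in> L" and c: "c \<in> L" for b c
  proof -
    \<comment> \<open>The exponent \<open>N\<close> for which \<open>t [^] N\<close> preserves every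
      orbit is known only after \<open>t\<close>, so the displacement has to cover all positive
      powers of \<open>t\<close> at once.\<close>
    obtain t where t: "t \<in> L" "\<And>N::nat. N > 0 \<Longrightarrow>
        (t [^] N \<otimes> inv b \<otimes> inv (t [^] N)) \<otimes> c = c \<otimes> (t [^] N \<otimes> inv b \<otimes> inv (t [^] N))"
      using disp[OF invL[OF b] c] by blast
    obtain N :: nat where N: "N > 0" "\<forall>h\<in>Hp k. sim h (hact (t [^] N) h)" using power_trivial[OF t(1)] by blast
    define s where "s = t [^] N"
    have sT: "s \<in> T" using N powL[OF t(1)] by (simp add: T_def s_def)
    have sL: "s \<in> L" using powL[OF t(1)] by (simp add: s_def)
    note G = LG[OF b] LG[OF c] LG[OF sL]
    \<comment> \<open>\<open>u\<close> commutes with \<open>c\<close>, so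
      \<open>b \<otimes> u\<close> and \<open>b\<close> have the same commutator with
      \<open>c\<close>. On the other hand \<open>b \<otimes> u\<close> is a conjugate of
      \<open>s\<close> times the inverse of \<open>s\<close>, hence lies in \<open>T\<close>, and so
      does its commutator with \<open>c\<close>.\<close>
    define u where "u = s \<otimes> inv b \<otimes> inv s"
    have uG: "u \<in> carrier G" using G by (simp add: u_def)
    have uc: "u \<otimes> c = c \<otimes> u" using t(2)[OF N(1)] by (simp add: u_def s_def)
    define w where "w = b \<otimes> u"
    have "w = (b \<otimes> s \<otimes> inv b) \<otimes> inv s" unfolding w_def u_def using G by (simp add: Gr.m_assoc)
    then have wT: "w \<in> T" using T_mult[OF T_conj[OF sT b] T_inv[OF sT]] by simp
    then have "w \<otimes> (c \<otimes> inv w \<otimes> inv c) \<in> T" using T_mult[OF wT T_conj[OF T_inv[OF wT] c]] by simp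
    moreover have "w \<otimes> (c \<otimes> inv w \<otimes> inv c) = b \<otimes> c \<otimes> inv b \<otimes> inv c"
    proof -
      have "inv w = inv u \<otimes> inv b" using Gr.inv_mult_group[of b u] G uG by (simp add: w_def)
      then have "w \<otimes> (c \<otimes> inv w \<otimes> inv c) = b \<otimes> (u \<otimes> c) \<otimes> inv u \<otimes> inv b \<otimes> inv c"
        using G uG by (simp add: w_def Gr.m_assoc)
      also have "\<dots> = b \<otimes> c \<otimes> inv b \<otimes> inv c"
        unfolding uc using G uG by (simp add: Gr.m_assoc)
      finally show ?thesis .
    qed
    ultimately show ?thesis by simp
  qed
  have LT: "l \<in> T" if "l \<in> L" for l
  proof -
    have "l \<in> generate G (\<Union>b\<in>L. \<Union>c\<in>L. {b \<otimes> c \<otimes> inv b \<otimes> inv c})"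
      using perf that unfolding derived_def by auto
    then show ?thesis
    proof (induction rule: generate.induct)
      case one
      then show ?case using subgroup.one_closed[OF L] hact_one[OF HV] sim_refl[OF HV] by (auto simp: T_def)
    next
      case (incl g)
      then show ?case using T_comm by auto
    next
      case (inv g)
      then show ?case using T_comm T_inv by auto
    next
      case (eng g g')
      then show ?case using T_mult by auto
    qed
  qed
  define F where "F = {l \<in> L. \<forall>h\<in>Hp k. hact l h = h}"
  have F_mult: "l \<otimes> m \<in> F" if "l \<in> F" "m \<in> F" for l m
    using that multL hact_mult LG HV by (auto simp: F_def)
  have F_inv: "inv l \<in> F" if "l \<in> F" for l
    using that invL hact_inv(1)[OF LG HV] by (auto simp: F_def) metis+
  have F_comm: "b \<otimes> c \<otimes> inv b \<otimes> inv c \<in> F" if b: "b \<in> L" and c: "c \<in> L" for b c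
  proof -
    \<comment> \<open>Both \<open>b\<close> and \<open>c\<close> act on \<open>h\<close> as powers
      of \<open>k\<close>, and they commute with these powers, so the order of \<open>b\<close> and
      \<open>c\<close> does not matter on \<open>h\<close>.\<close>
    have comm2: "hact (b \<otimes> c) h = hact (c \<otimes> b) h" if h: "h \<in> Hp k" for h
    proof -
      note hV = HV[OF h]
      obtain i j :: int where ij: "hact b h = hact (k [^] i) h" "hact c h = hact (k [^] j) h"
      proof -
        have "sim h (hact b h)" "sim h (hact c h)" using LT[OF b] LT[OF c] h by (simp_all add: T_def)
        then show ?thesis using that unfolding sim_def by blast
      qed
      have "hact (b \<otimes> c) h = hact (k [^] (j + i)) h"
        using hact_mult[OF LG[OF b] LG[OF c] hV] ij commp[OF b hV] hact_pw_add[OF k hV, of j i] by simp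
      moreover have "hact (c \<otimes> b) h = hact (k [^] (i + j)) h"
        using hact_mult[OF LG[OF c] LG[OF b] hV] ij commp[OF c hV] hact_pw_add[OF k hV, of i j] by simp
      ultimately show ?thesis by (simp add: add.commute)
    qed
    have "hact (b \<otimes> c \<otimes> inv b \<otimes> inv c) h = h" if h: "h \<in> Hp k" for h
    proof -
      have cb: "c \<otimes> b \<in> L" using multL c b by blast
      note h' = Hpinv[OF invL[OF cb] h]
      have "b \<otimes> c \<otimes> inv b \<otimes> inv c = (b \<otimes> c) \<otimes> inv (c \<otimes> b)"
        using LG[OF b] LG[OF c] by (simp add: Gr.inv_mult_group Gr.m_assoc)
      then have "hact (b \<otimes> c \<otimes> inv b \<otimes> inv c) h = hact (b \<otimes> c) (hact (inv (c \<otimes> b)) h)"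
        using hact_mult[OF LG[OF multL[OF b c]] LG[OF invL[OF cb]] HV[OF h]] by simp
      also have "\<dots> = h" using comm2[OF h'] hact_inv(2)[OF LG[OF cb] HV[OF h]] by simp
      finally show ?thesis .
    qed
    then show ?thesis using b c multL invL by (simp add: F_def)
  qed
  have "l \<in> generate G (\<Union>b\<in>L. \<Union>c\<in>L. {b \<otimes> c \<otimes> inv b \<otimes> inv c})"
    using perf l unfolding derived_def by auto
  then have "l \<in> F"
  proof (induction rule: generate.induct)
    case one
    then show ?case using subgroup.one_closed[OF L] hact_one[OF HV] by (auto simp: F_def)
  next
    case (incl g)
    then show ?case using F_comm by auto
  next
    case (inv g)
    then show ?case using F_comm F_inv by auto
  next
    case (eng g g')
    then show ?case using F_mult by auto
  qed
  then show ?thesis using h by (simp add: F_def)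
qed

end

section \<open>Dyadic piecewise linear maps\<close>

lemma dyadic_iff: "x \<in> dyadic \<longleftrightarrow> (\<exists>(a::int) (n::nat). x * 2 ^ n = of_int a)"
  unfolding dyadic_def by (auto simp: field_simps)

lemma dyadicI: "x * 2 ^ n = of_int a \<Longrightarrow> x \<in> dyadic"
  using dyadic_iff by blast

lemma dyadic_of_int [simp]: "of_int a \<in> dyadic"
  by (rule dyadicI[of _ 0 a]) simp

lemma dyadic_numeral [simp]: "0 \<in> dyadic" "1 \<in> dyadic" "numeral k \<in> dyadic" "of_nat n \<in> dyadic"
  using dyadic_of_int[of 0] dyadic_of_int[of 1] dyadic_of_int[of "numeral k"] dyadic_of_int[of "int n"]
  by simp_all

lemma dyadic_add [simp]: "x \<in> dyadic \<Longrightarrow> y \<in> dyadic \<Longrightarrow> x + y \<in> dyadic"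
proof -
  assume "x \<in> dyadic" "y \<in> dyadic"
  then obtain a b :: int and n m :: nat where "x * 2 ^ n = of_int a" "y * 2 ^ m = of_int b"
    by (auto simp: dyadic_iff)
  moreover have "(x + y) * 2 ^ (n + m) = (x * 2 ^ n) * 2 ^ m + (y * 2 ^ m) * 2 ^ n"
    by (simp add: power_add algebra_simps)
  ultimately have "(x + y) * 2 ^ (n + m) = of_int (a * 2 ^ m + b * 2 ^ n)" by simp
  then show ?thesis by (rule dyadicI)
qed

lemma dyadic_mult [simp]: "x \<in> dyadic \<Longrightarrow> y \<in> dyadic \<Longrightarrow> x * y \<in> dyadic"
proof -
  assume "x \<in> dyadic" "y \<in> dyadic"
  then obtain a b :: int and n m :: nat where "x * 2 ^ n = of_int a" "y * 2 ^ m = of_int b"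
    by (auto simp: dyadic_iff)
  moreover have "(x * y) * 2 ^ (n + m) = (x * 2 ^ n) * (y * 2 ^ m)"
    by (simp add: power_add mult_ac)
  ultimately have "(x * y) * 2 ^ (n + m) = of_int (a * b)" by simp
  then show ?thesis by (rule dyadicI)
qed

lemma dyadic_minus [simp]: "x \<in> dyadic \<Longrightarrow> - x \<in> dyadic"
  using dyadic_mult[OF dyadic_of_int[of "-1"]] by simp

lemma dyadic_diff [simp]: "x \<in> dyadic \<Longrightarrow> y \<in> dyadic \<Longrightarrow> x - y \<in> dyadic"
  using dyadic_add[OF _ dyadic_minus] by simp

lemma dyadic_half_power [simp]: "1 / 2 ^ n \<in> dyadic"
  by (rule dyadicI[of _ n 1]) simp

lemma dyadic_div_power [simp]: "x \<in> dyadic \<Longrightarrow> x / 2 ^ n \<in> dyadic"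
  using dyadic_mult[OF _ dyadic_half_power] by simp

lemma dyadic_div_2 [simp]: "x \<in> dyadic \<Longrightarrow> x / 2 \<in> dyadic"
  using dyadic_div_power[of x 1] by simp

lemma dyadic_div_4 [simp]: "x \<in> dyadic \<Longrightarrow> x / 4 \<in> dyadic"
  using dyadic_div_power[of x 2] by simp

lemma dyadic_power [simp]: "x \<in> dyadic \<Longrightarrow> x ^ n \<in> dyadic"
  by (induction n) auto

lemma dyadic_powi [simp]: "2 powi k \<in> dyadic"
proof (cases "k \<ge> 0")
  case True
  then show ?thesis by (simp add: power_int_def)
next
  case False
  then have "2 powi k = 1 / (2::real) ^ nat (- k)" by (simp add: power_int_def field_simps)
  then show ?thesis by simp
qed

lemma powi_pos [simp]: "2 powi k > (0::real)"
  by (simp add: zero_less_power_int)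

lemma powi_nz [simp]: "2 powi k \<noteq> (0::real)"
  using powi_pos[of k] by linarith

lemma powi_add: "2 powi (k + l) = 2 powi k * (2 powi l :: real)"
  by (simp add: power_int_add)

lemma powi_inv: "2 powi k * 2 powi (- k) = (1::real)" "2 powi (- k) * 2 powi k = (1::real)"
  by (simp_all add: power_int_minus)

section \<open>Affine pieces, germs and locally dyadic piecewise linear maps\<close>

definition aff :: "(real \<Rightarrow> real) \<Rightarrow> real set \<Rightarrow> bool" where
  "aff h S \<longleftrightarrow> (\<exists>k::int. \<exists>b\<in>dyadic. \<forall>y\<in>S. h y = 2 powi k * y + b)"

lemma aff_subset: "aff h S \<Longrightarrow> T \<subseteq> S \<Longrightarrow> aff h T"
  unfolding aff_def by blast

lemma aff_cong: "aff h S \<Longrightarrow> (\<And>y. y \<in> S \<Longrightarrow> h' y = h y) \<Longrightarrow> aff h' S"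
  unfolding aff_def by metis

lemma affI: "b \<in> dyadic \<Longrightarrow> (\<And>y. y \<in> S \<Longrightarrow> h y = 2 powi k * y + b) \<Longrightarrow> aff h S"
  unfolding aff_def by blast

lemma aff_comp:
  assumes "aff g S" "aff h (g ` S)"
  shows "aff (h \<circ> g) S"
proof -
  obtain k b l c where g: "b \<in> dyadic" "\<forall>y\<in>S. g y = 2 powi k * y + b"
    and h: "c \<in> dyadic" "\<forall>y\<in>g ` S. h y = 2 powi l * y + c"
    using assms unfolding aff_def by blast
  have "(h \<circ> g) y = 2 powi (l + k) * y + (2 powi l * b + c)" if "y \<in> S" for y
  proof -
    have "(h \<circ> g) y = 2 powi l * g y + c" using h(2) that by simp
    then show ?thesis using g(2) that by (simp add: powi_add algebra_simps)
  qed
  then show ?thesis using g(1) h(1) by (intro affI) auto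
qed

lemma aff_inverse:
  assumes "aff h S" "\<And>y. y \<in> S \<Longrightarrow> k (h y) = y"
  shows "aff k (h ` S)"
proof -
  obtain l b where h: "b \<in> dyadic" "\<forall>y\<in>S. h y = 2 powi l * y + b"
    using assms(1) unfolding aff_def by blast
  show ?thesis
  proof (rule affI)
    show "- (2 powi (- l) * b) \<in> dyadic" using h by simp
    fix z assume "z \<in> h ` S"
    then obtain y where y: "y \<in> S" "z = h y" by blast
    have "2 powi (- l) * z - 2 powi (- l) * b = (2 powi (- l) * 2 powi l) * y"
      using h(2) y by (simp add: algebra_simps)
    then show "k z = 2 powi (- l) * z + - (2 powi (- l) * b)"
      using assms(2)[OF y(1)] y(2) by (simp add: powi_inv)
  qed
qed

lemma aff_dyadic_iff:
  assumes "aff g S" "x \<in> S"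
  shows "g x \<in> dyadic \<longleftrightarrow> x \<in> dyadic"
proof -
  obtain k b where g: "b \<in> dyadic" "g x = 2 powi k * x + b"
    using assms unfolding aff_def by blast
  have "x = 2 powi (- k) * (g x - b)" using g powi_inv(2)[of k] by (simp add: mult.assoc[symmetric])
  then show ?thesis using g by (metis dyadic_add dyadic_diff dyadic_mult dyadic_powi)
qed

text \<open>The values 0, 1 and 1, 0 and 1, 1 of \<open>\<alpha>\<close>, \<open>\<beta>\<close>
  give right, left and two-sided neighbourhoods, so that composition and inversion are treated once
  for all three.\<close>

definition germ :: "real \<Rightarrow> real \<Rightarrow> (real \<Rightarrow> real) \<Rightarrow> real \<Rightarrow> bool" where
  "germ \<alpha> \<beta> h x \<longleftrightarrow> (\<exists>e>0. aff h {x - \<alpha> * e..x + \<beta> * e})"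

lemma germ_cong:
  assumes "germ \<alpha> \<beta> h x" "\<delta> > 0" "\<And>y. x - \<alpha> * \<delta> \<le> y \<Longrightarrow> y \<le> x + \<beta> * \<delta> \<Longrightarrow> h' y = h y"
    and ab: "\<alpha> \<ge> 0" "\<beta> \<ge> 0"
  shows "germ \<alpha> \<beta> h' x"
proof -
  obtain e where e: "e > 0" "aff h {x - \<alpha> * e..x + \<beta> * e}" using assms by (auto simp: germ_def)
  have m: "\<alpha> * min e \<delta> \<le> \<alpha> * e" "\<beta> * min e \<delta> \<le> \<beta> * e" "\<alpha> * min e \<delta> \<le> \<alpha> * \<delta>" "\<beta> * min e \<delta> \<le> \<beta> * \<delta>"
    using ab by (auto intro!: mult_left_mono)
  have "aff h {x - \<alpha> * min e \<delta>..x + \<beta> * min e \<delta>}"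
    using e(2) by (rule aff_subset) (use m in auto)
  then have "aff h' {x - \<alpha> * min e \<delta>..x + \<beta> * min e \<delta>}"
    by (rule aff_cong) (use assms(3) m in auto)
  then show ?thesis unfolding germ_def using e assms(2) by (intro exI[of _ "min e \<delta>"]) auto
qed

lemma germ_comp:
  assumes g: "germ \<alpha> \<beta> g x" and h: "germ \<alpha> \<beta> h (g x)" and ab: "\<alpha> \<ge> 0" "\<beta> \<ge> 0"
  shows "germ \<alpha> \<beta> (h \<circ> g) x"
proof -
  obtain e1 where e1: "e1 > 0" "aff g {x - \<alpha> * e1..x + \<beta> * e1}" using g by (auto simp: germ_def)
  obtain e2 where e2: "e2 > 0" "aff h {g x - \<alpha> * e2..g x + \<beta> * e2}" using h by (auto simp: germ_def)
  obtain k b where kb: "\<forall>y\<in>{x - \<alpha> * e1..x + \<beta> * e1}. g y = 2 powi k * y + b" using e1 by (auto simp: aff_def)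
  \<comment> \<open>Two constraints on the radius: \<open>g\<close> must be affine, and its image,
    stretched by \<open>2 powi k\<close>, must stay where \<open>h\<close> is affine.\<close>
  define e where "e = min e1 (2 powi (- k) * e2)"
  have e: "e > 0" using e1 e2 by (simp add: e_def)
  have m: "\<alpha> * e \<le> \<alpha> * e1" "\<beta> * e \<le> \<beta> * e1" using ab by (auto intro!: mult_left_mono simp: e_def)
  have x: "x \<in> {x - \<alpha> * e1..x + \<beta> * e1}" using ab e1 by simp
  have "2 powi k * e \<le> 2 powi k * (2 powi (- k) * e2)" by (intro mult_left_mono) (auto simp: e_def)
  then have ke: "2 powi k * e \<le> e2" using powi_inv(1)[of k] by (simp add: mult.assoc[symmetric])
  have "aff g {x - \<alpha> * e..x + \<beta> * e}" using e1(2) by (rule aff_subset) (use m in auto)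
  moreover have "g y \<in> {g x - \<alpha> * e2..g x + \<beta> * e2}" if y: "y \<in> {x - \<alpha> * e..x + \<beta> * e}" for y
  proof -
    have gy: "g y - g x = 2 powi k * (y - x)" using kb x y m by (simp add: algebra_simps)
    have "2 powi k * (y - x) \<le> 2 powi k * (\<beta> * e)" using y by (intro mult_left_mono) auto
    also have "\<dots> = \<beta> * (2 powi k * e)" by simp
    also have "\<dots> \<le> \<beta> * e2" using ab ke by (intro mult_left_mono) auto
    finally have 1: "g y - g x \<le> \<beta> * e2" using gy by simp
    have "2 powi k * (x - y) \<le> 2 powi k * (\<alpha> * e)" using y by (intro mult_left_mono) auto
    also have "\<dots> = \<alpha> * (2 powi k * e)" by simp
    also have "\<dots> \<le> \<alpha> * e2" using ab ke by (intro mult_left_mono) auto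
    finally have 2: "g x - g y \<le> \<alpha> * e2" using gy by (simp add: algebra_simps)
    show ?thesis using 1 2 by simp
  qed
  then have "aff h (g ` {x - \<alpha> * e..x + \<beta> * e})" by (intro aff_subset[OF e2(2)]) blast
  ultimately show ?thesis unfolding germ_def using aff_comp e by blast
qed

text \<open>\<open>k\<close> is only given as a left inverse, so the points near \<open>h x\<close>
  are exhibited as images under \<open>h\<close> by solving the affine formula.\<close>

lemma germ_inverse:
  assumes h: "germ \<alpha> \<beta> h x" and k: "\<And>y. k (h y) = y" and ab: "\<alpha> \<ge> 0" "\<beta> \<ge> 0"
  shows "germ \<alpha> \<beta> k (h x)"
proof -
  obtain e where e: "e > 0" "aff h {x - \<alpha> * e..x + \<beta> * e}" using h by (auto simp: germ_def)
  obtain l b where lb: "\<forall>y\<in>{x - \<alpha> * e..x + \<beta> * e}. h y = 2 powi l * y + b" using e by (auto simp: aff_def)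
  define e' where "e' = 2 powi l * e"
  have x: "x \<in> {x - \<alpha> * e..x + \<beta> * e}" using ab e by simp
  have "z \<in> h ` {x - \<alpha> * e..x + \<beta> * e}" if z: "z \<in> {h x - \<alpha> * e'..h x + \<beta> * e'}" for z
  proof -
    define y where "y = x + 2 powi (- l) * (z - h x)"
    have p: "2 powi (- l) * e' = e" using powi_inv(2)[of l] by (simp add: e'_def mult.assoc[symmetric])
    have "2 powi (- l) * (z - h x) \<le> 2 powi (- l) * (\<beta> * e')" using z by (intro mult_left_mono) auto
    then have 1: "y \<le> x + \<beta> * e" using p by (simp add: y_def mult.left_commute)
    have "2 powi (- l) * (h x - z) \<le> 2 powi (- l) * (\<alpha> * e')" using z by (intro mult_left_mono) auto
    then have "2 powi (- l) * (h x - z) \<le> \<alpha> * e" using p by (simp add: mult.left_commute)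
    then have 2: "x - \<alpha> * e \<le> y" by (simp add: y_def algebra_simps)
    have "h y = h x + 2 powi l * (y - x)" using lb x 1 2 by (simp add: algebra_simps)
    also have "\<dots> = z" using powi_inv(1)[of l] by (simp add: y_def mult.assoc[symmetric])
    finally show ?thesis using 1 2 by (intro image_eqI[of _ _ y]) auto
  qed
  then have "aff k {h x - \<alpha> * e'..h x + \<beta> * e'}"
    by (intro aff_subset[OF aff_inverse[OF e(2) k]] subsetI)
  then show ?thesis unfolding germ_def using e by (intro exI[of _ e']) (auto simp: e'_def)
qed

lemma germ_dyadic_iff: "germ \<alpha> \<beta> g x \<Longrightarrow> \<alpha> \<ge> 0 \<Longrightarrow> \<beta> \<ge> 0 \<Longrightarrow> g x \<in> dyadic \<longleftrightarrow> x \<in> dyadic"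
  unfolding germ_def using aff_dyadic_iff[of g _ x] by force

text \<open>One-sided germs exist everywhere, and a break is tolerated only at a dyadic point. Local
  finiteness of the breaks is not stated; it follows by compactness in
  \<open>lpl_std\<close>.\<close>

definition lpl_at :: "(real \<Rightarrow> real) \<Rightarrow> real \<Rightarrow> bool" where
  "lpl_at h x \<longleftrightarrow> germ 0 1 h x \<and> germ 1 0 h x \<and> (x \<notin> dyadic \<longrightarrow> germ 1 1 h x)"

definition lpl :: "(real \<Rightarrow> real) \<Rightarrow> bool" where
  "lpl h \<longleftrightarrow> (\<forall>x. lpl_at h x)"

lemma lpl_at_comp: "lpl_at g x \<Longrightarrow> lpl_at h (g x) \<Longrightarrow> lpl_at (h \<circ> g) x"
  unfolding lpl_at_def using germ_comp[of 0 1 g x h] germ_comp[of 1 0 g x h] germ_comp[of 1 1 g x h]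
    germ_dyadic_iff[of 0 1 g x] by auto

lemma lpl_comp: "lpl g \<Longrightarrow> lpl h \<Longrightarrow> lpl (h \<circ> g)"
  unfolding lpl_def using lpl_at_comp by blast

lemma lpl_at_inverse: "lpl_at h x \<Longrightarrow> (\<And>y. k (h y) = y) \<Longrightarrow> lpl_at k (h x)"
  unfolding lpl_at_def using germ_inverse[of 0 1 h x k] germ_inverse[of 1 0 h x k] germ_inverse[of 1 1 h x k]
    germ_dyadic_iff[of 0 1 h x] by auto

lemma germ_right_weaken: "germ 1 1 h x \<Longrightarrow> germ 0 1 h x" "germ 1 1 h x \<Longrightarrow> germ 1 0 h x"
  unfolding germ_def by (force intro: aff_subset)+

lemma lpl_at_cong_open:
  assumes "lpl_at h x" "a < x" "x < b" "\<And>y. a < y \<Longrightarrow> y < b \<Longrightarrow> h' y = h y"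
  shows "lpl_at h' x"
proof -
  define \<delta> where "\<delta> = min (x - a) (b - x) / 2"
  have \<delta>: "\<delta> > 0" "a < x - \<delta>" "x + \<delta> < b" using assms(2,3) by (auto simp: \<delta>_def min_def field_simps)
  have "germ \<alpha> \<beta> h' x" if g: "germ \<alpha> \<beta> h x" and ab: "0 \<le> \<alpha>" "\<alpha> \<le> 1" "0 \<le> \<beta>" "\<beta> \<le> 1" for \<alpha> \<beta>
  proof (rule germ_cong[OF g \<delta>(1) _ ab(1,3)])
    fix y assume y: "x - \<alpha> * \<delta> \<le> y" "y \<le> x + \<beta> * \<delta>"
    have "\<alpha> * \<delta> \<le> \<delta>" "\<beta> * \<delta> \<le> \<delta>" using ab \<delta>(1) by (simp_all add: mult_left_le_one_le)
    then have "a < y" "y < b" using y \<delta> by linarith+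
    then show "h' y = h y" by (rule assms(4))
  qed
  then show ?thesis using assms(1) unfolding lpl_at_def by simp
qed

text \<open>A dyadic point may carry a break, so two maps that agree there can be joined without
  matching slopes.\<close>

lemma lpl_at_glue:
  assumes h1: "lpl_at h1 x" and h2: "lpl_at h2 x" and x: "x \<in> dyadic" and ab: "a < x" "x < b"
    and e1: "\<And>y. a < y \<Longrightarrow> y \<le> x \<Longrightarrow> h y = h1 y" and e2: "\<And>y. x \<le> y \<Longrightarrow> y < b \<Longrightarrow> h y = h2 y"
  shows "lpl_at h x"
proof -
  have "germ 1 0 h x"
  proof (rule germ_cong[of 1 0 h1 x "(x - a) / 2"])
    show "germ 1 0 h1 x" using h1 by (simp add: lpl_at_def)
    show "h y = h1 y" if "x - 1 * ((x - a) / 2) \<le> y" "y \<le> x + 0 * ((x - a) / 2)" for y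
      by (rule e1) (use that ab in \<open>simp_all add: field_simps\<close>)
  qed (use ab in auto)
  moreover have "germ 0 1 h x"
  proof (rule germ_cong[of 0 1 h2 x "(b - x) / 2"])
    show "germ 0 1 h2 x" using h2 by (simp add: lpl_at_def)
    show "h y = h2 y" if "x - 0 * ((b - x) / 2) \<le> y" "y \<le> x + 1 * ((b - x) / 2)" for y
      by (rule e2) (use that ab in \<open>simp_all add: field_simps\<close>)
  qed (use ab in auto)
  ultimately show ?thesis using x by (simp add: lpl_at_def)
qed

lemma aff_lpl_at: "aff h {a..b} \<Longrightarrow> a < x \<Longrightarrow> x < b \<Longrightarrow> lpl_at h x"
proof -
  assume a: "aff h {a..b}" "a < x" "x < b"
  define \<delta> where "\<delta> = min (x - a) (b - x)"
  have "\<delta> > 0" "a \<le> x - \<delta>" "x + \<delta> \<le> b" using a(2,3) by (auto simp: \<delta>_def)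
  then have "germ 1 1 h x" unfolding germ_def by (intro exI[of _ \<delta>]) (auto intro: aff_subset[OF a(1)])
  then show ?thesis using germ_right_weaken by (auto simp: lpl_at_def)
qed

lemma lpl_affine: "b \<in> dyadic \<Longrightarrow> lpl (\<lambda>x. 2 powi k * x + b)"
  unfolding lpl_def using aff_lpl_at[of _ "x - 1" "x + 1" x for x] affI by (metis less_add_one diff_less_eq)

lemma lpl_translation: "b \<in> dyadic \<Longrightarrow> lpl (\<lambda>x. x + b)"
  using lpl_affine[of b 0] by simp

lemma lpl_id: "lpl id" "lpl (\<lambda>x. x)"
  using lpl_affine[of 0 0] by (simp_all add: id_def)

lemma lpl_glue:
  assumes "lpl h1" "lpl h2" "p \<in> dyadic" "h1 p = h2 p"
  shows "lpl (\<lambda>x. if x \<le> p then h1 x else h2 x)"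
  unfolding lpl_def
proof
  fix x
  have l: "lpl_at h1 x" "lpl_at h2 x" using assms(1,2) by (simp_all add: lpl_def)
  consider "x < p" | "x = p" | "x > p" by linarith
  then show "lpl_at (\<lambda>x. if x \<le> p then h1 x else h2 x) x"
  proof cases
    case 1
    show ?thesis by (rule lpl_at_cong_open[OF l(1), of "x - 1" p]) (use 1 in auto)
  next
    case 2
    show ?thesis by (rule lpl_at_glue[OF l, of "x - 1" "x + 1"]) (use 2 assms(3,4) in auto)
  next
    case 3
    show ?thesis by (rule lpl_at_cong_open[OF l(2), of p "x + 1"]) (use 3 in auto)
  qed
qed

lemma germ_bounds:
  assumes "lpl_at h x"
  obtains e L k l where "e > 0" "L = (2::real) powi k" "\<And>y. x \<le> y \<Longrightarrow> y \<le> x + e \<Longrightarrow> h y - h x = L * (y - x)"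
    "\<And>y. x - e \<le> y \<Longrightarrow> y \<le> x \<Longrightarrow> h x - h y = 2 powi l * (x - y)"
proof -
  obtain e1 k b where 1: "e1 > 0" "\<forall>y\<in>{x..x + e1}. h y = 2 powi k * y + b"
    using assms by (auto simp: lpl_at_def germ_def aff_def)
  obtain e2 l c where 2: "e2 > 0" "\<forall>y\<in>{x - e2..x}. h y = 2 powi l * y + c"
    using assms by (auto simp: lpl_at_def germ_def aff_def)
  show ?thesis
  proof (rule that[of "min e1 e2" "2 powi k" k l])
    show "h y - h x = 2 powi k * (y - x)" if "x \<le> y" "y \<le> x + min e1 e2" for y
    proof -
      have "h y = 2 powi k * y + b" "h x = 2 powi k * x + b" using 1 that by auto
      then show ?thesis by (simp add: algebra_simps)
    qed
    show "h x - h y = 2 powi l * (x - y)" if "x - min e1 e2 \<le> y" "y \<le> x" for y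
    proof -
      have "h y = 2 powi l * y + c" "h x = 2 powi l * x + c" using 2 that by auto
      then show ?thesis by (simp add: algebra_simps)
    qed
  qed (use 1 2 in auto)
qed

lemma lpl_at_isCont: "lpl_at h x \<Longrightarrow> isCont h x"
proof -
  assume "lpl_at h x"
  then obtain e L k l where e: "e > 0" "L = 2 powi k" "\<And>y. x \<le> y \<Longrightarrow> y \<le> x + e \<Longrightarrow> h y - h x = L * (y - x)"
    "\<And>y. x - e \<le> y \<Longrightarrow> y \<le> x \<Longrightarrow> h x - h y = 2 powi l * (x - y)" using germ_bounds by metis
  define K where "K = L + 2 powi l"
  have L: "L > 0" "K > 0" using e powi_pos[of l] by (auto simp: K_def intro: add_pos_pos)
  have *: "\<bar>h y - h x\<bar> \<le> K * \<bar>y - x\<bar>" if "\<bar>y - x\<bar> \<le> e" for y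
  proof (cases "x \<le> y")
    case True
    then have "\<bar>h y - h x\<bar> = L * \<bar>y - x\<bar>" using e(3)[of y] that L by (simp add: abs_mult)
    also have "\<dots> \<le> K * \<bar>y - x\<bar>" by (intro mult_right_mono) (auto simp: K_def less_imp_le)
    finally show ?thesis .
  next
    case False
    then have "\<bar>h y - h x\<bar> = 2 powi l * \<bar>y - x\<bar>" using e(4)[of y] that by (simp add: abs_mult abs_minus_commute)
    also have "\<dots> \<le> K * \<bar>y - x\<bar>" using L by (intro mult_right_mono) (auto simp: K_def)
    finally show ?thesis .
  qed
  show ?thesis
    unfolding continuous_at_eps_delta dist_real_def
  proof (intro allI impI)
    fix \<epsilon> :: real assume \<epsilon>: "\<epsilon> > 0"
    show "\<exists>d>0. \<forall>x'. \<bar>x' - x\<bar> < d \<longrightarrow> \<bar>h x' - h x\<bar> < \<epsilon>"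
    proof (intro exI[of _ "min e (\<epsilon> / K)"] conjI allI impI)
      show "0 < min e (\<epsilon> / K)" using e L \<epsilon> by simp
      fix y assume y: "\<bar>y - x\<bar> < min e (\<epsilon> / K)"
      then have "\<bar>h y - h x\<bar> \<le> K * \<bar>y - x\<bar>" using * by simp
      also have "\<dots> < \<epsilon>" using y L by (simp add: field_simps)
      finally show "\<bar>h y - h x\<bar> < \<epsilon>" .
    qed
  qed
qed

lemma lpl_continuous: "lpl h \<Longrightarrow> continuous_on A h"
  using lpl_at_isCont continuous_at_imp_continuous_on unfolding lpl_def by blast

text \<open>Near each point both sides increase with positive slope, and Bolzano's bisection
  principle carries this to any interval.\<close>

lemma lpl_strict_mono:
  assumes "lpl h"
  shows "strict_mono h"
proof (rule strict_monoI)
  fix a b :: real assume ab: "a < b"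
  have "a < b \<longrightarrow> h a < h b"
  proof (rule Bolzano[where P = "\<lambda>a b. a < b \<longrightarrow> h a < h b"])
    fix x
    obtain e L k l where e: "e > 0" "L = 2 powi k" "\<And>y. x \<le> y \<Longrightarrow> y \<le> x + e \<Longrightarrow> h y - h x = L * (y - x)"
      "\<And>y. x - e \<le> y \<Longrightarrow> y \<le> x \<Longrightarrow> h x - h y = 2 powi l * (x - y)"
      using germ_bounds assms unfolding lpl_def by metis
    show "\<exists>d>0. \<forall>a b. a \<le> x \<and> x \<le> b \<and> b - a < d \<longrightarrow> (a < b \<longrightarrow> h a < h b)"
    proof (intro exI[of _ e] conjI allI impI)
      fix a b assume ab: "a \<le> x \<and> x \<le> b \<and> b - a < e" "a < b"
      have 1: "h b - h x = L * (b - x)" using e(3)[of b] ab by simp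
      have 2: "h x - h a = 2 powi l * (x - a)" using e(4)[of a] ab by simp
      have "L * (b - x) \<ge> 0" "2 powi l * (x - a) \<ge> 0" using e(2) ab by (auto intro!: mult_nonneg_nonneg simp: less_imp_le)
      moreover have "L * (b - x) > 0 \<or> 2 powi l * (x - a) > 0"
        using e(2) ab by (cases "x < b") (auto intro: mult_pos_pos)
      ultimately show "h a < h b" using 1 2 by linarith
    qed (use e in auto)
  next
    fix a b c assume "a < b \<longrightarrow> h a < h b" "b < c \<longrightarrow> h b < h c" "a \<le> b" "b \<le> c"
    then show "a < c \<longrightarrow> h a < h c" by (cases "a < b"; cases "b < c") auto
  qed (use ab in auto)
  then show "h a < h b" using ab by simp
qed

section \<open>Standard dyadic intervals, the pieces matched by tree pair diagrams\<close>

definition stdaff :: "(real \<Rightarrow> real) \<Rightarrow> nat \<Rightarrow> int \<Rightarrow> nat \<Rightarrow> bool" where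
  "stdaff h n i L \<longleftrightarrow> (\<exists>m\<ge>L. \<exists>j::int. \<forall>s. 0 \<le> s \<longrightarrow> s \<le> 1 \<longrightarrow> h ((of_int i + s) / 2 ^ n) = (of_int j + s) / 2 ^ m)"

text \<open>An affine piece of slope \<open>2 powi k\<close> takes level \<open>n\<close> to level
  \<open>n - k\<close>. The threshold collects what is needed: \<open>n\<close> exceeds
  \<open>k\<close>, the offset \<open>b\<close> becomes a multiple of the image length, and the
  image level reaches \<open>L\<close>.\<close>

lemma aff_std:
  assumes "aff h S"
  shows "\<exists>n0. \<forall>n\<ge>n0. \<forall>i::int. {of_int i / 2 ^ n..(of_int i + 1) / 2 ^ n} \<subseteq> S \<longrightarrow> stdaff h n i L"
proof -
  obtain k b where kb: "b \<in> dyadic" "\<forall>y\<in>S. h y = 2 powi k * y + b" using assms by (auto simp: aff_def)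
  obtain B :: int and q :: nat where B: "b * 2 ^ q = of_int B" using kb(1) by (auto simp: dyadic_iff)
  show ?thesis
  proof (intro exI[of _ "q + L + nat \<bar>k\<bar>"] allI impI)
    fix n i assume n: "n \<ge> q + L + nat \<bar>k\<bar>" and I: "{of_int i / 2 ^ n..(of_int i + 1) / 2 ^ n} \<subseteq> S"
    define m where "m = nat (int n - k)"
    have m: "m \<ge> q + L" "int m = int n - k" using n unfolding m_def by linarith+
    have pk: "2 powi k / 2 ^ n = (1::real) / 2 ^ m"
    proof -
      have "(2::real) ^ m = 2 powi (int n - k)" using m(2)[symmetric] by simp
      also have "\<dots> = 2 ^ n / 2 powi k" by (simp add: power_int_diff)
      finally show ?thesis by (simp add: field_simps)
    qed
    have bm: "b * 2 ^ m = of_int (B * 2 ^ (m - q))"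
    proof -
      have "b * 2 ^ m = (b * 2 ^ q) * 2 ^ (m - q)" using m(1) by (simp add: mult.assoc power_add[symmetric])
      then show ?thesis using B by simp
    qed
    have "h ((of_int i + s) / 2 ^ n) = (of_int (i + B * 2 ^ (m - q)) + s) / 2 ^ m" if s: "0 \<le> s" "s \<le> 1" for s
    proof -
      have "(of_int i + s) / 2 ^ n \<in> S" using I s by (auto simp: subset_iff divide_right_mono)
      then have "h ((of_int i + s) / 2 ^ n) = (of_int i + s) * (2 powi k / 2 ^ n) + b" using kb by simp
      also have "\<dots> = (of_int i + s + b * 2 ^ m) / 2 ^ m" unfolding pk by (simp add: field_simps)
      finally show ?thesis unfolding bm by (simp add: algebra_simps)
    qed
    then show "stdaff h n i L" unfolding stdaff_def using m(1) by (intro exI[of _ m] conjI exI[of _ "i + B * 2 ^ (m - q)"]) auto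
  qed
qed

text \<open>Fine standard intervals do not straddle a dyadic \<open>x\<close>, so the one-sided
  germs suffice there; at other points the germ is two-sided.\<close>

lemma lpl_at_std:
  assumes "lpl_at h x"
  shows "\<exists>e>0. \<exists>n0. \<forall>n\<ge>n0. \<forall>i::int. {of_int i / 2 ^ n..(of_int i + 1) / 2 ^ n} \<subseteq> {x - e..x + e} \<longrightarrow> stdaff h n i L"
proof -
  obtain e1 where e1: "e1 > 0" "aff h {x..x + e1}" using assms by (auto simp: lpl_at_def germ_def)
  obtain e2 where e2: "e2 > 0" "aff h {x - e2..x}" using assms by (auto simp: lpl_at_def germ_def)
  obtain e3 where e3: "e3 > 0" "x \<notin> dyadic \<Longrightarrow> aff h {x - e3..x + e3}"
    using assms unfolding lpl_at_def germ_def by (metis mult_1 zero_less_one)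
  define e where "e = min e1 (min e2 e3)"
  have e: "e > 0" "e \<le> e1" "e \<le> e2" "e \<le> e3" using e1 e2 e3 by (auto simp: e_def)
  have a1: "aff h {x..x + e}" by (rule aff_subset[OF e1(2)]) (use e in auto)
  have a2: "aff h {x - e..x}" by (rule aff_subset[OF e2(2)]) (use e in auto)
  obtain n1 where n1: "\<forall>n\<ge>n1. \<forall>i::int. {of_int i / 2 ^ n..(of_int i + 1) / 2 ^ n} \<subseteq> {x..x + e} \<longrightarrow> stdaff h n i L"
    using aff_std[OF a1] by blast
  obtain n2 where n2: "\<forall>n\<ge>n2. \<forall>i::int. {of_int i / 2 ^ n..(of_int i + 1) / 2 ^ n} \<subseteq> {x - e..x} \<longrightarrow> stdaff h n i L"
    using aff_std[OF a2] by blast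
  show ?thesis
  proof (cases "x \<in> dyadic")
    case False
    have "aff h {x - e..x + e}" by (rule aff_subset[OF e3(2)[OF False]]) (use e in auto)
    then show ?thesis using aff_std e(1) by blast
  next
    case True
    then obtain X :: int and q :: nat where X: "x * 2 ^ q = of_int X" by (auto simp: dyadic_iff)
    have "stdaff h n i L" if n: "n \<ge> max q (max n1 n2)" and I: "{of_int i / 2 ^ n..(of_int i + 1) / 2 ^ n} \<subseteq> {x - e..x + e}"
      for n and i :: int
    proof -
      have "x * 2 ^ n = (x * 2 ^ q) * 2 ^ (n - q)" using n by (simp add: mult.assoc power_add[symmetric])
      then have xn: "x * 2 ^ n = of_int (X * 2 ^ (n - q))" using X by simp
      have sub: "of_int i / 2 ^ n \<ge> x - e" "(of_int i + 1) / 2 ^ n \<le> x + e"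
        using I by (auto simp: subset_iff divide_right_mono)
      have "X * 2 ^ (n - q) \<le> i \<or> i + 1 \<le> X * 2 ^ (n - q)" by linarith
      then have "x * 2 ^ n \<le> of_int i \<or> of_int i + 1 \<le> x * 2 ^ n"
        unfolding xn by (metis of_int_1 of_int_add of_int_le_iff)
      then have "x \<le> of_int i / 2 ^ n \<or> (of_int i + 1) / 2 ^ n \<le> x" by (simp add: field_simps)
      then show ?thesis
      proof
        assume "x \<le> of_int i / 2 ^ n"
        then have "{of_int i / 2 ^ n..(of_int i + 1) / 2 ^ n} \<subseteq> {x..x + e}" using sub by auto
        then show ?thesis using n1 n by auto
      next
        assume "(of_int i + 1) / 2 ^ n \<le> x"
        then have "{of_int i / 2 ^ n..(of_int i + 1) / 2 ^ n} \<subseteq> {x - e..x}" using sub by auto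
        then show ?thesis using n2 n by auto
      qed
    qed
    then show ?thesis using e(1) by blast
  qed
qed

lemma small_power: "(e::real) > 0 \<Longrightarrow> \<exists>n0. \<forall>n\<ge>n0. 1 / 2 ^ n \<le> e"
proof -
  assume "e > 0"
  then obtain n0 where n0: "(1/2::real) ^ n0 < e" using real_arch_pow_inv[of e "1/2"] by auto
  have "1 / 2 ^ n \<le> e" if "n \<ge> n0" for n
  proof -
    have "(1/2::real) ^ n \<le> (1/2) ^ n0" using that by (intro power_decreasing) auto
    then show ?thesis using n0 by (simp add: power_one_over)
  qed
  then show ?thesis by blast
qed

text \<open>Bisection again. An interval that straddles the common endpoint \<open>b\<close> is
  short, hence inside the neighbourhood on which the local statement at \<open>b\<close>
  holds.\<close>

lemma lpl_std:
  fixes a b :: real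
  assumes h: "lpl h" and ab: "a \<le> b"
  shows "\<exists>n0. \<forall>n\<ge>n0. \<forall>i::int. {of_int i / 2 ^ n..(of_int i + 1) / 2 ^ n} \<subseteq> {a..b} \<longrightarrow> stdaff h n i L"
  using ab
proof (induction rule: Bolzano)
  case (trans a b c)
  obtain n1 n2 where n1: "\<forall>n\<ge>n1. \<forall>i::int. {of_int i / 2 ^ n..(of_int i + 1) / 2 ^ n} \<subseteq> {a..b} \<longrightarrow> stdaff h n i L"
    and n2: "\<forall>n\<ge>n2. \<forall>i::int. {of_int i / 2 ^ n..(of_int i + 1) / 2 ^ n} \<subseteq> {b..c} \<longrightarrow> stdaff h n i L"
    using trans(1,2) by blast
  obtain e n3 where e: "e > 0" and n3: "\<forall>n\<ge>n3. \<forall>i::int. {of_int i / 2 ^ n..(of_int i + 1) / 2 ^ n} \<subseteq> {b - e..b + e} \<longrightarrow> stdaff h n i L"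
    using lpl_at_std h unfolding lpl_def by blast
  obtain n4 where n4: "\<forall>n\<ge>n4. 1 / 2 ^ n \<le> e" using small_power[OF e] by blast
  have "stdaff h n i L" if n: "n \<ge> max (max n1 n2) (max n3 n4)" and I: "{of_int i / 2 ^ n..(of_int i + 1) / 2 ^ n} \<subseteq> {a..c}"
    for n and i :: int
  proof -
    have sub: "of_int i / 2 ^ n \<ge> a" "(of_int i + 1) / 2 ^ n \<le> c"
      using I by (auto simp: subset_iff divide_right_mono)
    have len: "(of_int i + 1) / 2 ^ n = of_int i / 2 ^ n + 1 / (2::real) ^ n" by (simp add: add_divide_distrib)
    have le: "1 / 2 ^ n \<le> e" using n4 n by simp
    consider "(of_int i + 1) / 2 ^ n \<le> b" | "b \<le> of_int i / 2 ^ n" | "of_int i / 2 ^ n \<le> b" "b \<le> (of_int i + 1) / 2 ^ n"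
      by linarith
    then show ?thesis
    proof cases
      case 1
      then have "{of_int i / 2 ^ n..(of_int i + 1) / 2 ^ n} \<subseteq> {a..b}" using sub by auto
      then show ?thesis using n1 n by auto
    next
      case 2
      then have "{of_int i / 2 ^ n..(of_int i + 1) / 2 ^ n} \<subseteq> {b..c}" using sub by auto
      then show ?thesis using n2 n by auto
    next
      case 3
      have "b - e \<le> of_int i / 2 ^ n" "(of_int i + 1) / 2 ^ n \<le> b + e" using 3 le len by linarith+
      then have "{of_int i / 2 ^ n..(of_int i + 1) / 2 ^ n} \<subseteq> {b - e..b + e}" by auto
      then show ?thesis using n3 n by auto
    qed
  qed
  then show ?case by blast
next
  case (local x)
  obtain e n0 where e: "e > 0" and n0: "\<forall>n\<ge>n0. \<forall>i::int. {of_int i / 2 ^ n..(of_int i + 1) / 2 ^ n} \<subseteq> {x - e..x + e} \<longrightarrow> stdaff h n i L"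
    using lpl_at_std h unfolding lpl_def by blast
  show ?case
  proof (intro exI[of _ e] conjI allI impI e)
    fix a b assume ab: "a \<le> x \<and> x \<le> b \<and> b - a < e"
    then have "{a..b} \<subseteq> {x - e..x + e}" by auto
    then show "\<exists>n0. \<forall>n\<ge>n0. \<forall>i::int. {of_int i / 2 ^ n..(of_int i + 1) / 2 ^ n} \<subseteq> {a..b} \<longrightarrow> stdaff h n i L"
      using n0 by (meson order_trans)
  qed
qed

section \<open>The lift described by local germs\<close>

definition TL :: "(real \<Rightarrow> real) set" where
  "TL = {h. lpl h \<and> (\<forall>x. h (x + 1) = h x + 1)}"

lemma TL_lpl: "h \<in> TL \<Longrightarrow> lpl h" and TL_step: "h \<in> TL \<Longrightarrow> h (x + 1) = h x + 1"
  by (auto simp: TL_def)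

lemma TL_int:
  assumes "h \<in> TL"
  shows "h (x + of_int n) = h x + of_int n"
proof (induction n rule: int_induct[where k = 0])
  case (step1 i)
  have "h (x + of_int (i + 1)) = h ((x + of_int i) + 1)" by (simp add: add.assoc)
  then show ?case using TL_step[OF assms] step1 by simp
next
  case (step2 i)
  have "h (x + of_int i) = h ((x + of_int (i - 1)) + 1)" by (simp add: add.assoc)
  then show ?case using TL_step[OF assms, of "x + of_int (i - 1)"] step2 by simp
qed simp

lemma TL_strict_mono: "h \<in> TL \<Longrightarrow> strict_mono h"
  using lpl_strict_mono TL_lpl by blast

lemma TL_less_iff: "h \<in> TL \<Longrightarrow> h x < h y \<longleftrightarrow> x < y"
  using TL_strict_mono strict_mono_less by blast

lemma TL_le_iff: "h \<in> TL \<Longrightarrow> h x \<le> h y \<longleftrightarrow> x \<le> y"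
  using TL_strict_mono strict_mono_less_eq by blast

lemma TL_surj:
  assumes "h \<in> TL"
  shows "\<exists>x. h x = y"
proof -
  define a :: real where "a = of_int \<lfloor>y - h 0\<rfloor>"
  have "h (0 + of_int \<lfloor>y - h 0\<rfloor>) = h 0 + of_int \<lfloor>y - h 0\<rfloor>" "h (0 + of_int (\<lfloor>y - h 0\<rfloor> + 1)) = h 0 + of_int (\<lfloor>y - h 0\<rfloor> + 1)"
    using TL_int[OF assms] by blast+
  then have "h a = h 0 + of_int \<lfloor>y - h 0\<rfloor>" "h (a + 1) = h 0 + of_int \<lfloor>y - h 0\<rfloor> + 1"
    by (simp_all add: a_def)
  then have "h a \<le> y" "y \<le> h (a + 1)" by linarith+
  moreover have "continuous_on {a..a + 1} h" using lpl_continuous TL_lpl assms by blast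
  ultimately show ?thesis using IVT'[of h a y "a + 1"] by auto
qed

lemma TL_bij: "h \<in> TL \<Longrightarrow> bij h"
  using TL_surj strict_mono_imp_inj_on[OF TL_strict_mono] by (metis bijI surjI)

lemma TL_comp: "g \<in> TL \<Longrightarrow> h \<in> TL \<Longrightarrow> g \<circ> h \<in> TL"
  using lpl_comp by (auto simp: TL_def)

lemma TL_id: "id \<in> TL"
  using lpl_id by (simp add: TL_def)

lemma TL_translation: "b \<in> dyadic \<Longrightarrow> (\<lambda>x. x + b) \<in> TL"
  using lpl_translation by (simp add: TL_def)

lemma TL_inv:
  assumes "h \<in> TL"
  shows "Hilbert_Choice.inv h \<in> TL"
proof -
  have b: "bij h" using TL_bij assms by blast
  have k: "Hilbert_Choice.inv h (h y) = y" for y using b by (simp add: bij_is_inj)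
  have k': "h (Hilbert_Choice.inv h y) = y" for y using b by (simp add: bij_is_surj surj_f_inv_f)
  have "lpl_at (Hilbert_Choice.inv h) x" for x
    using lpl_at_inverse[of h "Hilbert_Choice.inv h x", OF _ k] TL_lpl[OF assms] k'[of x] by (simp add: lpl_def)
  moreover have "Hilbert_Choice.inv h (x + 1) = Hilbert_Choice.inv h x + 1" for x
    using k[of "Hilbert_Choice.inv h x + 1"] TL_step[OF assms] k' by simp
  ultimately show ?thesis unfolding TL_def lpl_def by blast
qed

lemma TL_dyadic_iff: "h \<in> TL \<Longrightarrow> h x \<in> dyadic \<longleftrightarrow> x \<in> dyadic"
  using germ_dyadic_iff[of 0 1 h x] TL_lpl[of h] by (auto simp: lpl_def lpl_at_def)

section \<open>From Thompson's definition to local germs\<close>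

lemma darboux:
  fixes f f' :: "real \<Rightarrow> real"
  assumes uv: "u < v" and f: "\<And>x. u \<le> x \<Longrightarrow> x \<le> v \<Longrightarrow> (f has_real_derivative f' x) (at x)"
    and c: "f' u < c" "c < f' v"
  shows "\<exists>w. u < w \<and> w < v \<and> f' w = c"
proof -
  \<comment> \<open>At an interior minimum of \<open>g\<close> the derivative \<open>f'\<close>
    takes the value \<open>c\<close>; the signs of the derivative of \<open>g\<close> at the ends
    keep the minimum inside.\<close>
  define g where "g x = f x - c * x" for x
  have g: "(g has_real_derivative f' x - c) (at x)" if "u \<le> x" "x \<le> v" for x
    unfolding g_def using f[OF that] by (auto intro!: derivative_eq_intros)
  have "continuous_on {u..v} g"
    using g by (meson DERIV_isCont atLeastAtMost_iff continuous_at_imp_continuous_on)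
  then obtain w where w: "u \<le> w" "w \<le> v" "\<And>y. u \<le> y \<Longrightarrow> y \<le> v \<Longrightarrow> g w \<le> g y"
    using continuous_attains_inf[of "{u..v}" g] uv by auto
  have "w \<noteq> u"
  proof
    assume "w = u"
    obtain \<delta> where d: "\<delta> > 0" "\<And>h. h > 0 \<Longrightarrow> h < \<delta> \<Longrightarrow> g (u + h) < g u"
      using DERIV_neg_dec_right[OF g[of u]] c uv by auto
    define h where "h = min (\<delta> / 2) (v - u)"
    have "h > 0" "h < \<delta>" "h \<le> v - u" using d uv by (auto simp: h_def)
    then show False using w(3)[of "u + h"] d(2)[of h] \<open>w = u\<close> by simp
  qed
  moreover have "w \<noteq> v"
  proof
    assume "w = v"
    obtain \<delta> where d: "\<delta> > 0" "\<And>h. h > 0 \<Longrightarrow> h < \<delta> \<Longrightarrow> g (v - h) < g v"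
      using DERIV_pos_inc_left[OF g[of v]] c uv by auto
    define h where "h = min (\<delta> / 2) (v - u)"
    have "h > 0" "h < \<delta>" "h \<le> v - u" using d uv by (auto simp: h_def)
    then show False using w(3)[of "v - h"] d(2)[of h] \<open>w = v\<close> by simp
  qed
  ultimately have wi: "u < w" "w < v" using w by auto
  define \<delta> where "\<delta> = min (w - u) (v - w)"
  have "\<delta> > 0" "\<And>y. \<bar>w - y\<bar> < \<delta> \<Longrightarrow> g w \<le> g y" using wi w(3) by (auto simp: \<delta>_def)
  then have "f' w - c = 0" using DERIV_local_min[OF g[of w]] wi by auto
  then show ?thesis using wi by auto
qed

text \<open>\<open>3 / 2 * 2 powi k\<close> is a value that a derivative running from
  \<open>2 powi k\<close> to a larger power of 2 must take, yet it is no power of 2.\<close>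

lemma powi_no_between: "2 powi k < (2::real) powi l \<Longrightarrow> 2 powi k < 3 / 2 * (2::real) powi k \<and> 3 / 2 * (2::real) powi k < 2 powi l \<and> 3 / 2 * 2 powi k \<noteq> (2::real) powi m"
proof -
  assume "2 powi k < (2::real) powi l"
  then have "k < l" by (metis linorder_not_less power_int_increasing one_le_numeral)
  then have "(2::real) powi (k + 1) \<le> 2 powi l" by (intro power_int_increasing) auto
  then have 1: "2 * (2::real) powi k \<le> 2 powi l" by (simp add: power_int_add)
  have "3 / 2 * 2 powi k \<noteq> (2::real) powi m"
  proof (cases "m \<le> k")
    case True
    then have "(2::real) powi m \<le> 2 powi k" by (intro power_int_increasing) auto
    then have "2 powi m < 3 / 2 * (2::real) powi k" using powi_pos[of k] by linarith
    then show ?thesis by simp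
  next
    case False
    then have "(2::real) powi (k + 1) \<le> 2 powi m" by (intro power_int_increasing) auto
    then have "2 * (2::real) powi k \<le> 2 powi m" by (simp add: power_int_add)
    then have "3 / 2 * (2::real) powi k < 2 powi m" using powi_pos[of k] by linarith
    then show ?thesis by simp
  qed
  moreover have "2 powi k < 3 / 2 * (2::real) powi k" "3 / 2 * (2::real) powi k < 2 powi l"
    using 1 powi_pos[of k] by linarith+
  ultimately show ?thesis by blast
qed

text \<open>By Darboux, a derivative with values in the powers of 2 is constant.\<close>

lemma derivative_powi_affine:
  fixes F :: "real \<Rightarrow> real"
  assumes ab: "a < b" and cont: "continuous_on {a..b} F"
    and diff: "\<And>x. a < x \<Longrightarrow> x < b \<Longrightarrow> F differentiable (at x)"
    and slope: "\<And>x s. (F has_real_derivative s) (at x) \<Longrightarrow> \<exists>k::int. s = 2 powi k"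
  shows "\<exists>k::int. \<exists>c. \<forall>y\<in>{a..b}. F y = 2 powi k * y + c"
proof -
  obtain F' where F': "\<And>x. a < x \<Longrightarrow> x < b \<Longrightarrow> (F has_real_derivative F' x) (at x)"
    using diff unfolding real_differentiable_def by metis
  have eq: "F' u = F' v" if uv: "a < u" "u < v" "v < b" for u v
  proof (rule ccontr)
    assume ne: "F' u \<noteq> F' v"
    obtain k l where kl: "F' u = 2 powi k" "F' v = 2 powi l" using F' slope uv by (meson order.strict_trans)
    consider "F' u < F' v" | "F' v < F' u" using ne by linarith
    then show False
    proof cases
      case 1
      have "\<exists>w. u < w \<and> w < v \<and> F' w = 3 / 2 * 2 powi k"
      proof (rule darboux[of u v F])
        show "F' u < 3 / 2 * 2 powi k" "3 / 2 * 2 powi k < F' v"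
          using powi_no_between[of k l 0] 1 unfolding kl by blast+
      qed (use F' uv in auto)
      then obtain w where w: "u < w" "w < v" "F' w = 3 / 2 * 2 powi k" by blast
      have "a < w" "w < b" using w uv by linarith+
      then obtain m where m: "F' w = 2 powi m" using slope[OF F'[of w]] by blast
      then show False using w(3) powi_no_between[of k l m] 1 unfolding kl by simp
    next
      case 2
      have "\<exists>w. u < w \<and> w < v \<and> - F' w = - (3 / 2 * 2 powi l)"
      proof (rule darboux[of u v "\<lambda>x. - F x"])
        show "- F' u < - (3 / 2 * 2 powi l)" "- (3 / 2 * 2 powi l) < - F' v"
          using powi_no_between[of l k 0] 2 unfolding kl by simp_all
        show "((\<lambda>x. - F x) has_real_derivative - F' x) (at x)" if "u \<le> x" "x \<le> v" for x
          using F'[of x] that uv by (intro DERIV_minus) auto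
      qed (use uv in auto)
      then obtain w where w: "u < w" "w < v" "F' w = 3 / 2 * 2 powi l" by (metis neg_equal_iff_equal)
      have "a < w" "w < b" using w uv by linarith+
      then obtain m where m: "F' w = 2 powi m" using slope[OF F'[of w]] by blast
      then show False using w(3) powi_no_between[of l k m] 2 unfolding kl by simp
    qed
  qed
  define p where "p = (a + b) / 2"
  have p: "a < p" "p < b" using ab by (auto simp: p_def)
  obtain k where k: "F' p = 2 powi k" using F' slope p by blast
  have Fk: "(F has_real_derivative 2 powi k) (at x)" if "a < x" "x < b" for x
    using F'[OF that] eq[of x p] eq[of p x] p that k by (cases x p rule: linorder_cases) auto
  define g where "g x = F x - 2 powi k * x" for x
  have g0: "(g has_real_derivative 0) (at x)" if "a < x" "x < b" for x
    unfolding g_def using Fk[OF that] by (auto intro!: derivative_eq_intros)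
  have "continuous_on {a..b} g" unfolding g_def by (intro continuous_intros cont)
  then have "g x = g a" if "a \<le> x" "x \<le> b" for x
    using DERIV_isconst2[OF ab _ g0 that] by blast
  then have "\<forall>y\<in>{a..b}. F y = 2 powi k * y + g a" by (auto simp: g_def algebra_simps)
  then show ?thesis by blast
qed

lemma dyadic_dense: "(a::real) < b \<Longrightarrow> \<exists>q\<in>dyadic. a < q \<and> q < b"
proof -
  assume ab: "a < b"
  obtain n where n: "1 / 2 ^ n \<le> (b - a) / 2" using small_power[of "(b - a) / 2"] ab by auto
  define q where "q = of_int (\<lfloor>a * 2 ^ n\<rfloor> + 1) / (2::real) ^ n"
  have "q \<in> dyadic" unfolding q_def by (intro dyadic_div_power dyadic_of_int)
  moreover have "a < q" unfolding q_def by (simp add: field_simps) linarith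
  moreover have "q \<le> a + 1 / 2 ^ n" unfolding q_def by (simp add: field_simps)
  ultimately show ?thesis using n ab by (intro bexI[of _ q]) auto
qed

text \<open>The preimage of one circle point is a coset of \<open>\<int>\<close>; the distance from
  \<open>x\<close> to it, or 1 if \<open>x\<close> belongs to it, is a valid radius.\<close>

lemma punctured_nbhd_avoids:
  assumes "finite P"
  shows "\<exists>e>0. \<forall>y. 0 < \<bar>y - x\<bar> \<and> \<bar>y - x\<bar> < e \<longrightarrow> circle_proj y \<notin> P"
  using assms
proof (induction rule: finite_induct)
  case empty
  then show ?case by (auto intro: exI[of _ 1])
next
  case (insert c P)
  obtain r where r: "c = circle_proj r" by (metis circle.abs_eq_iff Quotient3_circle Quotient3_def circle_proj_eq_iff)
  have "\<exists>e>0. \<forall>y. 0 < \<bar>y - x\<bar> \<and> \<bar>y - x\<bar> < e \<longrightarrow> y - r \<notin> \<int>"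
  proof (cases "x - r \<in> \<int>")
    case True
    have "y - r \<notin> \<int>" if y: "0 < \<bar>y - x\<bar>" "\<bar>y - x\<bar> < 1" for y
    proof
      assume "y - r \<in> \<int>"
      then have "(y - r) - (x - r) \<in> \<int>" using True by (rule Ints_diff)
      then have "y - x \<in> \<int>" by simp
      then show False using Ints_nonzero_abs_ge1[of "y - x"] y by auto
    qed
    then show ?thesis by (intro exI[of _ 1]) auto
  next
    case False
    define t where "t = x - r"
    have fr: "frac t > 0" "frac t < 1" using False frac_eq_0_iff[of t] frac_ge_0[of t] frac_lt_1[of t] by (auto simp: t_def less_le)
    have "y - r \<notin> \<int>" if y: "\<bar>y - x\<bar> < min (frac t) (1 - frac t)" for y
    proof
      assume "y - r \<in> \<int>"
      then obtain m where m: "y - r = of_int m" by (auto elim: Ints_cases)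
      then have "\<bar>of_int m - t\<bar> < min (frac t) (1 - frac t)" using y by (simp add: t_def algebra_simps)
      moreover have "t = of_int \<lfloor>t\<rfloor> + frac t" by (simp add: frac_def)
      ultimately have "of_int m < (of_int \<lfloor>t\<rfloor> + 1 :: real)" "of_int m > (of_int \<lfloor>t\<rfloor> :: real)" by linarith+
      then have "m < \<lfloor>t\<rfloor> + 1" "m > \<lfloor>t\<rfloor>" by (metis of_int_1 of_int_add of_int_less_iff)+
      then show False by simp
    qed
    then show ?thesis using fr by (intro exI[of _ "min (frac t) (1 - frac t)"]) auto
  qed
  then obtain e1 where e1: "e1 > 0" "\<forall>y. 0 < \<bar>y - x\<bar> \<and> \<bar>y - x\<bar> < e1 \<longrightarrow> y - r \<notin> \<int>" by blast
  obtain e2 where e2: "e2 > 0" "\<forall>y. 0 < \<bar>y - x\<bar> \<and> \<bar>y - x\<bar> < e2 \<longrightarrow> circle_proj y \<notin> P" using insert by blast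
  show ?case using e1 e2 unfolding r insert_iff circle_proj_eq_iff by (intro exI[of _ "min e1 e2"]) auto
qed

lemma int_valued_constant:
  fixes g :: "real \<Rightarrow> real"
  assumes "continuous_on UNIV g" "\<And>x. g x \<in> \<int>"
  shows "g x = g 0"
proof -
  have "g constant_on UNIV"
  proof (rule continuous_discrete_range_constant[OF connected_UNIV assms(1)])
    show "\<exists>e>0. \<forall>y. y \<in> UNIV \<and> g y \<noteq> g x \<longrightarrow> e \<le> norm (g y - g x)" for x
      using Ints_nonzero_abs_ge1[OF Ints_diff[OF assms(2) assms(2)]] by (intro exI[of _ 1]) auto
  qed
  then show ?thesis by (auto simp: constant_on_def)
qed

lemma proj_dyadic_iff: "circle_proj x \<in> dyadic_circle \<longleftrightarrow> x \<in> dyadic"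
proof
  assume "circle_proj x \<in> dyadic_circle"
  then obtain y where y: "y \<in> dyadic" "x - y \<in> \<int>" by (auto simp: dyadic_circle_def circle_proj_eq_iff)
  then obtain m where "x - y = of_int m" by (auto elim: Ints_cases)
  then have "x = y + of_int m" by simp
  then show "x \<in> dyadic" using y by simp
qed (auto simp: dyadic_circle_def)

text \<open>Between breaks the slope is a constant power of 2, and the offset is dyadic because some
  dyadic point of the piece has a dyadic image. The degree \<open>F (x + 1) - F x\<close> is a
  constant integer: positive by monotonicity, below 2 by injectivity of \<open>f\<close>.\<close>

lemma thompson_T_lift_in_TL:
  assumes "f \<in> thompson_T_set"
  obtains F where "F \<in> TL" "\<And>x. f (circle_proj x) = circle_proj (F x)"
proof -
  obtain F g where hom: "homeomorphism UNIV UNIV f g" and fd: "f ` dyadic_circle \<subseteq> dyadic_circle"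
    and lift: "circle_lift f F" and mono: "strict_mono F"
    and fin: "finite (circle_proj ` {x. \<not> F differentiable (at x)})"
    and dy: "circle_proj ` {x. \<not> F differentiable (at x)} \<subseteq> dyadic_circle"
    and slope: "\<And>x s. (F has_real_derivative s) (at x) \<Longrightarrow> \<exists>k::int. s = 2 powi k"
    using assms unfolding thompson_T_set_def by blast
  have cont: "continuous_on UNIV F" and fF: "\<And>x. f (circle_proj x) = circle_proj (F x)"
    using lift by (auto simp: circle_lift_def)
  have contA: "continuous_on A F" for A using cont continuous_on_subset by blast
  have Fd: "F x \<in> dyadic" if "x \<in> dyadic" for x
    using fd that fF[of x] proj_dyadic_iff by (metis image_subset_iff)
  have nd: "x \<in> dyadic" if "\<not> F differentiable (at x)" for x
    using dy that proj_dyadic_iff by blast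
  have affI: "aff F {a..b}" if ab: "a < b" and d: "\<And>x. a < x \<Longrightarrow> x < b \<Longrightarrow> F differentiable (at x)" for a b
  proof -
    have "\<exists>k::int. \<exists>c. \<forall>y\<in>{a..b}. F y = 2 powi k * y + c"
      by (rule derivative_powi_affine[OF ab contA]) (fact d, fact slope)
    then obtain k c where kc: "\<forall>y\<in>{a..b}. F y = 2 powi k * y + c" by blast
    obtain q where q: "q \<in> dyadic" "a < q" "q < b" using dyadic_dense[OF ab] by blast
    have "c = F q - 2 powi k * q" using kc q by simp
    then have "c \<in> dyadic" using Fd q(1) by simp
    then show ?thesis using kc unfolding aff_def by blast
  qed
  have "lpl_at F x" for x
  proof -
    obtain e where e: "e > 0" "\<forall>y. 0 < \<bar>y - x\<bar> \<and> \<bar>y - x\<bar> < e \<longrightarrow> circle_proj y \<notin> circle_proj ` {x. \<not> F differentiable (at x)}"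
      using punctured_nbhd_avoids[OF fin, of x] by blast
    have d: "F differentiable (at y)" if "y \<noteq> x" "\<bar>y - x\<bar> < e" for y
    proof (rule ccontr)
      assume "\<not> F differentiable (at y)"
      then have "circle_proj y \<in> circle_proj ` {x. \<not> F differentiable (at x)}" by blast
      moreover have "0 < \<bar>y - x\<bar>" using that(1) by simp
      ultimately show False using e(2) that(2) by blast
    qed
    have "aff F {x..x + e}"
    proof (rule affI)
      show "F differentiable (at y)" if "x < y" "y < x + e" for y by (rule d) (use that in auto)
    qed (use e(1) in auto)
    moreover have "aff F {x - e..x}"
    proof (rule affI)
      show "F differentiable (at y)" if "x - e < y" "y < x" for y by (rule d) (use that in auto)
    qed (use e(1) in auto)
    moreover have "aff F {x - e..x + e}" if "x \<notin> dyadic"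
    proof (rule affI)
      fix y assume "x - e < y" "y < x + e"
      then have "y \<noteq> x \<Longrightarrow> F differentiable (at y)" by (intro d) auto
      then show "F differentiable (at y)" using nd[of y] that by blast
    qed (use e in auto)
    ultimately show ?thesis unfolding lpl_at_def germ_def using e(1) by auto
  qed
  then have lpl: "lpl F" by (simp add: lpl_def)
  have inj: "inj f" using hom by (auto simp: homeomorphism_def inj_def) metis
  have int: "F (x + 1) - F x \<in> \<int>" for x
  proof -
    have "circle_proj (x + 1) = circle_proj x" by (simp add: circle_proj_eq_iff)
    then show ?thesis using fF[of x] fF[of "x + 1"] by (simp add: circle_proj_eq_iff[symmetric])
  qed
  have "continuous_on UNIV (\<lambda>x. F (x + 1) - F x)"
    by (intro continuous_intros continuous_on_compose2[OF cont]) auto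
  then have const: "F (x + 1) - F x = F 1 - F 0" for x using int_valued_constant[of "\<lambda>x. F (x + 1) - F x" x] int by simp
  obtain m where m: "F 1 - F 0 = of_int m" using int[of 0] by (auto elim: Ints_cases)
  have "F 0 < F 1" using mono by (simp add: strict_mono_def)
  then have "m \<ge> 1" using m by linarith
  \<comment> \<open>Otherwise \<open>F\<close> would take the value \<open>F 0 + 1\<close> strictly
    inside the period, and \<open>f\<close> would identify two circle points.\<close>
  moreover have "\<not> m \<ge> 2"
  proof
    assume "m \<ge> 2"
    then have "F 0 + 1 < F 1" using m by linarith
    then obtain y where y: "0 \<le> y" "y \<le> 1" "F y = F 0 + 1" using IVT'[of F 0 "F 0 + 1" 1] contA by auto
    have "circle_proj (F y) = circle_proj (F 0)" using y by (simp add: circle_proj_eq_iff)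
    then have "circle_proj y = circle_proj 0" using fF inj by (metis injD)
    then have "y \<in> \<int>" by (simp add: circle_proj_eq_iff)
    then have "y = 0 \<or> y = 1" using y by (auto elim!: Ints_cases)
    then show False using y \<open>F 0 + 1 < F 1\<close> by auto
  qed
  ultimately have "m = 1" by simp
  then have "F \<in> TL" using const m lpl by (simp add: TL_def) (metis add.commute diff_eq_eq)
  then show ?thesis using fF by (rule that)
qed

text \<open>\<open>h\<close> and the lift \<open>F\<close> cover the same circle map, so their
  difference is continuous and integer-valued, hence constant.\<close>

lemma thompson_T_lift_set_subset: "thompson_T_lift_set \<subseteq> TL"
proof
  fix h assume h: "h \<in> thompson_T_lift_set"
  then obtain f g where f: "f \<in> thompson_T_set" "\<And>x. f (circle_proj x) = circle_proj (h x)"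
    and "homeomorphism UNIV UNIV h g" unfolding thompson_T_lift_set_def by blast
  then have hc: "continuous_on UNIV h" by (simp add: homeomorphism_def)
  obtain F where F: "F \<in> TL" "\<And>x. f (circle_proj x) = circle_proj (F x)"
    using thompson_T_lift_in_TL[OF f(1)] by blast
  have int: "h x - F x \<in> \<int>" for x using f(2)[of x] F(2)[of x] circle_proj_eq_iff by metis
  have "continuous_on UNIV (\<lambda>x. h x - F x)"
    by (intro continuous_intros hc lpl_continuous TL_lpl F(1))
  then have const: "h x - F x = h 0 - F 0" for x using int_valued_constant[of "\<lambda>x. h x - F x" x] int by simp
  have hF: "h x = F x + (h 0 - F 0)" for x using const[of x] by linarith
  have "h = (\<lambda>x. x + (h 0 - F 0)) \<circ> F" unfolding o_def by (rule ext) (rule hF)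
  moreover have "h 0 - F 0 \<in> dyadic" using int[of 0] by (auto elim: Ints_cases)
  ultimately show "h \<in> TL" using TL_comp[OF TL_translation F(1)] by metis
qed

section \<open>Circle maps induced by elements of the lift\<close>

lemma circle_proj_rep [simp]: "circle_proj (circle_rep c) = c"
  using Quotient3_circle by (simp add: Quotient3_def)

lemma circle_rep_proj: "\<exists>n::int. circle_rep (circle_proj x) = x + of_int n"
proof -
  have "circle_proj (circle_rep (circle_proj x)) = circle_proj x" by simp
  then obtain n where "circle_rep (circle_proj x) - x = of_int n"
    unfolding circle_proj_eq_iff by (auto elim: Ints_cases)
  then show ?thesis by (intro exI[of _ n]) simp
qed

definition circ :: "(real \<Rightarrow> real) \<Rightarrow> circle \<Rightarrow> circle" where
  "circ h c = circle_proj (h (circle_rep c))"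

lemma circle_proj_int [simp]: "circle_proj (x + of_int n) = circle_proj x"
  by (simp add: circle_proj_eq_iff)

lemma circ_proj: "h \<in> TL \<Longrightarrow> circ h (circle_proj x) = circle_proj (h x)"
  using circle_rep_proj[of x] by (auto simp: circ_def TL_int)

lemma circ_unique: "h \<in> TL \<Longrightarrow> (\<And>x. f (circle_proj x) = circle_proj (h x)) \<Longrightarrow> f = circ h"
  using circ_proj by (metis circle_proj_rep ext)

lemma circ_comp: "g \<in> TL \<Longrightarrow> h \<in> TL \<Longrightarrow> circ (g \<circ> h) = circ g \<circ> circ h"
  by (rule circ_unique[symmetric]) (simp_all add: TL_comp circ_proj)

lemma circ_id: "circ id = id"
  by (rule circ_unique[symmetric]) (simp_all add: TL_id)

lemma TL_inv_comp: "h \<in> TL \<Longrightarrow> Hilbert_Choice.inv h \<circ> h = id" "h \<in> TL \<Longrightarrow> h \<circ> Hilbert_Choice.inv h = id"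
  using TL_bij[of h] surj_iff[of h] by (simp_all add: bij_is_inj bij_is_surj)

lemma circ_inv: "h \<in> TL \<Longrightarrow> circ (Hilbert_Choice.inv h) \<circ> circ h = id" "h \<in> TL \<Longrightarrow> circ h \<circ> circ (Hilbert_Choice.inv h) = id"
  using circ_comp[OF TL_inv, of h h] circ_comp[OF _ TL_inv, of h h] TL_inv_comp[of h]
  by (simp_all add: circ_id)

lemma continuous_on_circ: "h \<in> TL \<Longrightarrow> continuous_on UNIV (circ h)"
  unfolding continuous_on_open_vimage[OF open_UNIV]
proof (intro allI impI)
  fix U :: "circle set" assume h: "h \<in> TL" and U: "open U"
  have "circle_proj -` (circ h -` U) = h -` (circle_proj -` U)" using circ_proj[OF h] by auto
  moreover have "open (h -` (circle_proj -` U))"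
    using lpl_continuous[OF TL_lpl[OF h], of UNIV] U by (auto simp: continuous_on_open_vimage open_circle_def)
  ultimately show "open (circ h -` U \<inter> UNIV)" by (simp add: open_circle_def)
qed

text \<open>Compactness gives a level on one period; commuting with integer translations carries it
  to all \<open>i\<close>.\<close>

lemma TL_level:
  assumes h: "h \<in> TL"
  shows "\<exists>n0. \<forall>n\<ge>n0. \<forall>i. stdaff h n i L"
proof -
  obtain n0 where n0: "\<forall>n\<ge>n0. \<forall>i::int. {of_int i / 2 ^ n..(of_int i + 1) / 2 ^ n} \<subseteq> {0..1::real} \<longrightarrow> stdaff h n i L"
    using lpl_std[OF TL_lpl[OF h], of 0 1] by auto
  have "stdaff h n i L" if n: "n \<ge> n0" for n i
  proof -
    define r q where "r = i mod 2 ^ n" and "q = i div (2 ^ n :: int)"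
    have i: "i = r + 2 ^ n * q" by (simp add: r_def q_def)
    have r: "0 \<le> r" "r < 2 ^ n" by (simp_all add: r_def)
    have "real_of_int (r + 1) \<le> real_of_int (2 ^ n)" using r(2) unfolding of_int_le_iff by simp
    then have "(of_int r + 1) / 2 ^ n \<le> (1::real)" by (simp add: divide_le_eq)
    moreover have "0 \<le> of_int r / (2 ^ n :: real)" using r(1) by simp
    ultimately have "{of_int r / 2 ^ n..(of_int r + 1) / 2 ^ n} \<subseteq> {0..1::real}"
      unfolding atLeastatMost_subset_iff by blast
    then have "stdaff h n r L" using n0 n by blast
    then obtain m j where mj: "m \<ge> L" "\<And>s. 0 \<le> s \<Longrightarrow> s \<le> 1 \<Longrightarrow> h ((of_int r + s) / 2 ^ n) = (of_int j + s) / 2 ^ m"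
      unfolding stdaff_def by blast
    have "h ((of_int i + s) / 2 ^ n) = (of_int (j + 2 ^ m * q) + s) / 2 ^ m" if s: "0 \<le> s" "s \<le> 1" for s
    proof -
      have "(of_int i + s) / 2 ^ n = (of_int r + s) / 2 ^ n + of_int q" by (simp add: i field_simps)
      then have "h ((of_int i + s) / 2 ^ n) = (of_int j + s) / 2 ^ m + of_int q" using TL_int[OF h] mj(2)[OF s] by simp
      then show ?thesis by (simp add: field_simps)
    qed
    then show ?thesis unfolding stdaff_def using mj(1) by (intro exI[of _ m] conjI exI[of _ "j + 2 ^ m * q"]) auto
  qed
  then show ?thesis by blast
qed

lemma stdaff_affine:
  assumes "stdaff h n i L"
  shows "\<exists>(m::real) b. \<forall>y. of_int i / 2 ^ n \<le> y \<and> y \<le> (of_int i + 1) / 2 ^ n \<longrightarrow> h y = m * y + b"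
proof -
  obtain m j where mj: "\<And>s. 0 \<le> s \<Longrightarrow> s \<le> 1 \<Longrightarrow> h ((of_int i + s) / 2 ^ n) = (of_int j + s) / 2 ^ m"
    using assms unfolding stdaff_def by blast
  have "h y = 2 ^ n / 2 ^ m * y + (of_int j - of_int i) / 2 ^ m" if y: "of_int i / 2 ^ n \<le> y" "y \<le> (of_int i + 1) / 2 ^ n" for y
  proof -
    define s where "s = y * 2 ^ n - of_int i"
    have "0 \<le> s" "s \<le> 1" using y by (simp_all add: s_def field_simps)
    moreover have "y = (of_int i + s) / 2 ^ n" by (simp add: s_def)
    ultimately have "h y = (of_int j + s) / 2 ^ m" using mj by metis
    also have "\<dots> = 2 ^ n / 2 ^ m * y + (of_int j - of_int i) / 2 ^ m"
      by (simp add: s_def add_divide_distrib diff_divide_distrib)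
    finally show ?thesis .
  qed
  then show ?thesis by blast
qed

text \<open>At a suitable level \<open>n\<close> the map is affine on every standard interval, so
  its breaks lie among the multiples of \<open>1 / 2 ^ n\<close>, which are finite in number on the
  circle.\<close>

lemma TL_subset_thompson_T:
  assumes h: "h \<in> TL"
  shows "circ h \<in> thompson_T_set"
proof -
  obtain n where n: "\<And>i. stdaff h n i 0" using TL_level[OF h, of 0] by blast
  define NB where "NB = range (\<lambda>i::int. of_int i / (2::real) ^ n)"
  have NBd: "NB \<subseteq> dyadic" by (auto simp: NB_def)
  have NBf: "finite (circle_proj ` NB)"
  proof (rule finite_subset)
    show "circle_proj ` NB \<subseteq> (\<lambda>i. circle_proj (of_int i / 2 ^ n)) ` {0..<2 ^ n}"
    proof clarify
      fix y assume "y \<in> NB"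
      then obtain i :: int where i: "y = of_int i / 2 ^ n" by (auto simp: NB_def)
      have "(of_int i :: real) = of_int (i mod 2 ^ n) + 2 ^ n * of_int (i div 2 ^ n)"
      proof -
        have "i = i mod 2 ^ n + 2 ^ n * (i div 2 ^ n)" by simp
        then have "real_of_int i = real_of_int (i mod 2 ^ n + 2 ^ n * (i div 2 ^ n))" by (rule arg_cong)
        then show ?thesis by (simp only: of_int_add of_int_mult of_int_power of_int_numeral)
      qed
      then have "y = of_int (i mod 2 ^ n) / 2 ^ n + of_int (i div 2 ^ n)" by (simp add: i add_divide_distrib)
      then have "circle_proj y = circle_proj (of_int (i mod 2 ^ n) / 2 ^ n)" by simp
      then show "circle_proj y \<in> (\<lambda>i. circle_proj (of_int i / 2 ^ n)) ` {0..<2 ^ n}" by auto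
    qed
  qed simp
  have loc: "\<exists>m b. \<forall>\<^sub>F y in nhds x. h y = m * y + b" if x: "x \<notin> NB" for x
  proof -
    define i where "i = \<lfloor>x * 2 ^ n\<rfloor>"
    have "of_int i / 2 ^ n \<noteq> x" using x by (auto simp: NB_def)
    moreover have "of_int i \<le> x * 2 ^ n" "x * 2 ^ n < of_int i + 1" unfolding i_def by linarith+
    then have "of_int i / 2 ^ n \<le> x" "x < (of_int i + 1) / 2 ^ n" by (simp_all add: divide_le_eq less_divide_eq)
    ultimately have x1: "of_int i / 2 ^ n < x" "x < (of_int i + 1) / 2 ^ n" by simp_all
    obtain m b where mb: "\<And>y. of_int i / 2 ^ n \<le> y \<Longrightarrow> y \<le> (of_int i + 1) / 2 ^ n \<Longrightarrow> h y = m * y + b"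
      using stdaff_affine[OF n[of i]] by blast
    have "\<forall>\<^sub>F y in nhds x. y \<in> {of_int i / 2 ^ n<..<(of_int i + 1) / 2 ^ n}"
      by (rule eventually_nhds_in_open) (use x1 in simp_all)
    then have "\<forall>\<^sub>F y in nhds x. h y = m * y + b"
    proof (rule eventually_mono)
      fix y :: real assume "y \<in> {of_int i / 2 ^ n<..<(of_int i + 1) / 2 ^ n}"
      then show "h y = m * y + b" by (intro mb) simp_all
    qed
    then show ?thesis by blast
  qed
  have nd: "{x. \<not> h differentiable (at x)} \<subseteq> NB"
  proof (rule subsetI, rule ccontr)
    fix x assume x: "x \<in> {x. \<not> h differentiable (at x)}" "x \<notin> NB"
    then obtain m b where "\<forall>\<^sub>F y in nhds x. h y = m * y + b" using loc by blast
    then have ev: "\<forall>\<^sub>F y in nhds x. m * y + b = h y" by (rule eventually_mono) simp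
    have "((\<lambda>y. m * y + b) has_real_derivative m) (at x)" by (auto intro!: derivative_eq_intros)
    then have "(h has_real_derivative m) (at x)" using DERIV_cong_ev[OF refl ev refl] by simp
    then have "h differentiable (at x)" unfolding real_differentiable_def by blast
    then show False using x(1) by simp
  qed
  have slope: "\<exists>k::int. s = 2 powi k" if s: "(h has_real_derivative s) (at x)" for x s
  proof -
    have lx: "lpl_at h x" using TL_lpl[OF h] by (simp add: lpl_def)
    obtain e L k l where e: "e > 0" "L = 2 powi k" "\<And>y. x \<le> y \<Longrightarrow> y \<le> x + e \<Longrightarrow> h y - h x = L * (y - x)"
      "\<And>y. x - e \<le> y \<Longrightarrow> y \<le> x \<Longrightarrow> h x - h y = 2 powi l * (x - y)" using germ_bounds[OF lx] by metis
    \<comment> \<open>Where the derivative exists, the right-hand germ already determines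
      it.\<close>
    have "(h has_real_derivative s) (at_right x)" using s by (rule has_field_derivative_at_within)
    then have 1: "((\<lambda>y. (h y - h x) / (y - x)) \<longlongrightarrow> s) (at_right x)" by (simp add: has_field_derivative_iff)
    have "\<forall>\<^sub>F y in at_right x. y \<in> {x<..<x + e}" by (rule eventually_at_right_real) (use e(1) in simp)
    then have "\<forall>\<^sub>F y in at_right x. (h y - h x) / (y - x) = L"
    proof (rule eventually_mono)
      fix y assume "y \<in> {x<..<x + e}"
      then show "(h y - h x) / (y - x) = L" using e(3)[of y] by simp
    qed
    then have 2: "((\<lambda>y. (h y - h x) / (y - x)) \<longlongrightarrow> L) (at_right x)" by (rule tendsto_eventually)
    have "s = L" using tendsto_unique[OF _ 1 2] by simp
    then show ?thesis using e(2) by blast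
  qed
  have "homeomorphism UNIV UNIV (circ h) (circ (Hilbert_Choice.inv h))"
  proof (rule homeomorphismI)
    show "circ (Hilbert_Choice.inv h) (circ h x) = x" "circ h (circ (Hilbert_Choice.inv h) x) = x" for x
      using circ_inv[OF h] by (simp_all add: fun_eq_iff)
  qed (auto simp: continuous_on_circ h TL_inv)
  moreover have "circ h ` dyadic_circle \<subseteq> dyadic_circle"
    using circ_proj[OF h] TL_dyadic_iff[OF h] by (auto simp: dyadic_circle_def)
  moreover have "circle_lift (circ h) h"
    using lpl_continuous TL_lpl[OF h] circ_proj[OF h] by (simp add: circle_lift_def)
  moreover have "piecewise_linear_mod1 h"
    unfolding piecewise_linear_mod1_def using NBf loc by (intro exI[of _ "circle_proj ` NB"]) blast
  moreover have "finite (circle_proj ` {x. \<not> h differentiable (at x)})"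
    using nd NBf by (meson finite_subset image_mono)
  moreover have "circle_proj ` {x. \<not> h differentiable (at x)} \<subseteq> dyadic_circle"
    using nd NBd by (auto simp: proj_dyadic_iff)
  ultimately show ?thesis unfolding thompson_T_set_def using TL_strict_mono[OF h] slope by blast
qed

lemma thompson_T_set_eq: "thompson_T_set = circ ` TL"
proof
  show "thompson_T_set \<subseteq> circ ` TL"
  proof
    fix f assume "f \<in> thompson_T_set"
    then obtain F where F: "F \<in> TL" "\<And>x. f (circle_proj x) = circle_proj (F x)" using thompson_T_lift_in_TL by blast
    then have "f = circ F" by (rule circ_unique)
    then show "f \<in> circ ` TL" using F by blast
  qed
qed (use TL_subset_thompson_T in blast)

lemma thompson_T_lift_set_eq: "thompson_T_lift_set = TL"
proof
  show "TL \<subseteq> thompson_T_lift_set"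
  proof
    fix h assume h: "h \<in> TL"
    have "homeomorphism UNIV UNIV h (Hilbert_Choice.inv h)"
      using TL_bij[OF h] lpl_continuous TL_lpl h TL_inv
      by (intro homeomorphismI) (auto simp: bij_is_inj bij_is_surj surj_f_inv_f)
    then show "h \<in> thompson_T_lift_set"
      unfolding thompson_T_lift_set_def using TL_int[OF h] TL_subset_thompson_T[OF h] circ_proj[OF h] by blast
  qed
qed (rule thompson_T_lift_set_subset)

section \<open>Group structure of the lift and of \<open>T\<close>\<close>

lemma carrier_lift [simp]: "carrier thompson_T_lift = TL"
  by (simp add: thompson_T_lift_def thompson_T_lift_set_eq)

lemma mult_lift [simp]: "g \<otimes>\<^bsub>thompson_T_lift\<^esub> h = g \<circ> h"
  by (simp add: thompson_T_lift_def)

lemma one_lift [simp]: "\<one>\<^bsub>thompson_T_lift\<^esub> = id"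
  by (simp add: thompson_T_lift_def)

lemma group_lift: "group thompson_T_lift"
proof (rule groupI)
  fix x assume "x \<in> carrier thompson_T_lift"
  then show "\<exists>y\<in>carrier thompson_T_lift. y \<otimes>\<^bsub>thompson_T_lift\<^esub> x = \<one>\<^bsub>thompson_T_lift\<^esub>"
    using TL_inv_comp TL_inv by (intro bexI[of _ "Hilbert_Choice.inv x"]) auto
qed (auto simp: TL_comp TL_id)

lemma inv_lift: "h \<in> TL \<Longrightarrow> inv\<^bsub>thompson_T_lift\<^esub> h = Hilbert_Choice.inv h"
  by (rule group.inv_equality[OF group_lift]) (auto simp: TL_inv TL_inv_comp)

lemma carrier_T [simp]: "carrier thompson_T = circ ` TL"
  by (simp add: thompson_T_def thompson_T_set_eq)

lemma mult_T [simp]: "g \<otimes>\<^bsub>thompson_T\<^esub> h = g \<circ> h"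
  by (simp add: thompson_T_def)

lemma one_T [simp]: "\<one>\<^bsub>thompson_T\<^esub> = id"
  by (simp add: thompson_T_def)

lemma group_T: "group thompson_T"
proof (rule groupI)
  fix x assume "x \<in> carrier thompson_T"
  then obtain h where h: "h \<in> TL" "x = circ h" by auto
  then show "\<exists>y\<in>carrier thompson_T. y \<otimes>\<^bsub>thompson_T\<^esub> x = \<one>\<^bsub>thompson_T\<^esub>"
    using circ_inv(1)[OF h(1)] TL_inv[OF h(1)] by (intro bexI[of _ "circ (Hilbert_Choice.inv h)"]) auto
next
  fix x y assume "x \<in> carrier thompson_T" "y \<in> carrier thompson_T"
  then show "x \<otimes>\<^bsub>thompson_T\<^esub> y \<in> carrier thompson_T"
    using TL_comp by (auto simp: circ_comp[symmetric])
next
  show "\<one>\<^bsub>thompson_T\<^esub> \<in> carrier thompson_T" using circ_id TL_id by (auto intro: image_eqI[of _ _ id])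
qed (auto simp: comp_assoc)

lemma circ_hom: "circ \<in> hom thompson_T_lift thompson_T"
  by (auto simp: hom_def circ_comp)

section \<open>Periodic extension and maps that move dyadic points\<close>

definition per :: "real \<Rightarrow> (real \<Rightarrow> real) \<Rightarrow> real \<Rightarrow> real" where
  "per p k x = k (x - of_int \<lfloor>x - p\<rfloor>) + of_int \<lfloor>x - p\<rfloor>"

lemma per_eq:
  assumes "k (p + 1) = k p + 1" "p \<le> x" "x \<le> p + 1"
  shows "per p k x = k x"
proof (cases "x = p + 1")
  case False
  then have "\<lfloor>x - p\<rfloor> = 0" using assms by (simp add: floor_eq_iff)
  then show ?thesis by (simp add: per_def)
qed (use assms in \<open>simp add: per_def\<close>)

text \<open>The translates of one period of \<open>k\<close> are glued at the points
  \<open>p + of_int n\<close>, where breaks are allowed since \<open>p\<close> is dyadic.\<close>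

lemma per_TL:
  assumes k: "lpl k" and kp: "k (p + 1) = k p + 1" and p: "p \<in> dyadic"
  shows "per p k \<in> TL"
proof -
  have conj: "lpl ((\<lambda>y. y + of_int n) \<circ> (k \<circ> (\<lambda>y. y + - of_int n)))" for n
    using k by (intro lpl_comp lpl_translation) auto
  have loc: "per p k y = ((\<lambda>y. y + of_int n) \<circ> (k \<circ> (\<lambda>y. y + - of_int n))) y"
    if "p + of_int n \<le> y" "y \<le> p + of_int n + 1" for n y
  proof (cases "y = p + of_int n + 1")
    case True
    then have y: "y - p = of_int (n + 1)" by simp
    have fl: "\<lfloor>y - p\<rfloor> = n + 1" unfolding y by (rule floor_of_int)
    have e: "y - of_int (n + 1) = p" "y + - of_int n = p + 1" using y by simp_all
    show ?thesis unfolding per_def fl o_apply e kp by simp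
  next
    case False
    then have "\<lfloor>y - p\<rfloor> = n" using that by (simp add: floor_eq_iff)
    then show ?thesis by (simp add: per_def)
  qed
  have "lpl_at (per p k) x" for x
  proof -
    define n where "n = \<lfloor>x - p\<rfloor>"
    have n: "p + of_int n \<le> x" "x < p + of_int n + 1" unfolding n_def by linarith+
    show ?thesis
    proof (cases "x = p + of_int n")
      case True
      show ?thesis
      proof (rule lpl_at_glue)
        show "lpl_at ((\<lambda>y. y + of_int (n - 1)) \<circ> (k \<circ> (\<lambda>y. y + - of_int (n - 1)))) x"
          using conj[of "n - 1"] unfolding lpl_def by blast
        show "lpl_at ((\<lambda>y. y + of_int n) \<circ> (k \<circ> (\<lambda>y. y + - of_int n))) x"
          using conj[of n] unfolding lpl_def by blast
        show "x \<in> dyadic" using True p by simp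
        show "x - 1 < x" "x < x + 1" by simp_all
        show "per p k y = ((\<lambda>y. y + of_int (n - 1)) \<circ> (k \<circ> (\<lambda>y. y + - of_int (n - 1)))) y"
          if "x - 1 < y" "y \<le> x" for y by (rule loc) (use that True in auto)
        show "per p k y = ((\<lambda>y. y + of_int n) \<circ> (k \<circ> (\<lambda>y. y + - of_int n))) y"
          if "x \<le> y" "y < x + 1" for y by (rule loc) (use that True in auto)
      qed
    next
      case False
      show ?thesis
      proof (rule lpl_at_cong_open)
        show "lpl_at ((\<lambda>y. y + of_int n) \<circ> (k \<circ> (\<lambda>y. y + - of_int n))) x"
          using conj[of n] unfolding lpl_def by blast
        show "p + of_int n < x" "x < p + of_int n + 1" using n False by auto
        show "per p k y = ((\<lambda>y. y + of_int n) \<circ> (k \<circ> (\<lambda>y. y + - of_int n))) y"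
          if "p + of_int n < y" "y < p + of_int n + 1" for y by (rule loc) (use that in auto)
      qed
    qed
  qed
  moreover have "per p k (x + 1) = per p k x + 1" for x
  proof -
    have "x + 1 - p = (x - p) + 1" by simp
    then have "\<lfloor>x + 1 - p\<rfloor> = \<lfloor>x - p\<rfloor> + 1" by linarith
    then show ?thesis by (simp add: per_def)
  qed
  ultimately show ?thesis unfolding TL_def lpl_def by blast
qed

text \<open>It stretches the interval from 0 to \<open>c\<close> by 1 for every
  \<open>c \<ge> 1\<close>, so its iterates reach every larger integer length with slopes that are
  powers of 2.\<close>

definition dbl :: "real \<Rightarrow> real" where
  "dbl x = (if x \<le> 0 then x else if x \<le> 1 then 2 * x else x + 1)"

lemma lpl_double: "lpl (\<lambda>x. 2 * x)"
  using lpl_affine[of 0 1] by simp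

lemma lpl_dbl: "lpl dbl"
proof -
  have 1: "lpl (\<lambda>x. if x \<le> 1 then 2 * x else x + 1)"
    by (rule lpl_glue[OF lpl_double lpl_translation]) auto
  have "lpl (\<lambda>x. if x \<le> 0 then x else if x \<le> 1 then 2 * x else x + 1)"
    by (rule lpl_glue[OF lpl_id(2) 1]) auto
  then show ?thesis unfolding dbl_def[abs_def] .
qed

lemma lpl_funpow: "lpl h \<Longrightarrow> lpl (h ^^ n)"
  by (induction n) (auto simp: lpl_id lpl_comp)

lemma dbl_funpow: "(dbl ^^ j) 0 = 0" "c \<ge> 1 \<Longrightarrow> (dbl ^^ j) c = c + real j"
  by (induction j) (auto simp: dbl_def)

lemma dyadic_pos:
  assumes "x \<in> dyadic" "x > 0"
  shows "\<exists>c n. c \<ge> (1::nat) \<and> x * 2 ^ n = real c"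
proof -
  obtain a n where a: "x * 2 ^ n = of_int a" using assms by (auto simp: dyadic_iff)
  have "x * 2 ^ n > 0" using assms by simp
  then have "a \<ge> 1" unfolding a by simp
  then have "nat a \<ge> 1" "real (nat a) = of_int a" by auto
  then show ?thesis using a by metis
qed

text \<open>Scaling makes both lengths integers. The target \<open>c'\<close> is refined to
  \<open>c' * 2 ^ c\<close>, which is at least \<open>c\<close>; iterating \<open>dbl\<close> makes
  up the difference, and scaling back undoes the refinement.\<close>

lemma lpl_move:
  assumes d: "p \<in> dyadic" "q \<in> dyadic" "p' \<in> dyadic" "q' \<in> dyadic" and lt: "p < q" "p' < q'"
  shows "\<exists>\<tau>. lpl \<tau> \<and> \<tau> p = p' \<and> \<tau> q = q'"
proof -
  obtain c n where c: "c \<ge> (1::nat)" "(q - p) * 2 ^ n = real c" using dyadic_pos[of "q - p"] d lt by auto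
  obtain c' n' where c': "c' \<ge> (1::nat)" "(q' - p') * 2 ^ n' = real c'" using dyadic_pos[of "q' - p'"] d lt by auto
  define j where "j = c' * 2 ^ c - c"
  have "c \<le> 2 ^ c" using less_exp[of c] by linarith
  also have "2 ^ c \<le> c' * 2 ^ c" using c'(1) by simp
  finally have le: "c \<le> c' * 2 ^ c" .
  have j: "real c + real j = real c' * 2 ^ c" unfolding j_def using le by (simp add: of_nat_diff)
  define A where "A x = 2 powi (int n) * x + - (2 ^ n * p)" for x
  define B where "B x = 2 powi (- int (c + n')) * x + p'" for x
  have lA: "lpl A" unfolding A_def[abs_def] using d by (intro lpl_affine) auto
  have lB: "lpl B" unfolding B_def[abs_def] using d by (intro lpl_affine) auto
  have lpl: "lpl (B \<circ> ((dbl ^^ j) \<circ> A))" by (intro lpl_comp lpl_funpow lpl_dbl lA lB)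
  have Ap: "A p = 0" by (simp add: A_def)
  have "A q = (q - p) * 2 ^ n" by (simp add: A_def algebra_simps)
  then have Aq: "A q = real c" unfolding c(2) .
  have "B ((dbl ^^ j) (A p)) = p'" unfolding Ap dbl_funpow(1) by (simp add: B_def)
  moreover have "B ((dbl ^^ j) (A q)) = q'"
  proof -
    have 1: "(dbl ^^ j) (A q) = real c' * 2 ^ c" unfolding Aq using dbl_funpow(2)[of "real c" j] c(1) j by simp
    have "2 powi (- int (c + n')) = 1 / ((2::real) ^ c * 2 ^ n')"
      by (simp only: power_int_minus power_int_of_nat power_add inverse_eq_divide)
    then have "2 powi (- int (c + n')) * (real c' * 2 ^ c) = real c' / 2 ^ n'" by simp
    also have "\<dots> = q' - p'" unfolding c'(2)[symmetric] by simp
    finally show ?thesis unfolding 1 B_def by simp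
  qed
  ultimately show ?thesis using lpl by (intro exI[of _ "B \<circ> ((dbl ^^ j) \<circ> A)"]) simp
qed

section \<open>Arc groups: elements of the lift supported in an arc and its integer
  translates\<close>

definition Fix :: "real \<Rightarrow> real \<Rightarrow> (real \<Rightarrow> real) set" where
  "Fix u v = {h \<in> TL. \<forall>x. v \<le> x \<longrightarrow> x \<le> u + 1 \<longrightarrow> h x = x}"

lemma Fix_TL: "h \<in> Fix u v \<Longrightarrow> h \<in> TL"
  by (simp add: Fix_def)

lemma Fix_id: "h \<in> Fix u v \<Longrightarrow> v \<le> x \<Longrightarrow> x \<le> u + 1 \<Longrightarrow> h x = x"
  by (simp add: Fix_def)

lemma Fix_ends: "h \<in> Fix u v \<Longrightarrow> v \<le> u + 1 \<Longrightarrow> h u = u" "h \<in> Fix u v \<Longrightarrow> v \<le> u + 1 \<Longrightarrow> h v = v"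
  using Fix_id[of h u v "u + 1"] TL_step[OF Fix_TL[of h u v], of u] Fix_id[of h u v v] by simp_all

lemma Fix_mono: "u' \<le> u \<Longrightarrow> v \<le> v' \<Longrightarrow> Fix u v \<subseteq> Fix u' v'"
  by (auto simp: Fix_def)

lemma id_Fix: "id \<in> Fix u v"
  by (simp add: Fix_def TL_id)

lemma Fix_comp: "g \<in> Fix u v \<Longrightarrow> h \<in> Fix u v \<Longrightarrow> g \<circ> h \<in> Fix u v"
  by (simp add: Fix_def TL_comp)

lemma TL_inv_apply: "h \<in> TL \<Longrightarrow> Hilbert_Choice.inv h (h x) = x" "h \<in> TL \<Longrightarrow> h (Hilbert_Choice.inv h x) = x"
  using TL_inv_comp[of h] by (metis comp_apply id_apply)+

lemma Fix_inv: "h \<in> Fix u v \<Longrightarrow> Hilbert_Choice.inv h \<in> Fix u v"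
  unfolding Fix_def mem_Collect_eq using TL_inv TL_inv_apply(1) by metis

lemma Fix_conj:
  assumes "\<tau> \<in> TL" "h \<in> Fix u v"
  shows "\<tau> \<circ> h \<circ> Hilbert_Choice.inv \<tau> \<in> Fix (\<tau> u) (\<tau> v)"
proof -
  have "(\<tau> \<circ> h \<circ> Hilbert_Choice.inv \<tau>) x = x" if x: "\<tau> v \<le> x" "x \<le> \<tau> u + 1" for x
  proof -
    define y where "y = Hilbert_Choice.inv \<tau> x"
    have xy: "x = \<tau> y" using TL_inv_apply(2)[OF assms(1)] by (simp add: y_def)
    have "\<tau> v \<le> \<tau> y" "\<tau> y \<le> \<tau> (u + 1)" using x TL_step[OF assms(1), of u] unfolding xy by simp_all
    then have "v \<le> y" "y \<le> u + 1" unfolding TL_le_iff[OF assms(1)] .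
    then have "h y = y" by (rule Fix_id[OF assms(2)])
    then show ?thesis by (simp add: xy TL_inv_apply(1)[OF assms(1)])
  qed
  then show ?thesis
    using TL_comp[OF TL_comp[OF assms(1) Fix_TL[OF assms(2)]] TL_inv[OF assms(1)]] unfolding Fix_def by blast
qed

lemma TL_eqI:
  assumes "g \<in> TL" "h \<in> TL" "\<And>x. p \<le> x \<Longrightarrow> x \<le> p + 1 \<Longrightarrow> g x = h x"
  shows "g = h"
proof
  fix x
  define n where "n = \<lfloor>x - p\<rfloor>"
  have "p \<le> x - of_int n" "x - of_int n \<le> p + 1" unfolding n_def by linarith+
  then have "g (x - of_int n) = h (x - of_int n)" by (rule assms(3))
  then show "g x = h x"
    using TL_int[OF assms(1), of "x - of_int n" n] TL_int[OF assms(2), of "x - of_int n" n] by simp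
qed

lemma Fix_range:
  assumes "h \<in> Fix u v" "v \<le> u + 1" "u \<le> x" "x \<le> v"
  shows "u \<le> h x" "h x \<le> v"
  using TL_le_iff[OF Fix_TL[OF assms(1)], of u x] TL_le_iff[OF Fix_TL[OF assms(1)], of x v]
    Fix_ends[OF assms(1,2)] assms(3,4) by simp_all

text \<open>The supports are the complementary arcs from \<open>a\<close> to \<open>b\<close> and
  from \<open>b\<close> to \<open>a + 1\<close>: on each of them one map is the identity and the
  other preserves the arc.\<close>

lemma Fix_commute:
  assumes h: "h \<in> Fix a b" and k: "k \<in> Fix b (a + 1)" and ab: "a \<le> b" "b \<le> a + 1"
  shows "h \<circ> k = k \<circ> h"
proof (rule TL_eqI)
  fix x assume x: "a \<le> x" "x \<le> a + 1"
  show "(h \<circ> k) x = (k \<circ> h) x"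
  proof (cases "x \<le> b")
    case True
    have kid: "k y = y" if "a \<le> y" "y \<le> b" for y
      using Fix_id[OF k, of "y + 1"] TL_step[OF Fix_TL[OF k], of y] that by simp
    have "a \<le> h x" "h x \<le> b" using Fix_range[OF h ab(2) x(1) True] by auto
    then show ?thesis using kid x True by simp
  next
    case False
    have "b \<le> k x" "k x \<le> a + 1" using Fix_range[OF k, of x] ab x False by auto
    then show ?thesis using Fix_id[OF h] x False by simp
  qed
qed (use Fix_TL[OF h] Fix_TL[OF k] TL_comp in auto)

lemma Fix_move:
  assumes d: "u \<in> dyadic" "v \<in> dyadic" "a \<in> dyadic" "a' \<in> dyadic"
    and le: "v \<le> u + 1" "u < a" "a < v" "u < a'" "a' < v"
  shows "\<exists>s\<in>Fix u v. s a = a'"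
proof -
  obtain l1 where l1: "lpl l1" "l1 u = u" "l1 a = a'" using lpl_move[of u a u a'] d le by auto
  obtain l2 where l2: "lpl l2" "l2 a = a'" "l2 v = v" using lpl_move[of a v a' v] d le by auto
  define k where "k = (\<lambda>x. if x \<le> v then (if x \<le> a then l1 x else l2 x) else x)"
  have 1: "lpl (\<lambda>x. if x \<le> a then l1 x else l2 x)" by (rule lpl_glue[OF l1(1) l2(1) d(3)]) (simp add: l1 l2)
  have k: "lpl k" unfolding k_def by (rule lpl_glue[OF 1 lpl_id(2) d(2)]) (use le l2 in simp)
  have ku: "k u = u" using le l1 by (simp add: k_def)
  have kv: "k x = x" if "v \<le> x" for x using that le l2 by (cases "x = v") (simp_all add: k_def)
  have ku1: "k (u + 1) = k u + 1" using kv[of "u + 1"] le ku by simp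
  have "per u k \<in> Fix u v"
    unfolding Fix_def mem_Collect_eq
  proof (intro conjI allI impI per_TL[OF k ku1 d(1)])
    fix x assume "v \<le> x" "x \<le> u + 1"
    then show "per u k x = x" using per_eq[OF ku1, of x] kv le by simp
  qed
  moreover have "per u k a = a'" using per_eq[OF ku1, of a] le l1 by (simp add: k_def)
  ultimately show ?thesis by blast
qed

text \<open>A translation takes \<open>a\<close> to \<open>a'\<close>; the arc from
  \<open>a'\<close> to \<open>a' + 1\<close> is the circle cut at \<open>a'\<close>, and an element
  of its group then moves the second point.\<close>

lemma TL_move:
  assumes d: "a \<in> dyadic" "b \<in> dyadic" "a' \<in> dyadic" "b' \<in> dyadic"
    and le: "a < b" "b < a + 1" "a' < b'" "b' < a' + 1"
  shows "\<exists>\<tau>\<in>TL. \<tau> a = a' \<and> \<tau> b = b'"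
proof -
  obtain s where s: "s \<in> Fix a' (a' + 1)" "s (b + (a' - a)) = b'"
    using Fix_move[of a' "a' + 1" "b + (a' - a)" b'] d le by auto
  have "s \<circ> (\<lambda>x. x + (a' - a)) \<in> TL" using TL_comp[OF Fix_TL[OF s(1)] TL_translation] d by simp
  moreover have "s a' = a'" using Fix_ends(1)[OF s(1)] by simp
  ultimately show ?thesis using s(2) by (intro bexI[of _ "s \<circ> (\<lambda>x. x + (a' - a))"]) auto
qed

text \<open>\<open>g\<close> copies \<open>f\<close> on the arc from \<open>u\<close> to
  \<open>v\<close> and is the identity on the rest of the period; the quotient is supported in the
  complementary arc.\<close>

lemma Fix_split:
  assumes f: "f \<in> TL" "f u = u" "f v = v" and uv: "u < v" "v < u + 1" and d: "u \<in> dyadic" "v \<in> dyadic"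
  shows "\<exists>g\<in>Fix u v. \<exists>h\<in>Fix v (u + 1). f = g \<circ> h"
proof -
  define k where "k = (\<lambda>x. if x \<le> v then f x else x)"
  have k: "lpl k" unfolding k_def by (rule lpl_glue[OF TL_lpl[OF f(1)] lpl_id(2) d(2)]) (use f in simp)
  have ku1: "k (u + 1) = k u + 1" using uv f by (simp add: k_def)
  define g where "g = per u k"
  have gT: "g \<in> TL" unfolding g_def by (rule per_TL[OF k ku1 d(1)])
  have gk: "g x = k x" if "u \<le> x" "x \<le> u + 1" for x unfolding g_def by (rule per_eq[OF ku1 that])
  have gF: "g \<in> Fix u v" unfolding Fix_def mem_Collect_eq
  proof (intro conjI allI impI gT)
    fix x assume x: "v \<le> x" "x \<le> u + 1"
    then show "g x = x" using gk[of x] f uv by (cases "x = v") (simp_all add: k_def)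
  qed
  define h where "h = Hilbert_Choice.inv g \<circ> f"
  have hT: "h \<in> TL" unfolding h_def using TL_comp TL_inv gT f by blast
  have "h x = x" if x: "u + 1 \<le> x" "x \<le> v + 1" for x
  proof -
    have "g (x - 1) = f (x - 1)" using gk[of "x - 1"] x uv by (simp add: k_def)
    then have "g x = f x" using TL_step[OF gT, of "x - 1"] TL_step[OF f(1), of "x - 1"] by simp
    then show ?thesis using TL_inv_apply(1)[OF gT, of x] by (simp add: h_def)
  qed
  then have "h \<in> Fix v (u + 1)" using hT unfolding Fix_def by auto
  moreover have "f = g \<circ> h" using TL_inv_apply(2)[OF gT] by (auto simp: h_def)
  ultimately show ?thesis using gF by blast
qed

text \<open>The first point is moved, then the second inside the remaining arc from
  \<open>a'\<close> to \<open>v\<close>, whose group fixes \<open>a'\<close>.\<close>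

lemma Fix_move2:
  assumes d: "u \<in> dyadic" "v \<in> dyadic" "a \<in> dyadic" "b \<in> dyadic" "a' \<in> dyadic" "b' \<in> dyadic"
    and le: "v \<le> u + 1" "u < a" "a < b" "b < v" "u < a'" "a' < b'" "b' < v"
  shows "\<exists>s\<in>Fix u v. s a = a' \<and> s b = b'"
proof -
  obtain s where s: "s \<in> Fix u v" "s a = a'" using Fix_move[of u v a a'] d le by auto
  have sb: "s b \<in> dyadic" "a' < s b" "s b < v"
    using TL_dyadic_iff[OF Fix_TL[OF s(1)], of b] TL_less_iff[OF Fix_TL[OF s(1)], of a b]
      TL_less_iff[OF Fix_TL[OF s(1)], of b v] Fix_ends(2)[OF s(1)] s(2) d le by simp_all
  obtain t where t: "t \<in> Fix a' v" "t (s b) = b'" using Fix_move[of a' v "s b" b'] d le sb by auto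
  have "t a' = a'" using Fix_ends(1)[OF t(1)] le by simp
  moreover have "t \<in> Fix u v" using t(1) Fix_mono[of u a' v v] le by auto
  ultimately show ?thesis using s t Fix_comp by (intro bexI[of _ "t \<circ> s"]) auto
qed

text \<open>The images of \<open>0\<close> and \<open>1/2\<close> leave enough room on the circle to be moved back, up to a rotation,
  by an element supported in one of two fixed proper arcs.\<close>

lemma TL_decomposition:
  assumes f: "f \<in> TL"
  shows "\<exists>i::int. \<exists>s\<in>Fix (-1/8) (13/16) \<union> Fix (-3/8) (9/16). \<exists>e::int. \<exists>g\<in>Fix 0 (1/2). \<exists>h\<in>Fix (1/2) 1.
    f = (\<lambda>x. x + of_int i / 4) \<circ> s \<circ> (\<lambda>x. x + of_int e / 4) \<circ> g \<circ> h"
proof -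
  define i where "i = \<lfloor>4 * f 0\<rfloor>"
  define a where "a = f 0 - of_int i / 4"
  define b where "b = f (1/2) - of_int i / 4"
  have fd: "f 0 \<in> dyadic" "f (1/2) \<in> dyadic" using TL_dyadic_iff[OF f] dyadic_half_power[of 1] by auto
  then have d: "a \<in> dyadic" "b \<in> dyadic" by (simp_all add: a_def b_def)
  have a: "0 \<le> a" "a < 1/4" unfolding a_def i_def by linarith+
  have "f 0 < f (1/2)" "f (1/2) < f (0 + 1)" using TL_less_iff[OF f] by simp_all
  then have b: "a < b" "b < a + 1" using TL_step[OF f, of 0] by (simp_all add: a_def b_def)
  have "\<exists>s\<in>Fix (-1/8) (13/16) \<union> Fix (-3/8) (9/16). \<exists>e::int. s a = of_int e / 4 \<and> s b = 1 / 2 + of_int e / 4"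
  \<comment> \<open>If \<open>b \<le> 3/4\<close>, both points lie in the arc from
    \<open>-1/8\<close> to \<open>13/16\<close> and go to 0 and \<open>1/2\<close>. Otherwise
    \<open>b - 1\<close> and \<open>a\<close> lie in the arc from \<open>-3/8\<close> to
    \<open>9/16\<close> and go to 0 and \<open>1/2\<close>, the same configuration up to a half
    turn. Both arcs have length \<open>15/16\<close>.\<close>
  proof (cases "b \<le> 3/4")
    case True
    have "\<exists>s\<in>Fix (-1/8) (13/16). s a = 0 \<and> s b = 1/2"
    proof (rule Fix_move2)
      show "(- 1/8::real) \<in> dyadic" using dyadic_div_power[of "-1" 3] by simp
      show "(13/16::real) \<in> dyadic" using dyadic_div_power[of 13 4] by simp
    qed (use True a b d in simp_all)
    then obtain s where s: "s \<in> Fix (-1/8) (13/16)" "s a = 0" "s b = 1/2" by blast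
    have "s a = of_int 0 / 4 \<and> s b = 1 / 2 + of_int 0 / 4" using s(2,3) by simp
    then show ?thesis using s(1) by blast
  next
    case False
    have "\<exists>s\<in>Fix (-3/8) (9/16). s (b - 1) = 0 \<and> s a = 1/2"
    proof (rule Fix_move2)
      show "(- 3/8::real) \<in> dyadic" using dyadic_div_power[of "-3" 3] by simp
      show "(9/16::real) \<in> dyadic" using dyadic_div_power[of 9 4] by simp
    qed (use False a b d in simp_all)
    then obtain s where s: "s \<in> Fix (-3/8) (9/16)" "s (b - 1) = 0" "s a = 1/2" by blast
    have "s b = 1" using TL_step[OF Fix_TL[OF s(1)], of "b - 1"] s(2) by simp
    then have "s a = of_int 2 / 4 \<and> s b = 1 / 2 + of_int 2 / 4" using s(3) by simp
    then show ?thesis using s(1) by blast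
  qed
  then obtain s and e :: int where s: "s \<in> Fix (-1/8) (13/16) \<union> Fix (-3/8) (9/16)"
    "s a = of_int e / 4" "s b = 1 / 2 + of_int e / 4" by blast
  have sT: "s \<in> TL" using s(1) Fix_TL by blast
  define w where "w = (\<lambda>x. x + - (of_int e / 4)) \<circ> (s \<circ> ((\<lambda>x. x + - (of_int i / 4)) \<circ> f))"
  have wT: "w \<in> TL" unfolding w_def by (intro TL_comp TL_translation sT f) auto
  have w: "w 0 = 0" "w (1/2) = 1/2" using s by (simp_all add: w_def a_def b_def)
  obtain g h where gh: "g \<in> Fix 0 (1/2)" "h \<in> Fix (1/2) (0 + 1)" "w = g \<circ> h"
    using Fix_split[OF wT w] by auto
  have "f = (\<lambda>x. x + of_int i / 4) \<circ> Hilbert_Choice.inv s \<circ> (\<lambda>x. x + of_int e / 4) \<circ> w"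
    using TL_inv_apply(1)[OF sT] by (auto simp: w_def fun_eq_iff)
  then have "f = (\<lambda>x. x + of_int i / 4) \<circ> Hilbert_Choice.inv s \<circ> (\<lambda>x. x + of_int e / 4) \<circ> g \<circ> h"
    unfolding gh(3) by (simp add: comp_assoc)
  moreover have "Hilbert_Choice.inv s \<in> Fix (-1/8) (13/16) \<union> Fix (-3/8) (9/16)" using s(1) Fix_inv by blast
  moreover have "h \<in> Fix (1/2) 1" using gh(2) by simp
  ultimately show ?thesis using gh(1) by blast
qed

section \<open>Generators and perfectness of arc groups\<close>

lemma lpl_from_aff:
  assumes "\<And>i::int. aff h {of_int i..of_int i + 1}"
  shows "lpl h"
  unfolding lpl_def
proof
  fix x :: real
  define n where "n = \<lfloor>x\<rfloor>"
  have n: "of_int n \<le> x" "x < of_int n + 1" unfolding n_def by linarith+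
  show "lpl_at h x"
  proof (cases "x = of_int n")
    case True
    have "aff h {x - 1..x}" using assms[of "n - 1"] True by simp
    moreover have "aff h {x..x + 1}" using assms[of n] True by simp
    ultimately have "germ 1 0 h x" "germ 0 1 h x" unfolding germ_def by (auto intro: exI[of _ 1])
    moreover have "x \<in> dyadic" using True by simp
    ultimately show ?thesis by (simp add: lpl_at_def)
  next
    case False
    then show ?thesis using aff_lpl_at[OF assms[of n], of x] n by simp
  qed
qed

text \<open>\<open>chi\<close> straightens the arc \<open>[0, 1/2)\<close> to the half-line \<open>[0, \<infinity>)\<close> so that multiplication by \<open>1/2\<close>
  towards the endpoint \<open>1/2\<close> becomes translation by 1.\<close>

definition chi :: "real \<Rightarrow> real" where
  "chi x = (if x < 0 then x / 4 else 1 / 2 - (1 - frac x / 2) / 2 ^ (nat \<lfloor>x\<rfloor> + 1))"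

lemma chi_nat: "0 \<le> s \<Longrightarrow> s \<le> 1 \<Longrightarrow> chi (real n + s) = 1 / 2 - (1 - s / 2) / 2 ^ (n + 1)"
proof (cases "s = 1")
  case True
  then have "chi (real n + s) = chi (real (n + 1))" by (simp add: add.commute)
  also have "\<dots> = 1 / 2 - 1 / 2 ^ (n + 2)"
  proof -
    have fl: "\<lfloor>real (n + 1)\<rfloor> = int (n + 1)" by (rule floor_of_nat)
    have fr: "frac (real (n + 1)) = 0" unfolding frac_def fl by simp
    have "\<not> real (n + 1) < 0" by simp
    then show ?thesis unfolding chi_def fl fr nat_int by simp
  qed
  finally show ?thesis using True by simp
next
  case False
  assume s: "0 \<le> s" "s \<le> 1"
  then have fl: "\<lfloor>real n + s\<rfloor> = int n" using False by (simp add: floor_eq_iff)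
  then have "frac (real n + s) = s" by (simp add: frac_def)
  then show ?thesis using s fl by (simp add: chi_def)
qed

lemma chi_neg: "x \<le> 0 \<Longrightarrow> chi x = x / 4"
  by (cases "x = 0") (simp_all add: chi_def)

lemma nat_frac: "x \<ge> 0 \<Longrightarrow> \<exists>n s. x = real n + s \<and> 0 \<le> s \<and> s < 1"
proof -
  assume "x \<ge> 0"
  then have "x = real (nat \<lfloor>x\<rfloor>) + frac x" by (simp add: frac_def)
  then show ?thesis using frac_ge_0[of x] frac_lt_1[of x] by blast
qed

lemma lpl_chi: "lpl chi"
proof (rule lpl_from_aff)
  fix i :: int
  show "aff chi {of_int i..of_int i + 1}"
  proof (cases "i \<ge> 0")
    case True
    define n where "n = nat i"
    have i: "real_of_int i = real n" using True by (simp add: n_def)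
    show ?thesis
    proof (rule affI)
      show "1 / 2 - (1 + real n / 2) / 2 ^ (n + 1) \<in> dyadic" by (intro dyadic_diff dyadic_div_power dyadic_add) auto
      fix y assume y: "y \<in> {real_of_int i..real_of_int i + 1}"
      have "chi (real n + (y - real n)) = 1 / 2 - (1 - (y - real n) / 2) / 2 ^ (n + 1)"
        by (rule chi_nat) (use y i in auto)
      moreover have "2 powi (- int (n + 2)) = 1 / (2::real) ^ (n + 2)"
        by (simp only: power_int_minus power_int_of_nat inverse_eq_divide)
      ultimately show "chi y = 2 powi (- int (n + 2)) * y + (1 / 2 - (1 + real n / 2) / 2 ^ (n + 1))"
        by (simp add: field_simps)
    qed
  next
    case False
    then have "real_of_int i + 1 \<le> 0" by linarith
    then have *: "chi y = 2 powi (-2) * y + 0" if "y \<in> {of_int i..of_int i + 1}" for y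
      using that chi_neg[of y] by (simp add: power_int_def power2_eq_square)
    show ?thesis by (rule affI[OF dyadic_numeral(1) *])
  qed
qed

lemma chi_less_iff: "chi x < chi y \<longleftrightarrow> x < y" and chi_le_iff: "chi x \<le> chi y \<longleftrightarrow> x \<le> y"
  using lpl_strict_mono[OF lpl_chi] strict_mono_less strict_mono_less_eq by blast+

lemma chi_0: "chi 0 = 0" by (simp add: chi_neg)

lemma chi_lt: "chi x < 1 / 2"
proof (cases "x \<ge> 0")
  case True
  then obtain n s where ns: "x = real n + s" "0 \<le> s" "s < 1" using nat_frac by blast
  have "(1 - s / 2) / 2 ^ (n + 1) > 0" using ns by simp
  then show ?thesis using chi_nat[of s n] ns by simp
qed (simp add: chi_neg)

lemma chi_Suc: "x \<ge> 0 \<Longrightarrow> 1 / 2 - chi (x + 1) = (1 / 2 - chi x) / 2"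
proof -
  assume "x \<ge> 0"
  then obtain n s where ns: "x = real n + s" "0 \<le> s" "s < 1" using nat_frac by blast
  have "x + 1 = real (n + 1) + s" using ns by simp
  then have "chi (x + 1) = 1 / 2 - (1 - s / 2) / 2 ^ (n + 2)"
    using chi_nat[of s "n + 1"] ns(2,3) by (simp only: add.assoc) simp
  moreover have "chi x = 1 / 2 - (1 - s / 2) / 2 ^ (n + 1)"
    unfolding ns(1) by (rule chi_nat) (use ns in auto)
  ultimately show ?thesis by simp
qed

lemma chi_shift_nat: "x \<ge> 0 \<Longrightarrow> 1 / 2 - chi (x + real n) = (1 / 2 - chi x) / 2 ^ n"
proof (induction n)
  case (Suc n)
  have e: "x + real (Suc n) = (x + real n) + 1" by simp
  show ?case unfolding e using chi_Suc[of "x + real n"] Suc by simp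
qed simp

text \<open>Translation by \<open>c\<close> multiplies the distance to \<open>1/2\<close> by
  \<open>2 powi (- c)\<close>; this is how slopes at the end of the arc turn into integer
  shifts.\<close>

lemma chi_shift:
  assumes "x \<ge> 0" "x + of_int c \<ge> 0"
  shows "1 / 2 - chi (x + of_int c) = 2 powi (- c) * (1 / 2 - chi x)"
proof (cases "c \<ge> 0")
  case True
  define m where "m = nat c"
  have c: "c = int m" using True by (simp add: m_def)
  have "2 powi (- c) = 1 / (2::real) ^ m" by (simp only: c power_int_minus power_int_of_nat inverse_eq_divide)
  then show ?thesis using chi_shift_nat[OF assms(1), of m] by (simp add: c)
next
  case False
  define m where "m = nat (- c)"
  have c: "c = - int m" using False by (simp add: m_def)
  have "2 powi (- c) = (2::real) ^ m" by (simp add: c)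
  then show ?thesis using chi_shift_nat[OF assms(2), of m] by (simp add: c)
qed

lemma chi_surj: "y < 1 / 2 \<Longrightarrow> \<exists>x. chi x = y"
proof -
  assume y: "y < 1 / 2"
  obtain n where n: "1 / 2 ^ n \<le> 1 / 2 - y" using small_power[of "1 / 2 - y"] y by auto
  have "chi (real n + 0) = 1 / 2 - 1 / 2 ^ (n + 1)" using chi_nat[of 0 n] by simp
  moreover have "1 / 2 ^ (n + 1) \<le> (1::real) / 2 ^ n" by (simp add: field_simps)
  ultimately have 1: "y \<le> chi (real n)" using n by simp
  have 2: "chi (min 0 (4 * y)) \<le> y" by (simp add: chi_neg min_def)
  have "min 0 (4 * y) \<le> real n" by simp
  moreover have "continuous_on {min 0 (4 * y)..real n} chi" by (rule lpl_continuous[OF lpl_chi])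
  ultimately show ?thesis using IVT'[of chi "min 0 (4 * y)" y "real n"] 1 2 by auto
qed

definition psi :: "real \<Rightarrow> real" where "psi = Hilbert_Choice.inv chi"

lemma psi_chi [simp]: "psi (chi x) = x"
  unfolding psi_def using strict_mono_imp_inj_on[OF lpl_strict_mono[OF lpl_chi]] by simp

lemma chi_psi: "y < 1 / 2 \<Longrightarrow> chi (psi y) = y"
  using chi_surj[of y] psi_chi by metis

lemma lpl_at_psi: "y < 1 / 2 \<Longrightarrow> lpl_at psi y"
  using lpl_at_inverse[of chi "psi y" psi] lpl_chi chi_psi[of y] unfolding lpl_def by simp

lemma psi_nonneg: "0 \<le> y \<Longrightarrow> y < 1 / 2 \<Longrightarrow> 0 \<le> psi y"
  using chi_le_iff[of 0 "psi y"] chi_psi[of y] chi_0 by simp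

lemma psi_neg: "y \<le> 0 \<Longrightarrow> psi y = 4 * y"
  using psi_chi[of "4 * y"] chi_neg[of "4 * y"] by simp

definition shift :: "(real \<Rightarrow> real) \<Rightarrow> int \<Rightarrow> bool" where
  "shift h c \<longleftrightarrow> (\<exists>N. \<forall>x\<ge>N. h x = x + of_int c)"

text \<open>Thompson's group \<open>F\<close> on the half-line. Through \<open>chi\<close> it
  becomes the group of the arc from 0 to \<open>1/2\<close>, and the translation length near
  infinity records the slope at \<open>1/2\<close>.\<close>

definition Fh :: "(real \<Rightarrow> real) set" where
  "Fh = {h. lpl h \<and> (\<forall>x\<le>0. h x = x) \<and> (\<exists>c. shift h c)}"

lemma shift_unique: "shift h c \<Longrightarrow> shift h c' \<Longrightarrow> c = c'"
proof -
  assume "shift h c" "shift h c'"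
  then obtain N N' where N: "\<forall>x\<ge>N. h x = x + of_int c" "\<forall>x\<ge>N'. h x = x + of_int c'" by (auto simp: shift_def)
  have "h (max N N') = max N N' + of_int c" using N(1) by simp
  moreover have "h (max N N') = max N N' + of_int c'" using N(2) by simp
  ultimately show "c = c'" by simp
qed

lemma shift_comp: "shift g c \<Longrightarrow> shift h e \<Longrightarrow> shift (g \<circ> h) (c + e)"
proof -
  assume "shift g c" "shift h e"
  then obtain N N' where N: "\<forall>x\<ge>N. g x = x + of_int c" "\<forall>x\<ge>N'. h x = x + of_int e" by (auto simp: shift_def)
  have "(g \<circ> h) x = x + of_int (c + e)" if "x \<ge> max N' (N - of_int e)" for x
    using N that by simp
  then show ?thesis unfolding shift_def by blast
qed

lemma Fh_nonneg: "h \<in> Fh \<Longrightarrow> 0 \<le> x \<Longrightarrow> 0 \<le> h x"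
  using strict_mono_less_eq[OF lpl_strict_mono[of h], of 0 x] by (auto simp: Fh_def)

lemma Fh_comp: "g \<in> Fh \<Longrightarrow> h \<in> Fh \<Longrightarrow> g \<circ> h \<in> Fh"
  unfolding Fh_def using lpl_comp shift_comp by fastforce

definition Theta0 :: "(real \<Rightarrow> real) \<Rightarrow> real \<Rightarrow> real" where
  "Theta0 h x = (if x < 1 / 2 then chi (h (psi x)) else x)"

definition Theta :: "(real \<Rightarrow> real) \<Rightarrow> real \<Rightarrow> real" where
  "Theta h = per 0 (Theta0 h)"

lemma Theta0_neg: "h \<in> Fh \<Longrightarrow> x \<le> 0 \<Longrightarrow> Theta0 h x = x"
  by (simp add: Theta0_def Fh_def psi_neg chi_neg)

text \<open>Only the point \<open>1/2\<close> is delicate: near infinity \<open>h\<close> is a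
  translation by some \<open>c\<close>, which \<open>chi\<close> turns into the affine map of slope
  \<open>2 powi (- c)\<close> that fixes \<open>1/2\<close>.\<close>

lemma lpl_Theta0:
  assumes h: "h \<in> Fh"
  shows "lpl (Theta0 h)"
  unfolding lpl_def
proof
  fix x :: real
  have lh: "lpl h" using h by (simp add: Fh_def)
  consider "x < 1/2" | "x = 1/2" | "x > 1/2" by linarith
  then show "lpl_at (Theta0 h) x"
  proof cases
    case 1
    have "lpl_at (h \<circ> psi) x" using lpl_at_comp[OF lpl_at_psi[OF 1]] lh by (simp add: lpl_def)
    then have "lpl_at (chi \<circ> (h \<circ> psi)) x" using lpl_at_comp lpl_chi by (simp add: lpl_def)
    then show ?thesis by (rule lpl_at_cong_open[of _ _ "x - 1" "1/2"]) (use 1 in \<open>simp_all add: Theta0_def\<close>)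
  next
    case 2
    obtain c N where N: "\<forall>y\<ge>N. h y = y + of_int c" using h by (auto simp: Fh_def shift_def)
    \<comment> \<open>Beyond \<open>M\<close> the map \<open>h\<close> is a translation, and both
      the point and its image are non-negative, as \<open>chi_shift\<close> demands.\<close>
    define M where "M = max N (max 0 (- of_int c))"
    have M: "N \<le> M" "0 \<le> M" "- of_int c \<le> M" by (auto simp: M_def)
    define A where "A y = 2 powi (- c) * y + (1/2 - 2 powi (- c) / 2)" for y :: real
    have lA: "lpl A" unfolding A_def[abs_def] by (intro lpl_affine dyadic_diff dyadic_div_2) auto
    show ?thesis
    proof (rule lpl_at_glue[of A x id "chi M" "x + 1"])
      show "lpl_at A x" "lpl_at id x" using lA lpl_id(1) unfolding lpl_def by blast+
      show "x \<in> dyadic" unfolding 2 by (rule dyadic_div_2) simp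
      show "chi M < x" using chi_lt[of M] 2 by linarith
      show "x < x + 1" by simp
      show "Theta0 h y = id y" if "x \<le> y" "y < x + 1" for y
      proof -
        have "\<not> y < 1/2" using that 2 by linarith
        then show ?thesis unfolding Theta0_def by simp
      qed
      fix y assume y: "chi M < y" "y \<le> x"
      show "Theta0 h y = A y"
      proof (cases "y = x")
        case True
        show ?thesis unfolding True 2 Theta0_def A_def by simp
      next
        case False
        then have y2: "y < 1/2" using y 2 by linarith
        have "chi M < chi (psi y)" unfolding chi_psi[OF y2] by (rule y(1))
        then have p: "psi y \<ge> M" unfolding chi_less_iff by simp
        then have "h (psi y) = psi y + of_int c" using N M by simp
        moreover have "1/2 - chi (psi y + of_int c) = 2 powi (- c) * (1/2 - y)"
          using chi_shift[of "psi y" c] p M chi_psi[OF y2] by simp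
        ultimately have "chi (h (psi y)) = A y" unfolding A_def by (simp add: algebra_simps)
        then show ?thesis unfolding Theta0_def using y2 by simp
      qed
    qed
  next
    case 3
    have "lpl_at id x" using lpl_id(1) unfolding lpl_def by blast
    then show ?thesis by (rule lpl_at_cong_open[of _ _ "1/2" "x + 1"]) (use 3 in \<open>simp_all add: Theta0_def\<close>)
  qed
qed

lemma Theta_eq:
  assumes "h \<in> Fh" "0 \<le> x" "x \<le> 1"
  shows "Theta h x = Theta0 h x"
  unfolding Theta_def using assms Theta0_neg[OF assms(1), of 0] by (intro per_eq) (auto simp: Theta0_def)

lemma Theta_Fix:
  assumes h: "h \<in> Fh"
  shows "Theta h \<in> Fix 0 (1/2)"
proof -
  have "Theta0 h 0 = 0" by (rule Theta0_neg[OF h]) simp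
  then have T1: "Theta0 h (0 + 1) = Theta0 h 0 + 1" by (simp add: Theta0_def)
  have "Theta h \<in> TL" unfolding Theta_def by (rule per_TL[OF lpl_Theta0[OF h] T1 dyadic_numeral(1)])
  moreover have "Theta h x = x" if "1/2 \<le> x" "x \<le> 0 + 1" for x
    using Theta_eq[OF h, of x] that by (simp add: Theta0_def)
  ultimately show ?thesis unfolding Fix_def by blast
qed

lemma Theta_eqI:
  assumes f: "f \<in> Fix 0 (1/2)" and h: "h \<in> Fh" and e: "\<And>x. 0 \<le> x \<Longrightarrow> x < 1/2 \<Longrightarrow> f x = chi (h (psi x))"
  shows "f = Theta h"
proof (rule TL_eqI)
  fix x :: real assume x: "0 \<le> x" "x \<le> 0 + 1"
  show "f x = Theta h x"
    using Theta_eq[OF h, of x] x e[of x] Fix_id[OF f, of x] by (cases "x < 1/2") (simp_all add: Theta0_def)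
qed (use Fix_TL[OF f] Fix_TL[OF Theta_Fix[OF h]] in auto)

lemma Theta_comp:
  assumes g: "g \<in> Fh" and h: "h \<in> Fh"
  shows "Theta g \<circ> Theta h = Theta (g \<circ> h)"
proof (rule Theta_eqI)
  show "Theta g \<circ> Theta h \<in> Fix 0 (1/2)" using Fix_comp Theta_Fix g h by blast
  show "g \<circ> h \<in> Fh" using Fh_comp g h by blast
  fix x :: real assume x: "0 \<le> x" "x < 1/2"
  have "0 \<le> psi x" by (rule psi_nonneg) (fact x)+
  then have "0 \<le> h (psi x)" using Fh_nonneg[OF h, of "psi x"] by simp
  then have "0 \<le> chi (h (psi x))" using chi_le_iff[of 0 "h (psi x)"] chi_0 by simp
  then show "(Theta g \<circ> Theta h) x = chi ((g \<circ> h) (psi x))"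
    using Theta_eq[OF h, of x] Theta_eq[OF g, of "chi (h (psi x))"] x chi_lt[of "h (psi x)"] by (simp add: Theta0_def)
qed

text \<open>\<open>f\<close> is conjugated back by \<open>chi\<close>; a left slope
  \<open>2 powi k\<close> at \<open>1/2\<close> yields the shift \<open>- k\<close>. The extra
  clause, shift 0 for a map trivial near \<open>1/2\<close>, serves the computation of the derived
  subgroup.\<close>

lemma Theta_surj:
  assumes f: "f \<in> Fix 0 (1/2)"
  shows "\<exists>h\<in>Fh. f = Theta h \<and> (f \<in> Fix 0 q \<and> q < 1/2 \<longrightarrow> shift h 0)"
proof -
  define f0 where "f0 = (\<lambda>y. if y \<le> 0 then y else f y)"
  have fe: "f 0 = 0" "f (1/2) = 1/2" using Fix_ends[OF f] by simp_all
  have l0: "lpl f0" unfolding f0_def by (rule lpl_glue[OF lpl_id(2) TL_lpl[OF Fix_TL[OF f]]]) (use fe in auto)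
  have flt: "f y < 1/2 \<longleftrightarrow> y < 1/2" for y using TL_less_iff[OF Fix_TL[OF f], of y "1/2"] fe by simp
  have f0lt: "f0 y < 1/2" if "y < 1/2" for y using that flt by (simp add: f0_def)
  define h where "h = psi \<circ> (f0 \<circ> chi)"
  have "lpl h"
    unfolding lpl_def
  proof
    fix x
    have "lpl_at (f0 \<circ> chi) x" using lpl_comp[OF lpl_chi l0] by (simp add: lpl_def)
    moreover have "lpl_at psi ((f0 \<circ> chi) x)" using lpl_at_psi f0lt[OF chi_lt] by simp
    ultimately show "lpl_at h x" unfolding h_def by (rule lpl_at_comp)
  qed
  moreover have "h x = x" if "x \<le> 0" for x
  proof -
    have "chi x \<le> 0" using that by (simp add: chi_neg)
    then show ?thesis by (simp add: h_def f0_def)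
  qed
  moreover have sh: "shift h (- k)" if e: "e > 0" "\<And>y. 1/2 - e \<le> y \<Longrightarrow> y \<le> 1/2 \<Longrightarrow> 1/2 - f y = 2 powi k * (1/2 - y)" for e k
  proof -
    define M where "M = max 1 (max (of_int k) (psi (1/2 - e)))"
    have "h x = x + of_int (- k)" if x: "x \<ge> M" for x
    proof -
      have x1: "x > 0" "x - of_int k \<ge> 0" "x \<ge> psi (1/2 - e)" using x by (auto simp: M_def)
      have "1/2 - e \<le> chi x" using chi_le_iff[of "psi (1/2 - e)" x] x1 chi_psi[of "1/2 - e"] e by simp
      then have "1/2 - f (chi x) = 2 powi k * (1/2 - chi x)" using e(2)[of "chi x"] chi_lt[of x] by simp
      also have "\<dots> = 1/2 - chi (x + of_int (- k))" using chi_shift[of x "- k"] x1 by simp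
      finally have "f (chi x) = chi (x + of_int (- k))" by simp
      moreover have "0 < chi x" using chi_less_iff[of 0 x] x1 chi_0 by simp
      ultimately show ?thesis by (simp add: h_def f0_def)
    qed
    then show ?thesis unfolding shift_def by blast
  qed
  have "lpl_at f (1/2)" using TL_lpl[OF Fix_TL[OF f]] by (simp add: lpl_def)
  then obtain e L k l where "e > 0" "L = (2::real) powi k" "\<And>y. 1/2 \<le> y \<Longrightarrow> y \<le> 1/2 + e \<Longrightarrow> f y - f (1/2) = L * (y - 1/2)"
    and el: "\<And>y. 1/2 - e \<le> y \<Longrightarrow> y \<le> 1/2 \<Longrightarrow> f (1/2) - f y = 2 powi l * (1/2 - y)" by (rule germ_bounds) blast
  then have "shift h (- l)" using sh[of e l] fe by simp
  ultimately have hF: "h \<in> Fh" unfolding Fh_def by blast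
  have "f = Theta h"
  proof (rule Theta_eqI[OF f hF])
    fix x :: real assume x: "0 \<le> x" "x < 1/2"
    have "f0 x = f x" using x fe by (simp add: f0_def)
    then show "f x = chi (h (psi x))" using x chi_psi[of x] chi_psi[of "f x"] flt by (simp add: h_def)
  qed
  moreover have "shift h 0" if q: "f \<in> Fix 0 q" "q < 1/2"
    using sh[of "1/2 - q" 0] q Fix_id[OF q(1)] by simp
  ultimately show ?thesis using hF by blast
qed

section \<open>Words in the standard generators of \<open>F\<close>\<close>

definition Dn :: "nat \<Rightarrow> real \<Rightarrow> real" where
  "Dn n x = (if x \<le> real n then x else if x \<le> real n + 1 then 2 * x - real n else x + 1)"

text \<open>The inverse of \<open>Dn\<close>. The maps \<open>Dn n\<close> are the standard infinite
  generating sequence of \<open>F\<close>, each stretching one unit interval over two.\<close>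

definition En :: "nat \<Rightarrow> real \<Rightarrow> real" where
  "En n x = (if x \<le> real n then x else if x \<le> real n + 2 then (x + real n) / 2 else x - 1)"

lemma lpl_Dn: "lpl (Dn n)"
proof -
  have 0: "lpl (\<lambda>x. 2 * x - real n)" using lpl_affine[of "- real n" 1] by simp
  have 1: "lpl (\<lambda>x. if x \<le> real n + 1 then 2 * x - real n else x + 1)"
    by (rule lpl_glue[OF 0 lpl_translation]) auto
  have "lpl (\<lambda>x. if x \<le> real n then x else if x \<le> real n + 1 then 2 * x - real n else x + 1)"
    by (rule lpl_glue[OF lpl_id(2) 1]) auto
  then show ?thesis unfolding Dn_def[abs_def] .
qed

lemma lpl_En: "lpl (En n)"
proof -
  have 0: "lpl (\<lambda>x. (x + real n) / 2)"
    using lpl_affine[of "real n / 2" "-1"] by (simp add: power_int_def add_divide_distrib)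
  have 2: "lpl (\<lambda>x. x - 1)" using lpl_translation[of "-1"] by simp
  have 1: "lpl (\<lambda>x. if x \<le> real n + 2 then (x + real n) / 2 else x - 1)"
    by (rule lpl_glue[OF 0 2]) (auto simp: field_simps)
  have "lpl (\<lambda>x. if x \<le> real n then x else if x \<le> real n + 2 then (x + real n) / 2 else x - 1)"
    by (rule lpl_glue[OF lpl_id(2) 1]) auto
  then show ?thesis unfolding En_def[abs_def] .
qed

lemma En_Dn: "En n (Dn n x) = x" and Dn_En: "Dn n (En n x) = x"
  by (auto simp: En_def Dn_def field_simps)

lemma shift_Dn: "shift (Dn n) 1" and shift_En: "shift (En n) (-1)"
  unfolding shift_def by (auto simp: Dn_def En_def intro!: exI[of _ "real n + 3"])

lemma Dn_Fh: "Dn n \<in> Fh"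
  unfolding Fh_def using lpl_Dn shift_Dn by (auto simp: Dn_def)

lemma En_Fh: "En n \<in> Fh"
  unfolding Fh_def using lpl_En shift_En by (auto simp: En_def)

lemma shift_id: "shift id 0"
  by (simp add: shift_def)

lemma id_Fh: "id \<in> Fh"
  unfolding Fh_def using lpl_id(1) shift_id by auto

definition DG :: "(real \<Rightarrow> real) set" where
  "DG = {foldr (\<circ>) ws id | ws. set ws \<subseteq> range Dn \<union> range En}"

lemma DG_id: "id \<in> DG"
  unfolding DG_def mem_Collect_eq by (rule exI[of _ "[]"]) (simp only: foldr.simps id_apply set_simps empty_subsetI simp_thms)

lemma foldr_comp_Cons: "foldr (\<circ>) (a # ws) id = a \<circ> foldr (\<circ>) ws (id :: real \<Rightarrow> real)"
  by (rule ext) (simp only: foldr.simps o_apply)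

lemma DG_step: "g \<in> DG \<Longrightarrow> a \<in> range Dn \<union> range En \<Longrightarrow> a \<circ> g \<in> DG"
proof -
  assume "g \<in> DG" and a: "a \<in> range Dn \<union> range En"
  then obtain ws where ws: "g = foldr (\<circ>) ws id" "set ws \<subseteq> range Dn \<union> range En" unfolding DG_def by blast
  have "a \<circ> g = foldr (\<circ>) (a # ws) id" unfolding foldr_comp_Cons ws(1) by (rule refl)
  moreover have "set (a # ws) \<subseteq> range Dn \<union> range En" using a ws(2) by (metis insert_subset list.set(2))
  ultimately show ?thesis unfolding DG_def by blast
qed

lemma DG_induct [consumes 1, case_names I D E]:
  assumes g: "g \<in> DG" and I: "P id" and D: "\<And>g n. g \<in> DG \<Longrightarrow> P g \<Longrightarrow> P (Dn n \<circ> g)"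
    and E: "\<And>g n. g \<in> DG \<Longrightarrow> P g \<Longrightarrow> P (En n \<circ> g)"
  shows "P g"
proof -
  obtain ws where ws: "g = foldr (\<circ>) ws id" "set ws \<subseteq> range Dn \<union> range En" using g unfolding DG_def by blast
  have "P (foldr (\<circ>) ws id)" using ws(2)
  proof (induction ws)
    case Nil
    have "foldr (\<circ>) [] id = (id :: real \<Rightarrow> real)" by (rule ext) simp
    then show ?case using I by (simp only:)
  next
    case (Cons a ws)
    then have s: "set ws \<subseteq> range Dn \<union> range En" by (metis insert_subset list.set(2))
    have P: "P (foldr (\<circ>) ws id)" by (rule Cons.IH[OF s])
    have G: "foldr (\<circ>) ws id \<in> DG" unfolding DG_def using s by blast
    have "a \<in> range Dn \<union> range En" using Cons.prems by (metis insert_subset list.set(2))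
    then obtain n where "a = Dn n \<or> a = En n" by blast
    then have "P (a \<circ> foldr (\<circ>) ws id)" using D[OF G P, of n] E[OF G P, of n] by metis
    then show ?case by (simp only: foldr_comp_Cons)
  qed
  then show ?thesis by (simp only: ws(1))
qed

lemma DG_Fh: "g \<in> DG \<Longrightarrow> g \<in> Fh"
proof (induction rule: DG_induct)
  case I
  show ?case by (rule id_Fh)
next
  case (D g n)
  show ?case by (rule Fh_comp[OF Dn_Fh D.IH])
next
  case (E g n)
  show ?case by (rule Fh_comp[OF En_Fh E.IH])
qed

lemma DG_comp:
  assumes "g \<in> DG" and h: "h \<in> DG"
  shows "g \<circ> h \<in> DG"
  using assms(1)
proof (induction rule: DG_induct)
  case I
  show ?case using h by (simp only: id_comp)
next
  case (D g n)
  show ?case unfolding comp_assoc by (rule DG_step[OF D.IH]) blast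
next
  case (E g n)
  show ?case unfolding comp_assoc by (rule DG_step[OF E.IH]) blast
qed

lemma Dn_DG: "Dn n \<in> DG" and En_DG: "En n \<in> DG"
  using DG_step[OF DG_id, of "Dn n"] DG_step[OF DG_id, of "En n"] by (simp_all only: comp_id Un_iff rangeI simp_thms)

lemma DG_inverse: "g \<in> DG \<Longrightarrow> \<exists>g'\<in>DG. \<forall>x. g (g' x) = x"
proof (induction rule: DG_induct)
  case I
  show ?case using DG_id by (rule bexI[rotated]) (simp only: id_apply simp_thms)
next
  case (D g n)
  obtain g' where g': "g' \<in> DG" "\<forall>x. g (g' x) = x" using D.IH by (rule bexE)
  show ?case
    by (rule bexI[OF _ DG_comp[OF g'(1) En_DG[of n]]]) (simp only: o_apply g'(2)[rule_format] Dn_En simp_thms)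
next
  case (E g n)
  obtain g' where g': "g' \<in> DG" "\<forall>x. g (g' x) = x" using E.IH by (rule bexE)
  show ?case
    by (rule bexI[OF _ DG_comp[OF g'(1) Dn_DG[of n]]]) (simp only: o_apply g'(2)[rule_format] En_Dn simp_thms)
qed

text \<open>One half of a tree pair diagram: unit intervals are matched with standard dyadic
  intervals of length at most 1, \<open>m\<close> being a natural number.\<close>

definition ustd :: "(real \<Rightarrow> real) \<Rightarrow> nat \<Rightarrow> bool" where
  "ustd u i \<longleftrightarrow> (\<exists>(m::nat) (j::int). \<forall>s. 0 \<le> s \<longrightarrow> s \<le> 1 \<longrightarrow> u (real i + s) = (of_int j + s) / 2 ^ m)"

text \<open>An image interval has length \<open>1 / 2 ^ m\<close>, at most 1, so the lag behind the
  identity never decreases.\<close>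

lemma ustd_gap: "ustd u i \<Longrightarrow> real i - u (real i) \<le> real (Suc i) - u (real (Suc i))"
proof -
  assume "ustd u i"
  then obtain m :: nat and j :: int where mj: "\<And>s. 0 \<le> s \<Longrightarrow> s \<le> 1 \<Longrightarrow> u (real i + s) = (of_int j + s) / 2 ^ m"
    unfolding ustd_def by blast
  have "u (real (Suc i)) = (of_int j + 1) / 2 ^ m" using mj[of 1] by (simp add: add.commute)
  moreover have "u (real i) = of_int j / 2 ^ m" using mj[of 0] by simp
  moreover have "(1::real) / 2 ^ m \<le> 1" by simp
  ultimately show ?thesis by (simp add: add_divide_distrib)
qed

lemma ustd_gap_mono: "(\<And>i. ustd u i) \<Longrightarrow> i \<le> k \<Longrightarrow> real i - u (real i) \<le> real k - u (real k)"
  using lift_Suc_mono_le[of "\<lambda>i. real i - u (real i)" i k] ustd_gap by blast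

text \<open>With an odd numerator the fraction is in lowest terms, which excludes a strictly smaller
  power of 2 in the denominator.\<close>

lemma odd_level:
  fixes a b :: int
  assumes "of_int a / 2 ^ l = (of_int b / 2 ^ m :: real)" "m \<le> l" "odd a"
  shows "m = l \<and> b = a"
proof -
  have "(2::real) ^ l = 2 ^ m * 2 ^ (l - m)" using assms(2) by (simp add: power_add[symmetric])
  then have "real_of_int a = real_of_int (b * 2 ^ (l - m))" using assms(1) by (simp add: field_simps)
  then have a: "a = b * 2 ^ (l - m)" by (simp only: of_int_eq_iff)
  then have "l - m = 0" using assms(3) by (metis dvd_mult dvd_power even_numeral neq0_conv)
  then show ?thesis using a assms(2) by simp
qed

text \<open>A map sending each unit interval affinely onto a standard dyadic interval of length at most 1
  shrinks the half-line by a total amount \<open>c\<close>. The deepest image interval lies next to its sibling;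
  merging the two amounts to composing with some \<open>Dn i\<close> and lowers \<open>c\<close> by 1.\<close>

lemma ustd_DG:
  assumes "lpl u" "\<forall>x\<le>0. u x = x" "\<And>i. ustd u i" "\<forall>x\<ge>real N. u x = x - real c"
  shows "u \<in> DG"
  using assms
proof (induction c arbitrary: u N)
  case 0
  \<comment> \<open>The lag starts and ends at 0, so it vanishes throughout, and every image
    interval has length 1.\<close>
  note gm = ustd_gap_mono[OF 0(3)]
  have u0: "u 0 = 0" using 0(2) by simp
  have ui: "u (real i) = real i" for i
  proof (cases "i \<le> N")
    case True
    then show ?thesis using gm[of 0 i] gm[of i N] u0 0(4) by simp
  qed (use 0(4) in simp)
  have "u x = x" for x
  proof (cases "x \<ge> 0")
    case True
    then obtain i s where x: "x = real i + s" "0 \<le> s" "s < 1" using nat_frac by blast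
    obtain m :: nat and j :: int where mj: "\<And>s. 0 \<le> s \<Longrightarrow> s \<le> 1 \<Longrightarrow> u (real i + s) = (of_int j + s) / 2 ^ m"
      using 0(3)[of i] unfolding ustd_def by blast
    have "real i = of_int j / 2 ^ m" using mj[of 0] ui[of i] by simp
    moreover have "real i + 1 = (of_int j + 1) / 2 ^ m" using mj[of 1] ui[of "Suc i"] by (simp add: add.commute)
    ultimately have "(1::real) / 2 ^ m = 1" by (simp add: add_divide_distrib)
    then have "(2::real) ^ m = 1" by simp
    then show ?thesis using x mj[of s] \<open>real i = of_int j / 2 ^ m\<close> by simp
  qed (use 0(2) in simp)
  then have "u = id" by auto
  then show ?case using DG_id by (simp only:)
next
  case (Suc c)
  note st = Suc.prems(3) and tr = Suc.prems(4)
  have "\<exists>m j. \<forall>s. 0 \<le> s \<longrightarrow> s \<le> 1 \<longrightarrow> u (real i + s) = (of_int (j::int) + s) / 2 ^ (m::nat)" for i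
    using st[of i] unfolding ustd_def by blast
  then obtain m j where mj0: "\<forall>i s. 0 \<le> s \<longrightarrow> s \<le> 1 \<longrightarrow> u (real i + s) = (of_int (j i :: int) + s) / 2 ^ (m i :: nat)"
    by metis
  have mj: "u (real i + s) = (of_int (j i) + s) / 2 ^ m i" if "0 \<le> s" "s \<le> 1" for i s using mj0 that by blast
  have u_i: "u (real i) = of_int (j i) / 2 ^ m i" for i using mj[of 0 i] by simp
  have u_S: "u (real (Suc i)) = (of_int (j i) + 1) / 2 ^ m i" for i using mj[of 1 i] by (simp add: add.commute)
  have u0: "u 0 = 0" using Suc.prems(2) by simp
  have mN: "m i = 0" if "i \<ge> N" for i
  proof -
    have a: "u (real (Suc i)) = real (Suc i) - real (Suc c)" using that by (intro tr[rule_format]) simp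
    have b: "u (real i) = real i - real (Suc c)" using that by (intro tr[rule_format]) simp
    have "u (real (Suc i)) - u (real i) = 1" unfolding a b by simp
    then have "(1::real) / 2 ^ m i = 1" unfolding u_i[of i] u_S[of i] by (simp add: add_divide_distrib)
    then show ?thesis using one_less_power[of "2::real" "m i"] by (cases "m i = 0") auto
  qed
  have "\<exists>i. m i > 0"
  proof (rule ccontr)
    assume "\<nexists>i. 0 < m i"
    then have "u (real (Suc i)) = u (real i) + 1" for i using u_i[of i] u_S[of i] by simp
    then have "u (real i) = real i" for i by (induction i) (use u0 in simp_all)
    then show False using tr[rule_format, of "real N"] by simp
  qed
  then obtain i1 where i1: "m i1 > 0" by blast
  have bd: "m i < Suc (Max (m ` {..N}))" for i
  proof (cases "i \<le> N")
    case True
    then have "m i \<le> Max (m ` {..N})" by (intro Max_ge) auto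
    then show ?thesis by simp
  qed (use mN[of i] in simp)
  \<comment> \<open>An interval of greatest level; it exists because all levels from
    \<open>N\<close> on are 0.\<close>
  obtain i0 where i0: "\<And>i. m i \<le> m i0"
    using ex_has_greatest_nat[of "\<lambda>_. True" 0 m "Suc (Max (m ` {..N}))"] bd by blast
  define l where "l = m i0"
  have l: "l > 0" using i0[of i1] i1 by (simp add: l_def)
  \<comment> \<open>At the greatest level, the endpoint with odd numerator is shared with a
    neighbour, which by \<open>odd_level\<close> has the same level: the right neighbour if
    \<open>j i0\<close> is even, the left one if it is odd. The two are siblings.\<close>
  have "\<exists>i b. m i = l \<and> m (Suc i) = l \<and> j i = 2 * b \<and> j (Suc i) = 2 * b + 1"
  proof (cases "even (j i0)")
    case True
    have "of_int (j i0 + 1) / 2 ^ l = (of_int (j (Suc i0)) / 2 ^ m (Suc i0) :: real)"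
      using u_S[of i0] u_i[of "Suc i0"] by (simp add: l_def)
    then have "m (Suc i0) = l \<and> j (Suc i0) = j i0 + 1"
      by (rule odd_level) (use i0[of "Suc i0"] True in \<open>auto simp: l_def\<close>)
    then show ?thesis using True by (intro exI[of _ i0] exI[of _ "j i0 div 2"]) (auto simp: l_def)
  next
    case False
    have "i0 \<noteq> 0"
    proof
      assume "i0 = 0"
      then have "of_int (j i0) / 2 ^ m i0 = (0::real)" using u_i[of 0] u0 by simp
      then show False using False by simp
    qed
    then obtain k where k: "i0 = Suc k" by (rule not0_implies_Suc[THEN exE])
    have 1: "u (real i0) = of_int (j i0) / 2 ^ l" unfolding l_def by (rule u_i)
    have 2: "u (real i0) = (of_int (j k) + 1) / 2 ^ m k" unfolding k by (rule u_S)
    have 3: "real_of_int (j k) + 1 = of_int (j k + 1)" by simp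
    have "of_int (j i0) / 2 ^ l = (of_int (j k + 1) / 2 ^ m k :: real)" by (rule trans[OF 1[symmetric] 2[unfolded 3]])
    then have "m k = l \<and> j k + 1 = j i0"
      by (rule odd_level) (use i0[of k] False in \<open>auto simp: l_def\<close>)
    then have "m k = l" "m (Suc k) = l" "j k = 2 * (j i0 div 2)" "j (Suc k) = 2 * (j i0 div 2) + 1"
      using odd_two_times_div_two_succ[OF False] unfolding l_def k by linarith+
    then show ?thesis by blast
  qed
  then obtain i b where ib: "m i = l" "m (Suc i) = l" "j i = 2 * b" "j (Suc i) = 2 * b + 1" by blast
  have two: "u (real i + t) = (2 * of_int b + t) / 2 ^ l" if t: "0 \<le> t" "t \<le> 2" for t
  proof (cases "t \<le> 1")
    case True
    then show ?thesis using mj[of t i] t ib by simp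
  next
    case False
    then have "u (real (Suc i) + (t - 1)) = (of_int (j (Suc i)) + (t - 1)) / 2 ^ m (Suc i)"
      by (intro mj) (use t in auto)
    then show ?thesis using ib by (simp add: algebra_simps)
  qed
  \<comment> \<open>\<open>Dn i\<close> stretches the unit interval at \<open>i\<close> over two, so
    \<open>u'\<close> maps it onto the parent of the siblings, and later intervals are
    renumbered.\<close>
  define u' where "u' = u \<circ> Dn i"
  have "u' \<in> DG"
  proof (rule Suc.IH)
    show "lpl u'" unfolding u'_def by (rule lpl_comp[OF lpl_Dn Suc.prems(1)])
    show "\<forall>x\<le>0. u' x = x" using Suc.prems(2) by (simp add: u'_def Dn_def)
    show "\<forall>x\<ge>real (max N (Suc i)). u' x = x - real c"
    proof (intro allI impI)
      fix x assume x: "x \<ge> real (max N (Suc i))"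
      have xi: "real i + 1 \<le> x" "real N \<le> x" using x by auto
      have "Dn i x = x + 1" unfolding Dn_def using xi by auto
      moreover have "u (x + 1) = x + 1 - real (Suc c)" by (rule tr[rule_format]) (use xi in simp)
      ultimately show "u' x = x - real c" by (simp add: u'_def)
    qed
    fix k
    consider "k < i" | "k = i" | "k > i" by linarith
    then show "ustd u' k"
    proof cases
      case 1
      have "u' (real k + s) = (of_int (j k) + s) / 2 ^ m k" if "0 \<le> s" "s \<le> 1" for s
      proof -
        have "real k + s \<le> real i" using 1 that by linarith
        then show ?thesis using mj[OF that] by (simp add: u'_def Dn_def)
      qed
      then show ?thesis unfolding ustd_def by blast
    next
      case 2
      have "u' (real k + s) = (of_int b + s) / 2 ^ (l - 1)" if s: "0 \<le> s" "s \<le> 1" for s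
      proof -
        have "Dn i (real k + s) = real i + 2 * s" using 2 s by (auto simp: Dn_def)
        then have "u' (real k + s) = (2 * of_int b + 2 * s) / 2 ^ l" using two[of "2 * s"] s by (simp add: u'_def)
        moreover have "(2::real) ^ l = 2 * 2 ^ (l - 1)" using l by (cases l) auto
        moreover have "(2 * of_int b + 2 * s) / (2 * 2 ^ (l - 1)) = (of_int b + s) / 2 ^ (l - 1)"
          by (simp add: field_simps)
        ultimately show ?thesis by (simp only:)
      qed
      then show ?thesis unfolding ustd_def by blast
    next
      case 3
      have "u' (real k + s) = (of_int (j (Suc k)) + s) / 2 ^ m (Suc k)" if "0 \<le> s" "s \<le> 1" for s
      proof -
        have "real i + 1 \<le> real k + s" using 3 that by linarith
        then have "Dn i (real k + s) = real (Suc k) + s" by (auto simp: Dn_def)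
        then show ?thesis using mj[OF that, of "Suc k"] by (simp add: u'_def)
      qed
      then show ?thesis unfolding ustd_def by blast
    qed
  qed
  then have "u' \<circ> En i \<in> DG" using DG_comp En_DG by blast
  moreover have "u' \<circ> En i = u" unfolding u'_def by (rule ext) (simp only: o_apply Dn_En)
  ultimately show ?case by (simp only:)
qed

text \<open>A unit interval need not be mapped affinely by \<open>h\<close>. The map
  \<open>R\<close> contracts the interval from 0 to \<open>M\<close> by \<open>2 ^ n\<close>, finely
  enough for \<open>h\<close> to be standard on each image of a unit interval; then \<open>R\<close>
  and \<open>h \<circ> R\<close> both have the form treated by \<open>ustd_DG\<close>, and
  \<open>h\<close> is their quotient.\<close>

lemma Fh_DG:
  assumes h: "h \<in> Fh"
  shows "h \<in> DG"
proof -
  obtain c' N0 where N0: "\<forall>x\<ge>N0. h x = x + of_int c'" using h by (auto simp: Fh_def shift_def)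
  have lh: "lpl h" and h0: "\<forall>x\<le>0. h x = x" using h by (auto simp: Fh_def)
  define N where "N = nat \<lceil>max 1 N0\<rceil>"
  have N: "real N \<ge> N0" unfolding N_def by linarith
  have hN: "h x = x + of_int c'" if "x \<ge> real N" for x using N0 N that by simp
  obtain n where n: "\<And>i::int. {of_int i / 2 ^ n..(of_int i + 1) / 2 ^ n} \<subseteq> {0..real N} \<Longrightarrow> stdaff h n i 0"
    using lpl_std[OF lh, of 0 "real N" 0] by auto
  define M where "M = N * 2 ^ n"
  define c where "c = (2 ^ n - 1) * N"
  have Mc: "real M - real c = real N"
    unfolding M_def c_def by (simp add: of_nat_diff algebra_simps)
  have MN: "real M = real N * 2 ^ n" by (simp add: M_def)
  define R where "R x = (if x \<le> 0 then x else if x \<le> real M then x / 2 ^ n else x - real c)" for x :: real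
  have l1: "lpl (\<lambda>x. x / 2 ^ n)"
    using lpl_affine[of 0 "- int n"] by (simp add: power_int_minus divide_inverse mult.commute)
  have l2: "lpl (\<lambda>x. x - real c)" using lpl_translation[of "- real c"] by simp
  have l3: "lpl (\<lambda>x. if x \<le> real M then x / 2 ^ n else x - real c)"
    by (rule lpl_glue[OF l1 l2]) (use Mc MN in auto)
  have lR: "lpl R" unfolding R_def[abs_def] by (rule lpl_glue[OF lpl_id(2) l3]) auto
  have Rlow: "R (real i + s) = (real i + s) / 2 ^ n" if "i < M" "0 \<le> s" "s \<le> 1" for i s
  proof -
    have M: "real i + s \<le> real M" using that by linarith
    show ?thesis
    proof (cases "real i + s \<le> 0")
      case True
      have z: "real i + s = 0" by (rule antisym[OF True]) (use that in simp)
      show ?thesis unfolding z by (simp add: R_def)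
    qed (use M in \<open>simp add: R_def\<close>)
  qed
  have Rhigh: "R x = x - real c" if "real M \<le> x" for x
  proof (cases "x = real M")
    case True
    then show ?thesis using Mc MN by (cases "M = 0") (auto simp: R_def)
  next
    case False
    then have "x > real M" using that by simp
    moreover have "0 \<le> real M" by simp
    ultimately have "\<not> x \<le> 0" "\<not> x \<le> real M" by linarith+
    then show ?thesis by (simp add: R_def)
  qed
  have stR: "ustd R i" for i
  proof (cases "i < M")
    case True
    then show ?thesis unfolding ustd_def using Rlow[OF True] by (intro exI[of _ n] exI[of _ "int i"]) auto
  next
    case False
    then have "R (real i + s) = (of_int (int i - int c) + s) / 2 ^ 0" if "0 \<le> s" for s
      using Rhigh[of "real i + s"] that by simp
    then show ?thesis unfolding ustd_def by blast
  qed
  have RDG: "R \<in> DG" by (rule ustd_DG[of R M c]) (use lR stR Rhigh in \<open>auto simp: R_def\<close>)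
  define u where "u = h \<circ> R"
  have stu: "ustd u i" for i
  proof (cases "i < M")
    case True
    have "real i + 1 \<le> real N * 2 ^ n" using True MN by linarith
    then have "(real i + 1) / 2 ^ n \<le> real N" by (simp add: divide_le_eq)
    then have "{of_int (int i) / 2 ^ n..(of_int (int i) + 1) / 2 ^ n} \<subseteq> {0..real N}" by auto
    then have "stdaff h n (int i) 0" by (rule n)
    then show ?thesis unfolding stdaff_def ustd_def u_def o_apply using Rlow[OF True] by auto
  next
    case False
    then have "u (real i + s) = (of_int (int i - int c + c') + s) / 2 ^ 0" if "0 \<le> s" for s
      using Rhigh[of "real i + s"] that hN[of "real i + s - real c"] Mc by (simp add: u_def)
    then show ?thesis unfolding ustd_def by blast
  qed
  have uM: "u x = x - real c + of_int c'" if "x \<ge> real M" for x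
    using Rhigh[OF that] hN[of "x - real c"] that Mc by (simp add: u_def)
  have u0: "u x = x" if "x \<le> 0" for x using h0 that by (simp add: u_def R_def)
  \<comment> \<open>The composite still lags behind the identity, so the total amount by which it
    shrinks is a natural number.\<close>
  have "0 \<le> real c - of_int c'" using ustd_gap_mono[OF stu, of 0 M] u0[of 0] uM[of "real M"] by simp
  then have cc: "real (nat (int c - c')) = real c - of_int c'" by simp
  have "u \<in> DG"
  proof (rule ustd_DG[of u M "nat (int c - c')"])
    show "lpl u" unfolding u_def by (rule lpl_comp[OF lR lh])
    show "\<forall>x\<le>0. u x = x" by (intro allI impI u0)
    show "ustd u i" for i by (rule stu)
    show "\<forall>x\<ge>real M. u x = x - real (nat (int c - c'))"
    proof (intro allI impI)
      fix x assume x: "x \<ge> real M"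
      show "u x = x - real (nat (int c - c'))" unfolding cc uM[OF x] by simp
    qed
  qed
  moreover obtain R' where R': "R' \<in> DG" "\<forall>x. R (R' x) = x" using DG_inverse[OF RDG] by blast
  moreover have "u \<circ> R' = h" unfolding u_def by (rule ext) (simp only: o_apply R'(2)[rule_format])
  ultimately show ?thesis using DG_comp[of u R'] by (simp only:)
qed

section \<open>Congruence modulo the derived subgroup\<close>

lemma (in group_hom) derived_image:
  assumes K: "K \<subseteq> carrier G"
  shows "h ` derived G K \<subseteq> derived H (h ` K)"
proof -
  have "h ` derived_set G K \<subseteq> derived_set H (h ` K)"
  proof
    fix y assume "y \<in> h ` derived_set G K"
    then obtain a b where ab: "a \<in> K" "b \<in> K" "y = h (a \<otimes> b \<otimes> inv a \<otimes> inv b)" by blast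
    moreover have "a \<in> carrier G" "b \<in> carrier G" using ab K by auto
    ultimately have "y = h a \<otimes>\<^bsub>H\<^esub> h b \<otimes>\<^bsub>H\<^esub> inv\<^bsub>H\<^esub> h a \<otimes>\<^bsub>H\<^esub> inv\<^bsub>H\<^esub> h b" by simp
    then show "y \<in> derived_set H (h ` K)" using ab by blast
  qed
  then show ?thesis
    unfolding derived_def generate_img[OF G.derived_set_in_carrier[OF K], symmetric]
    by (rule H.mono_generate)
qed

text \<open>\<open>g\<close> is congruent to \<open>x [^] c\<close> modulo the derived subgroup of
  \<open>L\<close>; stating this for elements avoids forming the abelianisation.\<close>

definition (in group) pcong :: "'a set \<Rightarrow> 'a \<Rightarrow> 'a \<Rightarrow> int \<Rightarrow> bool" where
  "pcong L x g c \<longleftrightarrow> g \<in> L \<and> g \<otimes> inv (x [^] c) \<in> derived G L"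

context group
begin

context
  fixes L x
  assumes L: "subgroup L G" and x: "x \<in> L"
begin

lemma pcong_D: "subgroup (derived G L) G" "derived G L \<subseteq> L" "l \<in> L \<Longrightarrow> l \<in> carrier G" "d \<in> derived G L \<Longrightarrow> d \<in> carrier G"
  using derived_is_subgroup[OF subgroup.subset[OF L]] derived_incl[OF _ L, of L] subgroup.subset[OF L] by auto

lemma pcong_commutator: "a \<in> L \<Longrightarrow> b \<in> L \<Longrightarrow> a \<otimes> b \<otimes> inv a \<otimes> inv b \<in> derived G L"
  unfolding derived_def by (rule generate.incl) blast

lemma pcong_normal:
  assumes l: "l \<in> L" and d: "d \<in> derived G L"
  shows "l \<otimes> d \<otimes> inv l \<in> derived G L"
proof -
  have dL: "d \<in> L" using d pcong_D(2) by blast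
  have "(l \<otimes> d \<otimes> inv l \<otimes> inv d) \<otimes> d \<in> derived G L"
    using subgroup.m_closed[OF pcong_D(1) pcong_commutator[OF l dL] d] .
  then show ?thesis using pcong_D(3)[OF l] pcong_D(3)[OF dL] by (simp add: m_assoc)
qed

lemma pow_L: "x [^] (c::int) \<in> L"
  using subgroup_int_pow_closed[OF L x] .

lemma pcong_mult: "pcong L x g c \<Longrightarrow> pcong L x h e \<Longrightarrow> pcong L x (g \<otimes> h) (c + e)"
proof -
  assume gh: "pcong L x g c" "pcong L x h e"
  then have L1: "g \<in> L" "h \<in> L" and D1: "g \<otimes> inv (x [^] c) \<in> derived G L" "h \<otimes> inv (x [^] e) \<in> derived G L"
    by (auto simp: pcong_def)
  define p q where "p = x [^] c" and "q = x [^] e"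
  have c: "g \<in> carrier G" "h \<in> carrier G" "p \<in> carrier G" "q \<in> carrier G" "x \<in> carrier G"
    using L1 pcong_D(3) pow_L x by (auto simp: p_def q_def)
  have pq: "x [^] (c + e) = p \<otimes> q" unfolding p_def q_def using c(5) by (rule int_pow_mult)
  have "(g \<otimes> inv p) \<otimes> (p \<otimes> (h \<otimes> inv q) \<otimes> inv p) \<in> derived G L"
    using subgroup.m_closed[OF pcong_D(1) D1(1) pcong_normal[OF pow_L D1(2)]] unfolding p_def q_def .
  moreover have "(g \<otimes> inv p) \<otimes> (p \<otimes> (h \<otimes> inv q) \<otimes> inv p) = g \<otimes> h \<otimes> inv (p \<otimes> q)"
  proof -
    have "inv p \<otimes> (p \<otimes> (h \<otimes> (inv q \<otimes> inv p))) = h \<otimes> (inv q \<otimes> inv p)"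
      using c by (simp add: m_assoc[symmetric])
    then show ?thesis using c by (simp add: m_assoc inv_mult_group)
  qed
  ultimately show ?thesis unfolding pcong_def pq using subgroup.m_closed[OF L L1] by simp
qed

lemma pcong_inv: "pcong L x g c \<Longrightarrow> pcong L x (inv g) (- c)"
proof -
  assume g: "pcong L x g c"
  then have L1: "g \<in> L" and D1: "g \<otimes> inv (x [^] c) \<in> derived G L" by (auto simp: pcong_def)
  define p where "p = x [^] c"
  have c: "g \<in> carrier G" "p \<in> carrier G" "x \<in> carrier G" and pL: "p \<in> L"
    using L1 pcong_D(3) pow_L x by (auto simp: p_def)
  have "inv p \<in> L" using subgroup.m_inv_closed[OF L pL] .
  then have "inv p \<otimes> (g \<otimes> inv p) \<otimes> inv (inv p) \<in> derived G L" using pcong_normal D1 by (simp add: p_def)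
  moreover have "inv p \<otimes> (g \<otimes> inv p) \<otimes> inv (inv p) = inv p \<otimes> g" using c by (simp add: m_assoc)
  ultimately have "inv (inv p \<otimes> g) \<in> derived G L" using subgroup.m_inv_closed[OF pcong_D(1)] by simp
  moreover have "inv (inv p \<otimes> g) = inv g \<otimes> inv (x [^] (- c))" 
    using c by (simp add: inv_mult_group int_pow_neg p_def)
  ultimately show ?thesis unfolding pcong_def using subgroup.m_inv_closed[OF L L1] by simp
qed

lemma pcong_conj: "pcong L x g c \<Longrightarrow> t \<in> L \<Longrightarrow> pcong L x (t \<otimes> g \<otimes> inv t) c"
proof -
  assume g: "pcong L x g c" and t: "t \<in> L"
  then have L1: "g \<in> L" and D1: "g \<otimes> inv (x [^] c) \<in> derived G L" by (auto simp: pcong_def)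
  define p where "p = x [^] c"
  have c: "g \<in> carrier G" "t \<in> carrier G" "p \<in> carrier G" using L1 t pcong_D(3) pow_L by (auto simp: p_def)
  have "(t \<otimes> g \<otimes> inv t \<otimes> inv g) \<otimes> (g \<otimes> inv p) \<in> derived G L"
    using subgroup.m_closed[OF pcong_D(1) pcong_commutator[OF t L1] D1] unfolding p_def .
  moreover have "(t \<otimes> g \<otimes> inv t \<otimes> inv g) \<otimes> (g \<otimes> inv p) = t \<otimes> g \<otimes> inv t \<otimes> inv p"
  proof -
    have "inv g \<otimes> (g \<otimes> inv p) = inv p" using c by (simp add: m_assoc[symmetric])
    then show ?thesis using c by (simp add: m_assoc)
  qed
  moreover have "t \<otimes> g \<otimes> inv t \<in> L" using subgroup.m_closed[OF L] subgroup.m_inv_closed[OF L] t L1 by simp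
  ultimately show ?thesis by (simp add: pcong_def p_def)
qed

lemma pcong_one: "pcong L x \<one> 0"
  using subgroup.one_closed[OF L] subgroup.one_closed[OF pcong_D(1)] by (simp add: pcong_def)

lemma pcong_self: "pcong L x x 1"
  using subgroup.one_closed[OF pcong_D(1)] x pcong_D(3)[OF x] by (simp add: pcong_def int_pow_1)

lemma pcong_0: "pcong L x g 0 \<Longrightarrow> g \<in> derived G L"
  using pcong_D(3)[of g] by (simp add: pcong_def)

end

end

section \<open>Finite generation of arc groups\<close>

interpretation TLg: group thompson_T_lift
  by (rule group_lift)

lemma Fix_subgroup: "subgroup (Fix u v) thompson_T_lift"
proof (rule TLg.subgroupI)
  show "Fix u v \<noteq> {}" using id_Fix by blast
  show "Fix u v \<subseteq> carrier thompson_T_lift" unfolding carrier_lift using Fix_TL by blast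
  show "inv\<^bsub>thompson_T_lift\<^esub> a \<in> Fix u v" if "a \<in> Fix u v" for a
    unfolding inv_lift[OF Fix_TL[OF that]] by (rule Fix_inv[OF that])
  show "a \<otimes>\<^bsub>thompson_T_lift\<^esub> b \<in> Fix u v" if "a \<in> Fix u v" "b \<in> Fix u v" for a b
    unfolding mult_lift by (rule Fix_comp[OF that])
qed

definition cj :: "(real \<Rightarrow> real) \<Rightarrow> (real \<Rightarrow> real) \<Rightarrow> real \<Rightarrow> real" where
  "cj \<tau> h = \<tau> \<circ> h \<circ> Hilbert_Choice.inv \<tau>"

lemma cj_group: "\<tau> \<in> TL \<Longrightarrow> cj \<tau> h = \<tau> \<otimes>\<^bsub>thompson_T_lift\<^esub> h \<otimes>\<^bsub>thompson_T_lift\<^esub> inv\<^bsub>thompson_T_lift\<^esub> \<tau>"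
  by (simp only: cj_def inv_lift mult_lift)

lemma cj_hom:
  assumes t: "\<tau> \<in> TL"
  shows "group_hom thompson_T_lift thompson_T_lift (cj \<tau>)"
proof -
  have "cj \<tau> (g \<circ> h) = cj \<tau> g \<circ> cj \<tau> h" for g h
    by (rule ext) (simp only: cj_def o_apply TL_inv_apply(1)[OF t])
  moreover have "cj \<tau> g \<in> TL" if "g \<in> TL" for g
    unfolding cj_def by (intro TL_comp t that TL_inv)
  ultimately show ?thesis
    by (intro group_hom.intro group_lift group_hom_axioms.intro homI) (simp_all only: carrier_lift mult_lift)
qed

lemma cj_inverse: "\<tau> \<in> TL \<Longrightarrow> cj \<tau> (cj (Hilbert_Choice.inv \<tau>) h) = h"
  unfolding cj_def inv_inv_eq[OF TL_bij] by (rule ext) (simp only: o_apply TL_inv_apply(2))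

lemma cj_Fix:
  assumes t: "\<tau> \<in> TL"
  shows "cj \<tau> ` Fix u v = Fix (\<tau> u) (\<tau> v)"
proof
  show "cj \<tau> ` Fix u v \<subseteq> Fix (\<tau> u) (\<tau> v)" unfolding cj_def using Fix_conj[OF t] by blast
  show "Fix (\<tau> u) (\<tau> v) \<subseteq> cj \<tau> ` Fix u v"
  proof
    fix h assume "h \<in> Fix (\<tau> u) (\<tau> v)"
    then have "cj (Hilbert_Choice.inv \<tau>) h \<in> Fix u v"
      using Fix_conj[OF TL_inv[OF t], of h "\<tau> u" "\<tau> v"] unfolding cj_def TL_inv_apply(1)[OF t] by blast
    then show "h \<in> cj \<tau> ` Fix u v" using cj_inverse[OF t, of h] by (metis imageI)
  qed
qed

lemma Theta_id: "Theta id = id"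
  by (rule Theta_eqI[OF id_Fix id_Fh, symmetric]) (simp only: id_apply chi_psi)

abbreviation X :: "nat \<Rightarrow> real \<Rightarrow> real" where
  "X n \<equiv> Theta (Dn n)"

lemma X_Fix: "X n \<in> Fix 0 (1/2)"
  by (rule Theta_Fix[OF Dn_Fh])

lemma X_TL: "X n \<in> TL"
  by (rule Fix_TL[OF X_Fix])

lemma Theta_En: "Theta (En n) = inv\<^bsub>thompson_T_lift\<^esub> X n"
proof -
  have "En n \<circ> Dn n = id" by (rule ext) (simp only: o_apply En_Dn id_apply)
  then have "Theta (En n) \<circ> X n = id" unfolding Theta_comp[OF En_Fh Dn_Fh] by (simp only: Theta_id)
  then show ?thesis using TLg.inv_equality[of "Theta (En n)" "X n"] X_TL Fix_TL[OF Theta_Fix[OF En_Fh]] by simp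
qed

lemma cj_eqI: "\<tau> \<in> TL \<Longrightarrow> g \<circ> \<tau> = \<tau> \<circ> h \<Longrightarrow> g = cj \<tau> h"
proof -
  assume t: "\<tau> \<in> TL" and e: "g \<circ> \<tau> = \<tau> \<circ> h"
  have "cj \<tau> h = g \<circ> \<tau> \<circ> Hilbert_Choice.inv \<tau>" unfolding cj_def e by (rule refl)
  then show ?thesis by (simp only: comp_assoc TL_inv_comp(2)[OF t] comp_id)
qed

text \<open>The relation of \<open>F\<close> by which \<open>X 0\<close> conjugates each later
  generator to the next; it reduces the infinite sequence to \<open>X 0\<close> and
  \<open>X 1\<close>.\<close>

lemma X_rec: "X (Suc (Suc n)) = cj (X 0) (X (Suc n))"
proof (rule cj_eqI[OF X_TL])
  have "Dn (Suc (Suc n)) \<circ> Dn 0 = Dn 0 \<circ> Dn (Suc n)"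
    by (rule ext) (auto simp: Dn_def)
  then show "X (Suc (Suc n)) \<circ> X 0 = X 0 \<circ> X (Suc n)" unfolding Theta_comp[OF Dn_Fh Dn_Fh] by (simp only:)
qed

lemma X_generate: "X n \<in> generate thompson_T_lift {X 0, X 1}"
proof (induction n rule: less_induct)
  case (less n)
  note sg = TLg.generate_is_subgroup[of "{X 0, X 1}"]
  have S: "{X 0, X 1} \<subseteq> carrier thompson_T_lift" using X_TL by simp
  have X0: "X 0 \<in> generate thompson_T_lift {X 0, X 1}" by (rule generate.incl) blast
  consider "n = 0" | "n = 1" | k where "n = Suc (Suc k)" by (metis One_nat_def not0_implies_Suc)
  then show ?case
  proof cases
    case (3 k)
    then have "X (Suc k) \<in> generate thompson_T_lift {X 0, X 1}" using less by blast
    then show ?thesis unfolding 3 X_rec cj_group[OF X_TL]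
      by (intro subgroup.m_closed[OF sg[OF S]] X0 subgroup.m_inv_closed[OF sg[OF S]])
  qed (auto intro: generate.incl)
qed

lemma DG_Theta:
  assumes "g \<in> DG" and I: "P id"
    and D: "\<And>g n. P g \<Longrightarrow> P (X n \<circ> g)" and E: "\<And>g n. P g \<Longrightarrow> P (inv\<^bsub>thompson_T_lift\<^esub> X n \<circ> g)"
  shows "P (Theta g)"
  using assms(1)
proof (induction rule: DG_induct)
  case I
  show ?case unfolding Theta_id by (rule assms(2))
next
  case (D g n)
  show ?case unfolding Theta_comp[OF Dn_Fh DG_Fh[OF D.hyps], symmetric] by (rule assms(3)[OF D.IH])
next
  case (E g n)
  show ?case unfolding Theta_comp[OF En_Fh DG_Fh[OF E.hyps], symmetric] Theta_En by (rule assms(4)[OF E.IH])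
qed

lemma Fix_half_generate: "generate thompson_T_lift {X 0, X 1} = Fix 0 (1/2)"
proof
  show "generate thompson_T_lift {X 0, X 1} \<subseteq> Fix 0 (1/2)"
    by (rule TLg.generate_subgroup_incl[OF _ Fix_subgroup]) (use X_Fix in blast)
  show "Fix 0 (1/2) \<subseteq> generate thompson_T_lift {X 0, X 1}"
  proof
    fix f assume "f \<in> Fix 0 (1/2)"
    then obtain h where h: "h \<in> Fh" "f = Theta h" using Theta_surj by blast
    have sg: "subgroup (generate thompson_T_lift {X 0, X 1}) thompson_T_lift"
      by (rule TLg.generate_is_subgroup) (use X_TL in simp)
    have "Theta h \<in> generate thompson_T_lift {X 0, X 1}" using Fh_DG[OF h(1)]
    proof (rule DG_Theta)
      show "id \<in> generate thompson_T_lift {X 0, X 1}" using subgroup.one_closed[OF sg] unfolding one_lift .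
      show "X n \<circ> g \<in> generate thompson_T_lift {X 0, X 1}" if "g \<in> generate thompson_T_lift {X 0, X 1}" for g n
        using subgroup.m_closed[OF sg X_generate that] unfolding mult_lift .
      show "inv\<^bsub>thompson_T_lift\<^esub> X n \<circ> g \<in> generate thompson_T_lift {X 0, X 1}"
        if "g \<in> generate thompson_T_lift {X 0, X 1}" for g n
        using subgroup.m_closed[OF sg subgroup.m_inv_closed[OF sg X_generate] that] unfolding mult_lift .
    qed
    then show "f \<in> generate thompson_T_lift {X 0, X 1}" unfolding h(2) .
  qed
qed

text \<open>Some element of the lift carries the arc from 0 to \<open>1/2\<close> to that from
  \<open>a\<close> to \<open>b\<close>, and conjugation by it carries generators to
  generators.\<close>

lemma Fix_generate:
  assumes "a \<in> dyadic" "b \<in> dyadic" "a < b" "b < a + 1"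
  shows "\<exists>S. finite S \<and> S \<subseteq> Fix a b \<and> generate thompson_T_lift S = Fix a b"
proof -
  obtain \<tau> where t: "\<tau> \<in> TL" "\<tau> 0 = a" "\<tau> (1/2) = b"
    using TL_move[of 0 "1/2" a b] assms dyadic_half_power[of 1] by auto
  interpret group_hom thompson_T_lift thompson_T_lift "cj \<tau>" by (rule cj_hom[OF t(1)])
  have F: "cj \<tau> ` Fix 0 (1/2) = Fix a b" unfolding cj_Fix[OF t(1)] t(2,3) by (rule refl)
  have "generate thompson_T_lift (cj \<tau> ` {X 0, X 1}) = cj \<tau> ` generate thompson_T_lift {X 0, X 1}"
    by (rule generate_img) (use X_TL in simp)
  then have "generate thompson_T_lift (cj \<tau> ` {X 0, X 1}) = Fix a b" unfolding Fix_half_generate F .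
  moreover have "cj \<tau> ` {X 0, X 1} \<subseteq> Fix a b" unfolding F[symmetric] using X_Fix by (intro image_mono) blast
  ultimately show ?thesis by (intro exI[of _ "cj \<tau> ` {X 0, X 1}"] conjI) auto
qed

text \<open>In the coordinate \<open>chi\<close>, the halving map \<open>x \<mapsto> x / 2 + 1 / 4\<close> is the unit translation, and this
  translation conjugates \<open>Dn 0\<close> to \<open>Dn 1\<close> on the half-line.\<close>

lemma X1_conj:
  assumes u: "u \<in> dyadic" "u < 0" "-1/2 \<le> u"
  shows "\<exists>\<tau>\<in>Fix u (1/2). X 1 = cj \<tau> (X 0)"
proof -
  have d4: "(1/4 :: real) \<in> dyadic" and d2: "(1/2 :: real) \<in> dyadic" using dyadic_half_power[of 2] dyadic_half_power[of 1] by simp_all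
  obtain m where m: "lpl m" "m u = u" "m 0 = 1/4" using lpl_move[of u 0 u "1/4"] u d4 by auto
  \<comment> \<open>Halving moves 0 to \<open>1/4\<close>, so the conjugator needs room to the left
    of 0; there \<open>m\<close> fills in between \<open>u\<close> and 0.\<close>
  define t0 where "t0 x = (if x \<le> 0 then m x else if x \<le> 1/2 then x/2 + 1/4 else x)" for x :: real
  have l1: "lpl (\<lambda>x. x/2 + 1/4)" using lpl_affine[OF d4, of "-1"] by (simp add: power_int_def)
  have l2: "lpl (\<lambda>x. if x \<le> 1/2 then x/2 + 1/4 else x)"
    by (rule lpl_glue[OF l1 lpl_id(2) d2]) simp
  have l3: "lpl t0" unfolding t0_def[abs_def] by (rule lpl_glue[OF m(1) l2]) (use m(3) in auto)
  have t0u: "t0 u = u" using u m by (simp add: t0_def)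
  have t0h: "t0 x = x" if "1/2 \<le> x" for x
  proof (cases "x = 1/2")
    case True
    show ?thesis unfolding True t0_def by simp
  qed (use that in \<open>simp add: t0_def\<close>)
  have t0m: "t0 x = x/2 + 1/4" if "0 \<le> x" "x \<le> 1/2" for x
  proof (cases "x = 0")
    case True
    show ?thesis unfolding True t0_def using m(3) by simp
  next
    case False
    then have "\<not> x \<le> 0" using that by simp
    then show ?thesis using that unfolding t0_def by simp
  qed
  define \<tau> where "\<tau> = per u t0"
  have k: "t0 (u + 1) = t0 u + 1" using t0h[of "u + 1"] t0u u by simp
  have tTL: "\<tau> \<in> TL" unfolding \<tau>_def by (rule per_TL[OF l3 k u(1)])
  have te: "\<tau> x = t0 x" if "u \<le> x" "x \<le> u + 1" for x unfolding \<tau>_def by (rule per_eq[OF k that])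
  have tF: "\<tau> \<in> Fix u (1/2)" unfolding Fix_def mem_Collect_eq
  proof (intro conjI tTL allI impI)
    fix x :: real assume "1/2 \<le> x" "x \<le> u + 1"
    then show "\<tau> x = x" using te[of x] t0h[of x] u by simp
  qed
  have tm: "\<tau> x = x/2 + 1/4" if "0 \<le> x" "x \<le> 1/2" for x using te[of x] t0m[OF that] that u by simp
  have "X 1 \<circ> \<tau> = \<tau> \<circ> X 0"
  proof (rule TL_eqI[of _ _ 0])
    show "X 1 \<circ> \<tau> \<in> TL" "\<tau> \<circ> X 0 \<in> TL" by (intro TL_comp tTL X_TL)+
    fix x :: real assume x: "0 \<le> x" "x \<le> 0 + 1"
    show "(X 1 \<circ> \<tau>) x = (\<tau> \<circ> X 0) x"
    proof (cases "x < 1/2")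
      case True
      define y where "y = psi x"
      have y: "0 \<le> y" "chi y = x" using psi_nonneg[OF x(1) True] chi_psi[OF True] by (simp_all add: y_def)
      define z where "z = Dn 0 y"
      have z: "0 \<le> z" "Dn 1 (y + 1) = z + 1" using y by (auto simp: z_def Dn_def)
      have X0: "X 0 x = chi z" using Theta_eq[OF Dn_Fh, of x 0] x True by (simp add: Theta0_def z_def y_def)
      have c0: "0 \<le> chi z" using chi_le_iff[of 0 z] z chi_0 by simp
      have "\<tau> (chi z) = chi z / 2 + 1/4" using tm[OF c0] chi_lt[of z] by simp
      also have "\<dots> = chi (z + 1)" using chi_Suc[OF z(1)] by simp
      finally have 1: "\<tau> (X 0 x) = chi (z + 1)" unfolding X0 .
      have "\<tau> x = chi y / 2 + 1/4" using tm[of x] x True y by simp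
      also have "\<dots> = chi (y + 1)" using chi_Suc[OF y(1)] by simp
      finally have 2: "\<tau> x = chi (y + 1)" .
      have "0 \<le> chi (y + 1)" using chi_le_iff[of 0 "y + 1"] y(1) chi_0 by simp
      then have "X 1 (chi (y + 1)) = Theta0 (Dn 1) (chi (y + 1))"
        using Theta_eq[OF Dn_Fh, of "chi (y + 1)" 1] chi_lt[of "y + 1"] by simp
      also have "\<dots> = chi (z + 1)" using chi_lt[of "y + 1"] z(2) by (simp add: Theta0_def)
      finally show ?thesis unfolding o_apply 1 2 .
    next
      case False
      have X0: "X 0 x = x" using Fix_id[OF X_Fix, of x 0] False x by simp
      have h: "\<tau> (1/2) = 1/2" and z: "\<tau> 0 = 1/4" using tm[of "1/2"] tm[of 0] by simp_all
      have "\<tau> (0 + 1) = \<tau> 0 + 1" by (rule TL_step[OF tTL])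
      then have o: "\<tau> 1 = 5/4" using z by simp
      have w: "1/2 \<le> \<tau> x" "\<tau> x \<le> 5/4"
        using TL_le_iff[OF tTL, of "1/2" x] TL_le_iff[OF tTL, of x 1] h o False x by simp_all
      have "X 1 (\<tau> x) = \<tau> x"
      proof (cases "\<tau> x \<le> 1")
        case True
        then show ?thesis using Fix_id[OF X_Fix, of "\<tau> x" 1] w by simp
      next
        case False
        define y where "y = \<tau> x - 1"
        have y: "0 \<le> y" "y \<le> 1/4" "\<tau> x = y + 1" using False w by (auto simp: y_def)
        have y2: "y < 1/2" using y by simp
        have "chi (real 0 + 1) = 1/4" using chi_nat[of 1 0] by simp
        then have "psi y \<le> 1" using chi_le_iff[of "psi y" 1] chi_psi[OF y2] y by simp
        then have "Dn 1 (psi y) = psi y" by (simp add: Dn_def)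
        then have "Theta0 (Dn 1) y = y" using y2 chi_psi[OF y2] by (simp add: Theta0_def)
        then have "X 1 y = y" using Theta_eq[OF Dn_Fh, of y 1] y by simp
        then show ?thesis unfolding y(3) using TL_step[OF X_TL, of 1 y] by simp
      qed
      then show ?thesis unfolding o_apply X0 .
    qed
  qed
  then have "X 1 = cj \<tau> (X 0)" by (rule cj_eqI[OF tTL])
  then show ?thesis using tF by blast
qed

text \<open>In the larger arc group \<open>X 1\<close> is conjugate to \<open>X 0\<close>, and with
  \<open>X_rec\<close> all \<open>X n\<close> are congruent to \<open>X 0\<close> modulo
  commutators. A word is then congruent to \<open>X 0\<close> to the power of its exponent sum,
  which is its shift and equals 0 for an element trivial near \<open>1/2\<close>.\<close>

lemma Fix_half_derived:
  assumes u: "u \<in> dyadic" "u < 0" "-1/2 \<le> u" and f: "f \<in> Fix 0 q" "q < 1/2"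
  shows "f \<in> derived thompson_T_lift (Fix u (1/2))"
proof -
  let ?L = "Fix u (1/2)"
  have sub: "Fix 0 (1/2) \<subseteq> ?L" by (rule Fix_mono) (use u in simp_all)
  have XL: "X n \<in> ?L" for n using X_Fix sub by blast
  note pc = TLg.pcong_conj[OF Fix_subgroup XL[of 0]]
  obtain \<tau> where t: "\<tau> \<in> ?L" "X 1 = cj \<tau> (X 0)" using X1_conj[OF u] by blast
  have X1: "TLg.pcong ?L (X 0) (X (Suc n)) 1" for n
  proof (induction n)
    case 0
    show ?case using pc[OF TLg.pcong_self[OF Fix_subgroup XL[of 0]] t(1)] 
      unfolding cj_group[OF Fix_TL[OF t(1)], symmetric] t(2)[symmetric] One_nat_def .
  next
    case (Suc n)
    show ?case unfolding X_rec cj_group[OF X_TL] by (rule pc[OF Suc XL])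
  qed
  have Xn: "TLg.pcong ?L (X 0) (X n) 1" for n
    using X1 TLg.pcong_self[OF Fix_subgroup XL[of 0]] by (cases n) (simp_all only:)
  obtain h where h: "h \<in> Fh" "f = Theta h" "shift h 0" using Theta_surj[of f] Fix_mono[of 0 0 q "1/2"] f by force
  have "\<exists>c. shift h c \<and> TLg.pcong ?L (X 0) (Theta h) c" using Fh_DG[OF h(1)]
  proof (induction rule: DG_induct)
    case I
    show ?case unfolding Theta_id using TLg.pcong_one[OF Fix_subgroup XL[of 0]] shift_id unfolding one_lift by blast
  next
    case (D g n)
    then obtain c where "shift g c" "TLg.pcong ?L (X 0) (Theta g) c" by blast
    then have "shift (Dn n \<circ> g) (1 + c)" "TLg.pcong ?L (X 0) (X n \<circ> Theta g) (1 + c)"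
      using shift_comp[OF shift_Dn] TLg.pcong_mult[OF Fix_subgroup XL[of 0] Xn] unfolding mult_lift by blast+
    then show ?case unfolding Theta_comp[OF Dn_Fh DG_Fh[OF D.hyps]] by blast
  next
    case (E g n)
    then obtain c where "shift g c" "TLg.pcong ?L (X 0) (Theta g) c" by blast
    then have "shift (En n \<circ> g) (- 1 + c)" "TLg.pcong ?L (X 0) (Theta (En n) \<circ> Theta g) (- 1 + c)"
      using shift_comp[OF shift_En] TLg.pcong_mult[OF Fix_subgroup XL[of 0] TLg.pcong_inv[OF Fix_subgroup XL[of 0] Xn]]
      unfolding mult_lift Theta_En by blast+
    then show ?case unfolding Theta_comp[OF En_Fh DG_Fh[OF E.hyps]] by blast
  qed
  then obtain c where "shift h c" "TLg.pcong ?L (X 0) (Theta h) c" by blast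
  moreover have "c = 0" using shift_unique[OF \<open>shift h c\<close> h(3)] .
  ultimately have "TLg.pcong ?L (X 0) (Theta h) 0" by (simp only:)
  then show ?thesis unfolding h(2) by (rule TLg.pcong_0[OF Fix_subgroup XL[of 0]])
qed

section \<open>Perfectness and displacement inside an arc\<close>

lemma dyadic_mid: "x \<in> dyadic \<Longrightarrow> y \<in> dyadic \<Longrightarrow> (x + y) / 2 \<in> dyadic"
  by simp

text \<open>An arc from \<open>a\<close> to \<open>b\<close> around the support is conjugated to the
  standard one. The point \<open>m\<close> to its left supplies the room for
  \<open>Fix_half_derived\<close>, and \<open>b < m + 1\<close> keeps its preimage above
  \<open>-1/2\<close>.\<close>

lemma Fix_derived:
  assumes d: "u \<in> dyadic" "p \<in> dyadic" "q \<in> dyadic" "v \<in> dyadic"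
    and le: "u < p" "p < q" "q < v" "v \<le> u + 1" and f: "f \<in> Fix p q"
  shows "\<exists>m b. m \<in> dyadic \<and> b \<in> dyadic \<and> u < m \<and> m < b \<and> b < v \<and> f \<in> derived thompson_T_lift (Fix m b)"
proof -
  define a b m where "a = (u + p) / 2" and "b = (q + v) / 2" and "m = (u + a) / 2"
  have ab: "u < m" "m < a" "a < p" "q < b" "b < v" by (auto simp: a_def b_def m_def field_simps le)
  have dd: "a \<in> dyadic" "b \<in> dyadic" "m \<in> dyadic" using d dyadic_mid by (auto simp: a_def b_def m_def)
  obtain \<tau> where t: "\<tau> \<in> TL" "\<tau> 0 = a" "\<tau> (1/2) = b"
    using TL_move[of 0 "1/2" a b] dd ab le dyadic_half_power[of 1] by auto
  define i where "i = Hilbert_Choice.inv \<tau>"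
  have ti: "\<tau> (i x) = x" for x unfolding i_def by (rule TL_inv_apply(2)[OF t(1)])
  have iTL: "i \<in> TL" unfolding i_def by (rule TL_inv[OF t(1)])
  have lt: "x < y" if "\<tau> x < \<tau> y" for x y using that TL_less_iff[OF t(1)] by blast
  have "\<tau> (-1/2 + 1) = \<tau> (-1/2) + 1" by (rule TL_step[OF t(1)])
  then have h: "\<tau> (-1/2) = b - 1" using t(3) by simp
  have 1: "i m < 0" by (rule lt) (use ti t ab in simp)
  have 2: "-1/2 < i m" by (rule lt) (use ti h ab le in simp)
  have 3: "0 < i p" by (rule lt) (use ti t ab in simp)
  have 4: "i q < 1/2" by (rule lt) (use ti t ab in simp)
  have 5: "i m \<in> dyadic" using TL_dyadic_iff[OF iTL] dd by blast
  have "cj i f \<in> Fix (i p) (i q)" using cj_Fix[OF iTL, of p q] f by blast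
  then have "cj i f \<in> Fix 0 (i q)" using Fix_mono[of 0 "i p" "i q" "i q"] 3 by auto
  then have "cj i f \<in> derived thompson_T_lift (Fix (i m) (1/2))"
    using Fix_half_derived[OF 5 1 less_imp_le[OF 2] _ 4] by blast
  moreover have "cj \<tau> ` derived thompson_T_lift (Fix (i m) (1/2)) \<subseteq> derived thompson_T_lift (cj \<tau> ` Fix (i m) (1/2))"
    by (rule group_hom.derived_image[OF cj_hom[OF t(1)] subgroup.subset[OF Fix_subgroup]])
  ultimately have "cj \<tau> (cj i f) \<in> derived thompson_T_lift (Fix m b)"
    unfolding cj_Fix[OF t(1)] ti t(3) by blast
  then have "f \<in> derived thompson_T_lift (Fix m b)" unfolding i_def cj_inverse[OF t(1)] .
  then show ?thesis using dd ab le by (intro exI[of _ m] exI[of _ b]) auto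
qed

text \<open>The slopes at the ends of the arc are homomorphisms from \<open>Fix u v\<close> to a
  copy of \<open>\<int>\<close>. They vanish on supports in smaller arcs, and the union over all
  smaller arcs is perfect.\<close>

definition Lc :: "real \<Rightarrow> real \<Rightarrow> (real \<Rightarrow> real) set" where
  "Lc u v = (\<Union>(p, q) \<in> {(p, q). p \<in> dyadic \<and> q \<in> dyadic \<and> u < p \<and> p < q \<and> q < v}. Fix p q)"

lemma LcI: "p \<in> dyadic \<Longrightarrow> q \<in> dyadic \<Longrightarrow> u < p \<Longrightarrow> p < q \<Longrightarrow> q < v \<Longrightarrow> f \<in> Fix p q \<Longrightarrow> f \<in> Lc u v"
  unfolding Lc_def by blast

lemma Lc_common:
  assumes "f \<in> Lc u v" "g \<in> Lc u v"
  shows "\<exists>p q. p \<in> dyadic \<and> q \<in> dyadic \<and> u < p \<and> p < q \<and> q < v \<and> f \<in> Fix p q \<and> g \<in> Fix p q"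
proof -
  obtain p q p' q' where *: "p \<in> dyadic" "q \<in> dyadic" "u < p" "p < q" "q < v" "f \<in> Fix p q"
    "p' \<in> dyadic" "q' \<in> dyadic" "u < p'" "p' < q'" "q' < v" "g \<in> Fix p' q'"
    using assms unfolding Lc_def by blast
  have "f \<in> Fix (min p p') (max q q')" "g \<in> Fix (min p p') (max q q')"
    using *(6,12) Fix_mono[of "min p p'" p q "max q q'"] Fix_mono[of "min p p'" p' q' "max q q'"] by auto
  moreover have "min p p' \<in> dyadic" "max q q' \<in> dyadic" using * by (auto simp: min_def max_def)
  ultimately show ?thesis using * by (intro exI[of _ "min p p'"] exI[of _ "max q q'"]) auto
qed

lemma Lc_subgroup:
  assumes d: "u \<in> dyadic" "v \<in> dyadic" "u < v"
  shows "subgroup (Lc u v) thompson_T_lift"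
proof (rule TLg.subgroupI)
  define m where "m = (u + v) / 2"
  have m: "m \<in> dyadic" "u < m" "m < v" using d by (auto simp: m_def)
  have "id \<in> Lc u v"
    by (rule LcI[of "(u + m) / 2" m]) (use m d id_Fix in auto)
  then show "Lc u v \<noteq> {}" by blast
  show "Lc u v \<subseteq> carrier thompson_T_lift" unfolding Lc_def carrier_lift using Fix_TL by blast
  show "inv\<^bsub>thompson_T_lift\<^esub> a \<in> Lc u v" if "a \<in> Lc u v" for a
  proof -
    obtain p q where pq: "p \<in> dyadic" "q \<in> dyadic" "u < p" "p < q" "q < v" "a \<in> Fix p q"
      using \<open>a \<in> Lc u v\<close> unfolding Lc_def by blast
    show ?thesis by (rule LcI[OF pq(1-5) subgroup.m_inv_closed[OF Fix_subgroup pq(6)]])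
  qed
  show "a \<otimes>\<^bsub>thompson_T_lift\<^esub> b \<in> Lc u v" if ab: "a \<in> Lc u v" "b \<in> Lc u v" for a b
  proof -
    obtain p q where pq: "p \<in> dyadic" "q \<in> dyadic" "u < p" "p < q" "q < v" "a \<in> Fix p q" "b \<in> Fix p q"
      using Lc_common[OF ab] by blast
    show ?thesis by (rule LcI[OF pq(1-5) subgroup.m_closed[OF Fix_subgroup pq(6,7)]])
  qed
qed

lemma Lc_perfect:
  assumes d: "u \<in> dyadic" "v \<in> dyadic" and le: "v \<le> u + 1"
  shows "Lc u v \<subseteq> derived thompson_T_lift (Lc u v)"
proof
  fix f assume "f \<in> Lc u v"
  then obtain p q where pq: "p \<in> dyadic" "q \<in> dyadic" "u < p" "p < q" "q < v" "f \<in> Fix p q"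
    unfolding Lc_def by blast
  obtain m b where mb: "m \<in> dyadic" "b \<in> dyadic" "u < m" "m < b" "b < v" "f \<in> derived thompson_T_lift (Fix m b)"
    using Fix_derived[OF d(1) pq(1,2) d(2) pq(3-5) le pq(6)] by blast
  have "Fix m b \<subseteq> Lc u v" using LcI[OF mb(1-5)] by blast
  then show "f \<in> derived thompson_T_lift (Lc u v)" using TLg.mono_derived mb(6) by blast
qed

text \<open>\<open>t\<close> moves \<open>p\<close> to \<open>q\<close>, so every positive power
  pushes the common support beyond \<open>q\<close>, yet not past \<open>v'\<close>, which is below
  \<open>p + 1\<close>. The conjugate of \<open>b\<close> then lives on an arc disjoint from that of
  \<open>c\<close>.\<close>

lemma Lc_displace:
  assumes d: "u \<in> dyadic" "v \<in> dyadic" and le: "v \<le> u + 1" and b: "b \<in> Lc u v" and c: "c \<in> Lc u v"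
  shows "\<exists>t\<in>Lc u v. \<forall>N>0::nat. (t [^]\<^bsub>thompson_T_lift\<^esub> N \<otimes>\<^bsub>thompson_T_lift\<^esub> b \<otimes>\<^bsub>thompson_T_lift\<^esub> inv\<^bsub>thompson_T_lift\<^esub> (t [^]\<^bsub>thompson_T_lift\<^esub> N)) \<otimes>\<^bsub>thompson_T_lift\<^esub> c
    = c \<otimes>\<^bsub>thompson_T_lift\<^esub> (t [^]\<^bsub>thompson_T_lift\<^esub> N \<otimes>\<^bsub>thompson_T_lift\<^esub> b \<otimes>\<^bsub>thompson_T_lift\<^esub> inv\<^bsub>thompson_T_lift\<^esub> (t [^]\<^bsub>thompson_T_lift\<^esub> N))"
proof -
  obtain p q where pq: "p \<in> dyadic" "q \<in> dyadic" "u < p" "p < q" "q < v" "b \<in> Fix p q" "c \<in> Fix p q"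
    using Lc_common[OF b c] by blast
  define u' v' where "u' = (u + p) / 2" and "v' = (q + v) / 2"
  have uv: "u < u'" "u' < p" "q < v'" "v' < v" by (auto simp: u'_def v'_def pq)
  have dd: "u' \<in> dyadic" "v' \<in> dyadic" using d pq by (auto simp: u'_def v'_def)
  have v'u': "v' \<le> u' + 1" using uv le by linarith
  obtain t where t: "t \<in> Fix u' v'" "t p = q" using Fix_move[OF dd pq(1,2) v'u'] uv pq by auto
  have tN: "t [^]\<^bsub>thompson_T_lift\<^esub> (N::nat) \<in> Fix u' v'" for N
  proof (induction N)
    case 0
    show ?case unfolding nat_pow_0 one_lift by (rule id_Fix)
  next
    case (Suc N)
    show ?case unfolding nat_pow_Suc mult_lift by (rule Fix_comp[OF Suc t(1)])
  qed
  have tTL: "t \<in> TL" by (rule Fix_TL[OF t(1)])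
  have low: "q \<le> (t [^]\<^bsub>thompson_T_lift\<^esub> (Suc N)) p" for N
  proof (induction N)
    case (Suc N)
    have "(t [^]\<^bsub>thompson_T_lift\<^esub> (Suc N)) p \<le> (t [^]\<^bsub>thompson_T_lift\<^esub> (Suc N)) q"
      unfolding TL_le_iff[OF Fix_TL[OF tN]] using pq(4) by simp
    also have "\<dots> = (t [^]\<^bsub>thompson_T_lift\<^esub> (Suc (Suc N))) p"
      unfolding nat_pow_Suc[of _ _ "Suc N"] mult_lift o_apply t(2) by (rule refl)
    finally show ?case using Suc by (rule order_trans[rotated])
  qed (use t in simp)
  have "(t [^]\<^bsub>thompson_T_lift\<^esub> N \<otimes>\<^bsub>thompson_T_lift\<^esub> b \<otimes>\<^bsub>thompson_T_lift\<^esub> inv\<^bsub>thompson_T_lift\<^esub> (t [^]\<^bsub>thompson_T_lift\<^esub> N)) \<otimes>\<^bsub>thompson_T_lift\<^esub> c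
    = c \<otimes>\<^bsub>thompson_T_lift\<^esub> (t [^]\<^bsub>thompson_T_lift\<^esub> N \<otimes>\<^bsub>thompson_T_lift\<^esub> b \<otimes>\<^bsub>thompson_T_lift\<^esub> inv\<^bsub>thompson_T_lift\<^esub> (t [^]\<^bsub>thompson_T_lift\<^esub> N))" if "N > 0" for N :: nat
  proof -
    define s where "s = t [^]\<^bsub>thompson_T_lift\<^esub> N"
    have s: "s \<in> Fix u' v'" unfolding s_def by (rule tN)
    have "q \<le> s p" using low[of "N - 1"] that by (simp add: s_def)
    moreover have "s q \<le> v'" by (rule Fix_range(2)[OF s v'u']) (use uv pq in auto)
    moreover have "cj s b \<in> Fix (s p) (s q)" using cj_Fix[OF Fix_TL[OF s], of p q] pq(6) by blast
    ultimately have "cj s b \<in> Fix q (p + 1)" using Fix_mono[of q "s p" "s q" "p + 1"] uv le pq by auto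
    then have "c \<circ> cj s b = cj s b \<circ> c" by (rule Fix_commute[OF pq(7)]) (use pq le in auto)
    then show ?thesis unfolding s_def[symmetric] cj_group[OF Fix_TL[OF s], symmetric] unfolding mult_lift by (rule sym)
  qed
  moreover have "t \<in> Lc u v" by (rule LcI[OF dd _ _ _ t(1)]) (use uv pq in auto)
  ultimately show ?thesis by blast
qed

section \<open>Translations\<close>

abbreviation (input) tr :: "real \<Rightarrow> real \<Rightarrow> real" where
  "tr q \<equiv> \<lambda>x. x + q"

lemma tr_nat_pow: "tr q [^]\<^bsub>thompson_T_lift\<^esub> (n::nat) = tr (real n * q)"
proof (induction n)
  case 0
  show ?case unfolding nat_pow_0 one_lift by (rule ext) simp
next
  case (Suc n)
  show ?case unfolding nat_pow_Suc mult_lift Suc by (rule ext) (simp add: algebra_simps)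
qed

lemma tr_inv: "q \<in> dyadic \<Longrightarrow> inv\<^bsub>thompson_T_lift\<^esub> (tr q) = tr (- q)"
  by (rule TLg.inv_equality) (use TL_translation[of q] TL_translation[of "- q"] in \<open>simp_all add: fun_eq_iff\<close>)

lemma tr_int_pow: "q \<in> dyadic \<Longrightarrow> tr q [^]\<^bsub>thompson_T_lift\<^esub> (n::int) = tr (of_int n * q)"
proof (cases "n < 0")
  case True
  assume q: "q \<in> dyadic"
  have "real (nat (- n)) * q \<in> dyadic" using q by (intro dyadic_mult) simp
  then have e: "inv\<^bsub>thompson_T_lift\<^esub> (tr (real (nat (- n)) * q)) = tr (- (real (nat (- n)) * q))" by (rule tr_inv)
  have r: "- (real (nat (- n)) * q) = of_int n * q" using True by simp
  show ?thesis unfolding int_pow_def2 tr_nat_pow if_P[OF True] e r by (rule refl)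
next
  case False
  then show ?thesis unfolding int_pow_def2 tr_nat_pow by simp
qed

section \<open>Actions of the lift on median graphs\<close>

lemma Fix_shift: "h \<in> Fix u v \<Longrightarrow> h \<in> Fix (u + 1) (v + 1)"
proof -
  assume h: "h \<in> Fix u v"
  have "h x = x" if "v + 1 \<le> x" "x \<le> u + 1 + 1" for x
    using TL_step[OF Fix_TL[OF h], of "x - 1"] Fix_id[OF h, of "x - 1"] that by simp
  then show ?thesis using Fix_TL[OF h] unfolding Fix_def by blast
qed

locale lift_action = median_action thompson_T_lift V adj \<phi> for V :: "'v set" and adj and \<phi>
begin

text \<open>A dyadic translation has a root of order \<open>2 ^ m\<close> in the lift for every
  \<open>m\<close>.\<close>

lemma Hp_tr:
  assumes q: "q \<in> dyadic"
  shows "Hp (tr q) = {}"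
proof (rule Hp_empty_if_roots)
  fix m :: nat
  have d: "q / 2 ^ m \<in> dyadic" using q by (rule dyadic_div_power)
  have "tr q = tr (q / 2 ^ m) [^]\<^bsub>thompson_T_lift\<^esub> int (2 ^ m)" unfolding tr_int_pow[OF d] by simp
  moreover have "m \<le> 2 ^ m" by (rule less_imp_le[OF less_exp])
  moreover have "tr (q / 2 ^ m) \<in> carrier thompson_T_lift" using TL_translation[OF d] by simp
  ultimately show "\<exists>s\<in>carrier thompson_T_lift. \<exists>N\<ge>m. tr q = s [^]\<^bsub>thompson_T_lift\<^esub> int N" by blast
qed

text \<open>A positive power of \<open>tr 1\<close> fixes a vertex, and the powers of a non-trivial
  translation are pairwise distinct.\<close>

lemma not_proper: "\<exists>y\<in>V. infinite (stabilizer thompson_T_lift \<phi> y)"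
proof -
  have c: "tr q \<in> carrier thompson_T_lift" if "q \<in> dyadic" for q using TL_translation[OF that] by simp
  have d1: "(1::real) \<in> dyadic" by simp
  obtain N y where N: "N > (0::nat)" "y \<in> V" "\<phi> (tr 1 [^]\<^bsub>thompson_T_lift\<^esub> int N) y = y"
    using Hp_empty_fixed_vertex[OF c[OF d1] Hp_tr[OF d1]] by (elim exE conjE bexE)
  define z where "z = tr (real N)"
  have z: "z \<in> carrier thompson_T_lift" "\<phi> z y = y" using N(3) c[of "real N"] unfolding tr_int_pow[OF d1] z_def by simp_all
  have zm: "z [^]\<^bsub>thompson_T_lift\<^esub> (m::nat) \<in> stabilizer thompson_T_lift \<phi> y" for m
    unfolding stabilizer_def mem_Collect_eq
  proof (induction m)
    case (Suc m)
    then have m: "z [^]\<^bsub>thompson_T_lift\<^esub> m \<in> carrier thompson_T_lift" "\<phi> (z [^]\<^bsub>thompson_T_lift\<^esub> m) y = y" by blast+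
    show ?case unfolding nat_pow_Suc act_mult[OF m(1) z(1) N(2)] z(2) m(2)
      using TLg.m_closed[OF m(1) z(1)] by (rule conjI) (rule refl)
  next
    case 0
    show ?case unfolding nat_pow_0 using TLg.one_closed act_one[OF N(2)] by (rule conjI)
  qed
  have "inj (\<lambda>m::nat. z [^]\<^bsub>thompson_T_lift\<^esub> m)"
  proof (rule injI)
    fix m m' :: nat assume "z [^]\<^bsub>thompson_T_lift\<^esub> m = z [^]\<^bsub>thompson_T_lift\<^esub> m'"
    then have "tr (real m * real N) 0 = tr (real m' * real N) 0" unfolding z_def tr_nat_pow by (rule fun_cong)
    then show "m = m'" using N(1) by simp
  qed
  then have i: "infinite (range (\<lambda>m::nat. z [^]\<^bsub>thompson_T_lift\<^esub> m))" by (rule range_inj_infinite)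
  have "range (\<lambda>m::nat. z [^]\<^bsub>thompson_T_lift\<^esub> m) \<subseteq> stabilizer thompson_T_lift \<phi> y"
    by (rule image_subsetI) (rule zm)
  then have "infinite (stabilizer thompson_T_lift \<phi> y)" using i by (rule infinite_super)
  then show ?thesis using N(2) by (rule bexI)
qed

lemma Hp_conj:
  assumes g: "g \<in> TL" and k: "k \<in> TL" and h: "h \<in> Hp k"
  shows "hact g h \<in> Hp (cj g k)"
proof -
  interpret cjh: group_hom thompson_T_lift thompson_T_lift "cj g" by (rule cj_hom[OF g])
  have gG: "g \<in> carrier thompson_T_lift" and kG: "k \<in> carrier thompson_T_lift" using g k by simp_all
  have hV: "h \<subseteq> V" using Hp_Hs[OF h] Hs_subset by blast
  obtain y where y: "y \<in> V" using nonempty by auto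
  obtain N M where NM: "\<forall>n\<ge>N. pw k n y \<in> h" "\<forall>n\<le>M. pw k n y \<notin> h" using Hp_limits[OF kG h y] by blast
  have eq: "pw (cj g k) n (\<phi> g y) = \<phi> g (pw k n y)" for n
  proof -
    define K where "K = k [^]\<^bsub>thompson_T_lift\<^esub> n"
    have K: "K \<in> carrier thompson_T_lift" unfolding K_def by (rule TLg.int_pow_closed[OF kG])
    have p: "cj g k [^]\<^bsub>thompson_T_lift\<^esub> n = cj g K" unfolding K_def by (rule cjh.hom_int_pow[OF kG, symmetric])
    have "cj g K \<otimes>\<^bsub>thompson_T_lift\<^esub> g = g \<otimes>\<^bsub>thompson_T_lift\<^esub> K"
      unfolding cj_group[OF g] using gG K by (simp add: TLg.m_assoc del: carrier_lift mult_lift one_lift)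
    then have "\<phi> (cj g K) (\<phi> g y) = \<phi> g (\<phi> K y)"
      unfolding act_mult[OF cjh.hom_closed[OF K] gG y, symmetric] act_mult[OF gG K y, symmetric] by (rule arg_cong)
    then show ?thesis unfolding p unfolding K_def .
  qed
  have m: "pw (cj g k) n (\<phi> g y) \<in> hact g h \<longleftrightarrow> pw k n y \<in> h" for n
    unfolding eq by (rule act_mem[OF gG hV]) (intro act_closed TLg.int_pow_closed kG y)
  have "\<exists>N. \<forall>n\<ge>N. pw (cj g k) n (\<phi> g y) \<in> hact g h" unfolding m by (rule exI, rule NM(1))
  moreover have "\<exists>M. \<forall>n\<le>M. pw (cj g k) n (\<phi> g y) \<notin> hact g h" unfolding m by (rule exI, rule NM(2))
  ultimately show ?thesis unfolding Hp_def mem_Collect_eq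
    by (intro conjI[OF hact_Hs[OF gG Hp_Hs[OF h]]] bexI[OF _ act_closed[OF gG y]] conjI)
qed

section \<open>Actions on median graphs of bounded dimension\<close>

context
  fixes n
  assumes dim: "\<not> has_induced_cube V adj (Suc n)"
begin

text \<open>An element of an arc with a halfspace in \<open>Hp\<close> would have conjugates on \<open>n + 1\<close> disjoint arcs,
  each fixing the halfspaces of the others, hence an \<open>n + 1\<close>-cube.\<close>

lemma Fix_Hp:
  assumes d: "a \<in> dyadic" "b \<in> dyadic" and ab: "a < b" "b < a + 1" and k: "k \<in> Fix a b"
  shows "Hp k = {}"
proof (rule ccontr)
  assume "Hp k \<noteq> {}"
  then obtain h where h: "h \<in> Hp k" by auto
  \<comment> \<open>The arcs from \<open>A i\<close> to \<open>B i\<close> will be every second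
    interval of width \<open>e\<close>. As \<open>2 ^ (2 * n + 3)\<close> exceeds
    \<open>2 * n + 3\<close>, all \<open>n + 1\<close> of them fit strictly between 0 and 1.\<close>
  define e where "e = (1::real) / 2 ^ (2 * n + 3)"
  have e0: "e > 0" and ed: "e \<in> dyadic" unfolding e_def by (simp, intro dyadic_div_power) simp
  have "real (2 * n + 3) < 2 ^ (2 * n + 3)" using of_nat_less_iff[of "2 * n + 3" "2 ^ (2 * n + 3)", where 'a = real] less_exp[of "2 * n + 3"] by simp
  then have e1: "real (2 * n + 3) * e < 1" unfolding e_def by simp
  define A B where "A i = real (2 * i + 1) * e" and "B i = real (2 * i + 2) * e" for i
  have AB: "A i \<in> dyadic" "B i \<in> dyadic" "0 < A i" "A i < B i" for i
    using ed e0 by (auto simp: A_def B_def)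
  have B1: "B i < 1" if "i < Suc n" for i
  proof -
    have "B i \<le> real (2 * n + 3) * e" unfolding B_def by (rule mult_right_mono) (use that e0 in auto)
    then show ?thesis using e1 by simp
  qed
  have BA: "B i < A j" if "i < j" for i j
    unfolding A_def B_def by (rule mult_strict_right_mono) (use that e0 in auto)
  have "\<exists>t\<in>TL. t a = A i \<and> t b = B i" if "i < Suc n" for i
    by (rule TL_move) (use d ab AB[of i] B1[OF that] in auto)
  then obtain t where t: "\<And>i. i < Suc n \<Longrightarrow> t i \<in> TL \<and> t i a = A i \<and> t i b = B i" by metis
  define K where "K i = cj (t i) k" for i
  have K: "K i \<in> Fix (A i) (B i)" if "i < Suc n" for i
    using cj_Fix[of "t i" a b] t[OF that] k unfolding K_def by (metis imageI)
  have "has_induced_cube V adj (Suc n)"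
  proof (rule independent_Hp_cube[of "Suc n" K "\<lambda>i. hact (t i) h"])
    show "K i \<in> carrier thompson_T_lift" if "i < Suc n" for i using Fix_TL[OF K[OF that]] by simp
    show H: "hact (t i) h \<in> Hp (K i)" if "i < Suc n" for i
      unfolding K_def by (rule Hp_conj[OF _ Fix_TL[OF k] h]) (use t[OF that] in blast)
    show "hact (K j) (hact (t i) h) = hact (t i) h" if ij: "i < Suc n" "j < Suc n" "i \<noteq> j" for i j
    \<comment> \<open>The arc from \<open>B i\<close> to \<open>A i + 1\<close> is complementary to
      the support of \<open>K i\<close>: its group commutes with \<open>K i\<close> and contains
      \<open>K j\<close>.\<close>
    proof (rule perfect_displacing_fixes_Hp[where L = "Lc (B i) (A i + 1)" and k = "K i"])
      have BAi: "B i < A i + 1" using AB(3)[of i] B1[OF ij(1)] by simp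
      have Ad: "A i + 1 \<in> dyadic" using AB(1) by simp
      have le: "A i + 1 \<le> B i + 1" using AB(4)[of i] by simp
      show "K i \<in> carrier thompson_T_lift" using Fix_TL[OF K[OF ij(1)]] by simp
      show "subgroup (Lc (B i) (A i + 1)) thompson_T_lift" by (rule Lc_subgroup[OF AB(2) Ad BAi])
      show "Lc (B i) (A i + 1) \<subseteq> derived thompson_T_lift (Lc (B i) (A i + 1))" by (rule Lc_perfect[OF AB(2) Ad le])
      show "hact (t i) h \<in> Hp (K i)" by (rule H[OF ij(1)])
      show "l \<otimes>\<^bsub>thompson_T_lift\<^esub> K i = K i \<otimes>\<^bsub>thompson_T_lift\<^esub> l" if l: "l \<in> Lc (B i) (A i + 1)" for l
      proof -
        obtain p q where pq: "B i < p" "q < A i + 1" "l \<in> Fix p q" using Lc_common[OF l l] by blast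
        then have "l \<in> Fix (B i) (A i + 1)" using Fix_mono[of "B i" p q "A i + 1"] by auto
        then have "K i \<circ> l = l \<circ> K i" by (rule Fix_commute[OF K[OF ij(1)]]) (use AB(4)[of i] BAi in auto)
        then show ?thesis unfolding mult_lift by (rule sym)
      qed
      show "K j \<in> Lc (B i) (A i + 1)"
      proof (cases "i < j")
        case True
        show ?thesis by (rule LcI[OF AB(1) AB(2) BA[OF True] AB(4) _ K[OF ij(2)]]) (use B1[OF ij(2)] AB(3)[of i] in simp)
      next
        case False
        then have ji: "j < i" using ij by simp
        \<comment> \<open>An arc that precedes \<open>A i\<close> is seen one period later, where it
          lies between \<open>B i\<close> and \<open>A i + 1\<close>.\<close>
        show ?thesis
          by (rule LcI[OF _ _ _ _ _ Fix_shift[OF K[OF ij(2)]]])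
            (use AB(1,2)[of j] AB(3,4)[of j] B1[OF ij(1)] BA[OF ji] in auto)
      qed
      fix f g assume bc: "f \<in> Lc (B i) (A i + 1)" "g \<in> Lc (B i) (A i + 1)"
      show "\<exists>t\<in>Lc (B i) (A i + 1). \<forall>N>0::nat. (t [^]\<^bsub>thompson_T_lift\<^esub> N \<otimes>\<^bsub>thompson_T_lift\<^esub> f \<otimes>\<^bsub>thompson_T_lift\<^esub> inv\<^bsub>thompson_T_lift\<^esub> (t [^]\<^bsub>thompson_T_lift\<^esub> N)) \<otimes>\<^bsub>thompson_T_lift\<^esub> g
    = g \<otimes>\<^bsub>thompson_T_lift\<^esub> (t [^]\<^bsub>thompson_T_lift\<^esub> N \<otimes>\<^bsub>thompson_T_lift\<^esub> f \<otimes>\<^bsub>thompson_T_lift\<^esub> inv\<^bsub>thompson_T_lift\<^esub> (t [^]\<^bsub>thompson_T_lift\<^esub> N))"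
        by (rule Lc_displace[OF AB(2) Ad le bc])
    qed
  qed
  then show False using dim by blast
qed

lemma Fix_bounded:
  assumes "a \<in> dyadic" "b \<in> dyadic" "a < b" "b < a + 1" and x: "x \<in> V"
  shows "\<exists>B. \<forall>w\<in>Fix a b. d x (\<phi> w x) \<le> B"
proof -
  obtain S where S: "finite S" "S \<subseteq> Fix a b" "generate thompson_T_lift S = Fix a b"
    using Fix_generate[OF assms(1-4)] by blast
  have c: "S \<subseteq> carrier thompson_T_lift" using S(2) Fix_TL by auto
  have e: "Hp k = {}" if "k \<in> generate thompson_T_lift S" for k
    by (rule Fix_Hp[OF assms(1-4)]) (use that in \<open>simp only: S(3)\<close>)
  show ?thesis using bounded_orbit_generate[OF dim S(1) c e x] unfolding S(3) .
qed

lemma tr_bounded: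
  assumes q: "q \<in> dyadic" and x: "x \<in> V"
  shows "\<exists>B. \<forall>i::int. d x (\<phi> (tr (of_int i * q)) x) \<le> B"
proof -
  have c: "tr q \<in> carrier thompson_T_lift" using TL_translation[OF q] by simp
  have g: "generate thompson_T_lift {tr q} = {tr (of_int i * q) | i. i \<in> UNIV}"
    unfolding TLg.generate_pow[OF c] tr_int_pow[OF q] by (rule refl)
  have e: "Hp k = {}" if kg: "k \<in> generate thompson_T_lift {tr q}" for k
  proof -
    obtain i :: int where k: "k = tr (of_int i * q)" using kg unfolding g by blast
    have "of_int i * q \<in> dyadic" by (rule dyadic_mult[OF _ q]) simp
    then show ?thesis unfolding k by (rule Hp_tr)
  qed
  have "{tr q} \<subseteq> carrier thompson_T_lift" using c by blast
  from bounded_orbit_generate[OF dim _ this e x] show ?thesis unfolding g by blast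
qed

lemma d_comp:
  assumes x: "x \<in> V" and f: "f \<in> TL" "d x (\<phi> f x) \<le> A" and g: "g \<in> TL" "d x (\<phi> g x) \<le> B"
  shows "d x (\<phi> (f \<circ> g) x) \<le> A + B"
proof -
  have c: "f \<in> carrier thompson_T_lift" "g \<in> carrier thompson_T_lift" using f g by simp_all
  have e: "\<phi> (f \<circ> g) x = \<phi> f (\<phi> g x)" using act_mult[OF c x] unfolding mult_lift .
  have "d x (\<phi> f (\<phi> g x)) \<le> d x (\<phi> f x) + d (\<phi> f x) (\<phi> f (\<phi> g x))"
    by (rule dist_triangle) (intro act_closed c x)+
  then show ?thesis unfolding e using dist_act[OF c(1) x act_closed[OF c(2) x]] f g by linarith
qed

text \<open>\<open>TL_decomposition\<close> writes every element as five factors from sets of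
  bounded displacement at \<open>x\<close>, and displacements add up.\<close>

lemma finite_orbit: "\<exists>v\<in>V. finite (orbit thompson_T_lift \<phi> v)"
proof -
  obtain x where x: "x \<in> V" using nonempty by auto
  have q: "(1/4 :: real) \<in> dyadic" "(1/2 :: real) \<in> dyadic" "(-1/8 :: real) \<in> dyadic" "(13/16 :: real) \<in> dyadic"
    "(-3/8 :: real) \<in> dyadic" "(9/16 :: real) \<in> dyadic"
    using dyadic_div_power[of 1 2] dyadic_div_power[of 1 1] dyadic_div_power[of "-1" 3] dyadic_div_power[of 13 4]
      dyadic_div_power[of "-3" 3] dyadic_div_power[of 9 4] by simp_all
  obtain R where R: "\<And>i::int. d x (\<phi> (tr (of_int i * (1/4))) x) \<le> R" using tr_bounded[OF q(1) x] by blast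
  obtain B1 where B1: "\<forall>w\<in>Fix (-1/8) (13/16). d x (\<phi> w x) \<le> B1" using Fix_bounded[OF q(3,4) _ _ x] by auto
  obtain B2 where B2: "\<forall>w\<in>Fix (-3/8) (9/16). d x (\<phi> w x) \<le> B2" using Fix_bounded[OF q(5,6) _ _ x] by auto
  obtain B3 where B3: "\<forall>w\<in>Fix 0 (1/2). d x (\<phi> w x) \<le> B3" using Fix_bounded[OF dyadic_numeral(1) q(2) _ _ x] by auto
  obtain B4 where B4: "\<forall>w\<in>Fix (1/2) 1. d x (\<phi> w x) \<le> B4" using Fix_bounded[OF q(2) _ _ _ x, of 1] by auto
  have T: "tr (of_int i / 4) \<in> TL" for i :: int by (intro TL_translation) simp
  have Rq: "d x (\<phi> (tr (of_int i / 4)) x) \<le> R" for i :: int using R[of i] by simp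
  have bd: "d x (\<phi> f x) \<le> R + max B1 B2 + R + B3 + B4" if fT: "f \<in> TL" for f
  proof -
    obtain i e :: int and s g h where f: "f = tr (of_int i / 4) \<circ> s \<circ> tr (of_int e / 4) \<circ> g \<circ> h"
      and s: "s \<in> Fix (-1/8) (13/16) \<union> Fix (-3/8) (9/16)" and g: "g \<in> Fix 0 (1/2)" and h: "h \<in> Fix (1/2) 1"
      using TL_decomposition[OF fT] by blast
    have sB: "d x (\<phi> s x) \<le> max B1 B2" using s B1 B2 by (auto simp: le_max_iff_disj)
    have sT: "s \<in> TL" using s Fix_TL by blast
    show ?thesis unfolding f
      by (intro d_comp[OF x] TL_comp T sT Fix_TL[OF g] Fix_TL[OF h] Rq sB B3[rule_format, OF g] B4[rule_format, OF h])
  qed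
  show ?thesis by (rule bounded_orbit_finite_orbit[OF dim x]) (use bd in simp)
qed

end

end

lemma lift_not_proper:
  assumes "median_graph V adj"
  shows "\<not> proper_graph_action thompson_T_lift V adj \<phi>"
proof
  assume p: "proper_graph_action thompson_T_lift V adj \<phi>"
  then interpret lift_action V adj \<phi>
    by (intro lift_action.intro median_action.intro assms) (simp add: proper_graph_action_def)
  show False using not_proper p unfolding proper_graph_action_def by blast
qed

lemma lift_finite_orbit:
  assumes "median_graph V adj" "cubical_dim V adj < \<infinity>" "graph_action thompson_T_lift V adj \<phi>"
  shows "\<exists>x\<in>V. finite (orbit thompson_T_lift \<phi> x)"
proof -
  interpret lift_action V adj \<phi> by (intro lift_action.intro median_action.intro assms)
  show ?thesis using finite_dim_no_cube[OF assms(2)] finite_orbit by blast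
qed

section \<open>The quasi-isometry\<close>

abbreviation letters :: "('a, 'm) monoid_scheme \<Rightarrow> 'a set \<Rightarrow> 'a set" where
  "letters G A \<equiv> A \<union> m_inv G ` A"

context group
begin

lemma letters_carrier: "A \<subseteq> carrier G \<Longrightarrow> letters G A \<subseteq> carrier G"
  by auto

lemma foldr_closed: "set ws \<subseteq> carrier G \<Longrightarrow> foldr (mult G) ws \<one> \<in> carrier G"
  by (induction ws) auto

lemma foldr_mult_append:
  "set us \<subseteq> carrier G \<Longrightarrow> set ws \<subseteq> carrier G \<Longrightarrow>
    foldr (mult G) (us @ ws) \<one> = foldr (mult G) us \<one> \<otimes> foldr (mult G) ws \<one>"
proof (induction us)
  case (Cons a us)
  then show ?case using foldr_closed[of us] foldr_closed[of ws] by (simp add: m_assoc del: foldr_append)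
qed (use foldr_closed[of ws] in simp)

lemma generate_word:
  assumes A: "A \<subseteq> carrier G" and g: "g \<in> generate G A"
  shows "\<exists>ws. set ws \<subseteq> letters G A \<and> foldr (mult G) ws \<one> = g"
  using g
proof (induction rule: generate.induct)
  case one
  show ?case by (rule exI[of _ "[]"]) simp
next
  case (incl h)
  then show ?case using A by (intro exI[of _ "[h]"]) auto
next
  case (inv h)
  then show ?case using A by (intro exI[of _ "[inv h]"]) auto
next
  case (eng h k)
  then obtain us ws where uw: "set us \<subseteq> letters G A" "foldr (mult G) us \<one> = h" "set ws \<subseteq> letters G A" "foldr (mult G) ws \<one> = k"
    by blast
  have "set us \<subseteq> carrier G" "set ws \<subseteq> carrier G" using uw(1,3) letters_carrier[OF A] by blast+
  then have "foldr (mult G) (us @ ws) \<one> = h \<otimes> k" using foldr_mult_append uw(2,4) by blast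
  moreover have "set (us @ ws) \<subseteq> letters G A" using uw by simp
  ultimately show ?case by blast
qed

lemma word_length_le: "set ws \<subseteq> letters G A \<Longrightarrow> foldr (mult G) ws \<one> = g \<Longrightarrow> word_length G A g \<le> length ws"
  unfolding word_length_def by (rule Least_le) blast

lemma word_length_word:
  assumes "A \<subseteq> carrier G" "g \<in> generate G A"
  obtains ws where "length ws = word_length G A g" "set ws \<subseteq> letters G A" "foldr (mult G) ws \<one> = g"
proof -
  have "\<exists>n ws. length ws = n \<and> set ws \<subseteq> letters G A \<and> foldr (mult G) ws \<one> = g" using generate_word[OF assms] by blast
  then have "\<exists>ws. length ws = word_length G A g \<and> set ws \<subseteq> letters G A \<and> foldr (mult G) ws \<one> = g"
    unfolding word_length_def by (rule LeastI_ex)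
  then show thesis using that by blast
qed

end

lemma (in group_hom) foldr_hom:
  "set ws \<subseteq> carrier G \<Longrightarrow> foldr (mult H) (map h ws) \<one>\<^bsub>H\<^esub> = h (foldr (mult G) ws \<one>)"
proof (induction ws)
  case (Cons a ws)
  then show ?case using G.foldr_closed[of ws] by simp
qed simp

text \<open>\<open>h t - t\<close> is periodic, and over one period monotonicity traps
  \<open>h\<close> between \<open>h 0\<close> and \<open>h 0 + 1\<close>. This makes
  \<open>h 0\<close> additive up to a bounded error.\<close>

lemma TL_disp:
  assumes h: "h \<in> TL"
  shows "\<bar>h t - t - h 0\<bar> \<le> 1"
proof -
  have e: "h (frac t + of_int \<lfloor>t\<rfloor>) = h (frac t) + of_int \<lfloor>t\<rfloor>" by (rule TL_int[OF h])
  have t: "frac t + of_int \<lfloor>t\<rfloor> = t" by (simp add: frac_def)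
  have f: "0 \<le> frac t" "frac t < 1" by (simp_all add: frac_lt_1)
  have "h (0 + 1) = h 0 + 1" by (rule TL_step[OF h])
  then have "h 0 \<le> h (frac t)" "h (frac t) \<le> h 0 + 1"
    using TL_le_iff[OF h, of 0 "frac t"] TL_le_iff[OF h, of "frac t" 1] f by simp_all
  then show ?thesis using e f unfolding t by (simp add: frac_def) linarith
qed

section \<open>The product group and a finite generating set of the lift\<close>

abbreviation TZ :: "((circle \<Rightarrow> circle) \<times> int) monoid" where
  "TZ \<equiv> thompson_T \<times>\<times> integer_group"

lemma group_TZ: "group TZ"
  by (rule DirProd_group[OF group_T group_integer_group])

interpretation TZg: group TZ
  by (rule group_TZ)

lemma carrier_TZ: "carrier TZ = circ ` TL \<times> UNIV"
  by simp

lemma id_mult_TZ: "(id, s) \<otimes>\<^bsub>TZ\<^esub> (c, t) = (c, s + t)" and one_TZ: "\<one>\<^bsub>TZ\<^esub> = (id, 0)"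
  by simp_all

text \<open>The projection to the circle with trivial second coordinate; it carries words in the
  lift to words in the product.\<close>

definition jt :: "(real \<Rightarrow> real) \<Rightarrow> (circle \<Rightarrow> circle) \<times> int" where
  "jt h = (circ h, 0)"

interpretation jt: group_hom thompson_T_lift TZ jt
proof (intro group_hom.intro group_lift group_TZ group_hom_axioms.intro homI)
  show "jt x \<in> carrier TZ" if "x \<in> carrier thompson_T_lift" for x using that by (simp add: jt_def)
  show "jt (x \<otimes>\<^bsub>thompson_T_lift\<^esub> y) = jt x \<otimes>\<^bsub>TZ\<^esub> jt y"
    if "x \<in> carrier thompson_T_lift" "y \<in> carrier thompson_T_lift" for x y
    using that circ_comp by (simp add: jt_def)
qed

lemma circ_inverse: "h \<in> TL \<Longrightarrow> inv\<^bsub>thompson_T\<^esub> (circ h) = circ (inv\<^bsub>thompson_T_lift\<^esub> h)"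
  using group_hom.hom_inv[OF group_hom.intro[OF group_lift group_T group_hom_axioms.intro[OF circ_hom]], of h] by simp

lemma inv_TZ: "h \<in> TL \<Longrightarrow> inv\<^bsub>TZ\<^esub> (circ h, n) = (circ (inv\<^bsub>thompson_T_lift\<^esub> h), - n)"
  by (subst inv_DirProd[OF group_T group_integer_group]) (simp_all add: circ_inverse)

text \<open>The factors of \<open>TL_decomposition\<close> come from four finitely generated arc
  groups and the powers of a quarter rotation. \<open>tr 1\<close> is included because its powers
  will be counted as letters.\<close>

lemma TL_finitely_generated:
  "\<exists>A. finite A \<and> A \<subseteq> TL \<and> tr 1 \<in> A \<and> generate thompson_T_lift A = TL"
proof -
  have q: "(1/4 :: real) \<in> dyadic" "(1/2 :: real) \<in> dyadic" "(-1/8 :: real) \<in> dyadic" "(13/16 :: real) \<in> dyadic"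
    "(-3/8 :: real) \<in> dyadic" "(9/16 :: real) \<in> dyadic"
    using dyadic_div_power[of 1 2] dyadic_div_power[of 1 1] dyadic_div_power[of "-1" 3] dyadic_div_power[of 13 4]
      dyadic_div_power[of "-3" 3] dyadic_div_power[of 9 4] by simp_all
  obtain S1 where S1: "finite S1" "S1 \<subseteq> Fix (-1/8) (13/16)" "generate thompson_T_lift S1 = Fix (-1/8) (13/16)"
    using Fix_generate[OF q(3,4)] by auto
  obtain S2 where S2: "finite S2" "S2 \<subseteq> Fix (-3/8) (9/16)" "generate thompson_T_lift S2 = Fix (-3/8) (9/16)"
    using Fix_generate[OF q(5,6)] by auto
  obtain S3 where S3: "finite S3" "S3 \<subseteq> Fix 0 (1/2)" "generate thompson_T_lift S3 = Fix 0 (1/2)"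
    using Fix_generate[OF dyadic_numeral(1) q(2)] by auto
  obtain S4 where S4: "finite S4" "S4 \<subseteq> Fix (1/2) 1" "generate thompson_T_lift S4 = Fix (1/2) 1"
    using Fix_generate[OF q(2), of 1] by auto
  define A where "A = {tr (1/4), tr 1} \<union> S1 \<union> S2 \<union> S3 \<union> S4"
  have fA: "finite A" unfolding A_def using S1(1) S2(1) S3(1) S4(1) by blast
  have t4: "tr (1/4) \<in> TL" by (rule TL_translation[OF q(1)])
  have t1: "tr 1 \<in> TL" by (rule TL_translation) simp
  have AT: "A \<subseteq> TL" unfolding A_def using S1(2) S2(2) S3(2) S4(2) Fix_TL t4 t1 by blast
  then have sg: "subgroup (generate thompson_T_lift A) thompson_T_lift"
    by (intro TLg.generate_is_subgroup) simp
  have F: "Fix (-1/8) (13/16) \<union> Fix (-3/8) (9/16) \<subseteq> generate thompson_T_lift A" "Fix 0 (1/2) \<subseteq> generate thompson_T_lift A"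
    "Fix (1/2) 1 \<subseteq> generate thompson_T_lift A"
    unfolding S1(3)[symmetric] S2(3)[symmetric] S3(3)[symmetric] S4(3)[symmetric]
    by (intro Un_least TLg.mono_generate; force simp: A_def)+
  have T: "tr (of_int i / 4) \<in> generate thompson_T_lift A" for i :: int
  proof -
    have "tr (1/4) \<in> generate thompson_T_lift A" by (rule generate.incl) (simp add: A_def)
    then have "tr (1/4) [^]\<^bsub>thompson_T_lift\<^esub> i \<in> generate thompson_T_lift A"
      by (rule TLg.subgroup_int_pow_closed[OF sg])
    then show ?thesis unfolding tr_int_pow[OF q(1)] by simp
  qed
  have "f \<in> generate thompson_T_lift A" if fT: "f \<in> TL" for f
  proof -
    obtain i e :: int and s g h where f: "f = tr (of_int i / 4) \<circ> s \<circ> tr (of_int e / 4) \<circ> g \<circ> h"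
      and s: "s \<in> Fix (-1/8) (13/16) \<union> Fix (-3/8) (9/16)" and g: "g \<in> Fix 0 (1/2)" and h: "h \<in> Fix (1/2) 1"
      using TL_decomposition[OF fT] by blast
    note m = subgroup.m_closed[OF sg, unfolded mult_lift]
    show ?thesis unfolding f by (intro m T subsetD[OF F(1) s] subsetD[OF F(2) g] subsetD[OF F(3) h])
  qed
  moreover have "generate thompson_T_lift A \<subseteq> TL" using TLg.generate_incl[of A] AT by simp
  ultimately have "generate thompson_T_lift A = TL" by blast
  then show ?thesis using fA AT by (intro exI[of _ A]) (simp add: A_def)
qed

section \<open>Comparison of word lengths\<close>

context
  fixes A
  assumes A: "finite A" "A \<subseteq> TL" "tr 1 \<in> A" "generate thompson_T_lift A = TL"
begin

definition BB :: "((circle \<Rightarrow> circle) \<times> int) set" where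
  "BB = jt ` A \<union> {(id, 1)}"

lemma letters_A: "letters thompson_T_lift A \<subseteq> TL"
  using TLg.letters_carrier[of A] A(2) by simp

lemma A_word:
  assumes "w \<in> TL"
  obtains ws where "length ws = word_length thompson_T_lift A w" "set ws \<subseteq> letters thompson_T_lift A"
    "foldr (\<circ>) ws id = w"
proof -
  have m: "mult thompson_T_lift = (\<circ>)" by (intro ext) simp
  have "A \<subseteq> carrier thompson_T_lift" "w \<in> generate thompson_T_lift A" using A assms by simp_all
  then show thesis using TLg.word_length_word[of A w] that unfolding m one_lift by blast
qed

lemma A_word_le: "set ws \<subseteq> letters thompson_T_lift A \<Longrightarrow> word_length thompson_T_lift A (foldr (\<circ>) ws id) \<le> length ws"
proof -
  have m: "mult thompson_T_lift = (\<circ>)" by (intro ext) simp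
  assume "set ws \<subseteq> letters thompson_T_lift A"
  from TLg.word_length_le[OF this refl] show ?thesis unfolding m one_lift .
qed

lemma id1_TZ: "(id, n) \<in> carrier TZ"
  unfolding carrier_TZ using circ_id TL_id by (metis SigmaI UNIV_I image_eqI)

lemma BB_carrier: "BB \<subseteq> carrier TZ"
  unfolding BB_def using id1_TZ A(2) by (auto simp: jt_def)

lemma inv_id1: "inv\<^bsub>TZ\<^esub> (id, n) = (id, - n)"
  using inv_TZ[OF TL_id, of n] TLg.inv_one unfolding circ_id one_lift by (simp only: circ_id)

lemma letters_BB: "x \<in> letters TZ BB \<longleftrightarrow> x \<in> jt ` letters thompson_T_lift A \<or> x = (id, 1) \<or> x = (id, -1)"
proof -
  have i: "m_inv TZ ` jt ` A = jt ` m_inv thompson_T_lift ` A"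
    unfolding image_image using jt.hom_inv A(2) by (intro image_cong) auto
  have aux: "P \<union> {u} \<union> (R \<union> {v}) = P \<union> R \<union> {u, v}" for P R :: "((circle \<Rightarrow> circle) \<times> int) set" and u v by blast
  have "letters TZ BB = jt ` letters thompson_T_lift A \<union> {(id, 1), (id, -1)}"
    unfolding BB_def image_Un image_insert image_empty inv_id1 i by (rule aux)
  then show ?thesis by (simp only: Un_iff insert_iff empty_iff simp_thms)
qed

lemma id_pow_word: "\<exists>us. length us = nat \<bar>n\<bar> \<and> set us \<subseteq> {(id, 1), (id, -1)} \<and> foldr (mult TZ) us \<one>\<^bsub>TZ\<^esub> = (id, n :: int)"
proof -
  have *: "foldr (mult TZ) (replicate k (id, s)) \<one>\<^bsub>TZ\<^esub> = (id, int k * s)" for k s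
  proof (induction k)
    case 0
    show ?case unfolding replicate_0 foldr.simps id_apply one_TZ by (simp only: of_nat_0 mult_zero_left)
  next
    case (Suc k)
    have "s + int k * s = int (Suc k) * s" by (simp add: algebra_simps)
    then show ?case unfolding replicate_Suc foldr.simps o_apply Suc id_mult_TZ by (simp only:)
  qed
  define k s where "k = nat \<bar>n\<bar>" and "s = (if n \<ge> 0 then 1 else - 1 :: int)"
  have ks: "int k * s = n" by (simp add: k_def s_def)
  have "set (replicate k (id, s)) \<subseteq> {(id, 1), (id, -1)}" by (auto simp: s_def)
  then show ?thesis using *[of k s] unfolding ks by (intro exI[of _ "replicate k (id, s)"] conjI) (simp_all only: length_replicate k_def)
qed

lemma jt_mult: "jt h \<otimes>\<^bsub>TZ\<^esub> (id, n) = (circ h, n)"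
  by (simp add: jt_def)

lemma word_TL: "set ws \<subseteq> letters thompson_T_lift A \<Longrightarrow> foldr (\<circ>) ws id \<in> TL"
proof -
  have m: "mult thompson_T_lift = (\<circ>)" by (intro ext) simp
  assume "set ws \<subseteq> letters thompson_T_lift A"
  then have "set ws \<subseteq> carrier thompson_T_lift" unfolding carrier_lift using letters_A by (rule subset_trans)
  from TLg.foldr_closed[OF this] show ?thesis unfolding m one_lift carrier_lift .
qed

text \<open>The letters of \<open>ws\<close> give the circle part, and \<open>\<bar>n\<bar>\<close>
  central letters supply the integer.\<close>

lemma TZ_word:
  assumes ws: "set ws \<subseteq> letters thompson_T_lift A"
  shows "\<exists>vs. set vs \<subseteq> letters TZ BB \<and> foldr (mult TZ) vs \<one>\<^bsub>TZ\<^esub> = (circ (foldr (\<circ>) ws id), n) \<and> length vs = length ws + nat \<bar>n\<bar>"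
proof -
  have m: "mult thompson_T_lift = (\<circ>)" by (intro ext) simp
  obtain us where us: "length us = nat \<bar>n\<bar>" "set us \<subseteq> {(id, 1), (id, -1)}" "foldr (mult TZ) us \<one>\<^bsub>TZ\<^esub> = (id, n)"
    using id_pow_word[of n] by (elim exE conjE)
  have wc: "set ws \<subseteq> carrier thompson_T_lift" unfolding carrier_lift using ws letters_A by (rule subset_trans)
  have j: "foldr (mult TZ) (map jt ws) \<one>\<^bsub>TZ\<^esub> = jt (foldr (\<circ>) ws id)"
    using jt.foldr_hom[OF wc] unfolding m one_lift .
  have uc: "set us \<subseteq> carrier TZ" by (rule subset_trans[OF us(2)]) (simp only: insert_subset id1_TZ empty_subsetI simp_thms)
  have jc: "set (map jt ws) \<subseteq> carrier TZ" unfolding set_map by (rule image_subsetI, rule jt.hom_closed) (use wc in blast)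
  have "foldr (mult TZ) (map jt ws @ us) \<one>\<^bsub>TZ\<^esub> = jt (foldr (\<circ>) ws id) \<otimes>\<^bsub>TZ\<^esub> (id, n)"
    unfolding TZg.foldr_mult_append[OF jc uc] j us(3) by (rule refl)
  then have "foldr (mult TZ) (map jt ws @ us) \<one>\<^bsub>TZ\<^esub> = (circ (foldr (\<circ>) ws id), n)" unfolding jt_mult .
  moreover have "set (map jt ws @ us) \<subseteq> letters TZ BB"
  proof
    fix x assume "x \<in> set (map jt ws @ us)"
    then have "x \<in> jt ` set ws \<or> x \<in> set us" by (simp only: set_append set_map Un_iff)
    then show "x \<in> letters TZ BB" unfolding letters_BB
    proof
      assume "x \<in> jt ` set ws"
      then show "x \<in> jt ` letters thompson_T_lift A \<or> x = (id, 1) \<or> x = (id, -1)"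
        using subsetD[OF image_mono[OF ws]] by (intro disjI1)
    next
      assume "x \<in> set us"
      from subsetD[OF us(2) this] have "x = (id, 1) \<or> x = (id, -1)" by (simp only: insert_iff empty_iff simp_thms)
      then show "x \<in> jt ` letters thompson_T_lift A \<or> x = (id, 1) \<or> x = (id, -1)" by (rule disjI2)
    qed
  qed
  ultimately show ?thesis by (intro exI[of _ "map jt ws @ us"] conjI) (assumption, assumption, simp only: length_append length_map us(1))
qed

lemma TZ_generate: "generate TZ BB = carrier TZ"
proof
  show "generate TZ BB \<subseteq> carrier TZ" by (rule TZg.generate_incl[OF BB_carrier])
  show "carrier TZ \<subseteq> generate TZ BB"
  proof
    fix x assume "x \<in> carrier TZ"
    then obtain h n where x: "x = (circ h, n)" "h \<in> TL" unfolding carrier_TZ by blast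
    obtain ws where ws: "set ws \<subseteq> letters thompson_T_lift A" "foldr (\<circ>) ws id = h" using A_word[OF x(2)] by blast
    obtain vs where vs: "set vs \<subseteq> letters TZ BB" "foldr (mult TZ) vs \<one>\<^bsub>TZ\<^esub> = (circ h, n)" 
      using TZ_word[OF ws(1), of n] unfolding ws(2) by (elim exE conjE)
    have "foldr (mult TZ) vs \<one>\<^bsub>TZ\<^esub> \<in> generate TZ BB" if "set vs \<subseteq> letters TZ BB" for vs
      using that
    proof (induction vs)
      case Nil
      show ?case by (simp only: foldr.simps id_apply generate.one)
    next
      case (Cons a vs)
      have "a \<in> letters TZ BB" using Cons.prems by (rule subsetD) (simp only: list.set insertI1)
      then have a: "a \<in> generate TZ BB"
      proof
        assume "a \<in> m_inv TZ ` BB"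
        then show ?thesis by (rule imageE) (simp only: generate.inv)
      qed (rule generate.incl)
      have "set vs \<subseteq> letters TZ BB" using Cons.prems by (simp only: list.set insert_subset)
      then show ?case unfolding foldr.simps o_apply by (intro generate.eng a Cons.IH)
    qed
    from this[OF vs(1)] show "x \<in> generate TZ BB" unfolding vs(2) x(1) .
  qed
qed

text \<open>Dropping the central letters leaves a word over the lift with the same circle part; each
  dropped letter accounts for 1 in the integer coordinate.\<close>

lemma TZ_unword:
  assumes "set vs \<subseteq> letters TZ BB"
  shows "\<exists>ws. set ws \<subseteq> letters thompson_T_lift A \<and> length ws \<le> length vs \<and>
    fst (foldr (mult TZ) vs \<one>\<^bsub>TZ\<^esub>) = circ (foldr (\<circ>) ws id) \<and> \<bar>snd (foldr (mult TZ) vs \<one>\<^bsub>TZ\<^esub>)\<bar> \<le> int (length vs)"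
  using assms
proof (induction vs)
  case Nil
  show ?case
  proof (intro exI[of _ "[]"] conjI)
    show "fst (foldr (mult TZ) [] \<one>\<^bsub>TZ\<^esub>) = circ (foldr (\<circ>) [] id)"
      unfolding foldr.simps id_apply one_TZ fst_conv circ_id by (rule refl)
    show "\<bar>snd (foldr (mult TZ) [] \<one>\<^bsub>TZ\<^esub>)\<bar> \<le> int (length [])"
      unfolding foldr.simps id_apply one_TZ snd_conv by (simp only: abs_zero list.size of_nat_0 order_refl)
  qed simp_all
next
  case (Cons v vs)
  have vl: "v \<in> letters TZ BB" using Cons.prems by (rule subsetD) (simp only: list.set insertI1)
  have "set vs \<subseteq> letters TZ BB" using Cons.prems by (simp only: list.set insert_subset)
  from Cons.IH[OF this] obtain ws where ws: "set ws \<subseteq> letters thompson_T_lift A" "length ws \<le> length vs"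
    "fst (foldr (mult TZ) vs \<one>\<^bsub>TZ\<^esub>) = circ (foldr (\<circ>) ws id)" "\<bar>snd (foldr (mult TZ) vs \<one>\<^bsub>TZ\<^esub>)\<bar> \<le> int (length vs)"
    by (elim exE conjE)
  obtain c n where cn: "foldr (mult TZ) vs \<one>\<^bsub>TZ\<^esub> = (c, n)" by (rule prod.exhaust)
  have c: "c = circ (foldr (\<circ>) ws id)" using ws(3) unfolding cn fst_conv .
  have n: "\<bar>n\<bar> \<le> int (length vs)" using ws(4) unfolding cn snd_conv .
  have f: "foldr (mult TZ) (v # vs) \<one>\<^bsub>TZ\<^esub> = v \<otimes>\<^bsub>TZ\<^esub> (c, n)" by (simp only: foldr.simps o_apply cn)
  have wT: "foldr (\<circ>) ws id \<in> TL" by (rule word_TL[OF ws(1)])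
  from vl consider a where "v = jt a" "a \<in> letters thompson_T_lift A" | s where "v = (id, s)" "\<bar>s\<bar> \<le> 1"
    unfolding letters_BB by (elim disjE imageE) (simp_all only: abs_1 abs_minus_cancel order_refl simp_thms)
  then show ?case
  proof cases
    case (1 a)
    have aT: "a \<in> TL" using 1(2) letters_A by blast
    have "v \<otimes>\<^bsub>TZ\<^esub> (c, n) = (circ (foldr (\<circ>) (a # ws) id), n)"
      unfolding 1(1) jt_def c foldr_comp_Cons circ_comp[OF aT wT] by simp
    then have F: "foldr (mult TZ) (v # vs) \<one>\<^bsub>TZ\<^esub> = (circ (foldr (\<circ>) (a # ws) id), n)" unfolding f .
    show ?thesis unfolding F fst_conv snd_conv
    proof (intro exI[of _ "a # ws"] conjI)
      show "set (a # ws) \<subseteq> letters thompson_T_lift A" using 1(2) ws(1) by (simp only: list.set insert_subset)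
      show "length (a # ws) \<le> length (v # vs)" using ws(2) by simp
      show "\<bar>n\<bar> \<le> int (length (v # vs))" using n by simp
    qed (rule refl)
  next
    case (2 s)
    have F: "foldr (mult TZ) (v # vs) \<one>\<^bsub>TZ\<^esub> = (c, s + n)" using f unfolding 2(1) id_mult_TZ .
    show ?thesis unfolding F fst_conv snd_conv
    proof (intro exI[of _ ws] conjI ws(1) c)
      show "length ws \<le> length (v # vs)" using ws(2) by simp
      show "\<bar>s + n\<bar> \<le> int (length (v # vs))" using n 2(2) by simp
    qed
  qed
qed

text \<open>By \<open>TL_disp\<close> one constant bounds how far any of the finitely many letters
  moves any point.\<close>

lemma A_disp:
  "\<exists>D\<ge>0. \<forall>ws t. set ws \<subseteq> letters thompson_T_lift A \<longrightarrow> \<bar>foldr (\<circ>) ws id t - t\<bar> \<le> D * real (length ws)"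
proof -
  let ?L = "letters thompson_T_lift A"
  have fin: "finite ((\<lambda>a. \<bar>a 0\<bar> + 1) ` ?L)" using A(1) by blast
  define D where "D = Max (insert 0 ((\<lambda>a. \<bar>a 0\<bar> + 1) ` ?L))"
  have D: "0 \<le> D" "\<bar>a 0\<bar> + 1 \<le> D" if "a \<in> ?L" for a unfolding D_def using fin that by (auto intro!: Max_ge)
  have D0: "0 \<le> D" unfolding D_def using fin by (intro Max_ge) auto
  have aD: "\<bar>a t - t\<bar> \<le> D" if "a \<in> ?L" for a t
    using D(2)[OF that] TL_disp[of a t] letters_A that by force
  have "\<bar>foldr (\<circ>) ws id t - t\<bar> \<le> D * real (length ws)" if "set ws \<subseteq> ?L" for ws t
    using that
  proof (induction ws)
    case (Cons a ws)
    have "\<bar>a (foldr (\<circ>) ws id t) - foldr (\<circ>) ws id t\<bar> \<le> D" by (rule aD) (use Cons.prems in \<open>simp only: list.set insert_subset\<close>)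
    moreover have "\<bar>foldr (\<circ>) ws id t - t\<bar> \<le> D * real (length ws)"
      by (rule Cons.IH) (use Cons.prems in \<open>simp only: list.set insert_subset\<close>)
    moreover have "D * real (length (a # ws)) = D + D * real (length ws)" by (simp add: algebra_simps)
    moreover have "foldr (\<circ>) (a # ws) id t = a (foldr (\<circ>) ws id t)"
      unfolding foldr_comp_Cons by (rule o_apply)
    ultimately show ?case by linarith
  qed simp
  then show ?thesis by (intro exI[of _ D] conjI D0 allI impI)
qed

text \<open>The kernel of \<open>circ\<close> consists of integer translations, since a continuous
  integer-valued function is constant.\<close>

lemma circ_eq_translate:
  assumes "g \<in> TL" "h \<in> TL" "circ g = circ h"
  shows "\<exists>m::int. g = h \<circ> tr (of_int m)"
proof -
  define w where "w = Hilbert_Choice.inv h \<circ> g"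
  have w: "w \<in> TL" unfolding w_def by (intro TL_comp TL_inv assms)
  have hw: "g = h \<circ> w" unfolding w_def using TL_inv_comp(2)[OF assms(2)] by (simp only: comp_assoc[symmetric] id_comp)
  have "circ w = circ (Hilbert_Choice.inv h) \<circ> circ g" unfolding w_def by (rule circ_comp[OF TL_inv[OF assms(2)] assms(1)])
  then have "circ w = id" unfolding assms(3) using circ_inv(1)[OF assms(2)] by (simp only:)
  then have ints: "w x - x \<in> \<int>" for x
    using circ_proj[OF w, of x] circle_proj_eq_iff[of "w x" x] by simp
  have fl: "w x - x = of_int \<lfloor>w x - x\<rfloor>" for x using ints[of x] by (simp add: of_int_floor_cancel[THEN iffD2])
  have "(\<lambda>x. w x - x) constant_on UNIV"
  proof (rule continuous_discrete_range_constant)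
    show "continuous_on UNIV (\<lambda>x. w x - x)" by (intro continuous_intros lpl_continuous TL_lpl w)
    fix x :: real
    show "\<exists>e>0. \<forall>y. y \<in> UNIV \<and> w y - y \<noteq> w x - x \<longrightarrow> e \<le> norm (w y - y - (w x - x))"
    proof (intro exI[of _ 1] conjI allI impI)
      fix y assume y: "y \<in> UNIV \<and> w y - y \<noteq> w x - x"
      have "1 \<le> \<bar>of_int (\<lfloor>w y - y\<rfloor> - \<lfloor>w x - x\<rfloor>) :: real\<bar>"
        using y fl[of x] fl[of y] by (metis Ints_of_int eq_iff_diff_eq_0 Ints_nonzero_abs_ge1 of_int_diff)
      then show "1 \<le> norm (w y - y - (w x - x))" using fl[of x] fl[of y] by simp
    qed simp
  qed simp
  then obtain c where c: "\<And>x. w x - x = c" unfolding constant_on_def by blast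
  have wt: "w = tr (of_int \<lfloor>c\<rfloor>)"
  proof
    fix x
    have "c = of_int \<lfloor>c\<rfloor>" using fl[of 0] unfolding c .
    then show "w x = x + of_int \<lfloor>c\<rfloor>" using c[of x] by linarith
  qed
  show ?thesis by (rule exI[of _ "\<lfloor>c\<rfloor>"]) (rule hw[unfolded wt])
qed

text \<open>The map \<open>f\<close> is not a homomorphism, but
  \<open>\<lfloor>y 0\<rfloor> - \<lfloor>x 0\<rfloor>\<close> stays within 2 of \<open>w 0\<close>,
  where \<open>w\<close> is the quotient of \<open>x\<close> and \<open>y\<close>. For the upper
  bound, \<open>w 0\<close> is linear in the length of \<open>w\<close>; for the lower one, a word
  for the circle part gives \<open>w\<close> up to an integer translation, whose size is bounded in
  the same way.\<close>

lemma lift_quasi_isometric: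
  "quasi_isometric TL (word_dist thompson_T_lift A) (carrier TZ) (word_dist TZ BB)"
proof -
  obtain D where D0: "D \<ge> 0" "\<forall>ws t. set ws \<subseteq> letters thompson_T_lift A \<longrightarrow> \<bar>foldr (\<circ>) ws id t - t\<bar> \<le> D * real (length ws)"
    using A_disp by (elim exE conjE)
  note D = D0(1) D0(2)[rule_format]
  define f where "f h = (circ h, \<lfloor>h 0\<rfloor>)" for h
  have fc: "f \<in> TL \<rightarrow> carrier TZ" by (auto simp: f_def)
  let ?lA = "word_length thompson_T_lift A" and ?lB = "word_length TZ BB"
  have main: "real (?lB (inv\<^bsub>TZ\<^esub> f x \<otimes>\<^bsub>TZ\<^esub> f y)) \<le> (1 + D) * real (?lA (inv\<^bsub>thompson_T_lift\<^esub> x \<circ> y)) + 4"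
    "real (?lA (inv\<^bsub>thompson_T_lift\<^esub> x \<circ> y)) \<le> (2 + D) * real (?lB (inv\<^bsub>TZ\<^esub> f x \<otimes>\<^bsub>TZ\<^esub> f y)) + 4"
    if x: "x \<in> TL" and y: "y \<in> TL" for x y
  proof -
    define w where "w = inv\<^bsub>thompson_T_lift\<^esub> x \<circ> y"
    define n where "n = \<lfloor>y 0\<rfloor> - \<lfloor>x 0\<rfloor>"
    have iT: "inv\<^bsub>thompson_T_lift\<^esub> x \<in> TL" unfolding inv_lift[OF x] by (rule TL_inv[OF x])
    have wT: "w \<in> TL" unfolding w_def by (rule TL_comp[OF iT y])
    have cw: "circ w = circ (inv\<^bsub>thompson_T_lift\<^esub> x) \<circ> circ y" unfolding w_def by (rule circ_comp[OF iT y])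
    have e: "inv\<^bsub>TZ\<^esub> f x \<otimes>\<^bsub>TZ\<^esub> f y = (circ w, n)" unfolding f_def inv_TZ[OF x] cw n_def by simp
    have xw: "x (w 0) = y 0" unfolding w_def inv_lift[OF x] o_apply by (rule TL_inv_apply(2)[OF x])
    have "\<bar>x (w 0) - w 0 - x 0\<bar> \<le> 1" by (rule TL_disp[OF x])
    then have nw: "\<bar>of_int n - w 0\<bar> \<le> 2" unfolding xw n_def by linarith
    obtain ws where ws: "length ws = ?lA w" "set ws \<subseteq> letters thompson_T_lift A" "foldr (\<circ>) ws id = w"
      by (rule A_word[OF wT])
    have w0: "\<bar>w 0\<bar> \<le> D * real (?lA w)" using D(2)[OF ws(2), of 0] unfolding ws(1,3) by simp
    obtain vs where vs: "set vs \<subseteq> letters TZ BB" "foldr (mult TZ) vs \<one>\<^bsub>TZ\<^esub> = (circ w, n)" "length vs = ?lA w + nat \<bar>n\<bar>"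
      using TZ_word[OF ws(2), of n] unfolding ws(1,3) by (elim exE conjE)
    have "?lB (circ w, n) \<le> ?lA w + nat \<bar>n\<bar>" using TZg.word_length_le[OF vs(1,2)] unfolding vs(3) .
    then have "real (?lB (circ w, n)) \<le> real (?lA w) + \<bar>of_int n\<bar>" by linarith
    also have "\<dots> \<le> real (?lA w) + (D * real (?lA w) + 4)" using nw w0 by linarith
    finally show "real (?lB (inv\<^bsub>TZ\<^esub> f x \<otimes>\<^bsub>TZ\<^esub> f y)) \<le> (1 + D) * real (?lA (inv\<^bsub>thompson_T_lift\<^esub> x \<circ> y)) + 4"
      unfolding e w_def[symmetric] by (simp add: algebra_simps)
    define L where "L = ?lB (circ w, n)"
    have "(circ w, n) \<in> generate TZ BB" unfolding TZ_generate carrier_TZ using wT by blast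
    then obtain us where us: "length us = L" "set us \<subseteq> letters TZ BB" "foldr (mult TZ) us \<one>\<^bsub>TZ\<^esub> = (circ w, n)"
      unfolding L_def by (rule TZg.word_length_word[OF BB_carrier])
    obtain ts where ts: "set ts \<subseteq> letters thompson_T_lift A" "length ts \<le> L" "circ w = circ (foldr (\<circ>) ts id)" "\<bar>n\<bar> \<le> int L"
      using TZ_unword[OF us(2)] unfolding us(1,3) fst_conv snd_conv by (elim exE conjE)
    define w' where "w' = foldr (\<circ>) ts id"
    have w'T: "w' \<in> TL" unfolding w'_def by (rule word_TL[OF ts(1)])
    \<comment> \<open>\<open>w'\<close> has the right circle part, so only
      \<open>\<bar>m\<bar>\<close> letters \<open>tr 1\<close> or inverses of it are
      missing.\<close>
    obtain m where m: "w = w' \<circ> tr (of_int m)" using circ_eq_translate[OF wT w'T] ts(3) unfolding w'_def by blast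
    have "w' (0 + of_int m) = w' 0 + of_int m" by (rule TL_int[OF w'T])
    then have m0: "w 0 = w' 0 + of_int m" unfolding m by simp
    have "\<bar>w' 0\<bar> \<le> D * real (length ts)" using D(2)[OF ts(1), of 0] unfolding w'_def by simp
    also have "\<dots> \<le> D * real L" by (rule mult_left_mono) (use ts(2) D(1) in auto)
    finally have w'0: "\<bar>w' 0\<bar> \<le> D * real L" .
    have mb: "\<bar>of_int m\<bar> \<le> real L + 4 + D * real L" using m0 w'0 nw ts(4) by linarith
    define rs where "rs = replicate (nat \<bar>m\<bar>) (tr (of_int (sgn m)))"
    have tm: "foldr (\<circ>) (replicate k (tr s)) id = tr (real k * s)" for k and s :: real
    proof (induction k)
      case (Suc k)
      show ?case unfolding replicate_Suc foldr_comp_Cons Suc by (rule ext) (simp add: algebra_simps)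
    qed (rule ext, simp)
    have ms: "real (nat \<bar>m\<bar>) * of_int (sgn m) = of_int m" by (cases "m \<ge> 0") (auto simp: sgn_if)
    have rs: "foldr (\<circ>) rs id = tr (of_int m)" unfolding rs_def tm ms by (rule refl)
    have "inv\<^bsub>thompson_T_lift\<^esub> tr 1 = tr (- 1)" by (rule tr_inv) simp
    then have t1: "tr (- 1) \<in> letters thompson_T_lift A" using imageI[OF A(3), of "m_inv thompson_T_lift"] by (intro UnI2) (simp only:)
    have rsl: "set rs \<subseteq> letters thompson_T_lift A"
    proof (cases "m = 0")
      case True
      then have "rs = []" by (simp add: rs_def)
      then show ?thesis by (simp only: list.set empty_subsetI)
    next
      case False
      then consider "sgn m = 1" | "sgn m = - 1" by (cases "m > 0") auto
      then have tl: "tr (of_int (sgn m)) \<in> letters thompson_T_lift A"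
        by cases (use t1 A(3) in \<open>simp_all only: of_int_1 of_int_minus UnI1\<close>)
      show ?thesis
      proof
        fix a assume "a \<in> set rs"
        then have "a = tr (of_int (sgn m))" unfolding rs_def in_set_replicate by (rule conjunct1)
        then show "a \<in> letters thompson_T_lift A" using tl by (simp only:)
      qed
    qed
    have "foldr (\<circ>) (ts @ rs) id = foldr (\<circ>) ts id \<circ> foldr (\<circ>) rs id"
    proof (induction ts)
      case (Cons a ts)
      show ?case unfolding append_Cons foldr_comp_Cons Cons comp_assoc by (rule refl)
    qed (rule ext, simp)
    then have "foldr (\<circ>) (ts @ rs) id = w" unfolding rs w'_def[symmetric] m .
    moreover have "set (ts @ rs) \<subseteq> letters thompson_T_lift A" unfolding set_append using ts(1) rsl by (rule Un_least)
    ultimately have "?lA w \<le> length (ts @ rs)" using A_word_le[of "ts @ rs"] by (simp only:)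
    also have "\<dots> \<le> L + nat \<bar>m\<bar>" using ts(2) by (simp only: rs_def length_append length_replicate add_right_mono)
    finally have "real (?lA w) \<le> real L + \<bar>of_int m\<bar>" by linarith
    also have "\<dots> \<le> real L + (real L + 4 + D * real L)" using mb by linarith
    finally show "real (?lA (inv\<^bsub>thompson_T_lift\<^esub> x \<circ> y)) \<le> (2 + D) * real (?lB (inv\<^bsub>TZ\<^esub> f x \<otimes>\<^bsub>TZ\<^esub> f y)) + 4"
      unfolding e w_def[symmetric] L_def by (simp add: algebra_simps)
  qed
  \<comment> \<open>\<open>f\<close> is onto: an integer translation, invisible on the circle,
    adjusts \<open>\<lfloor>h 0\<rfloor>\<close> to any value.\<close>
  have surj: "\<exists>x\<in>TL. word_dist TZ BB (f x) z \<le> 4" if z: "z \<in> carrier TZ" for z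
  proof -
    obtain h n where hn: "z = (circ h, n)" "h \<in> TL" using z unfolding carrier_TZ by blast
    define k where "k = n - \<lfloor>h 0\<rfloor>"
    define x where "x = h \<circ> tr (of_int k)"
    have tT: "tr (of_int k) \<in> TL" by (rule TL_translation) simp
    have xT: "x \<in> TL" unfolding x_def by (rule TL_comp[OF hn(2) tT])
    have "circ x = circ h"
    proof (rule circ_unique[OF hn(2)])
      fix t
      have "x t = h t + of_int k" unfolding x_def o_apply by (rule TL_int[OF hn(2)])
      then show "circ x (circle_proj t) = circle_proj (h t)" unfolding circ_proj[OF xT] by (simp only: circle_proj_int)
    qed
    moreover have "\<lfloor>x 0\<rfloor> = n"
    proof -
      have "x 0 = h 0 + of_int k" unfolding x_def o_apply by (rule TL_int[OF hn(2)])
      then show ?thesis unfolding k_def by linarith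
    qed
    ultimately have fx: "f x = z" unfolding f_def hn(1) by simp
    have "inv\<^bsub>TZ\<^esub> z \<otimes>\<^bsub>TZ\<^esub> z = \<one>\<^bsub>TZ\<^esub>" by (rule TZg.l_inv[OF z])
    moreover have "?lB \<one>\<^bsub>TZ\<^esub> \<le> length ([] :: ((circle \<Rightarrow> circle) \<times> int) list)"
      by (rule TZg.word_length_le) (simp_all only: list.set empty_subsetI foldr.simps id_apply)
    ultimately have "word_dist TZ BB (f x) z \<le> 4" unfolding word_dist_def fx by simp
    then show ?thesis using xT by blast
  qed
  have K: "(1::real) \<le> 2 + D" using D(1) by simp
  have bounds: "word_dist thompson_T_lift A x y / (2 + D) - 4 \<le> word_dist TZ BB (f x) (f y) \<and>
      word_dist TZ BB (f x) (f y) \<le> (2 + D) * word_dist thompson_T_lift A x y + 4" if xy: "x \<in> TL" "y \<in> TL" for x y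
  proof -
    define a b where "a = word_dist thompson_T_lift A x y" and "b = word_dist TZ BB (f x) (f y)"
    have ab: "b \<le> (1 + D) * a + 4" "a \<le> (2 + D) * b + 4" "0 \<le> a"
      using main[OF xy] unfolding a_def b_def word_dist_def mult_lift by simp_all
    have "(2 + D) * b + 4 \<le> (2 + D) * (b + 4)" using D(1) by (simp add: algebra_simps)
    then have "a \<le> (b + 4) * (2 + D)" using ab(2) by (simp add: mult.commute)
    then have "a / (2 + D) \<le> b + 4" using K by (simp add: pos_divide_le_eq)
    moreover have "(1 + D) * a \<le> (2 + D) * a" by (rule mult_right_mono) (use ab(3) in auto)
    ultimately show ?thesis using ab(1) unfolding a_def[symmetric] b_def[symmetric] by linarith
  qed
  show ?thesis unfolding quasi_isometric_def
    by (intro bexI[OF _ fc] exI[of _ "2 + D"] exI[of _ 4] conjI ballI K) (use bounds surj in auto)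
qed

lemma TZ_quasi_isometric_groups_aux: "quasi_isometric_groups thompson_T_lift TZ"
proof -
  have "finite BB" unfolding BB_def using A(1) by blast
  then show ?thesis unfolding quasi_isometric_groups_def
    using group_lift group_TZ A BB_carrier TZ_generate lift_quasi_isometric
    by (intro conjI exI[of _ A] exI[of _ BB]) (simp_all only: carrier_lift)
qed

text \<open>Countability serves to name the vertices of the cube complex by natural numbers.\<close>

lemma countable_TL_aux: "countable TL"
proof -
  have "countable (lists (letters thompson_T_lift A))"
    by (intro countable_lists countable_finite) (use A(1) in blast)
  then have "countable ((\<lambda>ws. foldr (\<circ>) ws id) ` lists (letters thompson_T_lift A))" by (rule countable_image)
  moreover have "TL \<subseteq> (\<lambda>ws. foldr (\<circ>) ws id) ` lists (letters thompson_T_lift A)"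
  proof
    fix w assume "w \<in> TL"
    then obtain ws where ws: "set ws \<subseteq> letters thompson_T_lift A" "foldr (\<circ>) ws id = w" using A_word[of w] by blast
    have "ws \<in> lists (letters thompson_T_lift A)" unfolding in_lists_conv_set using ws(1) by blast
    then show "w \<in> (\<lambda>ws. foldr (\<circ>) ws id) ` lists (letters thompson_T_lift A)"
      by (rule image_eqI[rotated]) (rule ws(2)[symmetric])
  qed
  ultimately show ?thesis by (rule countable_subset[rotated])
qed

end

lemma lift_quasi_isometric_groups: "quasi_isometric_groups thompson_T_lift TZ"
  using TL_finitely_generated TZ_quasi_isometric_groups_aux by blast

lemma countable_TL: "countable TL"
  using TL_finitely_generated countable_TL_aux by blast

section \<open>A proper action of the product\<close>

lemma sym_diff_triangle_card:
  assumes "finite (sym_diff B C)" "finite (sym_diff C D)"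
  shows "finite (sym_diff B D)" "card (sym_diff B D) \<le> card (sym_diff B C) + card (sym_diff C D)"
proof -
  have sub: "sym_diff B D \<subseteq> sym_diff B C \<union> sym_diff C D" by blast
  have fin: "finite (sym_diff B C \<union> sym_diff C D)" using assms by (rule finite_UnI)
  show "finite (sym_diff B D)" by (rule finite_subset[OF sub fin])
  show "card (sym_diff B D) \<le> card (sym_diff B C) + card (sym_diff C D)"
    by (rule order_trans[OF card_mono[OF fin sub] card_Un_le])
qed

text \<open>Distances add up exactly when the two differences to \<open>m\<close> are disjoint, that
  is, when no element is switched twice on the way.\<close>

lemma sym_diff_between:
  assumes fin: "finite (sym_diff x m)" "finite (sym_diff m y)"
  shows "card (sym_diff x y) = card (sym_diff x m) + card (sym_diff m y) \<longleftrightarrow> x \<inter> y \<subseteq> m \<and> m \<subseteq> x \<union> y"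
proof -
  define P Q where "P = sym_diff x m" and "Q = sym_diff m y"
  have f: "finite P" "finite Q" using fin by (simp_all only: P_def Q_def)
  have sd: "sym_diff x y = (P \<union> Q) - (P \<inter> Q)" unfolding P_def Q_def by blast
  have 1: "card P + card Q = card (P \<union> Q) + card (P \<inter> Q)" by (rule card_Un_Int[OF f])
  have 2: "card (sym_diff x y) = card (P \<union> Q) - card (P \<inter> Q)" unfolding sd
    by (rule card_Diff_subset) (use f in auto)
  have 3: "card (P \<inter> Q) \<le> card (P \<union> Q)" by (rule card_mono) (use f in auto)
  have "card (sym_diff x y) = card P + card Q \<longleftrightarrow> card (P \<inter> Q) = 0" using 1 2 3 by linarith
  also have "\<dots> \<longleftrightarrow> P \<inter> Q = {}" using f by simp
  also have "\<dots> \<longleftrightarrow> x \<inter> y \<subseteq> m \<and> m \<subseteq> x \<union> y" unfolding P_def Q_def by blast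
  finally show ?thesis unfolding P_def Q_def .
qed

text \<open>A vertex is only a name, decoded by \<open>dec\<close> into a set; this allows natural numbers as vertices.\<close>

locale cube_graph =
  fixes V :: "'v set" and dec :: "'v \<Rightarrow> 'u set" and U A :: "'u set"
  assumes dec: "bij_betw dec V {B. B \<subseteq> U \<and> finite (sym_diff B A)}"
begin

definition cadj :: "'v \<Rightarrow> 'v \<Rightarrow> bool" where
  "cadj x y \<longleftrightarrow> x \<in> V \<and> y \<in> V \<and> card (sym_diff (dec x) (dec y)) = 1"

definition enc :: "'u set \<Rightarrow> 'v" where
  "enc = inv_into V dec"

lemma dec_V: "x \<in> V \<Longrightarrow> dec x \<subseteq> U" "x \<in> V \<Longrightarrow> finite (sym_diff (dec x) A)"
  using bij_betwE[OF dec] by blast+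

lemma dec_inj: "x \<in> V \<Longrightarrow> y \<in> V \<Longrightarrow> dec x = dec y \<longleftrightarrow> x = y"
  by (rule inj_on_eq_iff[OF bij_betw_imp_inj_on[OF dec]])

lemma enc: "B \<subseteq> U \<Longrightarrow> finite (sym_diff B A) \<Longrightarrow> enc B \<in> V \<and> dec (enc B) = B"
  using bij_betw_inv_into_right[OF dec, of B] bij_betwE[OF bij_betw_inv_into[OF dec]] unfolding enc_def by blast

lemma enc_dec: "x \<in> V \<Longrightarrow> enc (dec x) = x"
  unfolding enc_def by (rule bij_betw_inv_into_left[OF dec])

lemma fin: "x \<in> V \<Longrightarrow> y \<in> V \<Longrightarrow> finite (sym_diff (dec x) (dec y))"
  using sym_diff_triangle_card(1)[of "dec x" A "dec y"] dec_V(2)[of x] dec_V(2)[of y] by (simp add: Un_commute)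

lemma walk_ge: "(cadj ^^ n) x y \<Longrightarrow> x \<in> V \<Longrightarrow> y \<in> V \<and> card (sym_diff (dec x) (dec y)) \<le> n"
proof (induction n arbitrary: y)
  case (Suc n)
  then obtain z where z: "(cadj ^^ n) x z" "cadj z y" by auto
  have zV: "z \<in> V" "card (sym_diff (dec x) (dec z)) \<le> n" using Suc.IH[OF z(1) Suc.prems(2)] by auto
  have yV: "y \<in> V" "card (sym_diff (dec z) (dec y)) = 1" using z(2) by (auto simp: cadj_def)
  show ?case
    using sym_diff_triangle_card(2)[OF fin[OF Suc.prems(2) zV(1)] fin[OF zV(1) yV(1)]] yV zV(2) by linarith
qed auto

text \<open>One element of the symmetric difference is switched at a time, and the result is again
  commensurate to \<open>A\<close>.\<close>

lemma walk: "x \<in> V \<Longrightarrow> y \<in> V \<Longrightarrow> card (sym_diff (dec x) (dec y)) = n \<Longrightarrow> (cadj ^^ n) x y"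
proof (induction n arbitrary: x)
  case 0
  then have "sym_diff (dec x) (dec y) = {}" using fin[of x y] by simp
  then have "dec x = dec y" by blast
  then have "x = y" unfolding dec_inj[OF 0(1,2)] .
  then show ?case by simp
next
  case (Suc n)
  define S where "S = sym_diff (dec x) (dec y)"
  have S: "finite S" "card S = Suc n" using fin[OF Suc.prems(1,2)] Suc.prems(3) by (simp_all add: S_def)
  then have "S \<noteq> {}" by auto
  then obtain u where u: "u \<in> S" by blast
  define B where "B = sym_diff (dec x) {u}"
  have uU: "u \<in> U" using u dec_V(1) Suc.prems unfolding S_def by blast
  have xB: "sym_diff (dec x) B = {u}" unfolding B_def by blast
  have Bx: "sym_diff B (dec x) = {u}" unfolding B_def by blast
  have BU: "B \<subseteq> U" using uU dec_V(1)[OF Suc.prems(1)] unfolding B_def by blast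
  have "finite (sym_diff B (dec x))" unfolding Bx by simp
  then have BA: "finite (sym_diff B A)" using dec_V(2)[OF Suc.prems(1)] by (rule sym_diff_triangle_card(1))
  note e = conjunct1[OF enc[OF BU BA]] conjunct2[OF enc[OF BU BA]]
  have By: "sym_diff B (dec y) = S - {u}" using u unfolding B_def S_def by blast
  then have "card (sym_diff (dec (enc B)) (dec y)) = n" unfolding e(2) By using S u by simp
  then have "(cadj ^^ n) (enc B) y" by (rule Suc.IH[OF e(1) Suc.prems(2)])
  moreover have "cadj x (enc B)" unfolding cadj_def e(2) xB using Suc.prems(1) e(1) by simp
  ultimately show ?case by (rule relpowp_Suc_I2[rotated])
qed

lemma dist: "x \<in> V \<Longrightarrow> y \<in> V \<Longrightarrow> graph_dist cadj x y = card (sym_diff (dec x) (dec y))"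
  unfolding graph_dist_def by (rule Least_equality) (use walk walk_ge in blast)+

lemma simplicial: "simplicial_graph V cadj"
  by standard (auto simp: cadj_def Un_commute)

text \<open>By \<open>sym_diff_between\<close> the three distance equations say that
  \<open>dec m\<close> is the majority set \<open>M\<close> of the three vertices.\<close>

lemma median_graph: "A \<subseteq> U \<Longrightarrow> median_graph V cadj"
proof (intro median_graph.intro simplicial median_graph_axioms.intro)
  assume "A \<subseteq> U"
  then have "enc A \<in> V" using enc[of A] by simp
  then show "V \<noteq> {}" by blast
  show "\<exists>n. (cadj ^^ n) x y" if "x \<in> V" "y \<in> V" for x y using walk[OF that refl] by (rule exI)
  fix x y z assume V: "x \<in> V" "y \<in> V" "z \<in> V"
  define M where "M = (dec x \<inter> dec y) \<union> (dec y \<inter> dec z) \<union> (dec x \<inter> dec z)"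
  have bt: "graph_dist cadj a b = graph_dist cadj a m + graph_dist cadj m b \<longleftrightarrow> dec a \<inter> dec b \<subseteq> dec m \<and> dec m \<subseteq> dec a \<union> dec b"
    if "a \<in> V" "b \<in> V" "m \<in> V" for a b m
    unfolding dist[OF that(1,2)] dist[OF that(1,3)] dist[OF that(3,2)]
    by (rule sym_diff_between[OF fin[OF that(1,3)] fin[OF that(3,2)]])
  have MU: "M \<subseteq> U" using dec_V(1) V unfolding M_def by blast
  have "sym_diff M A \<subseteq> sym_diff (dec x) A \<union> sym_diff (dec y) A \<union> sym_diff (dec z) A" unfolding M_def by blast
  then have MA: "finite (sym_diff M A)"
    by (rule finite_subset) (use dec_V(2)[OF V(1)] dec_V(2)[OF V(2)] dec_V(2)[OF V(3)] in \<open>simp only: finite_Un simp_thms\<close>)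
  note e = conjunct1[OF enc[OF MU MA]] conjunct2[OF enc[OF MU MA]]
  have iff: "(graph_dist cadj x y = graph_dist cadj x m + graph_dist cadj m y \<and>
      graph_dist cadj y z = graph_dist cadj y m + graph_dist cadj m z \<and>
      graph_dist cadj x z = graph_dist cadj x m + graph_dist cadj m z) \<longleftrightarrow> dec m = M" if m: "m \<in> V" for m
    unfolding bt[OF V(1,2) m] bt[OF V(2,3) m] bt[OF V(1,3) m] M_def by blast
  show "\<exists>!m. m \<in> V \<and> graph_dist cadj x y = graph_dist cadj x m + graph_dist cadj m y \<and>
      graph_dist cadj y z = graph_dist cadj y m + graph_dist cadj m z \<and>
      graph_dist cadj x z = graph_dist cadj x m + graph_dist cadj m z"
  proof (rule ex1I[of _ "enc M"])
    show "enc M \<in> V \<and> graph_dist cadj x y = graph_dist cadj x (enc M) + graph_dist cadj (enc M) y \<and>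
      graph_dist cadj y z = graph_dist cadj y (enc M) + graph_dist cadj (enc M) z \<and>
      graph_dist cadj x z = graph_dist cadj x (enc M) + graph_dist cadj (enc M) z"
      unfolding iff[OF e(1)] using e by (rule conjI)
    fix m assume m: "m \<in> V \<and> graph_dist cadj x y = graph_dist cadj x m + graph_dist cadj m y \<and>
      graph_dist cadj y z = graph_dist cadj y m + graph_dist cadj m z \<and>
      graph_dist cadj x z = graph_dist cadj x m + graph_dist cadj m z"
    have "dec m = M" by (rule iff[THEN iffD1, OF conjunct1[OF m] conjunct2[OF m]])
    then have "dec m = dec (enc M)" unfolding e(2) .
    then show "m = enc M" unfolding dec_inj[OF conjunct1[OF m] e(1)] .
  qed
qed

end

text \<open>\<open>comm\<close> says that moving the base set alters it in finitely many elements,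
  so that \<open>G\<close> permutes the commensurate sets; \<open>finite_fix\<close> is properness
  of the resulting action.\<close>

locale commensurating_action = cube_graph V dec U A + group G
  for V :: "'v set" and dec and U A :: "'u set" and G (structure) +
  fixes \<alpha> :: "_ \<Rightarrow> 'u \<Rightarrow> 'u"
  assumes A_sub: "A \<subseteq> U"
    and \<alpha>_U: "g \<in> carrier G \<Longrightarrow> u \<in> U \<Longrightarrow> \<alpha> g u \<in> U"
    and \<alpha>_mult: "g \<in> carrier G \<Longrightarrow> h \<in> carrier G \<Longrightarrow> u \<in> U \<Longrightarrow> \<alpha> (g \<otimes> h) u = \<alpha> g (\<alpha> h u)"
    and \<alpha>_one: "u \<in> U \<Longrightarrow> \<alpha> \<one> u = u"
    and comm: "g \<in> carrier G \<Longrightarrow> finite (sym_diff (\<alpha> g ` A) A)"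
    and finite_fix: "B \<subseteq> U \<Longrightarrow> finite (sym_diff B A) \<Longrightarrow> finite {g \<in> carrier G. \<alpha> g ` B = B}"
begin

lemma \<alpha>_inj: "g \<in> carrier G \<Longrightarrow> inj_on (\<alpha> g) U"
  by (rule inj_on_inverseI[of _ "\<alpha> (inv g)"]) (simp flip: \<alpha>_mult add: \<alpha>_one)

lemma img_sym_diff: "g \<in> carrier G \<Longrightarrow> B \<subseteq> U \<Longrightarrow> C \<subseteq> U \<Longrightarrow> sym_diff (\<alpha> g ` B) (\<alpha> g ` C) = \<alpha> g ` sym_diff B C"
proof -
  assume g: "g \<in> carrier G" and BC: "B \<subseteq> U" "C \<subseteq> U"
  have "\<alpha> g ` (B - C) = \<alpha> g ` B - \<alpha> g ` C" by (rule inj_on_image_set_diff[OF \<alpha>_inj[OF g]]) (use BC in auto)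
  moreover have "\<alpha> g ` (C - B) = \<alpha> g ` C - \<alpha> g ` B" by (rule inj_on_image_set_diff[OF \<alpha>_inj[OF g]]) (use BC in auto)
  ultimately show ?thesis by (simp only: image_Un)
qed

lemma img_V: "g \<in> carrier G \<Longrightarrow> B \<subseteq> U \<Longrightarrow> finite (sym_diff B A) \<Longrightarrow> \<alpha> g ` B \<subseteq> U \<and> finite (sym_diff (\<alpha> g ` B) A)"
proof
  assume g: "g \<in> carrier G" and B: "B \<subseteq> U" "finite (sym_diff B A)"
  show "\<alpha> g ` B \<subseteq> U" using \<alpha>_U[OF g] B(1) by blast
  have "finite (sym_diff (\<alpha> g ` B) (\<alpha> g ` A))" unfolding img_sym_diff[OF g B(1) A_sub] using B(2) by (rule finite_imageI)
  then show "finite (sym_diff (\<alpha> g ` B) A)" using comm[OF g] by (rule sym_diff_triangle_card(1))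
qed

definition act :: "_ \<Rightarrow> 'v \<Rightarrow> 'v" where
  "act g = (\<lambda>x\<in>V. enc (\<alpha> g ` dec x))"

lemma act_V: "g \<in> carrier G \<Longrightarrow> x \<in> V \<Longrightarrow> act g x \<in> V \<and> dec (act g x) = \<alpha> g ` dec x"
proof -
  assume g: "g \<in> carrier G" and x: "x \<in> V"
  have e: "act g x = enc (\<alpha> g ` dec x)" unfolding act_def using x by simp
  note i = img_V[OF g dec_V(1)[OF x] dec_V(2)[OF x]]
  show ?thesis unfolding e by (rule enc[OF conjunct1[OF i] conjunct2[OF i]])
qed

lemma act_mult: "g \<in> carrier G \<Longrightarrow> h \<in> carrier G \<Longrightarrow> x \<in> V \<Longrightarrow> act (g \<otimes> h) x = act g (act h x)"
proof -
  assume gh: "g \<in> carrier G" "h \<in> carrier G" and x: "x \<in> V"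
  note a = act_V[OF gh(2) x]
  note b = act_V[OF gh(1) conjunct1[OF a]]
  note c = act_V[OF m_closed[OF gh] x]
  have "\<alpha> (g \<otimes> h) ` dec x = \<alpha> g ` \<alpha> h ` dec x"
    unfolding image_image using dec_V(1)[OF x] by (intro image_cong refl \<alpha>_mult gh) blast
  then have "dec (act (g \<otimes> h) x) = dec (act g (act h x))"
    unfolding conjunct2[OF b] conjunct2[OF c] conjunct2[OF a] .
  then show ?thesis unfolding dec_inj[OF conjunct1[OF c] conjunct1[OF b]] .
qed

lemma act_one: "x \<in> V \<Longrightarrow> act \<one> x = x"
proof -
  assume x: "x \<in> V"
  have "\<alpha> \<one> ` dec x = (\<lambda>u. u) ` dec x" using dec_V(1)[OF x] by (intro image_cong refl \<alpha>_one) blast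
  then show ?thesis unfolding act_def using x enc_dec[OF x] by simp
qed

lemma act_Bij: "g \<in> carrier G \<Longrightarrow> act g \<in> Bij V"
  unfolding Bij_def
proof
  assume g: "g \<in> carrier G"
  show "act g \<in> extensional V" unfolding act_def by (rule restrict_extensional)
  have 1: "act (inv g) (act g x) = x" if "x \<in> V" for x
    unfolding act_mult[OF inv_closed[OF g] g that, symmetric] l_inv[OF g] by (rule act_one[OF that])
  have 2: "act g (act (inv g) x) = x" if "x \<in> V" for x
    unfolding act_mult[OF g inv_closed[OF g] that, symmetric] r_inv[OF g] by (rule act_one[OF that])
  have "bij_betw (act g) V V"
    by (intro bij_betw_byWitness[of V "act (inv g)"] ballI image_subsetI 1 2
      conjunct1[OF act_V[OF g]] conjunct1[OF act_V[OF inv_closed[OF g]]])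
  then show "act g \<in> {f. bij_betw f V V}" by simp
qed

lemma proper_action: "proper_graph_action G V cadj act"
  unfolding proper_graph_action_def
proof (intro conjI ballI graph_action.intro group_action.intro simplicial)
  show "group_hom G (BijGroup V) act"
  proof (intro group_hom.intro group_BijGroup group_hom_axioms.intro homI)
    show "group G" by (rule group_axioms)
    show "act g \<in> carrier (BijGroup V)" if "g \<in> carrier G" for g using act_Bij[OF that] by (simp add: BijGroup_def)
    show "act (g \<otimes> h) = act g \<otimes>\<^bsub>BijGroup V\<^esub> act h" if gh: "g \<in> carrier G" "h \<in> carrier G" for g h
    proof -
      have "act (g \<otimes> h) = compose V (act g) (act h)"
      proof
        fix x show "act (g \<otimes> h) x = compose V (act g) (act h) x"
        proof (cases "x \<in> V")
          case True
          show ?thesis unfolding compose_eq[OF True] by (rule act_mult[OF gh True])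
        qed (simp add: compose_def act_def)
      qed
      then show ?thesis using act_Bij[OF gh(1)] act_Bij[OF gh(2)] by (simp add: BijGroup_def)
    qed
  qed
  show "graph_action_axioms G V cadj act"
  proof
    fix g x y assume g: "g \<in> carrier G" and x: "x \<in> V" and y: "y \<in> V"
    have sd: "sym_diff (dec (act g x)) (dec (act g y)) = \<alpha> g ` sym_diff (dec x) (dec y)"
      unfolding conjunct2[OF act_V[OF g x]] conjunct2[OF act_V[OF g y]]
      by (rule img_sym_diff[OF g dec_V(1)[OF x] dec_V(1)[OF y]])
    have sU: "sym_diff (dec x) (dec y) \<subseteq> U" using dec_V(1)[OF x] dec_V(1)[OF y] by blast
    have c: "card (\<alpha> g ` sym_diff (dec x) (dec y)) = card (sym_diff (dec x) (dec y))"
      by (rule card_image[OF inj_on_subset[OF \<alpha>_inj[OF g] sU]])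
    show "cadj (act g x) (act g y) \<longleftrightarrow> cadj x y"
      unfolding cadj_def sd c by (simp only: conjunct1[OF act_V[OF g x]] conjunct1[OF act_V[OF g y]] x y simp_thms)
  qed
  fix x assume x: "x \<in> V"
  have "stabilizer G act x \<subseteq> {g \<in> carrier G. \<alpha> g ` dec x = dec x}"
  proof
    fix g assume "g \<in> stabilizer G act x"
    then have "g \<in> carrier G" "act g x = x" by (auto simp: stabilizer_def)
    then show "g \<in> {g \<in> carrier G. \<alpha> g ` dec x = dec x}" using conjunct2[OF act_V[of g x]] x by simp
  qed
  then show "finite (stabilizer G act x)" by (rule finite_subset) (rule finite_fix[OF dec_V[OF x]])
qed

end

section \<open>Dyadic charts of the circle\<close>

definition sig :: "nat \<Rightarrow> int \<Rightarrow> real \<Rightarrow> circle" where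
  "sig n i s = circle_proj ((of_int i + frac s) / 2 ^ n)"

text \<open>The affine map onto the \<open>r\<close>-th of the \<open>2 ^ e\<close> standard
  subintervals of the unit interval; composing a chart with it subdivides the chart.\<close>

definition part :: "nat \<Rightarrow> int \<Rightarrow> real \<Rightarrow> real" where
  "part e r s = (of_int r + frac s) / 2 ^ e"

text \<open>A chart is a function on the line, made periodic by \<open>frac\<close>: a standard
  interval together with its affine parametrisation. Circle maps act by composition.\<close>

definition Sig :: "(real \<Rightarrow> circle) set" where
  "Sig = {sig n i | n i. True}"

lemma sig_part:
  assumes "0 \<le> r" "r < 2 ^ e"
  shows "sig (n + e) (2 ^ e * i + r) = sig n i \<circ> part e r"
proof
  fix s :: real
  have "of_int r + frac s < 2 ^ e"
  proof -
    have "r + 1 \<le> 2 ^ e" using assms by simp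
    then have "real_of_int (r + 1) \<le> real_of_int (2 ^ e)" by (simp only: of_int_le_iff)
    then show ?thesis using frac_lt_1[of s] by simp
  qed
  moreover have "0 \<le> of_int r + frac s" using assms(1) by simp
  ultimately have "0 \<le> part e r s" "part e r s < 1" unfolding part_def by simp_all
  then have f: "frac (part e r s) = part e r s" by (simp add: frac_eq)
  have "(of_int (2 ^ e * i + r) + frac s) / 2 ^ (n + e) = (of_int i + part e r s) / 2 ^ n"
    unfolding part_def by (simp add: field_simps power_add)
  then show "sig (n + e) (2 ^ e * i + r) s = (sig n i \<circ> part e r) s" unfolding sig_def o_apply f by (simp only:)
qed

lemma sig_ancestor: "sig (n + e) j = sig n (j div 2 ^ e) \<circ> part e (j mod 2 ^ e)"
  using sig_part[of "j mod 2 ^ e" e n "j div 2 ^ e"] by simp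

lemma sig_mod: "sig n i = sig n (i mod 2 ^ n)"
proof
  fix s :: real
  have "real_of_int i = of_int (2 ^ n * (i div 2 ^ n) + i mod 2 ^ n)" by simp
  then have "(of_int i + frac s) / 2 ^ n = (of_int (i mod 2 ^ n) + frac s) / 2 ^ n + of_int (i div 2 ^ n)"
    by (simp only: of_int_add of_int_mult of_int_power of_int_numeral) (simp add: field_simps)
  then show "sig n i s = sig n (i mod 2 ^ n) s" unfolding sig_def by (simp only: circle_proj_int)
qed

text \<open>Evaluating at 0 and \<open>1/2\<close> determines half the length of the interval modulo
  \<open>\<int>\<close>; half lengths lie above 0 and at most at \<open>1/2\<close>, so they agree
  exactly.\<close>

lemma sig_level:
  assumes "sig n i = sig m j"
  shows "n = m"
proof -
  have fr: "frac (1/2 :: real) = 1/2" by (simp add: frac_eq)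
  have fr0: "frac (0 :: real) = 0" by simp
  have "sig n i (1/2) = sig m j (1/2)" "sig n i 0 = sig m j 0" using assms by simp_all
  then have *: "(of_int i + 1/2) / 2 ^ n - (of_int j + 1/2) / 2 ^ m \<in> (\<int> :: real set)" "(of_int i + 0) / 2 ^ n - (of_int j + 0) / 2 ^ m \<in> (\<int> :: real set)"
    unfolding sig_def fr fr0 circle_proj_eq_iff .
  define a b where "a = 1/2 / (2::real) ^ n" and "b = 1/2 / (2::real) ^ m"
  have "a - b \<in> \<int>" using Ints_diff[OF *] unfolding a_def b_def by (simp add: add_divide_distrib)
  then obtain k where k: "a - b = of_int k" by (rule Ints_cases)
  have ab: "0 < a" "a \<le> 1/2" "0 < b" "b \<le> 1/2" unfolding a_def b_def by (simp_all add: divide_le_eq)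
  then have "\<bar>real_of_int k\<bar> < 1" unfolding k[symmetric] by linarith
  then have "k = 0" by linarith
  then have "a = b" using k by simp
  then have "(2::real) ^ n = 2 ^ m" unfolding a_def b_def by simp
  then show ?thesis by simp
qed

lemma sig_onto: "\<exists>i s. sig n i s = c"
proof -
  define x where "x = circle_rep c * 2 ^ n"
  have "(of_int \<lfloor>x\<rfloor> + frac x) / 2 ^ n = circle_rep c" unfolding x_def frac_def by simp
  then have "sig n \<lfloor>x\<rfloor> x = c" unfolding sig_def by simp
  then show ?thesis by blast
qed

lemma sig_in_Sig: "sig n i \<in> Sig"
  unfolding Sig_def by blast

lemma SigE: "f \<in> Sig \<Longrightarrow> (\<And>n i. f = sig n i \<Longrightarrow> P) \<Longrightarrow> P"
  unfolding Sig_def by (elim CollectE exE conjE)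

lemma finite_sig: "finite {sig n i | n i. n \<le> K}"
proof (rule finite_subset)
  show "{sig n i | n i. n \<le> K} \<subseteq> (\<Union>n\<in>{..K}. sig n ` {0..<2 ^ n})"
  proof
    fix f assume "f \<in> {sig n i | n i. n \<le> K}"
    then obtain n i where f: "f = sig n i" "n \<le> K" by blast
    have "f = sig n (i mod 2 ^ n)" unfolding f(1) by (rule sig_mod)
    moreover have "i mod 2 ^ n \<in> {0..<2 ^ n}" by simp
    ultimately show "f \<in> (\<Union>n\<in>{..K}. sig n ` {0..<2 ^ n})" using f(2) by blast
  qed
qed simp

text \<open>From some level on \<open>h\<close> maps standard intervals affinely to standard
  intervals, that is, charts to charts.\<close>

lemma TL_sig:
  assumes h: "h \<in> TL"
  shows "\<exists>n0. \<forall>n\<ge>n0. \<forall>i. circ h \<circ> sig n i \<in> Sig"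
proof -
  obtain n0 where n0: "\<forall>n\<ge>n0. \<forall>i. stdaff h n i 0" using TL_level[OF h] by blast
  have "circ h \<circ> sig n i \<in> Sig" if nn0: "n \<ge> n0" for n i
  proof -
    obtain m j where mj: "\<forall>s. 0 \<le> s \<longrightarrow> s \<le> 1 \<longrightarrow> h ((of_int i + s) / 2 ^ n) = (of_int j + s) / 2 ^ m"
      using n0[rule_format, OF nn0, of i] unfolding stdaff_def by (elim exE conjE)
    have "circ h \<circ> sig n i = sig m j"
    proof
      fix s :: real
      have "h ((of_int i + frac s) / 2 ^ n) = (of_int j + frac s) / 2 ^ m"
        by (rule mj[rule_format]) (simp_all add: less_imp_le frac_lt_1)
      then show "(circ h \<circ> sig n i) s = sig m j s" unfolding sig_def o_apply circ_proj[OF h] by (simp only:)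
    qed
    then show ?thesis by (simp only: sig_in_Sig)
  qed
  then show ?thesis by blast
qed

lemma post_inv: "h \<in> TL \<Longrightarrow> circ (Hilbert_Choice.inv h) \<circ> (circ h \<circ> f) = f" "h \<in> TL \<Longrightarrow> circ h \<circ> (circ (Hilbert_Choice.inv h) \<circ> f) = f"
  unfolding comp_assoc[symmetric] by (simp_all only: circ_inv id_comp)

lemma Sig_diff:
  assumes h: "h \<in> TL"
  shows "finite ((\<circ>) (circ h) ` Sig - Sig)"
proof -
  obtain n0 where n0: "\<forall>n\<ge>n0. \<forall>i. circ h \<circ> sig n i \<in> Sig" using TL_sig[OF h] by blast
  have "(\<circ>) (circ h) ` Sig - Sig \<subseteq> (\<circ>) (circ h) ` {sig n i | n i. n \<le> n0}"
  proof
    fix f assume f: "f \<in> (\<circ>) (circ h) ` Sig - Sig"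
    then obtain n i where ni: "f = circ h \<circ> sig n i" unfolding Sig_def by blast
    then have "\<not> n \<ge> n0" using n0 f by blast
    then show "f \<in> (\<circ>) (circ h) ` {sig n i | n i. n \<le> n0}" unfolding ni by (intro imageI CollectI exI conjI) auto
  qed
  then show ?thesis by (rule finite_subset) (rule finite_imageI[OF finite_sig])
qed

text \<open>Charts missed by \<open>circ h\<close> are charts that the inverse map sends outside
  \<open>Sig\<close>, so finiteness for the inverse suffices.\<close>

lemma Sig_diff': "h \<in> TL \<Longrightarrow> Sig - (\<circ>) (circ h) ` Sig \<subseteq> (\<circ>) (circ h) ` ((\<circ>) (circ (Hilbert_Choice.inv h)) ` Sig - Sig)"
proof
  fix f assume h: "h \<in> TL" and f: "f \<in> Sig - (\<circ>) (circ h) ` Sig"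
  have e: "f = circ h \<circ> (circ (Hilbert_Choice.inv h) \<circ> f)" by (rule post_inv(2)[OF h, symmetric])
  have "circ (Hilbert_Choice.inv h) \<circ> f \<notin> Sig"
  proof
    assume "circ (Hilbert_Choice.inv h) \<circ> f \<in> Sig"
    then have "circ h \<circ> (circ (Hilbert_Choice.inv h) \<circ> f) \<in> (\<circ>) (circ h) ` Sig" by (rule imageI)
    then show False using f unfolding e[symmetric] by blast
  qed
  then have "circ (Hilbert_Choice.inv h) \<circ> f \<in> (\<circ>) (circ (Hilbert_Choice.inv h)) ` Sig - Sig" using f by blast
  then show "f \<in> (\<circ>) (circ h) ` ((\<circ>) (circ (Hilbert_Choice.inv h)) ` Sig - Sig)"
    by (rule image_eqI[where f = "(\<circ>) (circ h)" and x = "circ (Hilbert_Choice.inv h) \<circ> f", OF e])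
qed

lemma Sig_commensurated: "h \<in> TL \<Longrightarrow> finite (sym_diff ((\<circ>) (circ h) ` Sig) Sig)"
proof (rule finite_UnI)
  assume h: "h \<in> TL"
  show "finite ((\<circ>) (circ h) ` Sig - Sig)" by (rule Sig_diff[OF h])
  show "finite (Sig - (\<circ>) (circ h) ` Sig)"
    by (rule finite_subset[OF Sig_diff'[OF h] finite_imageI[OF Sig_diff[OF TL_inv[OF h]]]])
qed

text \<open>The charts that \<open>circ h\<close> maps into \<open>Sig\<close> are closed under subdivision, so a bad chart of level \<open>n\<close>
  has \<open>n + 1\<close> bad ancestors.\<close>

lemma bad_level:
  assumes h: "h \<in> TL" and fin: "finite ((\<circ>) (circ h) ` Sig - Sig)" and bad: "circ h \<circ> sig n i \<notin> Sig"
  shows "n < card ((\<circ>) (circ h) ` Sig - Sig)"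
proof -
  define f where "f k = circ h \<circ> sig k (i div 2 ^ (n - k))" for k
  have bad': "f k \<notin> Sig" if "k \<le> n" for k
  proof
    assume "f k \<in> Sig"
    then obtain m j where mj: "f k = sig m j" by (rule SigE)
    have n: "k + (n - k) = n" using that by simp
    have "circ h \<circ> sig n i = sig m j \<circ> part (n - k) (i mod 2 ^ (n - k))"
      using sig_ancestor[of k "n - k" i] mj unfolding n f_def by (simp only: comp_assoc[symmetric])
    also have "\<dots> = sig (m + (n - k)) (2 ^ (n - k) * j + i mod 2 ^ (n - k))"
      by (rule sig_part[symmetric]) simp_all
    finally have e: "circ h \<circ> sig n i = sig (m + (n - k)) (2 ^ (n - k) * j + i mod 2 ^ (n - k))" .
    show False using bad by (simp only: e sig_in_Sig not_True_eq_False)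
  qed
  have inj: "inj_on f {..n}"
  proof (rule inj_onI)
    fix k l assume "f k = f l"
    then have "circ (Hilbert_Choice.inv h) \<circ> f k = circ (Hilbert_Choice.inv h) \<circ> f l" by (rule arg_cong)
    then show "k = l" unfolding f_def post_inv(1)[OF h] by (rule sig_level)
  qed
  have "f ` {..n} \<subseteq> (\<circ>) (circ h) ` Sig - Sig"
  proof
    fix x assume "x \<in> f ` {..n}"
    then obtain k where k: "x = f k" "k \<le> n" by blast
    have "f k \<in> (\<circ>) (circ h) ` Sig" unfolding f_def by (rule imageI[OF sig_in_Sig])
    then show "x \<in> (\<circ>) (circ h) ` Sig - Sig" unfolding k(1) using bad'[OF k(2)] by (rule DiffI)
  qed
  from card_mono[OF fin this] show ?thesis unfolding card_image[OF inj] by simp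
qed

text \<open>At level \<open>K\<close> neither the map nor its inverse has bad charts. If the image
  had level \<open>m > K\<close>, its ancestor at level \<open>K\<close> would be pulled back to a
  chart of some level \<open>p\<close>; the original chart is \<open>m - K\<close> levels below that
  one, so \<open>K = p + (m - K)\<close> and \<open>m \<le> 2 * K\<close>.\<close>

lemma good_level:
  assumes h: "h \<in> TL" and K: "card ((\<circ>) (circ h) ` Sig - Sig) \<le> K"
    and K': "card ((\<circ>) (circ (Hilbert_Choice.inv h)) ` Sig - Sig) \<le> K"
  shows "circ h \<circ> sig K i \<in> {sig n i | n i. n \<le> 2 * K}"
proof -
  have good: "circ h \<circ> sig K i \<in> Sig" for i using bad_level[OF h Sig_diff[OF h], of K i] K by linarith
  have good': "circ (Hilbert_Choice.inv h) \<circ> sig K i \<in> Sig" for i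
    using bad_level[OF TL_inv[OF h] Sig_diff[OF TL_inv[OF h]], of K i] K' by linarith
  obtain m j where mj: "circ h \<circ> sig K i = sig m j" using good[of i] by (rule SigE)
  have "m \<le> 2 * K"
  proof (cases "m \<le> K")
    case False
    then have m: "K + (m - K) = m" by simp
    define e where "e = m - K"
    obtain p q where pq: "circ (Hilbert_Choice.inv h) \<circ> sig K (j div 2 ^ e) = sig p q"
      using good'[of "j div 2 ^ e"] by (rule SigE)
    have s1: "sig K i = circ (Hilbert_Choice.inv h) \<circ> sig m j" using post_inv(1)[OF h, of "sig K i"] unfolding mj by (rule sym)
    have s2: "sig m j = sig K (j div 2 ^ e) \<circ> part e (j mod 2 ^ e)" using sig_ancestor[of K e j] unfolding e_def m .
    have s3: "circ (Hilbert_Choice.inv h) \<circ> sig m j = sig p q \<circ> part e (j mod 2 ^ e)"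
      unfolding s2 comp_assoc[symmetric] pq by (rule refl)
    have s4: "sig (p + e) (2 ^ e * q + j mod 2 ^ e) = sig p q \<circ> part e (j mod 2 ^ e)"
      by (rule sig_part) simp_all
    have "K = p + e" by (rule sig_level[OF trans[OF trans[OF s1 s3] s4[symmetric]]])
    then show ?thesis unfolding e_def by linarith
  qed simp
  then show ?thesis unfolding mj by blast
qed

text \<open>A circle map is determined by its composites with the \<open>2 ^ K\<close> charts of
  level \<open>K\<close>, and by \<open>good_level\<close> these have finitely many possible
  values.\<close>

lemma finite_Sig_close: "finite {g \<in> circ ` TL. card (sym_diff ((\<circ>) g ` Sig) Sig) \<le> K}"
proof -
  define E where "E g = (\<lambda>i\<in>{0..<2 ^ K :: int}. g \<circ> sig K i)" for g :: "circle \<Rightarrow> circle"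
  let ?S = "{g \<in> circ ` TL. card (sym_diff ((\<circ>) g ` Sig) Sig) \<le> K}"
  have "E ` ?S \<subseteq> {0..<2 ^ K} \<rightarrow>\<^sub>E {sig n i | n i. n \<le> 2 * K}"
  proof
    fix x assume "x \<in> E ` ?S"
    then obtain h where h: "h \<in> TL" "x = E (circ h)" "card (sym_diff ((\<circ>) (circ h) ` Sig) Sig) \<le> K" by blast
    have f: "finite (sym_diff ((\<circ>) (circ h) ` Sig) Sig)" by (rule Sig_commensurated[OF h(1)])
    have c1: "card ((\<circ>) (circ h) ` Sig - Sig) \<le> K"
      by (rule order_trans[OF card_mono[OF f Un_upper1] h(3)])
    have hi: "Hilbert_Choice.inv (Hilbert_Choice.inv h) = h" by (rule inv_inv_eq[OF TL_bij[OF h(1)]])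
    have sub: "(\<circ>) (circ (Hilbert_Choice.inv h)) ` Sig - Sig \<subseteq> (\<circ>) (circ (Hilbert_Choice.inv h)) ` (Sig - (\<circ>) (circ h) ` Sig)"
    proof
      fix y assume y: "y \<in> (\<circ>) (circ (Hilbert_Choice.inv h)) ` Sig - Sig"
      then obtain s where s: "s \<in> Sig" "y = circ (Hilbert_Choice.inv h) \<circ> s" by blast
      have "s \<notin> (\<circ>) (circ h) ` Sig"
      proof
        assume "s \<in> (\<circ>) (circ h) ` Sig"
        then obtain t where t: "t \<in> Sig" "s = circ h \<circ> t" by blast
        have "y = t" unfolding s(2) t(2) by (rule post_inv(1)[OF h(1)])
        then show False using y t(1) by blast
      qed
      then show "y \<in> (\<circ>) (circ (Hilbert_Choice.inv h)) ` (Sig - (\<circ>) (circ h) ` Sig)" unfolding s(2) using s(1) by blast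
    qed
    have f2: "finite (Sig - (\<circ>) (circ h) ` Sig)" by (rule finite_subset[OF Un_upper2 f])
    have c2: "card ((\<circ>) (circ (Hilbert_Choice.inv h)) ` Sig - Sig) \<le> K"
      by (rule order_trans[OF card_mono[OF finite_imageI[OF f2] sub] order_trans[OF card_image_le[OF f2] order_trans[OF card_mono[OF f Un_upper2] h(3)]]])
    show "x \<in> {0..<2 ^ K} \<rightarrow>\<^sub>E {sig n i | n i. n \<le> 2 * K}"
      unfolding h(2) E_def by (rule restrict_PiE_iff[THEN iffD2]) (intro ballI good_level[OF h(1) c1 c2])
  qed
  then have "finite (E ` ?S)" by (rule finite_subset) (intro finite_PiE finite_sig, simp)
  moreover have "inj_on E ?S"
  proof (rule inj_onI)
    fix g g' assume e: "E g = E g'"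
    show "g = g'"
    proof
      fix c
      obtain i s where isc: "sig K i s = c" using sig_onto[of K c] by (elim exE)
      have r: "i mod 2 ^ K \<in> {0..<2 ^ K}" by simp
      have "E g (i mod 2 ^ K) s = E g' (i mod 2 ^ K) s" unfolding e by (rule refl)
      then have "g (sig K (i mod 2 ^ K) s) = g' (sig K (i mod 2 ^ K) s)"
        unfolding E_def restrict_apply'[OF r] o_apply .
      then show "g c = g' c" unfolding sig_mod[of K i, symmetric] isc .
    qed
  qed
  ultimately show ?thesis by (rule finite_imageD)
qed

section \<open>The product acting on charts and integers\<close>

text \<open>The second summand, with the base set of non-negative integers, takes care of the factor \<open>\<int>\<close>.\<close>

fun tz_act :: "(circle \<Rightarrow> circle) \<times> int \<Rightarrow> (real \<Rightarrow> circle) + int \<Rightarrow> (real \<Rightarrow> circle) + int" where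
  "tz_act (g, k) (Inl f) = Inl (g \<circ> f)"
| "tz_act (g, k) (Inr m) = Inr (m + k)"

text \<open>The charts are closed up under \<open>T\<close> so that the ambient set is
  invariant.\<close>

definition tz_U :: "((real \<Rightarrow> circle) + int) set" where
  "tz_U = Inl ` (\<lambda>(h, s). circ h \<circ> s) ` (TL \<times> Sig) \<union> range Inr"

definition tz_A :: "((real \<Rightarrow> circle) + int) set" where
  "tz_A = Inl ` Sig \<union> Inr ` {0..}"

lemma countable_tz_U: "countable tz_U"
proof -
  have "Sig = (\<lambda>(n, i). sig n i) ` UNIV" unfolding Sig_def by auto
  then have "countable Sig" by (metis countable_image countableI_type)
  then show ?thesis unfolding tz_U_def by (intro countable_Un countable_image countable_SIGMA countable_TL countableI_type)
qed

lemma vimage_sym_diff: "inj f \<Longrightarrow> finite (sym_diff B C) \<Longrightarrow> finite (sym_diff (f -` B) (f -` C))"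
  using finite_vimageI[of "sym_diff B C" f] by (simp add: vimage_Un vimage_Diff)

lemma tz_vimage: "Inl -` tz_act (g, k) ` B = (\<circ>) g ` (Inl -` B)" "Inr -` tz_act (g, k) ` B = (\<lambda>m. m + k) ` (Inr -` B)"
proof -
  show "Inl -` tz_act (g, k) ` B = (\<circ>) g ` (Inl -` B)"
  proof (intro Set.set_eqI iffI)
    fix f assume "f \<in> Inl -` tz_act (g, k) ` B"
    then have "Inl f \<in> tz_act (g, k) ` B" by (simp only: vimage_eq)
    then obtain u where u: "Inl f = tz_act (g, k) u" "u \<in> B" by (rule imageE)
    show "f \<in> (\<circ>) g ` (Inl -` B)"
    proof (cases u)
      case (Inl s)
      have "f = g \<circ> s" using u(1) unfolding Inl tz_act.simps by (simp only: sum.inject)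
      moreover have "s \<in> Inl -` B" using u(2) unfolding Inl by (simp only: vimage_eq)
      ultimately show ?thesis by (rule image_eqI)
    qed (use u(1) in simp)
  next
    fix f assume "f \<in> (\<circ>) g ` (Inl -` B)"
    then obtain s where s: "f = g \<circ> s" "s \<in> Inl -` B" by (rule imageE)
    have "tz_act (g, k) (Inl s) \<in> tz_act (g, k) ` B" using s(2) by (intro imageI) (simp only: vimage_eq)
    then show "f \<in> Inl -` tz_act (g, k) ` B" unfolding s(1) tz_act.simps by (simp only: vimage_eq)
  qed
  show "Inr -` tz_act (g, k) ` B = (\<lambda>m. m + k) ` (Inr -` B)"
  proof (intro Set.set_eqI iffI)
    fix f assume "f \<in> Inr -` tz_act (g, k) ` B"
    then have "Inr f \<in> tz_act (g, k) ` B" by (simp only: vimage_eq)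
    then obtain u where u: "Inr f = tz_act (g, k) u" "u \<in> B" by (rule imageE)
    show "f \<in> (\<lambda>m. m + k) ` (Inr -` B)"
    proof (cases u)
      case (Inr s)
      have "f = s + k" using u(1) unfolding Inr tz_act.simps by (simp only: sum.inject)
      moreover have "s \<in> Inr -` B" using u(2) unfolding Inr by (simp only: vimage_eq)
      ultimately show ?thesis by (rule image_eqI)
    qed (use u(1) in simp)
  next
    fix f assume "f \<in> (\<lambda>m. m + k) ` (Inr -` B)"
    then obtain s where s: "f = s + k" "s \<in> Inr -` B" by (rule imageE)
    have "tz_act (g, k) (Inr s) \<in> tz_act (g, k) ` B" using s(2) by (intro imageI) (simp only: vimage_eq)
    then show "f \<in> Inr -` tz_act (g, k) ` B" unfolding s(1) tz_act.simps by (simp only: vimage_eq)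
  qed
qed

text \<open>A set commensurate to the non-negative integers is non-empty; invariance under a
  non-zero translation would then give it infinitely many negative elements.\<close>

lemma translate_fixed:
  fixes C :: "int set"
  assumes fin: "finite (sym_diff C {0..})" and fx: "(\<lambda>m. m + k) ` C = C"
  shows "k = 0"
proof (rule ccontr)
  assume k: "k \<noteq> 0"
  have p: "m + k \<in> C" if "m \<in> C" for m using fx that by blast
  have n: "m - k \<in> C" if "m \<in> C" for m
  proof -
    have "m \<in> (\<lambda>m. m + k) ` C" unfolding fx by (rule that)
    then show ?thesis by auto
  qed
  have d: "m - \<bar>k\<bar> \<in> C" if "m \<in> C" for m using p[OF that] n[OF that] by (cases "k > 0") simp_all
  have "\<not> {0..} \<subseteq> sym_diff C {0..}" using fin infinite_Ici finite_subset by blast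
  then obtain m where m: "m \<in> C" by blast
  have c: "m - int j * \<bar>k\<bar> \<in> C" for j
  proof (induction j)
    case (Suc j)
    show ?case using d[OF Suc] by (simp add: algebra_simps)
  qed (use m in simp)
  have "(\<lambda>j. m - int j * \<bar>k\<bar>) ` {nat m + 1..} \<subseteq> sym_diff C {0..}"
  proof
    fix x assume "x \<in> (\<lambda>j. m - int j * \<bar>k\<bar>) ` {nat m + 1..}"
    then obtain j where j: "x = m - int j * \<bar>k\<bar>" "j \<ge> nat m + 1" by blast
    have "int j * 1 \<le> int j * \<bar>k\<bar>" by (rule mult_left_mono) (use k in auto)
    then have "x < 0" using j by linarith
    then show "x \<in> sym_diff C {0..}" using c[of j] unfolding j(1)[symmetric] by simp
  qed
  moreover have "inj_on (\<lambda>j. m - int j * \<bar>k\<bar>) {nat m + 1..}" by (rule inj_onI) (use k in simp)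
  ultimately have "finite {nat m + 1..}" using fin finite_subset finite_imageD by blast
  then show False using infinite_Ici by blast
qed

lemma tz_A_sub: "tz_A \<subseteq> tz_U"
proof -
  have idS: "s \<in> (\<lambda>(h, s). circ h \<circ> s) ` (TL \<times> Sig)" if "s \<in> Sig" for s
    by (rule image_eqI[of _ _ "(id, s)"]) (use that TL_id in \<open>simp_all only: case_prod_conv circ_id id_comp mem_Sigma_iff simp_thms\<close>)
  show ?thesis unfolding tz_A_def tz_U_def using idS by blast
qed

lemma sum_sym_diff: "sym_diff (Inl ` P \<union> Inr ` R) (Inl ` P' \<union> Inr ` R') \<subseteq> Inl ` sym_diff P P' \<union> Inr ` sym_diff R R'"
  by auto

text \<open>If \<open>B\<close> is preserved, its integer part forces \<open>k = 0\<close>, and its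
  chart part \<open>S\<close> bounds the difference between \<open>Sig\<close> and its image by
  twice \<open>card (sym_diff S Sig)\<close>, so \<open>finite_Sig_close\<close> applies.\<close>

lemma tz_commensurating:
  assumes dec: "bij_betw dec V {B. B \<subseteq> tz_U \<and> finite (sym_diff B tz_A)}"
  shows "commensurating_action V dec tz_U tz_A TZ tz_act"
proof (intro commensurating_action.intro cube_graph.intro dec group_TZ commensurating_action_axioms.intro)
  show "tz_A \<subseteq> tz_U" by (rule tz_A_sub)
  fix g assume "g \<in> carrier TZ"
  then obtain h k where g: "g = (circ h, k)" "h \<in> TL" unfolding carrier_TZ by blast
  show "tz_act g u \<in> tz_U" if uU: "u \<in> tz_U" for u
  proof (cases u)
    case (Inl f)
    have "f \<in> (\<lambda>(h, s). circ h \<circ> s) ` (TL \<times> Sig)" using uU unfolding Inl tz_U_def by blast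
    then obtain y where y: "f = (\<lambda>(h, s). circ h \<circ> s) y" "y \<in> TL \<times> Sig" by (rule imageE)
    obtain h' s where hs: "y = (h', s)" by (rule prod.exhaust)
    have f: "h' \<in> TL" "s \<in> Sig" "f = circ h' \<circ> s" using y unfolding hs by simp_all
    have e: "circ h \<circ> f = circ (h \<circ> h') \<circ> s" unfolding f(3) circ_comp[OF g(2) f(1)] by (simp only: comp_assoc)
    have "circ h \<circ> f \<in> (\<lambda>(h, s). circ h \<circ> s) ` (TL \<times> Sig)"
      unfolding e by (rule image_eqI[of _ _ "(h \<circ> h', s)"]) (use f(2) TL_comp[OF g(2) f(1)] in simp_all)
    then show ?thesis unfolding g(1) Inl tz_act.simps tz_U_def by blast
  next
    case (Inr m)
    show ?thesis unfolding g(1) Inr tz_act.simps tz_U_def by blast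
  qed
  show "tz_act (g \<otimes>\<^bsub>TZ\<^esub> g') u = tz_act g (tz_act g' u)" for g' u
    unfolding g(1) by (cases g'; cases u) (simp_all add: comp_assoc)
  show "finite (sym_diff (tz_act g ` tz_A) tz_A)"
  proof -
    have "tz_act g ` tz_A = Inl ` (\<circ>) (circ h) ` Sig \<union> Inr ` (\<lambda>m. m + k) ` {0..}"
      unfolding tz_A_def g(1) image_Un image_image by (simp only: tz_act.simps)
    then have sub: "sym_diff (tz_act g ` tz_A) tz_A \<subseteq> Inl ` sym_diff ((\<circ>) (circ h) ` Sig) Sig \<union> Inr ` sym_diff ((\<lambda>m. m + k) ` {0..}) {0..}"
      unfolding tz_A_def by (simp only: sum_sym_diff)
    have "sym_diff ((\<lambda>m. m + k) ` {0..}) {0..} \<subseteq> {- \<bar>k\<bar>..\<bar>k\<bar>}"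
    proof -
      have "(\<lambda>m. m + k) ` {0..} = {k..}"
      proof
        show "{k..} \<subseteq> (\<lambda>m. m + k) ` {0..}"
        proof
          fix x assume "x \<in> {k..}"
          then show "x \<in> (\<lambda>m. m + k) ` {0..}" by (intro image_eqI[of _ _ "x - k"]) auto
        qed
      qed auto
      then show ?thesis by auto
    qed
    then have fk: "finite (sym_diff ((\<lambda>m. m + k) ` {0..}) {0..})" by (rule finite_subset) simp
    show ?thesis
      by (rule finite_subset[OF sub finite_UnI[OF finite_imageI[OF Sig_commensurated[OF g(2)]] finite_imageI[OF fk]]])
  qed
next
  show "tz_act \<one>\<^bsub>TZ\<^esub> u = u" for u
    unfolding one_TZ by (cases u) (simp_all only: tz_act.simps id_comp add_0_right)
  fix B assume B: "B \<subseteq> tz_U" "finite (sym_diff B tz_A)"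
  have A: "Inl -` tz_A = Sig" "Inr -` tz_A = {0..}" unfolding tz_A_def by auto
  define S where "S = Inl -` B"
  have S: "finite (sym_diff S Sig)" using vimage_sym_diff[OF inj_Inl B(2)] unfolding A S_def .
  have C: "finite (sym_diff (Inr -` B) {0..})" using vimage_sym_diff[OF inj_Inr B(2)] unfolding A .
  define K where "K = 2 * card (sym_diff S Sig)"
  have "{g \<in> carrier TZ. tz_act g ` B = B} \<subseteq> {g \<in> circ ` TL. card (sym_diff ((\<circ>) g ` Sig) Sig) \<le> K} \<times> {0}"
  proof
    fix x assume x: "x \<in> {g \<in> carrier TZ. tz_act g ` B = B}"
    note xD = CollectD[OF x]
    have "x \<in> circ ` TL \<times> UNIV" using conjunct1[OF xD] unfolding carrier_TZ .
    then obtain g0 k where g0: "g0 \<in> circ ` TL" "x = (g0, k)" by (rule SigmaE)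
    obtain h where h: "g0 = circ h" "h \<in> TL" using g0(1) by (rule imageE)
    have g: "x = (circ h, k)" "h \<in> TL" using g0(2) h(2) unfolding h(1) .
    have fB: "tz_act (circ h, k) ` B = B" using conjunct2[OF xD] unfolding g(1) .
    have k: "k = 0" by (rule translate_fixed[OF C]) (rule tz_vimage(2)[of "circ h" k B, unfolded fB, symmetric])
    have fS: "(\<circ>) (circ h) ` S = S" unfolding S_def by (rule tz_vimage(1)[of "circ h" k B, unfolded fB, symmetric])
    have inj: "inj ((\<circ>) (circ h) :: (real \<Rightarrow> circle) \<Rightarrow> _)"
      by (rule inj_on_inverseI[of _ "(\<circ>) (circ (Hilbert_Choice.inv h))"]) (rule post_inv(1)[OF g(2)])
    have "sym_diff ((\<circ>) (circ h) ` Sig) ((\<circ>) (circ h) ` S) = (\<circ>) (circ h) ` sym_diff Sig S"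
      by (simp only: image_Un image_set_diff[OF inj])
    then have e: "sym_diff ((\<circ>) (circ h) ` Sig) S = (\<circ>) (circ h) ` sym_diff Sig S" unfolding fS .
    have c: "sym_diff Sig S = sym_diff S Sig" by (rule Un_commute)
    have f1: "finite (sym_diff ((\<circ>) (circ h) ` Sig) S)" unfolding e c by (rule finite_imageI[OF S])
    have "card (sym_diff ((\<circ>) (circ h) ` Sig) S) \<le> card (sym_diff S Sig)" unfolding e c by (rule card_image_le[OF S])
    then have c3: "card (sym_diff ((\<circ>) (circ h) ` Sig) Sig) \<le> K"
      using sym_diff_triangle_card(2)[OF f1 S] unfolding K_def by linarith
    show "x \<in> {g \<in> circ ` TL. card (sym_diff ((\<circ>) g ` Sig) Sig) \<le> K} \<times> {0}"
      unfolding g(1) k by (intro SigmaI CollectI conjI imageI[OF g(2)] c3 singletonI)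
  qed
  then show "finite {g \<in> carrier TZ. tz_act g ` B = B}"
    by (rule finite_subset) (intro finite_cartesian_product finite_Sig_close, simp)
qed

text \<open>The vertices are the finite modifications of \<open>tz_A\<close> inside a countable set,
  hence countably many, and an enumeration of them turns the complex into a graph on natural
  numbers.\<close>

lemma TZ_proper_median_action:
  "\<exists>(V :: nat set) adj \<phi>. median_graph V adj \<and> proper_graph_action TZ V adj \<phi>"
proof -
  let ?W = "{B. B \<subseteq> tz_U \<and> finite (sym_diff B tz_A)}"
  note AU = tz_A_sub
  have "?W \<subseteq> (\<lambda>F. sym_diff F tz_A) ` {F. F \<subseteq> tz_U \<and> finite F}"
  proof
    fix B assume "B \<in> ?W"
    then have "sym_diff B tz_A \<in> {F. F \<subseteq> tz_U \<and> finite F}" using AU by blast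
    moreover have "B = sym_diff (sym_diff B tz_A) tz_A" by blast
    ultimately show "B \<in> (\<lambda>F. sym_diff F tz_A) ` {F. F \<subseteq> tz_U \<and> finite F}" by (rule image_eqI[rotated])
  qed
  moreover have "countable {F. F \<subseteq> tz_U \<and> finite F}"
    using countable_Collect_finite_subset[OF countable_tz_U] by (simp add: conj_commute)
  ultimately have "countable ?W" by (rule countable_subset[OF _ countable_image])
  then have "bij_betw (from_nat_into ?W) (to_nat_on ?W ` ?W) ?W"
    by (intro bij_betw_byWitness[of _ "to_nat_on ?W"]) auto
  then interpret commensurating_action "to_nat_on ?W ` ?W" "from_nat_into ?W" tz_U tz_A TZ tz_act
    by (rule tz_commensurating)
  show ?thesis using median_graph[OF A_sub] proper_action by blast
qed

theorem theorem1p4: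
  shows "(\<forall>(V :: 'v set) adj \<phi>. median_graph V adj \<longrightarrow>
            \<not> proper_graph_action thompson_T_lift V adj \<phi>) \<and>
         (\<forall>(V :: 'w set) adj \<phi>. median_graph V adj \<longrightarrow> cubical_dim V adj < \<infinity> \<longrightarrow>
            graph_action thompson_T_lift V adj \<phi> \<longrightarrow>
            (\<exists>x\<in>V. finite (orbit thompson_T_lift \<phi> x))) \<and>
         quasi_isometric_groups thompson_T_lift (thompson_T \<times>\<times> integer_group) \<and>
         (\<exists>(V :: nat set) adj \<phi>. median_graph V adj \<and>
            proper_graph_action (thompson_T \<times>\<times> integer_group) V adj \<phi>)"
proof (intro conjI allI impI)
  fix V :: "'v set" and adj \<phi>
  assume "median_graph V adj"
  then show "\<not> proper_graph_action thompson_T_lift V adj \<phi>" by (rule lift_not_proper)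
next
  fix V :: "'w set" and adj \<phi>
  assume "median_graph V adj" "cubical_dim V adj < \<infinity>" "graph_action thompson_T_lift V adj \<phi>"
  then show "\<exists>x\<in>V. finite (orbit thompson_T_lift \<phi> x)" by (rule lift_finite_orbit)
next
  show "quasi_isometric_groups thompson_T_lift (thompson_T \<times>\<times> integer_group)"
    by (rule lift_quasi_isometric_groups)
next
  show "\<exists>(V :: nat set) adj \<phi>. median_graph V adj \<and> proper_graph_action (thompson_T \<times>\<times> integer_group) V adj \<phi>"
    by (rule TZ_proper_median_action)
qed

end
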